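(* Let $(M,g,f)$ be an $n$-dimensional complete orientable weighted manifold. Let $\Sigma$ be a complete orientable immersed stable $f$-minimal hypersurface in $M$. Assume that $\mathrm{Ric}_f^1\ge0$ along $\Sigma$. Let $o\in\Sigma$, and assume that there is a constant $C>0$ such that for every $r>0$ $$m_{f,\Sigma}(B_r^\Sigma(o))\le C r^2 ,$$ where $B_r^\Sigma(o)$ is the intrinsic open geodesic ball in $\Sigma$ of radius $r$ centered at $o$. Then $$\mathrm{II}_\Sigma\equiv\frac{f_\nu}{n-1}\,g_\Sigma,\qquad \mathrm{Ric}_f^1(\nu,\nu)\equiv0\qquad\text{on }\Sigma .$$
   Context: Manifolds and hypersurfaces are smooth and connected, without boundary, and $n\ge2$. A weighted manifold $(M,g,f)$ of dimension $n$ is an $n$-dimensional Riemannian manifold $(M,g)$ together with $f\in C^\infty(M)$. Set $\mathrm{Ric}_f^\infty:=\mathrm{Ric}+\mathrm{Hess}\,f$ and $\mathrm{Ric}_f^1:=\mathrm{Ric}+\mathrm{Hess}\,f+\frac{df\otimes df}{n-1}$. Let $\Sigma$ be a two-sided immersed hypersurface with globally defined unit normal field $\nu$ (an orientable hypersurface in an orientable manifold is two-sided). $g_\Sigma$ is the induced metric; $m_{f,\Sigma}:=e^{-f}v_{g_\Sigma}$ is the weighted measure, $v_{g_\Sigma}$ being the Riemannian volume measure of $g_\Sigma$; $f_\nu:=\langle\nabla f,\nu\rangle$; $\mathrm{II}_\Sigma(X,Y):=\langle\nabla_X\nu,Y\rangle$; $H_\Sigma:=\mathrm{tr}\,\mathrm{II}_\Sigma$.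 $\Sigma$ is $f$-minimal if $H_\Sigma-f_\nu\equiv0$. An $f$-minimal $\Sigma$ is stable if for every $\phi\in C_0^\infty(\Sigma)$ $$\int_\Sigma\left(\mathrm{Ric}_f^\infty(\nu,\nu)+|\mathrm{II}_\Sigma|^2\right)\phi^2\,dm_{f,\Sigma}\le\int_\Sigma|\nabla_\Sigma\phi|^2\,dm_{f,\Sigma}.$$ *)

theory Defs
  imports "HOL-Analysis.Analysis"
begin

section \<open>Smooth manifolds\<close>

primrec Ck_on ::
  "nat \<Rightarrow> 'a::real_normed_vector set \<Rightarrow> ('a \<Rightarrow> 'b::real_normed_vector) \<Rightarrow> bool" where
  "Ck_on 0 S h \<longleftrightarrow> continuous_on S h"
| "Ck_on (Suc k) S h \<longleftrightarrow>
     (\<forall>x\<in>S. h differentiable (at x)) \<and> (\<forall>v. Ck_on k S (\<lambda>x. frechet_derivative h (at x) v))"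

text \<open>Only used on open sets of a Euclidean space, where it is the usual \<open>C\<^sup>\<infinity>\<close>.\<close>

definition smooth_on ::
  "'a::real_normed_vector set \<Rightarrow> ('a \<Rightarrow> 'b::real_normed_vector) \<Rightarrow> bool" where
  "smooth_on S h \<longleftrightarrow> (\<forall>k. Ck_on k S h)"

text \<open>
  The underlying set of a manifold is a whole type, whose topology is Hausdorff and second
  countable; its dimension is the cardinality of the index type \<open>'n\<close>. A chart is a pair
  \<open>(U, \<phi>)\<close>; values of \<open>\<phi>\<close> outside \<open>U\<close> are irrelevant. Atlases need not be maximal.
\<close>

type_synonym ('m, 'n) atlas = "('m set \<times> ('m \<Rightarrow> real ^ 'n)) set"

definition is_atlas :: "('m::topological_space, 'n::finite) atlas \<Rightarrow> bool" where
  "is_atlas A \<longleftrightarrow>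
     (\<forall>(U, \<phi>)\<in>A. open U \<and> open (\<phi> ` U) \<and> homeomorphism U (\<phi> ` U) \<phi> (inv_into U \<phi>)) \<and>
     (\<Union>(U, \<phi>)\<in>A. U) = UNIV \<and>
     (\<forall>(U, \<phi>)\<in>A. \<forall>(V, \<psi>)\<in>A. smooth_on (\<phi> ` (U \<inter> V)) (\<psi> \<circ> inv_into U \<phi>))"

definition smooth_manifold ::
  "('m::{t2_space, second_countable_topology}, 'n::finite) atlas \<Rightarrow> bool" where
  "smooth_manifold A \<longleftrightarrow> is_atlas A \<and> connected (UNIV :: 'm set)"

definition orientable :: "('m::topological_space, 'n::finite) atlas \<Rightarrow> bool" where
  "orientable A \<longleftrightarrow>
     (\<exists>B. is_atlas B \<and> is_atlas (A \<union> B) \<and>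
       (\<forall>(U, \<phi>)\<in>B. \<forall>(V, \<psi>)\<in>B. \<forall>x\<in>\<phi> ` (U \<inter> V).
          det (matrix (frechet_derivative (\<psi> \<circ> inv_into U \<phi>) (at x))) > 0))"

definition smooth_fun :: "('m, 'n::finite) atlas \<Rightarrow> ('m \<Rightarrow> real) \<Rightarrow> bool" where
  "smooth_fun A h \<longleftrightarrow> (\<forall>(U, \<phi>)\<in>A. smooth_on (\<phi> ` U) (h \<circ> inv_into U \<phi>))"

definition smooth_map ::
  "('s::topological_space, 'k::finite) atlas \<Rightarrow> ('m::topological_space, 'n::finite) atlas
    \<Rightarrow> ('s \<Rightarrow> 'm) \<Rightarrow> bool" where
  "smooth_map B A F \<longleftrightarrow> continuous_on UNIV F \<and>
     (\<forall>(U, \<phi>)\<in>B. \<forall>(V, \<psi>)\<in>A. smooth_on (\<phi> ` (U \<inter> F -` V)) (\<psi> \<circ> F \<circ> inv_into U \<phi>))"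


section \<open>Tangent vectors and vector fields\<close>

text \<open>
  A tangent vector is a derivation on smooth functions, made extensional by the value \<open>0\<close> on
  functions which are not smooth. The vector space operations are pointwise and written out,
  e.g. as \<open>\<lambda>h. a * u h + b * v h\<close>.
\<close>

type_synonym 'm tangent = "('m \<Rightarrow> real) \<Rightarrow> real"
type_synonym 'm vfield = "'m \<Rightarrow> 'm tangent"

definition coord_vec ::
  "('m, 'n::finite) atlas \<Rightarrow> 'm set \<times> ('m \<Rightarrow> real ^ 'n) \<Rightarrow> 'm \<Rightarrow> real ^ 'n \<Rightarrow> 'm tangent" where
  "coord_vec A c p a = (case c of (U, \<phi>) \<Rightarrow>
     (\<lambda>h. if smooth_fun A h then frechet_derivative (h \<circ> inv_into U \<phi>) (at (\<phi> p)) a else 0))"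

definition tangent_space :: "('m, 'n::finite) atlas \<Rightarrow> 'm \<Rightarrow> 'm tangent set" where
  "tangent_space A p = {coord_vec A c p a |c a. c \<in> A \<and> p \<in> fst c}"

definition pushforward ::
  "('m, 'n::finite) atlas \<Rightarrow> ('s \<Rightarrow> 'm) \<Rightarrow> 's tangent \<Rightarrow> 'm tangent" where
  "pushforward A F x = (\<lambda>h. if smooth_fun A h then x (h \<circ> F) else 0)"

definition smooth_vfield :: "('m, 'n::finite) atlas \<Rightarrow> 'm vfield \<Rightarrow> bool" where
  "smooth_vfield A X \<longleftrightarrow>
     (\<forall>p. X p \<in> tangent_space A p) \<and> (\<forall>h. smooth_fun A h \<longrightarrow> smooth_fun A (\<lambda>p. X p h))"

definition lie_bracket :: "'m vfield \<Rightarrow> 'm vfield \<Rightarrow> 'm vfield" where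
  "lie_bracket X Y = (\<lambda>p h. X p (\<lambda>q. Y q h) - Y p (\<lambda>q. X q h))"

text \<open>
  A smooth global vector field through a given tangent vector. It serves to evaluate tensors at a
  point; the resulting values do not depend on the choice.
\<close>

definition extension :: "('m, 'n::finite) atlas \<Rightarrow> 'm \<Rightarrow> 'm tangent \<Rightarrow> 'm vfield" where
  "extension A p v = (SOME X. smooth_vfield A X \<and> X p = v)"


section \<open>Riemannian metrics\<close>

type_synonym 'm metric = "'m \<Rightarrow> 'm tangent \<Rightarrow> 'm tangent \<Rightarrow> real"

definition riemannian_metric :: "('m, 'n::finite) atlas \<Rightarrow> 'm metric \<Rightarrow> bool" where
  "riemannian_metric A g \<longleftrightarrow>
     (\<forall>p. \<forall>u\<in>tangent_space A p. \<forall>v\<in>tangent_space A p. \<forall>w\<in>tangent_space A p. \<forall>a b.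
        g p (\<lambda>h. a * u h + b * v h) w = a * g p u w + b * g p v w) \<and>
     (\<forall>p. \<forall>u\<in>tangent_space A p. \<forall>v\<in>tangent_space A p. g p u v = g p v u) \<and>
     (\<forall>p. \<forall>v\<in>tangent_space A p. v \<noteq> (\<lambda>h. 0) \<longrightarrow> g p v v > 0) \<and>
     (\<forall>X Y. smooth_vfield A X \<longrightarrow> smooth_vfield A Y \<longrightarrow> smooth_fun A (\<lambda>p. g p (X p) (Y p)))"

definition orthonormal_basis ::
  "('m, 'n::finite) atlas \<Rightarrow> 'm metric \<Rightarrow> 'm \<Rightarrow> ('n \<Rightarrow> 'm tangent) \<Rightarrow> bool" where
  "orthonormal_basis A g p e \<longleftrightarrow>
     (\<forall>i. e i \<in> tangent_space A p) \<and> (\<forall>i j. g p (e i) (e j) = (if i = j then 1 else 0))"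

definition some_onb :: "('m, 'n::finite) atlas \<Rightarrow> 'm metric \<Rightarrow> 'm \<Rightarrow> 'n \<Rightarrow> 'm tangent" where
  "some_onb A g p = (SOME e. orthonormal_basis A g p e)"

text \<open>Trace and squared norm of a bilinear form do not depend on the orthonormal basis.\<close>

definition trace_form ::
  "('m, 'n::finite) atlas \<Rightarrow> 'm metric \<Rightarrow> 'm \<Rightarrow> ('m tangent \<Rightarrow> 'm tangent \<Rightarrow> real) \<Rightarrow> real" where
  "trace_form A g p b = (\<Sum>i\<in>UNIV. b (some_onb A g p i) (some_onb A g p i))"

definition norm_sq_form ::
  "('m, 'n::finite) atlas \<Rightarrow> 'm metric \<Rightarrow> 'm \<Rightarrow> ('m tangent \<Rightarrow> 'm tangent \<Rightarrow> real) \<Rightarrow> real" where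
  "norm_sq_form A g p b =
     (\<Sum>i\<in>UNIV. \<Sum>j\<in>UNIV. (b (some_onb A g p i) (some_onb A g p j))\<^sup>2)"

text \<open>\<open>v h\<close> is the directional derivative \<open>dh(v)\<close>.\<close>

definition gradient ::
  "('m, 'n::finite) atlas \<Rightarrow> 'm metric \<Rightarrow> ('m \<Rightarrow> real) \<Rightarrow> 'm vfield" where
  "gradient A g h p =
     (THE u. u \<in> tangent_space A p \<and> (\<forall>v\<in>tangent_space A p. g p u v = v h))"


subsection \<open>Riemannian distance\<close>

text \<open>
  The infimum is finite because manifolds are connected, so \<open>enn2real\<close> in \<open>riem_dist\<close> loses nothing.
\<close>

definition pw_C1_curve ::
  "('m::topological_space, 'n::finite) atlas \<Rightarrow> (real \<Rightarrow> 'm) \<Rightarrow> bool" where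
  "pw_C1_curve A \<gamma> \<longleftrightarrow> continuous_on {0..1} \<gamma> \<and>
     (\<forall>(U, \<phi>)\<in>A. \<forall>a b. a \<le> b \<longrightarrow> {a..b} \<subseteq> {0..1} \<longrightarrow> \<gamma> ` {a..b} \<subseteq> U \<longrightarrow>
        (\<phi> \<circ> \<gamma>) piecewise_C1_differentiable_on {a..b})"

definition velocity :: "('m, 'n::finite) atlas \<Rightarrow> (real \<Rightarrow> 'm) \<Rightarrow> real \<Rightarrow> 'm tangent" where
  "velocity A \<gamma> t = (\<lambda>h. if smooth_fun A h then deriv (h \<circ> \<gamma>) t else 0)"

definition curve_length ::
  "('m, 'n::finite) atlas \<Rightarrow> 'm metric \<Rightarrow> (real \<Rightarrow> 'm) \<Rightarrow> ennreal" where
  "curve_length A g \<gamma> =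
     (\<integral>\<^sup>+ t\<in>{0..1}. ennreal (sqrt (g (\<gamma> t) (velocity A \<gamma> t) (velocity A \<gamma> t))) \<partial>lborel)"

definition riem_dist ::
  "('m::topological_space, 'n::finite) atlas \<Rightarrow> 'm metric \<Rightarrow> 'm \<Rightarrow> 'm \<Rightarrow> real" where
  "riem_dist A g p q =
     enn2real (INF \<gamma>\<in>{\<gamma>. pw_C1_curve A \<gamma> \<and> \<gamma> 0 = p \<and> \<gamma> 1 = q}. curve_length A g \<gamma>)"

definition geodesic_ball ::
  "('m::topological_space, 'n::finite) atlas \<Rightarrow> 'm metric \<Rightarrow> 'm \<Rightarrow> real \<Rightarrow> 'm set" where
  "geodesic_ball A g p r = Metric_space.mball UNIV (riem_dist A g) p r"

text \<open>
  Completeness is that of the Riemannian distance, equivalent to geodesic completeness by the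
  Hopf-Rinow theorem.
\<close>

definition complete_riemannian ::
  "('m::topological_space, 'n::finite) atlas \<Rightarrow> 'm metric \<Rightarrow> bool" where
  "complete_riemannian A g \<longleftrightarrow> Metric_space.mcomplete UNIV (riem_dist A g)"


subsection \<open>Volume measure\<close>

definition gram_matrix ::
  "('m, 'n::finite) atlas \<Rightarrow> 'm metric \<Rightarrow> 'm set \<times> ('m \<Rightarrow> real ^ 'n) \<Rightarrow> 'm \<Rightarrow> real ^ 'n ^ 'n" where
  "gram_matrix A g c p =
     (\<chi> i j. g p (coord_vec A c p (axis i 1)) (coord_vec A c p (axis j 1)))"

text \<open>
  The Borel measure with density \<open>sqrt (det g\<^sub>i\<^sub>j)\<close> in every chart; it is unique because countably
  many charts cover the manifold.
\<close>

definition volume_measure ::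
  "('m::topological_space, 'n::finite) atlas \<Rightarrow> 'm metric \<Rightarrow> 'm measure" where
  "volume_measure A g = (THE \<mu>. sets \<mu> = sets borel \<and>
     (\<forall>(U, \<phi>)\<in>A. \<forall>E\<in>sets borel. E \<subseteq> U \<longrightarrow>
        emeasure \<mu> E =
          (\<integral>\<^sup>+ x\<in>\<phi> ` E. ennreal (sqrt (det (gram_matrix A g (U, \<phi>) (inv_into U \<phi> x)))) \<partial>lborel)))"

definition weighted_measure ::
  "('m::topological_space, 'n::finite) atlas \<Rightarrow> 'm metric \<Rightarrow> ('m \<Rightarrow> real) \<Rightarrow> 'm measure" where
  "weighted_measure A g f = density (volume_measure A g) (\<lambda>p. ennreal (exp (- f p)))"


subsection \<open>Levi-Civita connection, Hessian and curvature\<close>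

definition is_levi_civita ::
  "('m, 'n::finite) atlas \<Rightarrow> 'm metric \<Rightarrow> ('m vfield \<Rightarrow> 'm vfield \<Rightarrow> 'm vfield) \<Rightarrow> bool" where
  "is_levi_civita A g D \<longleftrightarrow>
     (\<forall>X Y. smooth_vfield A X \<longrightarrow> smooth_vfield A Y \<longrightarrow> smooth_vfield A (D X Y)) \<and>
     (\<forall>X Y Z h. smooth_vfield A X \<longrightarrow> smooth_vfield A Y \<longrightarrow> smooth_vfield A Z \<longrightarrow> smooth_fun A h \<longrightarrow>
        D (\<lambda>p k. h p * X p k + Y p k) Z = (\<lambda>p k. h p * D X Z p k + D Y Z p k)) \<and>
     (\<forall>X Y Z h. smooth_vfield A X \<longrightarrow> smooth_vfield A Y \<longrightarrow> smooth_vfield A Z \<longrightarrow> smooth_fun A h \<longrightarrow>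
        D X (\<lambda>p k. h p * Y p k + Z p k) =
          (\<lambda>p k. X p h * Y p k + h p * D X Y p k + D X Z p k)) \<and>
     (\<forall>X Y. smooth_vfield A X \<longrightarrow> smooth_vfield A Y \<longrightarrow>
        (\<lambda>p k. D X Y p k - D Y X p k) = lie_bracket X Y) \<and>
     (\<forall>X Y Z p. smooth_vfield A X \<longrightarrow> smooth_vfield A Y \<longrightarrow> smooth_vfield A Z \<longrightarrow>
        X p (\<lambda>q. g q (Y q) (Z q)) = g p (D X Y p) (Z p) + g p (Y p) (D X Z p))"

text \<open>On smooth vector fields there is exactly one such operation.\<close>

definition levi_civita ::
  "('m, 'n::finite) atlas \<Rightarrow> 'm metric \<Rightarrow> 'm vfield \<Rightarrow> 'm vfield \<Rightarrow> 'm vfield" where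
  "levi_civita A g = (SOME D. is_levi_civita A g D)"

definition hessian ::
  "('m, 'n::finite) atlas \<Rightarrow> 'm metric \<Rightarrow> ('m \<Rightarrow> real) \<Rightarrow> 'm \<Rightarrow> 'm tangent \<Rightarrow> 'm tangent \<Rightarrow> real" where
  "hessian A g h p v w =
     g p (levi_civita A g (extension A p v) (gradient A g h) p) w"

definition curvature ::
  "('m, 'n::finite) atlas \<Rightarrow> 'm metric \<Rightarrow> 'm vfield \<Rightarrow> 'm vfield \<Rightarrow> 'm vfield \<Rightarrow> 'm vfield" where
  "curvature A g X Y Z = (let D = levi_civita A g in
     (\<lambda>p h. D X (D Y Z) p h - D Y (D X Z) p h - D (lie_bracket X Y) Z p h))"

text \<open>Sign: \<open>Ric(v, w)\<close> is the trace of \<open>u \<mapsto> R(u, v) w\<close>, so that round spheres have \<open>Ric > 0\<close>.\<close>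

definition ricci ::
  "('m, 'n::finite) atlas \<Rightarrow> 'm metric \<Rightarrow> 'm \<Rightarrow> 'm tangent \<Rightarrow> 'm tangent \<Rightarrow> real" where
  "ricci A g p v w = trace_form A g p
     (\<lambda>u u'. g p (curvature A g (extension A p u) (extension A p v) (extension A p w) p) u')"

definition ric_f_infty ::
  "('m, 'n::finite) atlas \<Rightarrow> 'm metric \<Rightarrow> ('m \<Rightarrow> real) \<Rightarrow> 'm \<Rightarrow> 'm tangent \<Rightarrow> 'm tangent \<Rightarrow> real" where
  "ric_f_infty A g f p v w = ricci A g p v w + hessian A g f p v w"

definition ric_f_1 ::
  "('m, 'n::finite) atlas \<Rightarrow> 'm metric \<Rightarrow> ('m \<Rightarrow> real) \<Rightarrow> 'm \<Rightarrow> 'm tangent \<Rightarrow> 'm tangent \<Rightarrow> real" where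
  "ric_f_1 A g f p v w =
     ricci A g p v w + hessian A g f p v w + v f * w f / (real CARD('n) - 1)"

definition weighted_manifold ::
  "('m::{t2_space, second_countable_topology}, 'n::finite) atlas \<Rightarrow> 'm metric
    \<Rightarrow> ('m \<Rightarrow> real) \<Rightarrow> bool" where
  "weighted_manifold A g f \<longleftrightarrow> smooth_manifold A \<and> riemannian_metric A g \<and> smooth_fun A f"


section \<open>Two-sided immersed hypersurfaces\<close>

text \<open>
  A hypersurface is a manifold with atlas \<open>B\<close>, of dimension one less, together with an immersion
  \<open>F\<close> into the manifold with atlas \<open>A\<close>. Its normal field \<open>\<nu>\<close> is a vector field along \<open>F\<close>.
\<close>

definition immersed_hypersurface ::
  "('m::{t2_space, second_countable_topology}, 'n::finite) atlas
    \<Rightarrow> ('s::{t2_space, second_countable_topology}, 'k::finite) atlas \<Rightarrow> ('s \<Rightarrow> 'm) \<Rightarrow> bool" where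
  "immersed_hypersurface A B F \<longleftrightarrow>
     smooth_manifold B \<and> CARD('n) = CARD('k) + 1 \<and> smooth_map B A F \<and>
     (\<forall>q. inj_on (pushforward A F) (tangent_space B q))"

definition induced_metric ::
  "('m, 'n::finite) atlas \<Rightarrow> 'm metric \<Rightarrow> ('s \<Rightarrow> 'm) \<Rightarrow> 's metric" where
  "induced_metric A g F q x y = g (F q) (pushforward A F x) (pushforward A F y)"

definition unit_normal ::
  "('m, 'n::finite) atlas \<Rightarrow> 'm metric \<Rightarrow> ('s, 'k::finite) atlas \<Rightarrow> ('s \<Rightarrow> 'm)
    \<Rightarrow> ('s \<Rightarrow> 'm tangent) \<Rightarrow> bool" where
  "unit_normal A g B F \<nu> \<longleftrightarrow>
     (\<forall>q. \<nu> q \<in> tangent_space A (F q)) \<and>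
     (\<forall>h. smooth_fun A h \<longrightarrow> smooth_fun B (\<lambda>q. \<nu> q h)) \<and>
     (\<forall>q. g (F q) (\<nu> q) (\<nu> q) = 1) \<and>
     (\<forall>q. \<forall>x\<in>tangent_space B q. g (F q) (\<nu> q) (pushforward A F x) = 0)"

definition normal_deriv ::
  "('m, 'n::finite) atlas \<Rightarrow> 'm metric \<Rightarrow> ('m \<Rightarrow> real) \<Rightarrow> ('s \<Rightarrow> 'm) \<Rightarrow> ('s \<Rightarrow> 'm tangent)
    \<Rightarrow> 's \<Rightarrow> real" where
  "normal_deriv A g f F \<nu> q = g (F q) (gradient A g f (F q)) (\<nu> q)"

text \<open>
  \<open>\<nu>\<close> is differentiated, as usual, by extending it near \<open>q\<close> to a vector field of the ambient
  manifold; an extension exists because \<open>F\<close> is injective near \<open>q\<close>, and all extensions give the same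
  derivatives in directions tangent to the hypersurface.
\<close>

definition normal_extension ::
  "('m, 'n::finite) atlas \<Rightarrow> ('s::topological_space \<Rightarrow> 'm) \<Rightarrow> ('s \<Rightarrow> 'm tangent) \<Rightarrow> 's
    \<Rightarrow> 'm vfield" where
  "normal_extension A F \<nu> q =
     (SOME N. smooth_vfield A N \<and> (\<exists>W. open W \<and> q \<in> W \<and> (\<forall>q'\<in>W. N (F q') = \<nu> q')))"

definition second_ff ::
  "('m, 'n::finite) atlas \<Rightarrow> 'm metric \<Rightarrow> ('s::topological_space \<Rightarrow> 'm) \<Rightarrow> ('s \<Rightarrow> 'm tangent)
    \<Rightarrow> 's \<Rightarrow> 's tangent \<Rightarrow> 's tangent \<Rightarrow> real" where
  "second_ff A g F \<nu> q x y =
     g (F q)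
       (levi_civita A g (extension A (F q) (pushforward A F x)) (normal_extension A F \<nu> q) (F q))
       (pushforward A F y)"

definition mean_curvature ::
  "('m, 'n::finite) atlas \<Rightarrow> 'm metric \<Rightarrow> ('s::topological_space, 'k::finite) atlas \<Rightarrow> ('s \<Rightarrow> 'm)
    \<Rightarrow> ('s \<Rightarrow> 'm tangent) \<Rightarrow> 's \<Rightarrow> real" where
  "mean_curvature A g B F \<nu> q = trace_form B (induced_metric A g F) q (second_ff A g F \<nu> q)"

definition f_minimal ::
  "('m, 'n::finite) atlas \<Rightarrow> 'm metric \<Rightarrow> ('m \<Rightarrow> real) \<Rightarrow> ('s::topological_space, 'k::finite) atlas
    \<Rightarrow> ('s \<Rightarrow> 'm) \<Rightarrow> ('s \<Rightarrow> 'm tangent) \<Rightarrow> bool" where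
  "f_minimal A g f B F \<nu> \<longleftrightarrow> (\<forall>q. mean_curvature A g B F \<nu> q - normal_deriv A g f F \<nu> q = 0)"

definition hypersurface_measure ::
  "('m, 'n::finite) atlas \<Rightarrow> 'm metric \<Rightarrow> ('m \<Rightarrow> real) \<Rightarrow> ('s::topological_space, 'k::finite) atlas
    \<Rightarrow> ('s \<Rightarrow> 'm) \<Rightarrow> 's measure" where
  "hypersurface_measure A g f B F = weighted_measure B (induced_metric A g F) (f \<circ> F)"

definition test_fun :: "('s::topological_space, 'k::finite) atlas \<Rightarrow> ('s \<Rightarrow> real) \<Rightarrow> bool" where
  "test_fun B \<phi> \<longleftrightarrow> smooth_fun B \<phi> \<and> compact (closure {q. \<phi> q \<noteq> 0})"

definition stable_f_minimal ::
  "('m, 'n::finite) atlas \<Rightarrow> 'm metric \<Rightarrow> ('m \<Rightarrow> real) \<Rightarrow> ('s::topological_space, 'k::finite) atlas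
    \<Rightarrow> ('s \<Rightarrow> 'm) \<Rightarrow> ('s \<Rightarrow> 'm tangent) \<Rightarrow> bool" where
  "stable_f_minimal A g f B F \<nu> \<longleftrightarrow> f_minimal A g f B F \<nu> \<and>
     (let gS = induced_metric A g F; m = hypersurface_measure A g f B F in
      \<forall>\<phi>. test_fun B \<phi> \<longrightarrow>
        (\<integral>q. (ric_f_infty A g f (F q) (\<nu> q) (\<nu> q)
               + norm_sq_form B gS q (second_ff A g F \<nu> q)) * (\<phi> q)\<^sup>2 \<partial>m)
        \<le> (\<integral>q. gS q (gradient B gS \<phi> q) (gradient B gS \<phi> q) \<partial>m))"

end

theory Submission
  imports Defs "HOL-Computational_Algebra.Polynomial"
begin

text \<open>
  For an \<open>f\<close>-minimal hypersurface \<open>tr II = f\<^sub>\<nu>\<close>, so \<open>Ric\<^sub>f\<^sup>\<infinity>(\<nu>, \<nu>) + |II|\<^sup>2\<close> is the sum of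
  \<open>Ric\<^sub>f\<^sup>1(\<nu>, \<nu>)\<close> and the squared norm of \<open>II - f\<^sub>\<nu>/(n-1) g\<close>, both nonnegative. It remains to see that
  this function \<open>Q\<close> vanishes. Averaging cutoff functions at the scales \<open>R, 2R, \<dots>, 2\<^sup>k\<^sup>-\<^sup>1R\<close> gives a test
  function \<open>\<phi>\<close> which is \<open>1\<close> on the ball of radius \<open>R\<close> and has energy \<open>O(1/k)\<close> under quadratic volume
  growth, and stability gives \<open>\<integral> Q \<phi>\<^sup>2 \<le> \<integral> |\<nabla>\<phi>|\<^sup>2 \<rightarrow> 0\<close>. The cutoffs are smoothings of the distance, which
  have compact support because closed balls of a complete manifold are compact.
\<close>

section \<open>Smooth maps between Euclidean spaces\<close>

text \<open>A cutoff at a single scale does not suffice: a gradient of order 1/R on a ball of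
  measure at most C (2R)^2 has bounded energy, but not small energy. Averaging over k dyadic scales
  divides every gradient by k; as the gradient bounds decay geometrically with the scale, the square
  of their sum is controlled by the sum of their squares, and k terms of size O(1/k^2) remain.
  Stability is assumed for smooth test functions while the distance is only Lipschitz; a smoothing
  that loses a fixed factor in the gradient is good enough, because a constant independent of the
  scale is absorbed by k. That Q vanishes everywhere, and not just almost everywhere, rests on its
  continuity. This explains the amount of geometry: connection, extensions of vectors and of the
  normal, orthonormal bases and the volume measure are given by choice or description operators.
  Their existence, and the independence of the values from the choices, must be established before Q
  is known to be smooth and open sets to have positive measure.\<close>

lemma Ck_on_subset: "Ck_on k S f \<Longrightarrow> T \<subseteq> S \<Longrightarrow> Ck_on k T f"
  by (induction k arbitrary: f) (auto intro: continuous_on_subset)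

lemma Ck_on_has_derivative:
  "Ck_on (Suc k) S f \<Longrightarrow> x \<in> S \<Longrightarrow> (f has_derivative frechet_derivative f (at x)) (at x)"
  by (simp add: frechet_derivative_works)

text \<open>Openness of \<open>S\<close> is essential: \<open>frechet_derivative\<close> at a point
  depends on a full neighbourhood, so agreement on \<open>S\<close> passes to derivatives only if
  \<open>S\<close> is open.\<close>

lemma Ck_on_cong:
  assumes "open S" "\<And>x. x \<in> S \<Longrightarrow> f x = g x" "Ck_on k S f"
  shows "Ck_on k S g"
  using assms(2,3)
proof (induction k arbitrary: f g)
  case 0
  then show ?case by (simp cong: continuous_on_cong)
next
  case (Suc k)
  have *: "(g has_derivative frechet_derivative f (at x)) (at x)" if "x \<in> S" for x
    by (rule has_derivative_transform_within_open[OF Ck_on_has_derivative[OF Suc.prems(2) that] \<open>open S\<close> that])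
      (use Suc.prems(1) in auto)
  then have eq: "frechet_derivative f (at x) = frechet_derivative g (at x)" if "x \<in> S" for x
    using frechet_derivative_at that by blast
  have "Ck_on k S (\<lambda>x. frechet_derivative g (at x) v)" for v
    by (rule Suc.IH[of "\<lambda>x. frechet_derivative f (at x) v"]) (use Suc.prems eq in auto)
  then show ?case
    using * by (auto simp: differentiable_def)
qed

text \<open>Replaces the chosen \<open>frechet_derivative\<close> by an explicit formula
  \<open>f'\<close>, with which the inductions below can work.\<close>

lemma Ck_on_SucI:
  assumes "open S" "\<And>x. x \<in> S \<Longrightarrow> (f has_derivative f' x) (at x)" "\<And>v. Ck_on k S (\<lambda>x. f' x v)"
  shows "Ck_on (Suc k) S f"
proof -
  have "f' x = frechet_derivative f (at x)" if "x \<in> S" for x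
    using frechet_derivative_at assms(2) that by blast
  then have "Ck_on k S (\<lambda>x. frechet_derivative f (at x) v)" for v
    by (intro Ck_on_cong[OF assms(1) _ assms(3)[of v]]) auto
  then show ?thesis
    using assms(2) by (auto simp: differentiable_def)
qed

lemma Ck_on_Suc_imp: "Ck_on (Suc k) S f \<Longrightarrow> Ck_on k S f"
proof (induction k arbitrary: f)
  case 0
  then show ?case
    by (auto intro!: continuous_at_imp_continuous_on differentiable_imp_continuous_within)
qed auto

lemma Ck_on_const: "Ck_on k S (\<lambda>x. c)"
  by (induction k arbitrary: c) (auto simp: frechet_derivative_const)

lemma Ck_on_linear:
  assumes "open S" "bounded_linear f"
  shows "Ck_on k S f"
proof (cases k)
  case 0
  then show ?thesis using assms by (simp add: linear_continuous_on)
next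
  case (Suc j)
  show ?thesis unfolding Suc
    by (rule Ck_on_SucI[where f' = "\<lambda>x. f"])
      (use assms in \<open>simp_all add: bounded_linear_imp_has_derivative Ck_on_const\<close>)
qed

lemma Ck_on_add:
  assumes "open S"
  shows "Ck_on k S f \<Longrightarrow> Ck_on k S g \<Longrightarrow> Ck_on k S (\<lambda>x. f x + g x)"
proof (induction k arbitrary: f g)
  case (Suc k)
  show ?case
    by (rule Ck_on_SucI[OF assms has_derivative_add
          [OF Ck_on_has_derivative[OF Suc.prems(1)] Ck_on_has_derivative[OF Suc.prems(2)]]])
      (use Suc in auto)
qed (auto intro: continuous_intros)

text \<open>By the Leibniz rule the derivative is a sum of two expressions of the same bilinear
  kind, so the induction closes. Scalar multiples, products and inner products are
  instances.\<close>

lemma Ck_on_bilinear: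
  assumes "bounded_bilinear pr" "open S"
  shows "Ck_on k S f \<Longrightarrow> Ck_on k S g \<Longrightarrow> Ck_on k S (\<lambda>x. pr (f x) (g x))"
proof (induction k arbitrary: f g)
  case 0
  then show ?case by (auto intro: bounded_bilinear.continuous_on[OF assms(1)])
next
  case (Suc k)
  have *: "Ck_on k S f" "Ck_on k S g" using Suc.prems by (auto intro: Ck_on_Suc_imp)
  show ?case
  proof (rule Ck_on_SucI[OF assms(2)])
    show "((\<lambda>x. pr (f x) (g x)) has_derivative (\<lambda>v. pr (f x) (frechet_derivative g (at x) v)
        + pr (frechet_derivative f (at x) v) (g x))) (at x)" if "x \<in> S" for x
      using bounded_bilinear.FDERIV[OF assms(1) Ck_on_has_derivative[OF Suc.prems(1) that]
          Ck_on_has_derivative[OF Suc.prems(2) that]] .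
    show "Ck_on k S (\<lambda>x. pr (f x) (frechet_derivative g (at x) v)
        + pr (frechet_derivative f (at x) v) (g x))" for v
      by (intro Ck_on_add assms(2) Suc.IH *) (use Suc.prems in auto)
  qed
qed

lemma Ck_on_sum:
  assumes "open S" "\<And>i. i \<in> I \<Longrightarrow> Ck_on k S (f i)"
  shows "Ck_on k S (\<lambda>x. \<Sum>i\<in>I. f i x)"
  using assms(2) by (induction I rule: infinite_finite_induct) (simp_all add: Ck_on_const Ck_on_add[OF assms(1)])

lemma Ck_on_prod:
  fixes f :: "'i \<Rightarrow> 'a::real_normed_vector \<Rightarrow> real"
  assumes "open S" "\<And>i. i \<in> I \<Longrightarrow> Ck_on k S (f i)"
  shows "Ck_on k S (\<lambda>x. \<Prod>i\<in>I. f i x)"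
  using assms(2) by (induction I rule: infinite_finite_induct)
    (simp_all add: Ck_on_const Ck_on_bilinear[OF bounded_bilinear_mult assms(1)])

text \<open>The derivative of a composition applies a linear map that itself varies with the point.
  Expanding its argument in \<open>Basis\<close> gives a finite sum of scalar multiples, to which
  the induction hypothesis and the bilinear rule apply; this is why the middle space is
  Euclidean.\<close>

lemma Ck_on_compose:
  fixes f :: "'a::real_normed_vector \<Rightarrow> 'b::euclidean_space"
  assumes S: "open S" and fS: "f ` S \<subseteq> T"
  shows "Ck_on k T h \<Longrightarrow> Ck_on k S f \<Longrightarrow> Ck_on k S (\<lambda>x. h (f x))"
proof (induction k arbitrary: h)
  case 0
  then show ?case using fS by (auto intro: continuous_on_compose2)
next
  case (Suc k)
  note hf = Ck_on_has_derivative[OF Suc.prems(2)]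
  note hh = Ck_on_has_derivative[OF Suc.prems(1)]
  show ?case
  proof (rule Ck_on_SucI[OF S])
    fix x assume x: "x \<in> S"
    have d: "((\<lambda>x. h (f x)) has_derivative
        (\<lambda>v. frechet_derivative h (at (f x)) (frechet_derivative f (at x) v))) (at x)"
      by (rule has_derivative_compose[OF hf[OF x] hh]) (use x fS in auto)
    have rep: "frechet_derivative h (at (f x)) w =
        (\<Sum>b\<in>Basis. (w \<bullet> b) *\<^sub>R frechet_derivative h (at (f x)) b)" for w
    proof -
      have "linear (frechet_derivative h (at (f x)))"
        using hh[of "f x"] x fS by (auto dest: has_derivative_linear)
      then show ?thesis
        by (subst (1) euclidean_representation[of w, symmetric])
          (simp add: linear_sum linear_cmul)
    qed
    show "((\<lambda>x. h (f x)) has_derivative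
        (\<lambda>v. \<Sum>b\<in>Basis. (frechet_derivative f (at x) v \<bullet> b) *\<^sub>R frechet_derivative h (at (f x)) b)) (at x)"
      by (rule has_derivative_eq_rhs[OF d]) (rule ext, rule rep)
  next
    fix v
    have 1: "Ck_on k S (\<lambda>x. frechet_derivative h (at (f x)) b)" for b
      by (rule Suc.IH[OF _ Ck_on_Suc_imp[OF Suc.prems(2)], of "\<lambda>y. frechet_derivative h (at y) b"])
        (use Suc.prems(1) in simp)
    have 2: "Ck_on k S (\<lambda>x. frechet_derivative f (at x) v \<bullet> b)" for b
      by (rule Ck_on_bilinear[OF bounded_bilinear_inner S _ Ck_on_const]) (use Suc.prems(2) in simp)
    show "Ck_on k S (\<lambda>x. \<Sum>b\<in>Basis.
        (frechet_derivative f (at x) v \<bullet> b) *\<^sub>R frechet_derivative h (at (f x)) b)"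
      by (rule Ck_on_sum[OF S], rule Ck_on_bilinear[OF bounded_bilinear_scaleR S 2 1])
  qed
qed

text \<open>Derivatives are taken in full neighbourhoods and not relative to \<open>S\<close>, so
  the property is decided near each point. In this form smooth pieces are glued later.\<close>

lemma Ck_on_local:
  assumes "\<And>x. x \<in> S \<Longrightarrow> \<exists>T. open T \<and> x \<in> T \<and> Ck_on k T f"
  shows "Ck_on k S f"
  using assms
proof (induction k arbitrary: f)
  case 0
  then show ?case
    by (auto intro!: continuous_at_imp_continuous_on simp: continuous_on_eq_continuous_at)
      (metis continuous_on_eq_continuous_at)
next
  case (Suc k)
  have "\<exists>T. open T \<and> x \<in> T \<and> Ck_on k T (\<lambda>x. frechet_derivative f (at x) v)" if "x \<in> S" for x v
    using Suc.prems[OF that] by auto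
  then have "Ck_on k S (\<lambda>x. frechet_derivative f (at x) v)" for v by (rule Suc.IH)
  then show ?case using Suc.prems by (force simp: Ck_on.simps(2))
qed

section \<open>Closure properties of smooth maps, inherited from every finite order\<close>

lemma smooth_on_subset: "smooth_on S f \<Longrightarrow> T \<subseteq> S \<Longrightarrow> smooth_on T f"
  unfolding smooth_on_def using Ck_on_subset by blast

lemma smooth_on_cong:
  "open S \<Longrightarrow> (\<And>x. x \<in> S \<Longrightarrow> f x = g x) \<Longrightarrow> smooth_on S f \<Longrightarrow> smooth_on S g"
  unfolding smooth_on_def by (metis Ck_on_cong)

lemma smooth_on_imp_continuous_on: "smooth_on S f \<Longrightarrow> continuous_on S f"
  by (metis smooth_on_def Ck_on.simps(1))

lemma smooth_on_imp_has_derivative: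
  "smooth_on S f \<Longrightarrow> x \<in> S \<Longrightarrow> (f has_derivative frechet_derivative f (at x)) (at x)"
  by (metis smooth_on_def Ck_on_has_derivative)

lemma smooth_on_frechet: "smooth_on S f \<Longrightarrow> smooth_on S (\<lambda>x. frechet_derivative f (at x) v)"
  by (metis smooth_on_def Ck_on.simps(2))

lemma smooth_on_local:
  assumes "\<And>x. x \<in> S \<Longrightarrow> \<exists>T. open T \<and> x \<in> T \<and> smooth_on T f"
  shows "smooth_on S f"
  unfolding smooth_on_def
proof
  show "Ck_on k S f" for k
    by (rule Ck_on_local) (use assms in \<open>metis smooth_on_def\<close>)
qed

lemma smooth_on_const: "smooth_on S (\<lambda>x. c)"
  by (simp add: smooth_on_def Ck_on_const)

lemma smooth_on_linear: "open S \<Longrightarrow> bounded_linear f \<Longrightarrow> smooth_on S f"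
  by (simp add: smooth_on_def Ck_on_linear)

lemma smooth_on_id: "open S \<Longrightarrow> smooth_on S (\<lambda>x. x)"
  by (rule smooth_on_linear) (auto simp: bounded_linear_ident)

lemma smooth_on_add:
  "open S \<Longrightarrow> smooth_on S f \<Longrightarrow> smooth_on S g \<Longrightarrow> smooth_on S (\<lambda>x. f x + g x)"
  by (simp add: smooth_on_def Ck_on_add)

lemma smooth_on_bilinear:
  "bounded_bilinear pr \<Longrightarrow> open S \<Longrightarrow> smooth_on S f \<Longrightarrow> smooth_on S g \<Longrightarrow>
    smooth_on S (\<lambda>x. pr (f x) (g x))"
  by (simp add: smooth_on_def Ck_on_bilinear)

lemmas smooth_on_scaleR = smooth_on_bilinear[OF bounded_bilinear_scaleR]
lemmas smooth_on_mult = smooth_on_bilinear[OF bounded_bilinear_mult]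
lemmas smooth_on_inner = smooth_on_bilinear[OF bounded_bilinear_inner]

lemma smooth_on_minus: "open S \<Longrightarrow> smooth_on S f \<Longrightarrow> smooth_on S (\<lambda>x. - f x)"
  using smooth_on_scaleR[OF _ smooth_on_const[of _ "-1"]] by fastforce

lemma smooth_on_diff:
  "open S \<Longrightarrow> smooth_on S f \<Longrightarrow> smooth_on S g \<Longrightarrow> smooth_on S (\<lambda>x. f x - g x)"
  using smooth_on_add[OF _ _ smooth_on_minus] by fastforce

lemma smooth_on_sum:
  "open S \<Longrightarrow> (\<And>i. i \<in> I \<Longrightarrow> smooth_on S (f i)) \<Longrightarrow> smooth_on S (\<lambda>x. \<Sum>i\<in>I. f i x)"
  by (simp add: smooth_on_def Ck_on_sum)

lemma smooth_on_prod:
  fixes f :: "'i \<Rightarrow> 'a::real_normed_vector \<Rightarrow> real"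
  shows "open S \<Longrightarrow> (\<And>i. i \<in> I \<Longrightarrow> smooth_on S (f i)) \<Longrightarrow> smooth_on S (\<lambda>x. \<Prod>i\<in>I. f i x)"
  by (simp add: smooth_on_def Ck_on_prod)

lemma smooth_on_compose:
  fixes f :: "'a::real_normed_vector \<Rightarrow> 'b::euclidean_space"
  shows "open S \<Longrightarrow> f ` S \<subseteq> T \<Longrightarrow> smooth_on T h \<Longrightarrow> smooth_on S f \<Longrightarrow> smooth_on S (\<lambda>x. h (f x))"
  by (simp add: smooth_on_def Ck_on_compose)

lemma Ck_on_vec_nth:
  fixes f :: "'a::real_normed_vector \<Rightarrow> real ^ 'n"
  assumes "open S" "\<And>i. Ck_on k S (\<lambda>x. f x $ i)"
  shows "Ck_on k S f"
proof (rule Ck_on_cong[OF assms(1)])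
  show "Ck_on k S (\<lambda>x. \<Sum>i\<in>UNIV. (f x $ i) *\<^sub>R axis i 1)"
    by (rule Ck_on_sum[OF assms(1)])
      (rule Ck_on_bilinear[OF bounded_bilinear_scaleR assms(1) assms(2) Ck_on_const])
  show "(\<Sum>i\<in>UNIV. (f x $ i) *\<^sub>R axis i 1) = f x" for x
    using basis_expansion[of "f x"] by (simp only: scalar_mult_eq_scaleR)
qed

lemma smooth_on_vec_nth:
  fixes f :: "'a::real_normed_vector \<Rightarrow> real ^ 'n"
  shows "open S \<Longrightarrow> (\<And>i. smooth_on S (\<lambda>x. f x $ i)) \<Longrightarrow> smooth_on S f"
  by (simp add: smooth_on_def Ck_on_vec_nth)

lemma smooth_on_nth:
  fixes f :: "'a::real_normed_vector \<Rightarrow> real ^ 'n"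
  shows "open S \<Longrightarrow> smooth_on S f \<Longrightarrow> smooth_on S (\<lambda>x. f x $ i)"
  using smooth_on_compose[where h = "\<lambda>x. x $ i" and T = UNIV and f = f and S = S]
  by (simp add: smooth_on_linear bounded_linear_vec_nth)

text \<open>Meant for families such as \<open>flat_exp\<close>, whose derivatives keep their shape
  while a parameter changes: the induction over the order has to range over all members at
  once.\<close>

lemma smooth_on_real_family:
  fixes F :: "(real \<Rightarrow> real) set"
  assumes "open S" "\<And>f. f \<in> F \<Longrightarrow> \<exists>f'\<in>F. \<forall>x\<in>S. (f has_field_derivative f' x) (at x)" "f \<in> F"
  shows "smooth_on S f"
proof -
  have "Ck_on k S f" if "f \<in> F" for k f
    using that
  proof (induction k arbitrary: f)
    case 0
    then obtain f' where "\<forall>x\<in>S. (f has_field_derivative f' x) (at x)" using assms(2) by blast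
    then show ?case by (auto intro!: continuous_at_imp_continuous_on DERIV_isCont)
  next
    case (Suc k)
    then obtain f' where f': "f' \<in> F" "\<forall>x\<in>S. (f has_field_derivative f' x) (at x)"
      using assms(2) by blast
    show ?case
    proof (rule Ck_on_SucI[OF assms(1), where f' = "\<lambda>x v. f' x * v"])
      show "Ck_on k S (\<lambda>x. f' x * v)" for v
        by (intro Ck_on_bilinear[OF bounded_bilinear_mult assms(1)] Ck_on_const Suc.IH f'(1))
    qed (use f' in \<open>auto simp: has_field_derivative_def\<close>)
  qed
  then show ?thesis using assms(3) by (simp add: smooth_on_def)
qed

text \<open>The derivative of the inverse is a multiple of a product of inverses, so each order of
  differentiability yields the next. The square root below is bootstrapped in the same way, its
  derivative being half the inverse of the root.\<close>

lemma Ck_on_inverse: "Ck_on k (- {0}) (inverse :: real \<Rightarrow> real)"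
proof (induction k)
  case 0
  then show ?case by (auto intro!: continuous_intros)
next
  case (Suc k)
  show ?case
  proof (rule Ck_on_SucI[where f' = "\<lambda>x v. - (inverse x * v * inverse x)"])
    have "Ck_on k (- {0}) (\<lambda>x::real. (inverse x * (- v)) * inverse x)" for v
      by (intro Ck_on_bilinear[OF bounded_bilinear_mult] Ck_on_const Suc) auto
    then show "Ck_on k (- {0}) (\<lambda>x::real. - (inverse x * v * inverse x))" for v by simp
    show "(inverse has_derivative (\<lambda>v. - (inverse x * v * inverse x))) (at x)"
      if "x \<in> - {0}" for x :: real
      by (rule has_derivative_inverse') (use that in auto)
  qed auto
qed

lemma smooth_on_inverse: "smooth_on (- {0}) (inverse :: real \<Rightarrow> real)"
  by (simp add: smooth_on_def Ck_on_inverse)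

lemma smooth_on_divide:
  fixes f g :: "'a::real_normed_vector \<Rightarrow> real"
  assumes "open S" "smooth_on S f" "smooth_on S g" "\<And>x. x \<in> S \<Longrightarrow> g x \<noteq> 0"
  shows "smooth_on S (\<lambda>x. f x / g x)"
  unfolding divide_inverse
  by (intro smooth_on_mult assms smooth_on_compose[OF assms(1) _ smooth_on_inverse]) (use assms in auto)

lemma smooth_on_sqrt: "smooth_on {0<..} sqrt"
proof -
  have "Ck_on k {0<..} sqrt" for k
  proof (induction k)
    case (Suc k)
    have "Ck_on k {0<..} (\<lambda>x. inverse (sqrt x))"
      by (rule Ck_on_compose[OF _ _ Ck_on_inverse Suc]) auto
    then have *: "Ck_on k {0<..} (\<lambda>x. inverse (sqrt x) * (v / 2))" for v
      by (intro Ck_on_bilinear[OF bounded_bilinear_mult] Ck_on_const) auto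
    show ?case
      by (rule Ck_on_SucI[OF _ _ *]) (auto intro!: derivative_eq_intros simp: field_simps)
  qed (auto intro!: continuous_intros)
  then show ?thesis by (simp add: smooth_on_def)
qed

subsection \<open>A smooth step function\<close>

text \<open>For \<open>P = 1\<close> this is the classical function exp(-1/t), extended by 0 to t
  \<le> 0. The polynomial in 1/t makes the family closed under differentiation.\<close>

definition flat_exp :: "real poly \<Rightarrow> real \<Rightarrow> real" where
  "flat_exp P t = (if t > 0 then poly P (inverse t) * exp (- inverse t) else 0)"

lemma poly_exp_tendsto_0: "((\<lambda>x::real. poly P x * exp (- x)) \<longlongrightarrow> 0) at_top"
proof -
  have "((\<lambda>x::real. coeff P i * x ^ i * exp (- x)) \<longlongrightarrow> 0) at_top" for i
    using tendsto_mult_right_zero[OF tendsto_power_div_exp_0[of i], of "coeff P i"]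
    by (simp add: exp_minus field_simps)
  then have "((\<lambda>x::real. \<Sum>i\<le>degree P. coeff P i * x ^ i * exp (- x)) \<longlongrightarrow> 0) at_top"
    by (intro tendsto_null_sum)
  then show ?thesis by (simp add: poly_altdef sum_distrib_right)
qed

lemma flat_exp_tendsto_0: "((\<lambda>t. poly P (inverse t) * exp (- inverse t)) \<longlongrightarrow> 0) (at_right (0::real))"
  by (rule filterlim_compose[OF poly_exp_tendsto_0 filterlim_inverse_at_top_right])

text \<open>With s = 1/t, differentiating P(s) exp(-s) in t brings out the factor s^2 and replaces P
  by P - P'. At 0 the derivative exists because exp(-1/t) beats every power of 1/t.\<close>

lemma flat_exp_deriv:
  "(flat_exp P has_field_derivative flat_exp (monom 1 2 * (P - pderiv P)) t) (at t)"
proof -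
  consider "t > 0" | "t < 0" | "t = 0" by linarith
  then show ?thesis
  proof cases
    case 1
    have i: "(inverse has_field_derivative - (inverse t * inverse t)) (at t)"
      using DERIV_inverse[of t UNIV] 1 by (simp add: power2_eq_square)
    have "((\<lambda>t. poly P (inverse t) * exp (- inverse t)) has_field_derivative
        poly (pderiv P) (inverse t) * (- (inverse t * inverse t)) * exp (- inverse t)
        + exp (- inverse t) * - (- (inverse t * inverse t)) * poly P (inverse t)) (at t)"
      by (intro DERIV_mult DERIV_chain2[OF poly_DERIV] DERIV_chain2[OF DERIV_exp] DERIV_minus i)
    moreover have "poly (pderiv P) (inverse t) * (- (inverse t * inverse t)) * exp (- inverse t)
        + exp (- inverse t) * - (- (inverse t * inverse t)) * poly P (inverse t)
        = flat_exp (monom 1 2 * (P - pderiv P)) t"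
      using 1 by (simp add: flat_exp_def poly_monom power2_eq_square algebra_simps)
    ultimately have "((\<lambda>t. poly P (inverse t) * exp (- inverse t)) has_field_derivative
        flat_exp (monom 1 2 * (P - pderiv P)) t) (at t)" by simp
    then show ?thesis
      by (rule has_field_derivative_transform_within_open[of _ _ _ "{0<..}"])
        (use 1 in \<open>auto simp: flat_exp_def\<close>)
  next
    case 2
    have "(flat_exp P has_field_derivative 0) (at t)"
      by (rule has_field_derivative_transform_within_open[of "\<lambda>t. 0" _ _ "{..<0}"])
        (use 2 in \<open>auto simp: flat_exp_def\<close>)
    then show ?thesis using 2 by (simp add: flat_exp_def)
  next
    case 3
    \<comment> \<open>Dividing by \<open>h\<close> multiplies the polynomial in 1/h by the
      indeterminate, hence \<open>pCons 0 P\<close>.\<close>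
    have "((\<lambda>h. flat_exp P h / h) \<longlongrightarrow> 0) (at_right 0)"
      by (rule Lim_transform_eventually[OF flat_exp_tendsto_0[of "pCons 0 P"]])
        (auto simp: eventually_at_filter flat_exp_def field_simps)
    moreover have "((\<lambda>h. flat_exp P h / h) \<longlongrightarrow> 0) (at_left 0)"
      by (rule Lim_transform_eventually[OF tendsto_const])
        (auto simp: eventually_at_filter flat_exp_def)
    ultimately have "((\<lambda>h. flat_exp P h / h) \<longlongrightarrow> 0) (at 0)"
      by (simp add: filterlim_split_at)
    then show ?thesis using 3 by (simp add: DERIV_def flat_exp_def)
  qed
qed

lemma smooth_on_flat_exp: "smooth_on UNIV (flat_exp P)"
  by (rule smooth_on_real_family[where F = "range flat_exp"]) (use flat_exp_deriv in auto)

lemma flat_exp_1_nonneg: "flat_exp 1 t \<ge> 0"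
  and flat_exp_1_pos: "t > 0 \<Longrightarrow> flat_exp 1 t > 0"
  and flat_exp_1_zero: "t \<le> 0 \<Longrightarrow> flat_exp 1 t = 0"
  by (auto simp: flat_exp_def)

text \<open>The numbers t and 1 - t are not both \<le> 0, so the denominator of
  \<open>smooth_step\<close> has no zero.\<close>

lemma flat_exp_1_sum_pos: "flat_exp 1 t + flat_exp 1 (1 - t) > 0"
  using flat_exp_1_nonneg[of t] flat_exp_1_nonneg[of "1 - t"] flat_exp_1_pos[of t] flat_exp_1_pos[of "1 - t"]
  by (cases "t > 0") (auto intro: add_pos_nonneg add_nonneg_pos)

definition smooth_step :: "real \<Rightarrow> real" where
  "smooth_step t = flat_exp 1 t / (flat_exp 1 t + flat_exp 1 (1 - t))"

lemma smooth_on_smooth_step: "smooth_on UNIV smooth_step"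
proof -
  have "smooth_on UNIV (\<lambda>t. flat_exp 1 (1 - t))"
    by (rule smooth_on_compose[OF _ _ smooth_on_flat_exp[of 1]])
      (auto simp del: diff_conv_add_uminus intro!: smooth_on_diff[of _ "\<lambda>t. 1" "\<lambda>t. t", simplified] smooth_on_const smooth_on_id)
  then have "smooth_on UNIV (\<lambda>t. flat_exp 1 t / (flat_exp 1 t + flat_exp 1 (1 - t)))"
    by (intro smooth_on_divide smooth_on_add smooth_on_flat_exp)
      (use flat_exp_1_sum_pos in \<open>auto simp: less_le\<close>)
  then show ?thesis by (simp add: smooth_step_def[abs_def])
qed

lemma smooth_step_0: "t \<le> 0 \<Longrightarrow> smooth_step t = 0"
  by (simp add: smooth_step_def flat_exp_1_zero)

lemma smooth_step_1: "t \<ge> 1 \<Longrightarrow> smooth_step t = 1"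
  using flat_exp_1_pos[of t] by (simp add: smooth_step_def flat_exp_1_zero)

lemma smooth_step_ge_0: "0 \<le> smooth_step t"
  using flat_exp_1_sum_pos[of t] flat_exp_1_nonneg[of t] by (simp add: smooth_step_def)

lemma smooth_step_le_1: "smooth_step t \<le> 1"
  using flat_exp_1_sum_pos[of t] flat_exp_1_nonneg[of "1 - t"] by (simp add: smooth_step_def)

subsection \<open>Symmetry of second derivatives\<close>

lemma has_derivative_along_line:
  fixes f :: "'a::real_normed_vector \<Rightarrow> real"
  assumes "(f has_derivative F) (at (p + s *\<^sub>R v))"
  shows "((\<lambda>s. f (p + s *\<^sub>R v)) has_field_derivative F v) (at s)"
proof -
  have "((\<lambda>s. f (p + s *\<^sub>R v)) has_derivative (\<lambda>t. F (t *\<^sub>R v))) (at s)"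
    by (rule has_derivative_compose[where f = "\<lambda>s. p + s *\<^sub>R v" and g = f, OF _ assms])
      (auto intro!: derivative_eq_intros)
  moreover have "(\<lambda>t. F (t *\<^sub>R v)) = (*) (F v)"
    by (rule ext) (simp add: linear_cmul[OF has_derivative_linear[OF assms]])
  ultimately show ?thesis by (simp add: has_field_derivative_def)
qed

text \<open>The mean value theorem is used twice: along \<open>v\<close> for the difference of
  \<open>f\<close> and its translate in direction \<open>w\<close>, then along \<open>w\<close> for
  the derivative so obtained. The second difference itself is symmetric in \<open>v\<close> and
  \<open>w\<close>, which gives the symmetry of second derivatives below.\<close>

lemma second_difference_mvt:
  fixes f :: "'a::real_normed_vector \<Rightarrow> real"
  assumes f: "Ck_on (Suc (Suc 0)) (ball x r) f" and h: "h > 0" "h * (norm v + norm w) < r"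
  obtains y where "dist x y \<le> h * (norm v + norm w)"
    "f (x + h *\<^sub>R v + h *\<^sub>R w) - f (x + h *\<^sub>R v) - f (x + h *\<^sub>R w) + f x =
      h * h * frechet_derivative (\<lambda>y. frechet_derivative f (at y) v) (at y) w"
proof -
  let ?fv = "\<lambda>y. frechet_derivative f (at y) v"
  have fv: "Ck_on (Suc 0) (ball x r) ?fv" using f by simp
  have near: "x + s *\<^sub>R v + t *\<^sub>R w \<in> ball x r" "dist x (x + s *\<^sub>R v + t *\<^sub>R w) \<le> h * (norm v + norm w)"
    if "0 \<le> s" "s \<le> h" "0 \<le> t" "t \<le> h" for s t
  proof -
    have "norm (s *\<^sub>R v + t *\<^sub>R w) \<le> h * norm v + h * norm w"
      using that by (intro order_trans[OF norm_triangle_ineq] add_mono) (auto intro: mult_right_mono)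
    moreover have "dist x (x + s *\<^sub>R v + t *\<^sub>R w) = norm (s *\<^sub>R v + t *\<^sub>R w)"
      by (metis add.assoc add_diff_cancel_left' dist_commute dist_norm)
    ultimately show "x + s *\<^sub>R v + t *\<^sub>R w \<in> ball x r"
      "dist x (x + s *\<^sub>R v + t *\<^sub>R w) \<le> h * (norm v + norm w)"
      using h by (auto simp: distrib_left)
  qed
  have "\<exists>s>0. s < h \<and> (f (x + h *\<^sub>R w + h *\<^sub>R v) - f (x + h *\<^sub>R v)) - (f (x + h *\<^sub>R w + 0 *\<^sub>R v) - f (x + 0 *\<^sub>R v))
      = (h - 0) * (?fv (x + h *\<^sub>R w + s *\<^sub>R v) - ?fv (x + s *\<^sub>R v))"
  proof (rule MVT2)
    fix s :: real assume s: "0 \<le> s" "s \<le> h"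
    show "((\<lambda>s. f (x + h *\<^sub>R w + s *\<^sub>R v) - f (x + s *\<^sub>R v)) has_field_derivative
        ?fv (x + h *\<^sub>R w + s *\<^sub>R v) - ?fv (x + s *\<^sub>R v)) (at s)"
      using near(1)[of s h] near(1)[of s 0] s h
      by (intro DERIV_diff has_derivative_along_line Ck_on_has_derivative[OF f]) (auto simp: algebra_simps)
  qed (use h in auto)
  then obtain s where s: "0 < s" "s < h" "f (x + h *\<^sub>R v + h *\<^sub>R w) - f (x + h *\<^sub>R v) - f (x + h *\<^sub>R w) + f x
      = h * (?fv (x + s *\<^sub>R v + h *\<^sub>R w) - ?fv (x + s *\<^sub>R v))"
    by (auto simp: algebra_simps)
  have "\<exists>t>0. t < h \<and> ?fv (x + s *\<^sub>R v + h *\<^sub>R w) - ?fv (x + s *\<^sub>R v + 0 *\<^sub>R w)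
      = (h - 0) * frechet_derivative ?fv (at (x + s *\<^sub>R v + t *\<^sub>R w)) w"
  proof (rule MVT2)
    fix t :: real assume t: "0 \<le> t" "t \<le> h"
    show "((\<lambda>t. ?fv (x + s *\<^sub>R v + t *\<^sub>R w)) has_field_derivative
        frechet_derivative ?fv (at (x + s *\<^sub>R v + t *\<^sub>R w)) w) (at t)"
      using near(1)[of s t] t s by (intro has_derivative_along_line Ck_on_has_derivative[OF fv]) auto
  qed (use h in auto)
  then obtain t where t: "0 < t" "t < h" "?fv (x + s *\<^sub>R v + h *\<^sub>R w) - ?fv (x + s *\<^sub>R v)
      = h * frechet_derivative ?fv (at (x + s *\<^sub>R v + t *\<^sub>R w)) w"
    by auto
  show ?thesis
    by (rule that[of "x + s *\<^sub>R v + t *\<^sub>R w"]) (use near(2)[of s t] s t in auto)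
qed

lemma symmetric_second_frechet_derivative:
  fixes f :: "'a::real_normed_vector \<Rightarrow> real"
  assumes "open S" "Ck_on (Suc (Suc 0)) S f" "x \<in> S"
  shows "frechet_derivative (\<lambda>y. frechet_derivative f (at y) v) (at x) w =
    frechet_derivative (\<lambda>y. frechet_derivative f (at y) w) (at x) v"
proof (rule ccontr)
  let ?D = "\<lambda>v w y. frechet_derivative (\<lambda>y. frechet_derivative f (at y) v) (at y) w"
  assume ne: "?D v w x \<noteq> ?D w v x"
  define e where "e = \<bar>?D v w x - ?D w v x\<bar> / 2"
  have "e > 0" using ne by (simp add: e_def)
  have "continuous_on S (?D v w)" "continuous_on S (?D w v)" using assms(2) by auto
  then have "isCont (?D v w) x" "isCont (?D w v) x"
    using assms continuous_on_eq_continuous_at by blast+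
  then obtain d1 d2 where d: "d1 > 0" "\<And>y. dist y x < d1 \<Longrightarrow> dist (?D v w y) (?D v w x) < e"
     "d2 > 0" "\<And>y. dist y x < d2 \<Longrightarrow> dist (?D w v y) (?D w v x) < e"
    using \<open>e > 0\<close> unfolding continuous_at_eps_delta by metis
  obtain r where r: "r > 0" "ball x r \<subseteq> S" using assms openE by blast
  define c where "c = norm v + norm w + 1"
  have c: "c > 0" by (simp add: c_def add_nonneg_pos)
  \<comment> \<open>So small that both intermediate points fall where the two second derivatives
    differ from their values at \<open>x\<close> by less than \<open>e\<close>, which is half of the
    supposed gap between them.\<close>
  define h where "h = Min {d1, d2, r} / (2 * c)"
  have m: "Min {d1, d2, r} > 0" using d r by auto
  then have "h > 0" using c by (auto simp: h_def)
  have "h * (norm v + norm w) \<le> h * c" using \<open>h > 0\<close> by (intro mult_left_mono) (auto simp: c_def)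
  also have "... = Min {d1, d2, r} / 2" using c by (simp add: h_def)
  also have "... < Min {d1, d2, r}" using m by linarith
  finally have hd: "h * (norm v + norm w) < Min {d1, d2, r}" .
  then have "h * (norm v + norm w) < r" "h * (norm w + norm v) < r" by (auto simp: add.commute)
  from second_difference_mvt[OF Ck_on_subset[OF assms(2) r(2)] \<open>h > 0\<close> this(1)]
    second_difference_mvt[OF Ck_on_subset[OF assms(2) r(2)] \<open>h > 0\<close> this(2)]
  obtain y z where y: "dist x y \<le> h * (norm v + norm w)"
    "f (x + h *\<^sub>R v + h *\<^sub>R w) - f (x + h *\<^sub>R v) - f (x + h *\<^sub>R w) + f x = h * h * ?D v w y"
    and z: "dist x z \<le> h * (norm w + norm v)"
    "f (x + h *\<^sub>R w + h *\<^sub>R v) - f (x + h *\<^sub>R w) - f (x + h *\<^sub>R v) + f x = h * h * ?D w v z"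
    by metis
  have "h * h * ?D v w y = h * h * ?D w v z"
    using y(2) z(2) by (simp add: algebra_simps)
  then have "?D v w y = ?D w v z" using \<open>h > 0\<close> by simp
  moreover have "dist (?D v w y) (?D v w x) < e" "dist (?D w v z) (?D w v x) < e"
  proof -
    have "dist y x < d1" "dist z x < d2"
      using y(1) z(1) hd by (auto simp: dist_commute[of _ x] add.commute[of "norm w"])
    then show "dist (?D v w y) (?D v w x) < e" "dist (?D w v z) (?D w v x) < e" using d by blast+
  qed
  ultimately show False by (auto simp: e_def dist_real_def abs_if split: if_splits)
qed

subsection \<open>Smooth inverses\<close>

text \<open>The derivative of the inverse is the inverse of the matrix of the derivative of
  \<open>F\<close> at \<open>G y\<close>. By Cramer's rule (\<open>N\<close> below) its components
  are quotients of polynomials in the entries of that matrix, so from order \<open>k\<close> for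
  \<open>G\<close> follows order \<open>k\<close> for its derivative.\<close>

lemma smooth_on_inverse_map:
  fixes F G :: "real ^ 'n \<Rightarrow> real ^ 'n"
  assumes "open S" "open T" "smooth_on S F" "G ` T \<subseteq> S"
    and G: "\<And>y. y \<in> T \<Longrightarrow> (G has_derivative inv (frechet_derivative F (at (G y)))) (at y)"
    and bij: "\<And>y. y \<in> T \<Longrightarrow> bij (frechet_derivative F (at (G y)))"
  shows "smooth_on T G"
proof -
  define M where "M y = matrix (frechet_derivative F (at (G y)))" for y
  define N where "N v y = (\<chi> k. det (\<chi> i j. if j = k then v $ i else M y $ i $ j) / det (M y))" for v :: "real ^ 'n" and y
  have lin: "linear (frechet_derivative F (at (G y)))" if "y \<in> T" for y
    using smooth_on_imp_has_derivative[OF assms(3)] assms(4) that by (auto intro: has_derivative_linear)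
  have M: "frechet_derivative F (at (G y)) w = M y *v w" if "y \<in> T" for y w
    using fun_cong[OF matrix_vector_mul(2)[OF lin[OF that]], of w] by (simp add: M_def)
  have det: "det (M y) \<noteq> 0" if "y \<in> T" for y
  proof -
    have "frechet_derivative F (at (G y)) = (*v) (M y)" using M[OF that] by auto
    then show ?thesis using bij[OF that] by (metis invertible_det_nz invertible_eq_bij)
  qed
  have N: "inv (frechet_derivative F (at (G y))) v = N v y" if "y \<in> T" for y v
  proof -
    have "M y *v inv (frechet_derivative F (at (G y))) v = v"
      using M[OF that] bij[OF that] by (metis bij_inv_eq_iff)
    then show ?thesis unfolding N_def by (simp add: cramer[OF det[OF that]])
  qed
  have "Ck_on k T G" for k
  proof (induction k)
    case 0
    show ?case by (auto intro!: continuous_at_imp_continuous_on has_derivative_continuous[OF G])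
  next
    case (Suc k)
    have M_Ck: "Ck_on k T (\<lambda>y. M y $ i $ j)" for i j
    proof -
      have "Ck_on k S (\<lambda>x. frechet_derivative F (at x) (axis j 1) $ i)"
        using smooth_on_nth[OF assms(1) smooth_on_frechet[OF assms(3)]] by (simp add: smooth_on_def)
      from Ck_on_compose[OF assms(2,4) this Suc] show ?thesis
        by (simp add: M_def matrix_def)
    qed
    have det_Ck: "Ck_on k T (\<lambda>y. det (A y))"
      if "\<And>i j. Ck_on k T (\<lambda>y. A y $ i $ j)" for A :: "real ^ 'n \<Rightarrow> real ^ 'n ^ 'n"
      unfolding det_def
      by (rule Ck_on_sum[OF assms(2) Ck_on_bilinear[OF bounded_bilinear_mult assms(2) Ck_on_const
        Ck_on_prod[OF assms(2) that]]])
    have "Ck_on k T (N v)" for v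
      unfolding N_def
    proof (rule Ck_on_vec_nth[OF assms(2)])
      fix i
      have a: "Ck_on k T (\<lambda>y. det (\<chi> i' j. if j = i then v $ i' else M y $ i' $ j))"
      proof (rule det_Ck)
        show "Ck_on k T (\<lambda>y. (\<chi> i' j. if j = i then v $ i' else M y $ i' $ j) $ i' $ j)" for i' j
          by (cases "j = i") (simp_all add: M_Ck Ck_on_const)
      qed
      have b: "Ck_on k T (\<lambda>y. inverse (det (M y)))"
        by (rule Ck_on_compose[OF assms(2) _ Ck_on_inverse det_Ck[OF M_Ck]]) (use det in auto)
      show "Ck_on k T (\<lambda>y. (\<chi> k. det (\<chi> i j. if j = k then v $ i else M y $ i $ j) / det (M y)) $ i)"
        using Ck_on_bilinear[OF bounded_bilinear_mult assms(2) a b] by (simp add: divide_inverse)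
    qed
    then have "Ck_on k T (\<lambda>y. inv (frechet_derivative F (at (G y))) v)" for v
      by (rule Ck_on_cong[OF assms(2), rotated]) (simp add: N)
    then show ?case by (intro Ck_on_SucI[OF assms(2) G])
  qed
  then show ?thesis by (simp add: smooth_on_def)
qed

text \<open>The inverse function theorem asks for derivatives that vary continuously as bounded
  linear maps, and yields an inverse that is differentiable with the inverse derivatives; the
  previous lemma upgrades this to smoothness.\<close>

lemma smooth_local_inverse:
  fixes F :: "real ^ 'n \<Rightarrow> real ^ 'n"
  assumes "open S" "smooth_on S F" "x0 \<in> S" "inj (frechet_derivative F (at x0))"
  obtains U V G where "open U" "U \<subseteq> S" "x0 \<in> U" "open V" "homeomorphism U V F G" "smooth_on V G"
proof -
  have der: "(F has_derivative frechet_derivative F (at x)) (at x)" if "x \<in> S" for x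
    using smooth_on_imp_has_derivative[OF assms(2) that] .
  have bl: "bounded_linear (frechet_derivative F (at x))" if "x \<in> S" for x
    using der[OF that] by (rule has_derivative_bounded_linear)
  have app: "blinfun_apply (Blinfun (frechet_derivative F (at x))) = frechet_derivative F (at x)" if "x \<in> S" for x
    using bl[OF that] by (rule bounded_linear_Blinfun_apply)
  have lin: "linear (frechet_derivative F (at x0))" using bl[OF assms(3)] by (rule bounded_linear.linear)
  obtain K where K: "linear K" "K \<circ> frechet_derivative F (at x0) = id"
    using linear_injective_left_inverse[OF lin assms(4)] by blast
  have Kb: "bounded_linear K" using K(1) by (simp add: linear_conv_bounded_linear)
  have 1: "(F has_derivative blinfun_apply (Blinfun (frechet_derivative F (at x)))) (at x)" if "x \<in> S" for x
    using der app that by simp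
  have 2: "continuous_on S (\<lambda>x. Blinfun (frechet_derivative F (at x)))"
  proof (rule continuous_on_blinfun_componentwise)
    fix i :: "real ^ 'n"
    have "continuous_on S (\<lambda>x. frechet_derivative F (at x) i)"
      using smooth_on_imp_continuous_on[OF smooth_on_frechet[OF assms(2)]] .
    then show "continuous_on S (\<lambda>x. blinfun_apply (Blinfun (frechet_derivative F (at x))) i)"
      using app by (auto cong: continuous_on_cong)
  qed
  have 3: "Blinfun K o\<^sub>L Blinfun (frechet_derivative F (at x0)) = id_blinfun"
    using K(2) by (intro blinfun_eqI) (auto simp: app[OF assms(3)] bounded_linear_Blinfun_apply[OF Kb] fun_eq_iff)
  obtain U V G G' where UV: "open U" "U \<subseteq> S" "x0 \<in> U" "open V" "F x0 \<in> V" "homeomorphism U V F G"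
    "\<And>y. y \<in> V \<Longrightarrow> (G has_derivative G' y) (at y)"
    "\<And>y. y \<in> V \<Longrightarrow> G' y = inv (blinfun_apply (Blinfun (frechet_derivative F (at (G y)))))"
    "\<And>y. y \<in> V \<Longrightarrow> bij (blinfun_apply (Blinfun (frechet_derivative F (at (G y)))))"
    using inverse_function_theorem[OF assms(1) 1 2 assms(3) 3] by (metis (no_types, lifting))
  have GV: "G y \<in> S" if "y \<in> V" for y using UV(2,6) that by (auto simp: homeomorphism_def)
  have "smooth_on V G"
    by (rule smooth_on_inverse_map[OF assms(1) UV(4) assms(2)]) (use UV(7-9) GV app in auto)
  then show ?thesis using that UV by blast
qed

text \<open>Built from the squared distance, which unlike the distance is smooth at the centre: the
  argument of the step is at least 1 within distance \<rho> and at most -2 beyond 2 \<rho>.\<close>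

lemma euclidean_bump:
  fixes x0 :: "'a::euclidean_space"
  assumes "\<rho> > 0"
  obtains \<beta> :: "'a \<Rightarrow> real" where "smooth_on UNIV \<beta>" "\<And>x. 0 \<le> \<beta> x" "\<And>x. \<beta> x \<le> 1"
    "\<And>x. dist x0 x \<le> \<rho> \<Longrightarrow> \<beta> x = 1" "\<And>x. dist x0 x \<ge> 2 * \<rho> \<Longrightarrow> \<beta> x = 0"
proof
  let ?\<beta> = "\<lambda>x. smooth_step (2 - (1 / \<rho>\<^sup>2) * ((x - x0) \<bullet> (x - x0)))"
  have d: "smooth_on UNIV (\<lambda>x. x - x0)" by (intro smooth_on_diff smooth_on_id smooth_on_const) auto
  show "smooth_on UNIV ?\<beta>"
    by (rule smooth_on_compose[OF open_UNIV subset_UNIV smooth_on_smooth_step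
      smooth_on_diff[OF open_UNIV smooth_on_const
        smooth_on_mult[OF open_UNIV smooth_on_const smooth_on_inner[OF open_UNIV d d]]]])
  have sq: "(x - x0) \<bullet> (x - x0) = (dist x0 x)\<^sup>2" for x
    by (metis dist_commute dist_norm power2_norm_eq_inner)
  show "?\<beta> x = 1" if "dist x0 x \<le> \<rho>" for x
  proof (rule smooth_step_1)
    have "(dist x0 x)\<^sup>2 \<le> \<rho>\<^sup>2" using that by (intro power_mono) auto
    then show "1 \<le> 2 - 1 / \<rho>\<^sup>2 * ((x - x0) \<bullet> (x - x0))" using assms by (simp add: sq)
  qed
  show "?\<beta> x = 0" if "dist x0 x \<ge> 2 * \<rho>" for x
  proof (rule smooth_step_0)
    have "(2 * \<rho>)\<^sup>2 \<le> (dist x0 x)\<^sup>2" using that assms by (intro power_mono) auto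
    then show "2 - 1 / \<rho>\<^sup>2 * ((x - x0) \<bullet> (x - x0)) \<le> 0"
      using assms by (simp add: sq field_simps power_mult_distrib) (smt (verit) zero_le_power2)
  qed
qed (auto simp: smooth_step_ge_0 smooth_step_le_1)

subsection \<open>Smoothing Lipschitz functions\<close>

lemma frechet_derivative_zero_open:
  assumes "open S" "x \<in> S" "\<And>y. y \<in> S \<Longrightarrow> f y = c"
  shows "frechet_derivative f (at x) = (\<lambda>v. 0)"
proof -
  have "(f has_derivative (\<lambda>v. 0)) (at x)"
    by (rule has_derivative_transform_within_open[OF has_derivative_const[of c] assms(1,2)])
      (use assms(3) in auto)
  then show ?thesis by (metis frechet_derivative_at)
qed

text \<open>A bump supported in [-1, 1], written as a difference of neighbouring steps so that the
  sum of its integer translates telescopes to 1.\<close>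

definition hat :: "real \<Rightarrow> real" where
  "hat t = smooth_step (t + 1) - smooth_step t"

lemma smooth_on_hat: "smooth_on UNIV hat"
proof -
  have 1: "smooth_on UNIV (\<lambda>t::real. t + 1)"
    by (rule smooth_on_add[OF open_UNIV smooth_on_id[OF open_UNIV] smooth_on_const])
  show ?thesis unfolding hat_def[abs_def]
    by (rule smooth_on_diff[OF open_UNIV smooth_on_compose[OF open_UNIV subset_UNIV smooth_on_smooth_step 1]
        smooth_on_smooth_step])
qed

lemma abs_hat_le_1: "\<bar>hat t\<bar> \<le> 1"
  using smooth_step_ge_0[of t] smooth_step_ge_0[of "t+1"] smooth_step_le_1[of t] smooth_step_le_1[of "t+1"]
  by (auto simp: hat_def abs_le_iff)

lemma hat_eq_0: "\<bar>t\<bar> \<ge> 1 \<Longrightarrow> hat t = 0"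
  by (cases "t \<ge> 0") (auto simp: hat_def smooth_step_0 smooth_step_1)

lemma hat_sum: "\<bar>t\<bar> \<le> real N \<Longrightarrow> (\<Sum>z\<in>{- int N..int N}. hat (t - of_int z)) = 1"
proof -
  have "(\<Sum>z\<in>{- int N..int N}. hat (t - of_int z)) = smooth_step (t + N + 1) - smooth_step (t - N)"
  proof (induction N)
    case (Suc N)
    have "{- int (Suc N)..int (Suc N)} = insert (- int (Suc N)) (insert (int (Suc N)) {- int N..int N})" by auto
    then show ?case using Suc by (simp add: hat_def algebra_simps)
  qed (simp add: hat_def)
  then show "\<bar>t\<bar> \<le> real N \<Longrightarrow> ?thesis" by (simp add: smooth_step_0 smooth_step_1)
qed

definition hat_vec :: "real ^ 'k \<Rightarrow> real" where
  "hat_vec y = (\<Prod>i\<in>UNIV. hat (y $ i))"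

definition lattice_box :: "nat \<Rightarrow> ('k::finite \<Rightarrow> int) set" where
  "lattice_box N = (\<Pi>\<^sub>E i\<in>UNIV. {- int N..int N})"

definition lattice_pt :: "('k::finite \<Rightarrow> int) \<Rightarrow> real ^ 'k" where
  "lattice_pt z = (\<chi> i. of_int (z i))"

lemma finite_lattice_box: "finite (lattice_box N)"
  by (auto simp: lattice_box_def intro: finite_PiE)

lemma smooth_on_hat_vec: "smooth_on UNIV (hat_vec :: real ^ 'k \<Rightarrow> real)"
proof -
  have "smooth_on UNIV (\<lambda>y :: real ^ 'k. hat (y $ i))" for i
    by (rule smooth_on_compose[OF open_UNIV subset_UNIV smooth_on_hat smooth_on_nth[OF open_UNIV smooth_on_id[OF open_UNIV]]])
  then show ?thesis unfolding hat_vec_def[abs_def] by (rule smooth_on_prod[OF open_UNIV])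
qed

lemma hat_vec_eq_0: "\<bar>y $ i\<bar> \<ge> 1 \<Longrightarrow> hat_vec y = 0"
  using hat_eq_0[of "y $ i"] by (auto simp: hat_vec_def)

lemma abs_hat_vec_le_1: "\<bar>hat_vec y\<bar> \<le> 1"
  unfolding hat_vec_def abs_prod by (rule prod_le_1) (simp add: abs_hat_le_1)

text \<open>The product of the one-dimensional partitions of unity, multiplied out over the lattice
  points of the box.\<close>

lemma hat_vec_sum:
  assumes "\<And>i. \<bar>y $ i\<bar> \<le> real N"
  shows "(\<Sum>z\<in>lattice_box N. hat_vec (y - lattice_pt z)) = 1"
proof -
  have "(\<Sum>z\<in>lattice_box N. hat_vec (y - lattice_pt z))
      = (\<Prod>i\<in>UNIV. \<Sum>z\<in>{- int N..int N}. hat (y $ i - of_int z))"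
    by (simp add: hat_vec_def lattice_box_def lattice_pt_def prod_sum_PiE)
  then show ?thesis using hat_sum[OF assms] by simp
qed

lemma hat_vec_derivative_eq_0: "\<bar>y $ i\<bar> > 1 \<Longrightarrow> frechet_derivative hat_vec (at y) = (\<lambda>v. 0)"
  by (rule frechet_derivative_zero_open[of "{y. \<bar>y $ i\<bar> > 1}" _ _ 0])
    (auto simp: hat_vec_eq_0[of _ i] less_imp_le intro!: open_Collect_less continuous_intros)

text \<open>Outside the cube [-1, 1]^k the derivative vanishes, and on the cube it is continuous,
  hence bounded; the bounds for the basis vectors add up.\<close>

lemma hat_vec_derivative_bound:
  obtains M where "M \<ge> 0" "\<And>y v :: real ^ 'k. \<bar>frechet_derivative hat_vec (at y) v\<bar> \<le> M * norm v"
proof -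
  let ?D = "\<lambda>y :: real ^ 'k. frechet_derivative hat_vec (at y)"
  have "\<exists>m\<ge>0. \<forall>y. \<bar>?D y (axis i 1)\<bar> \<le> m" for i
  proof -
    have c: "compact ((\<lambda>y. ?D y (axis i 1)) ` cbox (\<chi> i. - 1) (\<chi> i. 1))"
      by (intro compact_continuous_image continuous_on_subset
          [OF smooth_on_imp_continuous_on[OF smooth_on_frechet[OF smooth_on_hat_vec]]]) auto
    then obtain m where m: "\<And>y. y \<in> cbox (\<chi> i. - 1) (\<chi> i. 1) \<Longrightarrow> \<bar>?D y (axis i 1)\<bar> \<le> m"
      using compact_imp_bounded[OF c] unfolding bounded_iff by auto
    have "\<bar>?D y (axis i 1)\<bar> \<le> max m 0" for y
    proof (cases "y \<in> cbox (\<chi> i. - 1) (\<chi> i. 1)")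
      case False
      then obtain j where "\<not> (- 1 \<le> y $ j \<and> y $ j \<le> 1)" by (auto simp: mem_box_cart)
      then have "\<bar>y $ j\<bar> > 1" by linarith
      then show ?thesis by (simp add: hat_vec_derivative_eq_0)
    qed (use m in fastforce)
    then show ?thesis by (intro exI[of _ "max m 0"]) auto
  qed
  then obtain m where m: "\<And>i. m i \<ge> 0" "\<And>i y. \<bar>?D y (axis i 1)\<bar> \<le> m i" by metis
  have "\<bar>?D y v\<bar> \<le> (\<Sum>i\<in>UNIV. m i) * norm v" for y v
  proof -
    have lin: "linear (?D y)"
      using smooth_on_imp_has_derivative[OF smooth_on_hat_vec] by (auto intro: has_derivative_linear)
    have "v = (\<Sum>i\<in>UNIV. (v $ i) *\<^sub>R axis i 1)"
      using basis_expansion[of v] by (simp only: scalar_mult_eq_scaleR)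
    then have "?D y v = ?D y (\<Sum>i\<in>UNIV. (v $ i) *\<^sub>R axis i 1)" by simp
    also have "... = (\<Sum>i\<in>UNIV. v $ i * ?D y (axis i 1))"
      by (simp only: linear_sum[OF lin] linear_cmul[OF lin] real_scaleR_def)
    also have "\<bar>...\<bar> \<le> (\<Sum>i\<in>UNIV. norm v * m i)"
      by (rule order_trans[OF sum_abs])
        (auto intro!: sum_mono mult_mono simp: abs_mult m component_le_norm_cart)
    finally show ?thesis by (simp add: sum_distrib_left mult.commute)
  qed
  then show ?thesis using that[of "\<Sum>i\<in>UNIV. m i"] m(1) by (auto intro: sum_nonneg)
qed

text \<open>In each coordinate at most three integers lie within distance 1 of a given real. The
  bound does not involve the size \<open>N\<close> of the box, which makes the smoothing constant
  uniform.\<close>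

lemma card_near_lattice_le:
  "card {z \<in> lattice_box N. \<forall>i. \<bar>(y :: real ^ 'k) $ i - of_int (z i)\<bar> \<le> 1} \<le> 3 ^ CARD('k)"
proof -
  let ?T = "\<lambda>i. {\<lceil>y $ i - 1\<rceil>..\<lfloor>y $ i + 1\<rfloor>}"
  have 1: "{z \<in> lattice_box N. \<forall>i. \<bar>y $ i - of_int (z i)\<bar> \<le> 1} \<subseteq> (\<Pi>\<^sub>E i\<in>UNIV. ?T i)"
  proof (intro subsetI PiE_I)
    fix z i assume "z \<in> {z \<in> lattice_box N. \<forall>i. \<bar>y $ i - of_int (z i)\<bar> \<le> 1}"
    then have "\<bar>y $ i - of_int (z i)\<bar> \<le> 1" by auto
    then have "of_int (z i) \<le> y $ i + 1" "y $ i - 1 \<le> of_int (z i)" by linarith+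
    then show "z i \<in> ?T i"
      unfolding atLeastAtMost_iff by (intro conjI le_floor_iff[THEN iffD2] ceiling_le_iff[THEN iffD2])
  qed auto
  have 2: "card (\<Pi>\<^sub>E i\<in>UNIV. ?T i) \<le> (\<Prod>i\<in>(UNIV :: 'k set). 3)"
    unfolding card_PiE[OF finite_class.finite_UNIV]
  proof (rule prod_mono)
    fix i
    have "real_of_int (\<lfloor>y $ i + 1\<rfloor> - \<lceil>y $ i - 1\<rceil>) \<le> 2"
      using of_int_floor_le[of "y $ i + 1"] le_of_int_ceiling[of "y $ i - 1"] by linarith
    then have "\<lfloor>y $ i + 1\<rfloor> + 1 - \<lceil>y $ i - 1\<rceil> \<le> 3" by linarith
    then have "nat (\<lfloor>y $ i + 1\<rfloor> + 1 - \<lceil>y $ i - 1\<rceil>) \<le> 3" by (simp only: nat_le_iff of_nat_numeral)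
    then show "0 \<le> card (?T i) \<and> card (?T i) \<le> 3" by (simp only: card_atLeastAtMost_int le0 simp_thms)
  qed
  have 3: "finite (\<Pi>\<^sub>E i\<in>UNIV. ?T i)" by (intro finite_PiE) auto
  show ?thesis by (rule order_trans[OF card_mono[OF 3 1] order_trans[OF 2]]) simp
qed

text \<open>Interpolation of the values on a fine lattice. The gradient is bounded because near a point only
  \<open>3 ^ CARD('k)\<close> lattice points contribute, and the derivatives of the weights sum to \<open>0\<close>.\<close>

lemma Lipschitz_smoothing:
  obtains L where "L > 0"
    "\<And>(u :: real ^ 'k \<Rightarrow> real) y0 r e. r > 0 \<Longrightarrow> e > 0 \<Longrightarrow>
      (\<And>x y. x \<in> ball y0 (2 * r) \<Longrightarrow> y \<in> ball y0 (2 * r) \<Longrightarrow> \<bar>u x - u y\<bar> \<le> dist x y) \<Longrightarrow>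
      \<exists>V. smooth_on UNIV V \<and>
        (\<forall>y\<in>ball y0 r. \<bar>V y - u y\<bar> \<le> e \<and> (\<forall>v. \<bar>frechet_derivative V (at y) v\<bar> \<le> L * norm v))"
proof -
  let ?c = "real CARD('k)"
  obtain M where M: "M \<ge> 0" "\<And>y v :: real ^ 'k. \<bar>frechet_derivative hat_vec (at y) v\<bar> \<le> M * norm v"
    using hat_vec_derivative_bound by blast
  \<comment> \<open>The number of contributing lattice points, times a bound for their distance in
    units of the mesh, times the bound on the derivative of a weight; the mesh itself cancels. The 1
    secures positivity.\<close>
  define L where "L = 3 ^ CARD('k) * ?c * M + 1"
  have "L > 0" using M(1) by (simp add: L_def add_nonneg_pos)
  moreover have "\<exists>V. smooth_on UNIV V \<and>
        (\<forall>y\<in>ball y0 r. \<bar>V y - u y\<bar> \<le> e \<and> (\<forall>v. \<bar>frechet_derivative V (at y) v\<bar> \<le> L * norm v))"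
    if r: "r > 0" and e: "e > 0"
      and u: "\<And>x y. x \<in> ball y0 (2 * r) \<Longrightarrow> y \<in> ball y0 (2 * r) \<Longrightarrow> \<bar>u x - u y\<bar> \<le> dist x y"
    for u :: "real ^ 'k \<Rightarrow> real" and y0 r e
  proof -
    \<comment> \<open>The mesh of the lattice. The first bound keeps the lattice points near
      \<open>ball y0 r\<close> inside \<open>ball y0 (2 * r)\<close>, where \<open>u\<close> is
      Lipschitz; the second makes the interpolation error at most \<open>e\<close>.\<close>
    define s where "s = min (r / (2 * ?c)) (e / (3 ^ CARD('k) * ?c))"
    have cpos: "?c > 0" by simp
    have s: "s > 0" "s * ?c < r" "3 ^ CARD('k) * (s * ?c) \<le> e"
    proof -
      show "s > 0" using r e by (auto simp: s_def)
      have "s * ?c \<le> r / (2 * ?c) * ?c" by (intro mult_right_mono) (auto simp: s_def)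
      then show "s * ?c < r" using r by simp
      have "3 ^ CARD('k) * (s * ?c) \<le> 3 ^ CARD('k) * (e / (3 ^ CARD('k) * ?c) * ?c)"
        by (intro mult_left_mono mult_right_mono) (auto simp: s_def)
      then show "3 ^ CARD('k) * (s * ?c) \<le> e" by simp
    qed
    \<comment> \<open>Points of the rescaled ball have coordinates of size at most \<open>N\<close>,
      so on the ball the weights indexed by the box sum to 1.\<close>
    define N where "N = nat \<lceil>(norm y0 + r) / s\<rceil>"
    define w where "w z y = hat_vec ((1 / s) *\<^sub>R y - lattice_pt z)" for z :: "'k \<Rightarrow> int" and y
    define nr where "nr y z \<longleftrightarrow> (\<forall>i. \<bar>((1 / s) *\<^sub>R y) $ i - of_int (z i)\<bar> \<le> 1)" for y :: "real ^ 'k" and z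
    define V where "V y = (\<Sum>z\<in>lattice_box N. u (s *\<^sub>R lattice_pt z) * w z y)" for y
    have aff: "smooth_on UNIV (\<lambda>y. (1 / s) *\<^sub>R y - lattice_pt z)" for z :: "'k \<Rightarrow> int"
      by (rule smooth_on_diff[OF open_UNIV smooth_on_scaleR[OF open_UNIV smooth_on_const smooth_on_id[OF open_UNIV]] smooth_on_const])
    have w_smooth: "smooth_on UNIV (w z)" for z
      unfolding w_def[abs_def] by (rule smooth_on_compose[OF open_UNIV subset_UNIV smooth_on_hat_vec aff])
    have V_smooth: "smooth_on UNIV V"
      unfolding V_def[abs_def]
      by (rule smooth_on_sum[OF open_UNIV smooth_on_mult[OF open_UNIV smooth_on_const w_smooth]])
    have w_der: "(w z has_derivative (\<lambda>v. (1 / s) * frechet_derivative hat_vec (at ((1 / s) *\<^sub>R y - lattice_pt z)) v)) (at y)" for z y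
    proof -
      have h: "(hat_vec has_derivative frechet_derivative hat_vec (at ((1 / s) *\<^sub>R y - lattice_pt z))) (at ((1 / s) *\<^sub>R y - lattice_pt z))"
        by (rule smooth_on_imp_has_derivative[OF smooth_on_hat_vec UNIV_I])
      have "((\<lambda>y. (1 / s) *\<^sub>R y - lattice_pt z) has_derivative (\<lambda>v. (1 / s) *\<^sub>R v)) (at y)"
        by (auto intro!: derivative_eq_intros)
      from has_derivative_compose[OF this h] show ?thesis
        by (simp only: w_def[abs_def] linear_cmul[OF has_derivative_linear[OF h]] real_scaleR_def)
    qed
    have far: "w z y = 0" "frechet_derivative hat_vec (at ((1 / s) *\<^sub>R y - lattice_pt z)) v = 0"
      if nnr: "\<not> nr y z" for z y v
    proof -
      obtain i where "\<not> \<bar>((1 / s) *\<^sub>R y) $ i - of_int (z i)\<bar> \<le> 1"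
        using nnr unfolding nr_def by blast
      then have i: "\<bar>((1 / s) *\<^sub>R y - lattice_pt z) $ i\<bar> > 1" by (simp add: lattice_pt_def)
      then show "w z y = 0" unfolding w_def by (intro hat_vec_eq_0[of _ i]) linarith
      show "frechet_derivative hat_vec (at ((1 / s) *\<^sub>R y - lattice_pt z)) v = 0"
        using hat_vec_derivative_eq_0[OF i] by (rule fun_cong)
    qed
    have near: "\<bar>u (s *\<^sub>R lattice_pt z) - u y\<bar> \<le> s * ?c"
      if "nr y z" "y \<in> ball y0 r" for z y
    proof -
      have "dist (s *\<^sub>R lattice_pt z) y = norm (s *\<^sub>R ((1 / s) *\<^sub>R y - lattice_pt z))"
        using s(1) by (simp add: dist_norm norm_minus_commute algebra_simps)
      also have "... = s * norm ((1 / s) *\<^sub>R y - lattice_pt z)" using s(1) by simp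
      also have "norm ((1 / s) *\<^sub>R y - lattice_pt z) \<le> (\<Sum>i\<in>UNIV. \<bar>((1 / s) *\<^sub>R y - lattice_pt z) $ i\<bar>)"
        by (rule norm_le_l1_cart)
      also have "... \<le> (\<Sum>i\<in>(UNIV :: 'k set). 1)"
        using that(1) by (intro sum_mono) (simp add: nr_def lattice_pt_def)
      finally have d: "dist (s *\<^sub>R lattice_pt z) y \<le> s * ?c" using s(1) by simp
      have "dist y0 (s *\<^sub>R lattice_pt z) \<le> dist y0 y + dist (s *\<^sub>R lattice_pt z) y"
        using dist_triangle[of y0 "s *\<^sub>R lattice_pt z" y] by (simp only: dist_commute[of y])
      then have "s *\<^sub>R lattice_pt z \<in> ball y0 (2 * r)" "y \<in> ball y0 (2 * r)" using d s that(2) r by auto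
      from u[OF this] d show ?thesis by linarith
    qed
    have one: "(\<Sum>z\<in>lattice_box N. w z y) = 1" if "y \<in> ball y0 r" for y
      unfolding w_def
    proof (rule hat_vec_sum)
      fix i
      have "\<bar>y $ i\<bar> \<le> norm y" by (rule component_le_norm_cart)
      also have "... \<le> norm y0 + r"
        using that norm_triangle_ineq2[of y y0] by (simp add: dist_norm norm_minus_commute)
      finally have "\<bar>y $ i\<bar> / s \<le> (norm y0 + r) / s" using s(1) by (simp add: divide_right_mono)
      also have "... \<le> real N" by (simp add: N_def real_nat_ceiling_ge)
      finally have "\<bar>y $ i\<bar> / s \<le> real N" .
      moreover have "\<bar>((1 / s) *\<^sub>R y) $ i\<bar> = \<bar>y $ i\<bar> / s" using s(1) by simp
      ultimately show "\<bar>((1 / s) *\<^sub>R y) $ i\<bar> \<le> real N" by (simp only:)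
    qed
    \<comment> \<open>Used for the weights and again for their derivatives. Subtracting
      \<open>u y\<close> costs nothing, as the weights sum to 1 and their derivatives to 0, and it
      leaves differences of \<open>u\<close> over distances of the order of the mesh.\<close>
    have bound: "\<bar>\<Sum>z\<in>lattice_box N. (u (s *\<^sub>R lattice_pt z) - u y) * a z\<bar> \<le> 3 ^ CARD('k) * (s * ?c * K)"
      if "y \<in> ball y0 r" "K \<ge> 0" "\<And>z. \<bar>a z\<bar> \<le> K"
        "\<And>z. \<not> nr y z \<Longrightarrow> a z = 0" for y a K
    proof -
      let ?A = "{z \<in> lattice_box N. nr y z}"
      have "(\<Sum>z\<in>lattice_box N. (u (s *\<^sub>R lattice_pt z) - u y) * a z)
        = (\<Sum>z\<in>?A. (u (s *\<^sub>R lattice_pt z) - u y) * a z)"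
      proof (rule sum.mono_neutral_right[OF finite_lattice_box])
        show "\<forall>z\<in>lattice_box N - ?A. (u (s *\<^sub>R lattice_pt z) - u y) * a z = 0"
        proof
          fix z assume "z \<in> lattice_box N - ?A"
          then have "\<not> nr y z" by simp
          from that(4)[OF this] show "(u (s *\<^sub>R lattice_pt z) - u y) * a z = 0" by simp
        qed
      qed auto
      also have "\<bar>...\<bar> \<le> (\<Sum>z\<in>?A. s * ?c * K)"
      proof (rule order_trans[OF sum_abs sum_mono])
        fix z assume "z \<in> ?A"
        then have "\<bar>u (s *\<^sub>R lattice_pt z) - u y\<bar> * \<bar>a z\<bar> \<le> s * ?c * K"
          using near[OF _ that(1)] that(3) s(1) by (intro mult_mono) auto
        then show "\<bar>(u (s *\<^sub>R lattice_pt z) - u y) * a z\<bar> \<le> s * ?c * K" by (simp add: abs_mult)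
      qed
      also have "... = real (card ?A) * (s * ?c * K)" by simp
      also have "... \<le> 3 ^ CARD('k) * (s * ?c * K)"
        using card_near_lattice_le[of N "(1 / s) *\<^sub>R y"] that(2) s(1)
        by (intro mult_right_mono) (simp_all add: nr_def del: vector_scaleR_component flip: of_nat_le_iff)
      finally show ?thesis .
    qed
    have "\<bar>V y - u y\<bar> \<le> e" if "y \<in> ball y0 r" for y
    proof -
      have "V y - u y = V y - u y * (\<Sum>z\<in>lattice_box N. w z y)" using one[OF that] by simp
      also have "... = (\<Sum>z\<in>lattice_box N. (u (s *\<^sub>R lattice_pt z) - u y) * w z y)"
        by (simp add: V_def sum_distrib_left sum_subtractf left_diff_distrib)
      also have "\<bar>...\<bar> \<le> 3 ^ CARD('k) * (s * ?c * 1)"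
        by (rule bound[OF that]) (use far(1) in \<open>auto simp: w_def abs_hat_vec_le_1\<close>)
      finally show ?thesis using s(3) by simp
    qed
    moreover have "\<bar>frechet_derivative V (at y) v\<bar> \<le> L * norm v" if y: "y \<in> ball y0 r" for y v
    proof -
      let ?d = "\<lambda>z v. (1 / s) * frechet_derivative hat_vec (at ((1 / s) *\<^sub>R y - lattice_pt z)) v"
      have 1: "((\<lambda>y. \<Sum>z\<in>lattice_box N. w z y) has_derivative (\<lambda>v. \<Sum>z\<in>lattice_box N. ?d z v)) (at y)"
        by (intro has_derivative_sum w_der)
      have 2: "((\<lambda>y. \<Sum>z\<in>lattice_box N. w z y) has_derivative (\<lambda>v. 0)) (at y)"
        by (rule has_derivative_transform_within_open[OF has_derivative_const[of 1] open_ball y])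
          (use one in auto)
      have zero: "(\<Sum>z\<in>lattice_box N. ?d z v) = 0"
        by (rule fun_cong[OF has_derivative_unique[OF 1 2]])
      have "(V has_derivative (\<lambda>v. \<Sum>z\<in>lattice_box N. u (s *\<^sub>R lattice_pt z) * ?d z v)) (at y)"
        unfolding V_def[abs_def] by (intro has_derivative_sum has_derivative_mult_right w_der)
      from fun_cong[OF frechet_derivative_at[OF this], of v, symmetric]
      have "frechet_derivative V (at y) v = (\<Sum>z\<in>lattice_box N. u (s *\<^sub>R lattice_pt z) * ?d z v)" .
      also have "... = (\<Sum>z\<in>lattice_box N. u (s *\<^sub>R lattice_pt z) * ?d z v) - u y * (\<Sum>z\<in>lattice_box N. ?d z v)"
        by (simp only: zero)
      also have "... = (\<Sum>z\<in>lattice_box N. (u (s *\<^sub>R lattice_pt z) - u y) * ?d z v)"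
        by (simp only: sum_distrib_left sum_subtractf left_diff_distrib)
      also have "\<bar>...\<bar> \<le> 3 ^ CARD('k) * (s * ?c * ((1 / s) * (M * norm v)))"
      proof (rule bound[OF y])
        show "\<bar>?d z v\<bar> \<le> (1 / s) * (M * norm v)" for z
          using M(2)[of "(1 / s) *\<^sub>R y - lattice_pt z" v] s(1) by (simp add: abs_mult divide_right_mono)
      qed (use M(1) s(1) far(2) in auto)
      also have "... = 3 ^ CARD('k) * ?c * M * norm v" using s(1) by simp
      also have "... \<le> L * norm v" by (intro mult_right_mono) (auto simp: L_def)
      finally show ?thesis .
    qed
    ultimately show ?thesis using V_smooth by blast
  qed
  ultimately show ?thesis using that[of L] by blast
qed

section \<open>Smooth functions on a manifold\<close>

locale manifold =
  fixes A :: "('m::{t2_space, second_countable_topology}, 'n::finite) atlas"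
  assumes atlas: "is_atlas A"
begin

lemma chart_open: "(U, \<phi>) \<in> A \<Longrightarrow> open U"
  and chart_open_range: "(U, \<phi>) \<in> A \<Longrightarrow> open (\<phi> ` U)"
  and chart_homeomorphism: "(U, \<phi>) \<in> A \<Longrightarrow> homeomorphism U (\<phi> ` U) \<phi> (inv_into U \<phi>)"
  and chart_transition: "(U, \<phi>) \<in> A \<Longrightarrow> (V, \<psi>) \<in> A \<Longrightarrow> smooth_on (\<phi> ` (U \<inter> V)) (\<psi> \<circ> inv_into U \<phi>)"
  using atlas unfolding is_atlas_def by blast+

lemma chart_exists: obtains U \<phi> where "(U, \<phi>) \<in> A" "p \<in> U"
proof -
  have "p \<in> (\<Union>(U, \<phi>)\<in>A. U)" using atlas by (simp add: is_atlas_def)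
  then show ?thesis using that by auto
qed

lemma chart_inv: "(U, \<phi>) \<in> A \<Longrightarrow> p \<in> U \<Longrightarrow> inv_into U \<phi> (\<phi> p) = p"
  using chart_homeomorphism by (auto simp: homeomorphism_def)

lemma chart_continuous: "(U, \<phi>) \<in> A \<Longrightarrow> continuous_on U \<phi>"
  using chart_homeomorphism by (auto simp: homeomorphism_def)

lemma chart_inv_continuous: "(U, \<phi>) \<in> A \<Longrightarrow> continuous_on (\<phi> ` U) (inv_into U \<phi>)"
  using chart_homeomorphism by (auto simp: homeomorphism_def)

lemma chart_open_image:
  assumes "(U, \<phi>) \<in> A" "open W"
  shows "open (\<phi> ` (U \<inter> W))"
proof -
  have "\<phi> ` (U \<inter> W) = \<phi> ` U \<inter> inv_into U \<phi> -` W" using chart_inv[OF assms(1)] by auto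
  then show ?thesis
    using continuous_open_preimage[OF chart_inv_continuous[OF assms(1)] chart_open_range[OF assms(1)] assms(2)] by simp
qed

lemma chart_open_preimage: "(U, \<phi>) \<in> A \<Longrightarrow> open T \<Longrightarrow> open (U \<inter> \<phi> -` T)"
  by (rule continuous_open_preimage[OF chart_continuous chart_open])

lemma smooth_funD: "smooth_fun A h \<Longrightarrow> (U, \<phi>) \<in> A \<Longrightarrow> smooth_on (\<phi> ` U) (\<lambda>x. h (inv_into U \<phi> x))"
  unfolding smooth_fun_def o_def by blast

lemma smooth_funI: "(\<And>U \<phi>. (U, \<phi>) \<in> A \<Longrightarrow> smooth_on (\<phi> ` U) (\<lambda>x. h (inv_into U \<phi> x))) \<Longrightarrow> smooth_fun A h"
  unfolding smooth_fun_def o_def by blast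

lemma smooth_fun_const: "smooth_fun A (\<lambda>p. c)"
  by (rule smooth_funI) (rule smooth_on_const)

lemma smooth_fun_add: "smooth_fun A h \<Longrightarrow> smooth_fun A k \<Longrightarrow> smooth_fun A (\<lambda>p. h p + k p)"
  by (rule smooth_funI, rule smooth_on_add) (auto dest: smooth_funD chart_open_range)

lemma smooth_fun_diff: "smooth_fun A h \<Longrightarrow> smooth_fun A k \<Longrightarrow> smooth_fun A (\<lambda>p. h p - k p)"
  by (rule smooth_funI, rule smooth_on_diff) (auto dest: smooth_funD chart_open_range)

lemma smooth_fun_mult: "smooth_fun A h \<Longrightarrow> smooth_fun A k \<Longrightarrow> smooth_fun A (\<lambda>p. h p * k p)"
  by (rule smooth_funI, rule smooth_on_mult) (auto dest: smooth_funD chart_open_range)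

lemma smooth_fun_sum: "(\<And>i. i \<in> I \<Longrightarrow> smooth_fun A (h i)) \<Longrightarrow> smooth_fun A (\<lambda>p. \<Sum>i\<in>I. h i p)"
  by (rule smooth_funI, rule smooth_on_sum) (auto dest: smooth_funD chart_open_range)

lemma smooth_fun_compose:
  fixes G :: "real \<Rightarrow> real"
  assumes "smooth_on T G" "smooth_fun A h" "\<And>p. h p \<in> T"
  shows "smooth_fun A (\<lambda>p. G (h p))"
proof (rule smooth_funI)
  fix U \<phi> assume c: "(U, \<phi>) \<in> A"
  show "smooth_on (\<phi> ` U) (\<lambda>x. G (h (inv_into U \<phi> x)))"
    by (rule smooth_on_compose[OF chart_open_range[OF c] _ assms(1) smooth_funD[OF assms(2) c]])
      (use assms(3) in auto)
qed

lemma smooth_fun_compose_vec: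
  fixes G :: "real ^ 'j \<Rightarrow> real"
  assumes "smooth_on UNIV G" "\<And>i. smooth_fun A (h i)"
  shows "smooth_fun A (\<lambda>p. G (\<chi> i. h i p))"
proof (rule smooth_funI)
  fix U \<phi> assume c: "(U, \<phi>) \<in> A"
  have "smooth_on (\<phi> ` U) (\<lambda>x. \<chi> i. h i (inv_into U \<phi> x))"
    by (rule smooth_on_vec_nth[OF chart_open_range[OF c]]) (simp add: smooth_funD[OF assms(2) c])
  then show "smooth_on (\<phi> ` U) (\<lambda>x. G (\<chi> i. h i (inv_into U \<phi> x)))"
    by (rule smooth_on_compose[OF chart_open_range[OF c] subset_UNIV assms(1)])
qed

lemma smooth_fun_local:
  assumes "\<And>p. \<exists>W k. open W \<and> p \<in> W \<and> smooth_fun A k \<and> (\<forall>q\<in>W. h q = k q)"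
  shows "smooth_fun A h"
proof (rule smooth_funI)
  fix U \<phi> assume c: "(U, \<phi>) \<in> A"
  show "smooth_on (\<phi> ` U) (\<lambda>x. h (inv_into U \<phi> x))"
  proof (rule smooth_on_local)
    fix x assume "x \<in> \<phi> ` U"
    then obtain p where p: "p \<in> U" "x = \<phi> p" by auto
    obtain W k where W: "open W" "p \<in> W" "smooth_fun A k" "\<forall>q\<in>W. h q = k q" using assms by blast
    have o: "open (\<phi> ` (U \<inter> W))" by (rule chart_open_image[OF c W(1)])
    have "smooth_on (\<phi> ` (U \<inter> W)) (\<lambda>x. h (inv_into U \<phi> x))"
    proof (rule smooth_on_cong[OF o])
      show "smooth_on (\<phi> ` (U \<inter> W)) (\<lambda>x. k (inv_into U \<phi> x))"
        by (rule smooth_on_subset[OF smooth_funD[OF W(3) c]]) auto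
    qed (use W(4) chart_inv[OF c] in auto)
    then show "\<exists>T. open T \<and> x \<in> T \<and> smooth_on T (\<lambda>x. h (inv_into U \<phi> x))" using o p W(2) by blast
  qed
qed

lemma smooth_fun_continuous:
  assumes "smooth_fun A h"
  shows "continuous_on UNIV h"
proof (rule continuous_at_imp_continuous_on, rule ballI)
  fix p
  obtain U \<phi> where c: "(U, \<phi>) \<in> A" "p \<in> U" by (rule chart_exists)
  have "continuous_on U (\<lambda>q. h (inv_into U \<phi> (\<phi> q)))"
    by (rule continuous_on_compose2[OF smooth_on_imp_continuous_on[OF smooth_funD[OF assms c(1)]]
          chart_continuous[OF c(1)]]) auto
  then have "continuous_on U h"
    by (rule continuous_on_eq) (use chart_inv[OF c(1)] in auto)
  then show "isCont h p" using chart_open[OF c(1)] c(2) by (simp add: continuous_on_eq_continuous_at)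
qed

text \<open>The open set \<open>U'\<close> and the complement of \<open>K\<close> cover the
  manifold, \<open>K\<close> being compact and hence closed in a Hausdorff space. On the first the
  function is smooth through the change of charts, on the second it is 0.\<close>

lemma smooth_fun_glue:
  assumes c: "(U, \<phi>) \<in> A" and U': "open U'" "U' \<subseteq> U" and K: "compact K" "K \<subseteq> U'"
    and H: "smooth_on (\<phi> ` U') H" "\<And>q. q \<in> U' \<Longrightarrow> q \<notin> K \<Longrightarrow> H (\<phi> q) = 0"
  shows "smooth_fun A (\<lambda>q. if q \<in> U' then H (\<phi> q) else 0)"
proof (rule smooth_funI, rule smooth_on_local)
  fix V \<psi> x assume d: "(V, \<psi>) \<in> A" and "x \<in> \<psi> ` V"
  then obtain p where p: "p \<in> V" "x = \<psi> p" by auto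
  let ?h = "\<lambda>x. if inv_into V \<psi> x \<in> U' then H (\<phi> (inv_into V \<psi> x)) else 0"
  show "\<exists>T. open T \<and> x \<in> T \<and> smooth_on T ?h"
  proof (cases "p \<in> U'")
    case True
    let ?T = "\<psi> ` (V \<inter> U')"
    have o: "open ?T" by (rule chart_open_image[OF d U'(1)])
    have "smooth_on ?T (\<lambda>x. H ((\<phi> \<circ> inv_into V \<psi>) x))"
    proof (rule smooth_on_compose[OF o _ H(1)])
      show "smooth_on ?T (\<phi> \<circ> inv_into V \<psi>)"
        by (rule smooth_on_subset[OF chart_transition[OF d c]]) (use U'(2) in auto)
    qed (use chart_inv[OF d] in auto)
    then have "smooth_on ?T ?h"
      by (rule smooth_on_cong[OF o, rotated]) (use chart_inv[OF d] in auto)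
    then show ?thesis using o p True by blast
  next
    case False
    let ?T = "\<psi> ` (V \<inter> - K)"
    have o: "open ?T" using K(1) by (intro chart_open_image[OF d]) (simp add: compact_imp_closed open_Compl)
    have "smooth_on ?T ?h"
    proof (rule smooth_on_cong[OF o _ smooth_on_const[of _ 0]])
      fix y assume "y \<in> ?T"
      then show "0 = ?h y" using chart_inv[OF d] H(2) by auto
    qed
    then show ?thesis using o p False K(2) by blast
  qed
qed

text \<open>A closed coordinate ball inside the given neighbourhood corresponds to the compact set
  \<open>K\<close>. The bump is returned as a function of the coordinates, so that it can be
  multiplied with other such functions before the product is extended by 0.\<close>

lemma chart_bump:
  assumes c: "(U, \<phi>) \<in> A" and "p \<in> U" "open W" "p \<in> W"
  obtains \<beta> :: "real ^ 'n \<Rightarrow> real" and V K where "smooth_on UNIV \<beta>" "\<And>x. 0 \<le> \<beta> x" "\<And>x. \<beta> x \<le> 1" "open V" "p \<in> V" "V \<subseteq> K" "compact K"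
    "K \<subseteq> U \<inter> W" "\<And>q. q \<in> V \<Longrightarrow> \<beta> (\<phi> q) = 1" "\<And>q. q \<in> U \<Longrightarrow> q \<notin> K \<Longrightarrow> \<beta> (\<phi> q) = 0"
proof -
  have "open (\<phi> ` (U \<inter> W))" "\<phi> p \<in> \<phi> ` (U \<inter> W)" using chart_open_image[OF c] assms by auto
  then obtain e where e: "e > 0" "cball (\<phi> p) e \<subseteq> \<phi> ` (U \<inter> W)" using open_contains_cball by blast
  obtain \<beta> :: "real ^ 'n \<Rightarrow> real" where \<beta>: "smooth_on UNIV \<beta>" "\<And>x. 0 \<le> \<beta> x" "\<And>x. \<beta> x \<le> 1"
    "\<And>x. dist (\<phi> p) x \<le> e / 2 \<Longrightarrow> \<beta> x = 1" "\<And>x. dist (\<phi> p) x \<ge> 2 * (e / 2) \<Longrightarrow> \<beta> x = 0"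
    using euclidean_bump[of "e / 2" "\<phi> p"] e(1) by auto
  define K where "K = inv_into U \<phi> ` cball (\<phi> p) e"
  define V where "V = U \<inter> \<phi> -` ball (\<phi> p) (e / 2)"
  have KU: "K \<subseteq> U \<inter> W" using e(2) chart_inv[OF c] by (auto simp: K_def)
  have K: "compact K" unfolding K_def
    by (intro compact_continuous_image continuous_on_subset[OF chart_inv_continuous[OF c]] compact_cball)
      (use e(2) in auto)
  have V: "open V" unfolding V_def by (rule chart_open_preimage[OF c open_ball])
  have inK: "q \<in> K" if "q \<in> U" "dist (\<phi> p) (\<phi> q) \<le> e" for q
    unfolding K_def by (rule image_eqI[of _ _ "\<phi> q"]) (use that chart_inv[OF c] in auto)
  have VK: "V \<subseteq> K" using e(1) inK by (auto simp: V_def)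
  have "\<beta> (\<phi> q) = 0" if "q \<in> U" "q \<notin> K" for q
    using inK[of q] that by (cases "dist (\<phi> p) (\<phi> q) \<le> e") (auto intro!: \<beta>(5))
  moreover have "p \<in> V" using assms(2) e(1) by (simp add: V_def)
  moreover have "\<beta> (\<phi> q) = 1" if "q \<in> V" for q using that by (intro \<beta>(4)) (simp add: V_def)
  ultimately show ?thesis
    by (intro that[of \<beta> V K] \<beta>(1-3) KU K V VK)
qed

lemma smooth_bump:
  assumes "open W" "p \<in> W"
  obtains \<eta> V K where "smooth_fun A \<eta>" "\<And>q. 0 \<le> \<eta> q" "\<And>q. \<eta> q \<le> 1" "open V" "p \<in> V" "V \<subseteq> K" "compact K" "K \<subseteq> W"
    "\<And>q. q \<in> V \<Longrightarrow> \<eta> q = 1" "\<And>q. q \<notin> K \<Longrightarrow> \<eta> q = 0"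
proof -
  obtain U \<phi> where c: "(U, \<phi>) \<in> A" "p \<in> U" by (rule chart_exists)
  obtain \<beta> :: "real ^ 'n \<Rightarrow> real" and V K where \<beta>: "smooth_on UNIV \<beta>" "\<And>x. 0 \<le> \<beta> x" "\<And>x. \<beta> x \<le> 1" "open V" "p \<in> V" "V \<subseteq> K" "compact K"
    "K \<subseteq> U \<inter> W" "\<And>q. q \<in> V \<Longrightarrow> \<beta> (\<phi> q) = 1" "\<And>q. q \<in> U \<Longrightarrow> q \<notin> K \<Longrightarrow> \<beta> (\<phi> q) = 0"
    using chart_bump[OF c assms] by blast
  have s: "smooth_fun A (\<lambda>q. if q \<in> U then \<beta> (\<phi> q) else 0)"
    by (rule smooth_fun_glue[OF c(1) chart_open[OF c(1)] order_refl \<beta>(7)])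
      (use \<beta>(8,10) smooth_on_subset[OF \<beta>(1)] in auto)
  show ?thesis
    by (rule that[OF s _ _ \<beta>(4-7)]) (use \<beta>(2,3,6,8,9,10) in auto)
qed

text \<open>All members of the family are multiplied by the same bump, so the neighbourhood
  \<open>V\<close> on which they are reproduced is common to them. The index type may be infinite:
  the smoothing of distances applies this to a family indexed by functions.\<close>

lemma local_smooth_extension:
  assumes c: "(U, \<phi>) \<in> A" "p \<in> U" and T: "open T" "\<phi> p \<in> T" and H: "\<And>i. smooth_on T (H i)"
  obtains h V where "\<And>i. smooth_fun A (h i)" "open V" "p \<in> V" "V \<subseteq> U"
    "\<And>q i. q \<in> V \<Longrightarrow> \<phi> q \<in> T \<and> h i q = (H i (\<phi> q) :: real)"
proof -
  let ?W = "U \<inter> \<phi> -` T"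
  have W: "open ?W" "p \<in> ?W" using chart_open_preimage[OF c(1) T(1)] c(2) T(2) by auto
  obtain \<beta> :: "real ^ 'n \<Rightarrow> real" and V K where \<beta>: "smooth_on UNIV \<beta>" "\<And>x. 0 \<le> \<beta> x" "\<And>x. \<beta> x \<le> 1" "open V" "p \<in> V" "V \<subseteq> K" "compact K"
    "K \<subseteq> U \<inter> ?W" "\<And>q. q \<in> V \<Longrightarrow> \<beta> (\<phi> q) = 1" "\<And>q. q \<in> U \<Longrightarrow> q \<notin> K \<Longrightarrow> \<beta> (\<phi> q) = 0"
    using chart_bump[OF c W] by blast
  let ?h = "\<lambda>i q. if q \<in> ?W then \<beta> (\<phi> q) * H i (\<phi> q) else 0"
  have o: "open (\<phi> ` ?W)" using chart_open_image[OF c(1) W(1)] by (simp add: Int_left_absorb)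
  have h: "smooth_fun A (?h i)" for i
  proof (rule smooth_fun_glue[OF c(1) W(1) _ \<beta>(7)])
    show "smooth_on (\<phi> ` ?W) (\<lambda>x. \<beta> x * H i x)"
      by (rule smooth_on_mult[OF o smooth_on_subset[OF \<beta>(1)] smooth_on_subset[OF H]]) auto
  qed (use \<beta>(8,10) in auto)
  have VW: "V \<subseteq> ?W" using \<beta>(6,8) by auto
  have "\<phi> q \<in> T \<and> ?h i q = H i (\<phi> q)" if "q \<in> V" for q i using VW \<beta>(9)[OF that] that by auto
  moreover have "V \<subseteq> U" using VW by auto
  ultimately show ?thesis using that[of ?h V, OF h \<beta>(4,5)] by blast
qed

end

section \<open>Tangent vectors and vector fields\<close>

context manifold
begin

lemma coord_vec_smooth: "smooth_fun A h \<Longrightarrow>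
    coord_vec A (U, \<phi>) p a h = frechet_derivative (\<lambda>x. h (inv_into U \<phi> x)) (at (\<phi> p)) a"
  by (simp add: coord_vec_def o_def)

lemma coord_vec_nonsmooth: "\<not> smooth_fun A h \<Longrightarrow> coord_vec A c p a h = 0"
  by (cases c) (simp add: coord_vec_def)

lemma chart_has_derivative:
  "smooth_fun A h \<Longrightarrow> (U, \<phi>) \<in> A \<Longrightarrow> p \<in> U \<Longrightarrow>
    ((\<lambda>x. h (inv_into U \<phi> x)) has_derivative (\<lambda>a. coord_vec A (U, \<phi>) p a h)) (at (\<phi> p))"
  using smooth_on_imp_has_derivative[OF smooth_funD] by (simp add: coord_vec_smooth)

lemma coord_vec_unique:
  assumes "smooth_fun A h" "((\<lambda>x. h (inv_into U \<phi> x)) has_derivative D) (at (\<phi> p))"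
  shows "coord_vec A (U, \<phi>) p a h = D a"
  using frechet_derivative_at[OF assms(2)] assms(1) by (simp add: coord_vec_smooth)

lemma coord_vec_local:
  assumes "smooth_fun A h" "(U, \<phi>) \<in> A" "p \<in> U" "open V" "p \<in> V" "\<And>q. q \<in> V \<Longrightarrow> q \<in> U \<Longrightarrow> h q = H (\<phi> q)"
    "(H has_derivative D) (at (\<phi> p))"
  shows "coord_vec A (U, \<phi>) p a h = D a"
proof (rule coord_vec_unique[OF assms(1)])
  show "((\<lambda>x. h (inv_into U \<phi> x)) has_derivative D) (at (\<phi> p))"
    by (rule has_derivative_transform_within_open[OF assms(7) chart_open_image[OF assms(2,4)]])
      (use assms(3,5,6) chart_inv[OF assms(2)] in auto)
qed

lemma coord_vec_lin: "(U, \<phi>) \<in> A \<Longrightarrow> p \<in> U \<Longrightarrow>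
    coord_vec A (U, \<phi>) p (r *\<^sub>R a + s *\<^sub>R b) h = r * coord_vec A (U, \<phi>) p a h + s * coord_vec A (U, \<phi>) p b h"
proof (cases "smooth_fun A h")
  case True
  assume c: "(U, \<phi>) \<in> A" "p \<in> U"
  from linear_add[OF has_derivative_linear[OF chart_has_derivative[OF True c]]]
    linear_cmul[OF has_derivative_linear[OF chart_has_derivative[OF True c]]]
  show ?thesis by simp
qed (simp add: coord_vec_nonsmooth)

lemma tangent_nonsmooth: "v \<in> tangent_space A p \<Longrightarrow> \<not> smooth_fun A h \<Longrightarrow> v h = 0"
  by (auto simp: tangent_space_def coord_vec_nonsmooth)

lemma tangentE:
  assumes "v \<in> tangent_space A p"
  obtains U \<phi> a where "(U, \<phi>) \<in> A" "p \<in> U" "v = coord_vec A (U, \<phi>) p a"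
  using assms unfolding tangent_space_def by force

lemma coord_vec_tangent: "(U, \<phi>) \<in> A \<Longrightarrow> p \<in> U \<Longrightarrow> coord_vec A (U, \<phi>) p a \<in> tangent_space A p"
  unfolding tangent_space_def by force

text \<open>The chain rule for the transition map. It is the reason why
  \<open>tangent_space\<close>, a union over charts, can be described in any single chart around the
  point and is a vector space.\<close>

lemma coord_vec_change:
  assumes c: "(U, \<phi>) \<in> A" "p \<in> U" and d: "(V, \<psi>) \<in> A" "p \<in> V"
  shows "coord_vec A (V, \<psi>) p b =
    coord_vec A (U, \<phi>) p (frechet_derivative (\<phi> \<circ> inv_into V \<psi>) (at (\<psi> p)) b)"
proof (rule ext)
  fix h
  let ?\<tau> = "\<phi> \<circ> inv_into V \<psi>"
  have \<tau>: "(?\<tau> has_derivative frechet_derivative ?\<tau> (at (\<psi> p))) (at (\<psi> p))"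
    by (rule smooth_on_imp_has_derivative[OF chart_transition[OF d(1) c(1)]]) (use c d in auto)
  show "coord_vec A (V, \<psi>) p b h = coord_vec A (U, \<phi>) p (frechet_derivative ?\<tau> (at (\<psi> p)) b) h"
  proof (cases "smooth_fun A h")
    case True
    have t: "?\<tau> (\<psi> p) = \<phi> p" using chart_inv[OF d] by simp
    have 1: "((\<lambda>x. h (inv_into U \<phi> (?\<tau> x))) has_derivative
        (\<lambda>b. coord_vec A (U, \<phi>) p (frechet_derivative ?\<tau> (at (\<psi> p)) b) h)) (at (\<psi> p))"
      by (rule has_derivative_compose[OF \<tau>, unfolded t, OF chart_has_derivative[OF True c]])
    have "((\<lambda>x. h (inv_into V \<psi> x)) has_derivative
        (\<lambda>b. coord_vec A (U, \<phi>) p (frechet_derivative ?\<tau> (at (\<psi> p)) b) h)) (at (\<psi> p))"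
      by (rule has_derivative_transform_within_open[OF 1 chart_open_image[OF d(1) chart_open[OF c(1)]]])
        (use c d chart_inv[OF c(1)] chart_inv[OF d(1)] in auto)
    then show ?thesis by (rule coord_vec_unique[OF True])
  qed (simp add: coord_vec_nonsmooth)
qed

lemma tangent_in_chart:
  assumes v: "v \<in> tangent_space A p" and c: "(U, \<phi>) \<in> A" "p \<in> U"
  obtains a where "v = coord_vec A (U, \<phi>) p a"
  using tangentE[OF v] coord_vec_change[OF c] by metis

lemma tangent_lin_comb:
  assumes "u \<in> tangent_space A p" "v \<in> tangent_space A p"
  shows "(\<lambda>h. r * u h + s * v h) \<in> tangent_space A p"
proof -
  obtain U \<phi> a where c: "(U, \<phi>) \<in> A" "p \<in> U" and a: "u = coord_vec A (U, \<phi>) p a"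
    using tangentE[OF assms(1)] .
  obtain b where b: "v = coord_vec A (U, \<phi>) p b" using tangent_in_chart[OF assms(2) c] .
  have "(\<lambda>h. r * u h + s * v h) = coord_vec A (U, \<phi>) p (r *\<^sub>R a + s *\<^sub>R b)"
    unfolding a b by (simp add: coord_vec_lin[OF c] fun_eq_iff)
  then show ?thesis using coord_vec_tangent[OF c] by simp
qed

lemma tangent_zero: "(\<lambda>h. 0) \<in> tangent_space A p"
proof -
  obtain U \<phi> where c: "(U, \<phi>) \<in> A" "p \<in> U" by (rule chart_exists)
  show ?thesis
    using tangent_lin_comb[OF coord_vec_tangent[OF c] coord_vec_tangent[OF c], of 0 0 0 0] by simp
qed

lemma tangent_sum:
  assumes "finite I" "\<And>i. i \<in> I \<Longrightarrow> v i \<in> tangent_space A p"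
  shows "(\<lambda>h. \<Sum>i\<in>I. c i * v i h) \<in> tangent_space A p"
  using assms
proof (induction I rule: finite_induct)
  case (insert i I)
  then show ?case using tangent_lin_comb[of "v i" p "\<lambda>h. \<Sum>i\<in>I. c i * v i h" "c i" 1] by simp
qed (simp add: tangent_zero)

lemma tangent_scale: "u \<in> tangent_space A p \<Longrightarrow> (\<lambda>h. r * u h) \<in> tangent_space A p"
  using tangent_lin_comb[of u p u r 0] by simp

lemma tangent_diff: "u \<in> tangent_space A p \<Longrightarrow> v \<in> tangent_space A p \<Longrightarrow> (\<lambda>h. u h - v h) \<in> tangent_space A p"
  using tangent_lin_comb[of u p v 1 "-1"] by simp

lemma tangent_local:
  assumes v: "v \<in> tangent_space A p" and "smooth_fun A h" "smooth_fun A k" "open V" "p \<in> V" "\<And>q. q \<in> V \<Longrightarrow> h q = k q"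
  shows "v h = v k"
proof -
  obtain U \<phi> a where c: "(U, \<phi>) \<in> A" "p \<in> U" and a: "v = coord_vec A (U, \<phi>) p a"
    using tangentE[OF v] .
  show ?thesis unfolding a
    by (rule coord_vec_local[OF assms(2) c assms(4,5) _ chart_has_derivative[OF assms(3) c]])
      (use assms(6) chart_inv[OF c(1)] in auto)
qed

lemma tangent_const: "v \<in> tangent_space A p \<Longrightarrow> v (\<lambda>q. c) = 0"
  by (erule tangentE) (simp add: coord_vec_unique[OF smooth_fun_const has_derivative_const])

lemma tangent_add:
  assumes "v \<in> tangent_space A p" "smooth_fun A h" "smooth_fun A k"
  shows "v (\<lambda>q. h q + k q) = v h + v k"
proof -
  obtain U \<phi> a where c: "(U, \<phi>) \<in> A" "p \<in> U" and a: "v = coord_vec A (U, \<phi>) p a"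
    using tangentE[OF assms(1)] .
  show ?thesis unfolding a
    by (rule coord_vec_unique[OF smooth_fun_add[OF assms(2,3)]
          has_derivative_add[OF chart_has_derivative[OF assms(2) c] chart_has_derivative[OF assms(3) c]]])
qed

lemma tangent_mult:
  assumes "v \<in> tangent_space A p" "smooth_fun A h" "smooth_fun A k"
  shows "v (\<lambda>q. h q * k q) = h p * v k + v h * k p"
proof -
  obtain U \<phi> a where c: "(U, \<phi>) \<in> A" "p \<in> U" and a: "v = coord_vec A (U, \<phi>) p a"
    using tangentE[OF assms(1)] .
  have "v (\<lambda>q. h q * k q) = h (inv_into U \<phi> (\<phi> p)) * v k + v h * k (inv_into U \<phi> (\<phi> p))" unfolding a
    by (rule coord_vec_unique[OF smooth_fun_mult[OF assms(2,3)]
          has_derivative_mult[OF chart_has_derivative[OF assms(2) c] chart_has_derivative[OF assms(3) c]]])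
  then show ?thesis using chart_inv[OF c] by simp
qed

lemma tangent_cmult:
  assumes "v \<in> tangent_space A p" "smooth_fun A h"
  shows "v (\<lambda>q. c * h q) = c * v h"
  using tangent_mult[OF assms(1) smooth_fun_const assms(2), of c] tangent_const[OF assms(1)] by simp

lemma tangent_minus_fun:
  assumes "v \<in> tangent_space A p" "smooth_fun A h" "smooth_fun A k"
  shows "v (\<lambda>q. h q - k q) = v h - v k"
  using tangent_add[OF assms(1,2) smooth_fun_mult[OF smooth_fun_const assms(3)], of "-1"]
    tangent_cmult[OF assms(1,3), of "-1"] by simp

lemma tangent_sum_fun:
  assumes "v \<in> tangent_space A p" "finite I" "\<And>i. i \<in> I \<Longrightarrow> smooth_fun A (h i)"
  shows "v (\<lambda>q. \<Sum>i\<in>I. h i q) = (\<Sum>i\<in>I. v (h i))"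
  using assms(2,3)
proof (induction I rule: finite_induct)
  case (insert i I)
  then show ?case by (simp add: tangent_add[OF assms(1) _ smooth_fun_sum])
qed (simp add: tangent_const[OF assms(1)])

lemma tangent_compose:
  fixes G :: "real \<Rightarrow> real"
  assumes "v \<in> tangent_space A p" "smooth_on UNIV G" "smooth_fun A h" "(G has_field_derivative G') (at (h p))"
  shows "v (\<lambda>q. G (h q)) = G' * v h"
proof -
  obtain U \<phi> a where c: "(U, \<phi>) \<in> A" "p \<in> U" and a: "v = coord_vec A (U, \<phi>) p a"
    using tangentE[OF assms(1)] .
  have G: "(G has_derivative (*) G') (at (h (inv_into U \<phi> (\<phi> p))))"
    using assms(4) chart_inv[OF c] by (simp add: has_field_derivative_def)
  show ?thesis unfolding a
    by (rule coord_vec_unique[OF smooth_fun_compose[OF assms(2,3)]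
          has_derivative_compose[OF chart_has_derivative[OF assms(3) c] G]]) simp
qed

lemma smooth_vfield_tangent: "smooth_vfield A X \<Longrightarrow> X p \<in> tangent_space A p"
  and smooth_vfield_fun: "smooth_vfield A X \<Longrightarrow> smooth_fun A h \<Longrightarrow> smooth_fun A (\<lambda>p. X p h)"
  by (auto simp: smooth_vfield_def)

lemma smooth_vfieldI:
  "(\<And>p. X p \<in> tangent_space A p) \<Longrightarrow> (\<And>h. smooth_fun A h \<Longrightarrow> smooth_fun A (\<lambda>p. X p h)) \<Longrightarrow> smooth_vfield A X"
  by (simp add: smooth_vfield_def)

lemma smooth_vfield_lin:
  assumes "smooth_vfield A X" "smooth_vfield A Y" "smooth_fun A f" "smooth_fun A k"
  shows "smooth_vfield A (\<lambda>p h. f p * X p h + k p * Y p h)"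
  by (rule smooth_vfieldI, rule tangent_lin_comb)
    (simp_all add: smooth_vfield_tangent smooth_fun_add smooth_fun_mult smooth_vfield_fun assms)

lemma smooth_vfield_affine:
  "smooth_vfield A X \<Longrightarrow> smooth_vfield A Y \<Longrightarrow> smooth_fun A f \<Longrightarrow> smooth_vfield A (\<lambda>p h. f p * X p h + Y p h)"
  using smooth_vfield_lin[OF _ _ _ smooth_fun_const[of 1]] by simp

lemma smooth_vfield_scale:
  "smooth_vfield A X \<Longrightarrow> smooth_fun A f \<Longrightarrow> smooth_vfield A (\<lambda>p h. f p * X p h)"
  using smooth_vfield_lin[of X X f "\<lambda>p. 0"] by (simp add: smooth_fun_const)

lemma smooth_vfield_zero: "smooth_vfield A (\<lambda>p h. 0)"
  by (rule smooth_vfieldI) (simp_all add: tangent_zero smooth_fun_const)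

lemma smooth_vfield_sum:
  assumes "finite I" "\<And>i. i \<in> I \<Longrightarrow> smooth_fun A (f i)" "\<And>i. i \<in> I \<Longrightarrow> smooth_vfield A (X i)"
  shows "smooth_vfield A (\<lambda>p h. \<Sum>i\<in>I. f i p * X i p h)"
proof (rule smooth_vfieldI)
  show "(\<lambda>h. \<Sum>i\<in>I. f i p * X i p h) \<in> tangent_space A p" for p
    by (rule tangent_sum[OF assms(1) smooth_vfield_tangent[OF assms(3)]])
  show "smooth_fun A (\<lambda>p. \<Sum>i\<in>I. f i p * X i p h)" if "smooth_fun A h" for h
    by (rule smooth_fun_sum[OF smooth_fun_mult[OF assms(2) smooth_vfield_fun[OF assms(3) that]]])
qed

text \<open>Tangent vectors act on globally smooth functions, so the coordinates are cut off to
  global functions that keep their values near \<open>p\<close>.\<close>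

lemma chart_coordinates:
  assumes c: "(U, \<phi>) \<in> A" "p \<in> U"
  shows "\<exists>x :: 'n \<Rightarrow> 'm \<Rightarrow> real. \<exists>V. (\<forall>i. smooth_fun A (x i)) \<and> open V \<and> p \<in> V \<and> V \<subseteq> U \<and>
    (\<forall>q\<in>V. \<forall>i. x i q = \<phi> q $ i \<and> (\<forall>a. coord_vec A (U, \<phi>) q a (x i) = a $ i))"
proof -
  have nth: "smooth_on UNIV (\<lambda>y :: real ^ 'n. y $ i)" for i
    by (rule smooth_on_linear) (auto intro: bounded_linear_vec_nth)
  obtain x :: "'n \<Rightarrow> 'm \<Rightarrow> real" and V1 where x: "\<And>i. smooth_fun A (x i)" "open V1" "p \<in> V1" "V1 \<subseteq> U"
    "\<And>q i. q \<in> V1 \<Longrightarrow> \<phi> q \<in> UNIV \<and> x i q = \<phi> q $ i"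
    using local_smooth_extension[OF c open_UNIV UNIV_I, where H = "\<lambda>i y. y $ i", OF nth] by blast
  have "coord_vec A (U, \<phi>) q a (x j) = a $ j" if "q \<in> V1" for q a j
    by (rule coord_vec_local[OF x(1) c(1) _ x(2) that, where H = "\<lambda>y. y $ j"])
      (use that x(4,5) in \<open>auto intro!: bounded_linear_imp_has_derivative bounded_linear_vec_nth\<close>)
  then show ?thesis using x by (intro exI[of _ x] exI[of _ V1]) simp
qed

lemma coord_vec_eq_zero:
  assumes c: "(U, \<phi>) \<in> A" "p \<in> U" and "coord_vec A (U, \<phi>) p a = (\<lambda>h. 0)"
  shows "a = 0"
proof -
  obtain x :: "'n \<Rightarrow> 'm \<Rightarrow> real" and V where "p \<in> V" "\<forall>q\<in>V. \<forall>i. x i q = \<phi> q $ i \<and> (\<forall>a. coord_vec A (U, \<phi>) q a (x i) = a $ i)"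
    using chart_coordinates[OF c] by blast
  then have "a $ i = 0" for i using assms(3) by metis
  then show ?thesis by (simp add: vec_eq_iff)
qed

lemma chart_fields:
  assumes c: "(U, \<phi>) \<in> A" "p \<in> U"
  shows "\<exists>X :: 'n \<Rightarrow> 'm vfield. \<exists>V. (\<forall>i. smooth_vfield A (X i)) \<and> open V \<and> p \<in> V \<and> V \<subseteq> U \<and>
    (\<forall>q\<in>V. \<forall>i. X i q = coord_vec A (U, \<phi>) q (axis i 1))"
proof -
  obtain \<beta> :: "real ^ 'n \<Rightarrow> real" and V2 K where \<beta>: "smooth_on UNIV \<beta>" "\<And>x. 0 \<le> \<beta> x" "\<And>x. \<beta> x \<le> 1" "open V2" "p \<in> V2" "V2 \<subseteq> K" "compact K"
    "K \<subseteq> U \<inter> U" "\<And>q. q \<in> V2 \<Longrightarrow> \<beta> (\<phi> q) = 1" "\<And>q. q \<in> U \<Longrightarrow> q \<notin> K \<Longrightarrow> \<beta> (\<phi> q) = 0"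
    using chart_bump[OF c chart_open[OF c(1)] c(2)] by blast
  define X :: "'n \<Rightarrow> 'm vfield" where
    "X i q h = (if q \<in> U then \<beta> (\<phi> q) * coord_vec A (U, \<phi>) q (axis i 1) h else 0)" for i q h
  have X_smooth: "smooth_vfield A (X i)" for i
    unfolding smooth_vfield_def
  proof (intro conjI allI impI)
    fix q
    show "X i q \<in> tangent_space A q"
      by (cases "q \<in> U") (simp_all add: X_def[abs_def] tangent_scale coord_vec_tangent[OF c(1)] tangent_zero)
  next
    fix h assume h: "smooth_fun A h"
    let ?H = "\<lambda>y. \<beta> y * frechet_derivative (\<lambda>x. h (inv_into U \<phi> x)) (at y) (axis i 1)"
    have "smooth_fun A (\<lambda>q. if q \<in> U then ?H (\<phi> q) else 0)"
    proof (rule smooth_fun_glue[OF c(1) chart_open[OF c(1)] order_refl \<beta>(7)])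
      show "smooth_on (\<phi> ` U) ?H"
        by (rule smooth_on_mult[OF chart_open_range[OF c(1)] smooth_on_subset[OF \<beta>(1)] smooth_on_frechet[OF smooth_funD[OF h c(1)]]]) auto
    qed (use \<beta>(8,10) in auto)
    then show "smooth_fun A (\<lambda>q. X i q h)" by (simp add: X_def coord_vec_smooth[OF h] cong: if_cong)
  qed
  have "X i q = coord_vec A (U, \<phi>) q (axis i 1)" if "q \<in> V2" for i q
    using that \<beta>(6,8,9) by (auto simp: X_def[abs_def])
  moreover have "V2 \<subseteq> U" using \<beta>(6,8) by auto
  ultimately show ?thesis using X_smooth \<beta>(4,5) by (intro exI[of _ X] exI[of _ V2]) simp
qed

text \<open>Coordinates and coordinate fields around \<open>p\<close>, cut off to global objects.
  Duality, expansion of tangent vectors and commuting of the fields record what the tensor calculus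
  uses of a chart.\<close>

definition coord_frame :: "'m \<Rightarrow> 'm set \<Rightarrow> ('n \<Rightarrow> 'm \<Rightarrow> real) \<Rightarrow> ('n \<Rightarrow> 'm vfield) \<Rightarrow> bool" where
  "coord_frame p V x X \<longleftrightarrow> open V \<and> p \<in> V \<and> (\<forall>i. smooth_fun A (x i)) \<and> (\<forall>i. smooth_vfield A (X i)) \<and>
    (\<forall>q\<in>V. \<forall>i j. X i q (x j) = (if i = j then 1 else 0)) \<and>
    (\<forall>q\<in>V. \<forall>v\<in>tangent_space A q. \<forall>h. v h = (\<Sum>i\<in>UNIV. v (x i) * X i q h)) \<and>
    (\<forall>q\<in>V. \<forall>h. smooth_fun A h \<longrightarrow> (\<forall>i j. X i q (\<lambda>r. X j r h) = X j q (\<lambda>r. X i r h)))"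

lemma coord_frameD:
  assumes "coord_frame p V x X"
  shows "open V" "p \<in> V" "\<And>i. smooth_fun A (x i)" "\<And>i. smooth_vfield A (X i)"
    "\<And>q i j. q \<in> V \<Longrightarrow> X i q (x j) = (if i = j then 1 else 0)"
    "\<And>q v h. q \<in> V \<Longrightarrow> v \<in> tangent_space A q \<Longrightarrow> v h = (\<Sum>i\<in>UNIV. v (x i) * X i q h)"
    "\<And>q i j h. q \<in> V \<Longrightarrow> smooth_fun A h \<Longrightarrow> X i q (\<lambda>r. X j r h) = X j q (\<lambda>r. X i r h)"
  using assms unfolding coord_frame_def by blast+

lemma coordinate_frame: "\<exists>V x X. coord_frame p V x X"
proof -
  obtain U \<phi> where c: "(U, \<phi>) \<in> A" "p \<in> U" by (rule chart_exists)
  obtain x :: "'n \<Rightarrow> 'm \<Rightarrow> real" and V1 where x: "\<And>i. smooth_fun A (x i)" "open V1" "p \<in> V1" "V1 \<subseteq> U"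
    "\<forall>q\<in>V1. \<forall>i. x i q = \<phi> q $ i \<and> (\<forall>a. coord_vec A (U, \<phi>) q a (x i) = a $ i)"
    using chart_coordinates[OF c] by metis
  obtain X :: "'n \<Rightarrow> 'm vfield" and V2 where X: "\<And>i. smooth_vfield A (X i)" "open V2" "p \<in> V2" "V2 \<subseteq> U"
    "\<forall>q\<in>V2. \<forall>i. X i q = coord_vec A (U, \<phi>) q (axis i 1)"
    using chart_fields[OF c] by metis
  define V where "V = V1 \<inter> V2"
  have V: "open V" "p \<in> V" "V \<subseteq> U" using x X by (auto simp: V_def)
  note X_smooth = X(1)
  have X_V: "X i q = coord_vec A (U, \<phi>) q (axis i 1)" if "q \<in> V" for i q
    using that X(5) by (simp add: V_def)
  have x_der: "coord_vec A (U, \<phi>) q a (x j) = a $ j" if "q \<in> V" for q a j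
    using that x(5) by (simp add: V_def)
  have expand: "v h = (\<Sum>i\<in>UNIV. v (x i) * X i q h)" if q: "q \<in> V" and v: "v \<in> tangent_space A q" for v q h
  proof -
    have qU: "q \<in> U" using q V by auto
    obtain a where a: "v = coord_vec A (U, \<phi>) q a" using tangent_in_chart[OF v c(1) qU] .
    show ?thesis
    proof (cases "smooth_fun A h")
      case True
      have lin: "linear (\<lambda>a. coord_vec A (U, \<phi>) q a h)"
        by (rule has_derivative_linear[OF chart_has_derivative[OF True c(1) qU]])
      have "a = (\<Sum>i\<in>UNIV. (a $ i) *\<^sub>R axis i 1)"
        using basis_expansion[of a] by (simp only: scalar_mult_eq_scaleR)
      then have "v h = coord_vec A (U, \<phi>) q (\<Sum>i\<in>UNIV. (a $ i) *\<^sub>R axis i 1) h" using a by simp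
      also have "... = (\<Sum>i\<in>UNIV. a $ i * coord_vec A (U, \<phi>) q (axis i 1) h)"
        by (simp only: linear_sum[OF lin] linear_cmul[OF lin] real_scaleR_def)
      finally show ?thesis by (simp only: X_V[OF q] a x_der[OF q])
    next
      case False
      then show ?thesis using tangent_nonsmooth[OF v] tangent_nonsmooth[OF smooth_vfield_tangent[OF X_smooth]] by simp
    qed
  qed
  \<comment> \<open>Coordinate fields commute because second partial derivatives do.\<close>
  have comm: "X i q (\<lambda>r. X j r h) = X j q (\<lambda>r. X i r h)" if q: "q \<in> V" and h: "smooth_fun A h" for q i j h
  proof -
    let ?h = "\<lambda>x. h (inv_into U \<phi> x)"
    have qU: "q \<in> U" using q V by auto
    have XX: "X i q (\<lambda>r. X j r h) = frechet_derivative (\<lambda>y. frechet_derivative ?h (at y) (axis j 1)) (at (\<phi> q)) (axis i 1)" for i j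
      unfolding X_V[OF q]
    proof (rule coord_vec_local[OF smooth_vfield_fun[OF X_smooth h] c(1) qU V(1) q])
      show "X j r h = frechet_derivative ?h (at (\<phi> r)) (axis j 1)" if "r \<in> V" for r
        by (simp add: X_V[OF that] coord_vec_smooth[OF h])
      show "((\<lambda>y. frechet_derivative ?h (at y) (axis j 1)) has_derivative
          frechet_derivative (\<lambda>y. frechet_derivative ?h (at y) (axis j 1)) (at (\<phi> q))) (at (\<phi> q))"
        by (rule smooth_on_imp_has_derivative[OF smooth_on_frechet[OF smooth_funD[OF h c(1)]]]) (use qU in auto)
    qed
    have "Ck_on (Suc (Suc 0)) (\<phi> ` U) ?h" using smooth_funD[OF h c(1)] unfolding smooth_on_def by blast
    then show ?thesis unfolding XX
      by (rule symmetric_second_frechet_derivative[OF chart_open_range[OF c(1)]]) (use qU in auto)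
  qed
  have "coord_frame p V x X"
    unfolding coord_frame_def using V(1,2) x(1) X_smooth expand comm by (auto simp: X_V x_der axis_def)
  then show ?thesis by blast
qed

lemma tangent_extend:
  assumes "v \<in> tangent_space A p"
  shows "\<exists>X. smooth_vfield A X \<and> X p = v"
proof -
  obtain V x X where "coord_frame p V x X" using coordinate_frame by blast
  note f = coord_frameD[OF this]
  have a: "smooth_vfield A (\<lambda>q h. \<Sum>i\<in>UNIV. v (x i) * X i q h)"
    by (rule smooth_vfield_sum[OF finite smooth_fun_const f(4)])
  have b: "(\<lambda>h. \<Sum>i\<in>UNIV. v (x i) * X i p h) = v" using f(6)[OF f(2) assms, symmetric] by (rule ext)
  show ?thesis by (rule exI[of _ "\<lambda>q h. \<Sum>i\<in>UNIV. v (x i) * X i q h"], rule conjI, rule a, rule b)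
qed

lemma extension:
  assumes "v \<in> tangent_space A p"
  shows "smooth_vfield A (extension A p v)" "extension A p v p = v"
  using someI_ex[OF tangent_extend[OF assms]] by (auto simp: extension_def)

lemma tangent_eqI:
  assumes "u \<in> tangent_space A p" "v \<in> tangent_space A p" "\<And>h. smooth_fun A h \<Longrightarrow> u h = v h"
  shows "u = v"
proof (rule ext)
  fix h show "u h = v h"
    by (cases "smooth_fun A h")
      (simp_all add: assms(3) tangent_nonsmooth[OF assms(1)] tangent_nonsmooth[OF assms(2)])
qed

text \<open>The point is that the bracket lies in the span of coordinate vectors. In a commuting
  frame the second-order part of X(Y h) is symmetric in X and Y, so it cancels and a first-order
  expression remains.\<close>

lemma smooth_vfield_bracket:
  assumes X: "smooth_vfield A X" and Y: "smooth_vfield A Y"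
  shows "smooth_vfield A (lie_bracket X Y)"
  unfolding smooth_vfield_def
proof (intro conjI allI impI)
  fix h assume "smooth_fun A h"
  then show "smooth_fun A (\<lambda>p. lie_bracket X Y p h)"
    unfolding lie_bracket_def by (simp add: smooth_fun_diff smooth_vfield_fun X Y)
next
  fix p
  obtain V x E where "coord_frame p V x E" using coordinate_frame by blast
  note f = coord_frameD[OF this]
  \<comment> \<open>The iterated derivative of \<open>h\<close> splits into a first-order part,
    linear in the \<open>E j p h\<close>, and a part with second derivatives along the
    frame.\<close>
  have *: "Z p (\<lambda>q. W q h) = (\<Sum>j\<in>UNIV. Z p (\<lambda>q. W q (x j)) * E j p h)
      + (\<Sum>i\<in>UNIV. \<Sum>j\<in>UNIV. Z p (x i) * W p (x j) * E i p (\<lambda>q. E j q h))"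
    if Z: "smooth_vfield A Z" and W: "smooth_vfield A W" and h: "smooth_fun A h" for Z W h
  proof -
    note Zp = smooth_vfield_tangent[OF Z, of p]
    have s: "smooth_fun A (\<lambda>q. W q (x j))" "smooth_fun A (\<lambda>q. E j q h)" for j
      using smooth_vfield_fun W f(3,4) h by auto
    have zz: "Z p (\<lambda>q. E j q h) = (\<Sum>i\<in>UNIV. Z p (x i) * E i p (\<lambda>q. E j q h))" for j
      by (rule f(6)[OF f(2) Zp])
    have "Z p (\<lambda>q. W q h) = Z p (\<lambda>q. \<Sum>j\<in>UNIV. W q (x j) * E j q h)"
      by (rule tangent_local[OF Zp smooth_vfield_fun[OF W h] _ f(1,2) f(6)[OF _ smooth_vfield_tangent[OF W]]])
        (rule smooth_fun_sum[OF smooth_fun_mult[OF s]])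
    also have "... = (\<Sum>j\<in>UNIV. Z p (\<lambda>q. W q (x j) * E j q h))"
      by (rule tangent_sum_fun[OF Zp finite smooth_fun_mult[OF s]])
    also have "... = (\<Sum>j\<in>UNIV. W p (x j) * Z p (\<lambda>q. E j q h) + Z p (\<lambda>q. W q (x j)) * E j p h)"
      by (simp add: tangent_mult[OF Zp] s)
    also have "... = (\<Sum>j\<in>UNIV. W p (x j) * (\<Sum>i\<in>UNIV. Z p (x i) * E i p (\<lambda>q. E j q h)) + Z p (\<lambda>q. W q (x j)) * E j p h)"
      by (simp only: zz)
    also have "... = (\<Sum>j\<in>UNIV. Z p (\<lambda>q. W q (x j)) * E j p h)
      + (\<Sum>j\<in>UNIV. \<Sum>i\<in>UNIV. Z p (x i) * W p (x j) * E i p (\<lambda>q. E j q h))"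
      by (simp add: sum.distrib sum_distrib_left mult.assoc mult.left_commute)
    also have "(\<Sum>j\<in>UNIV. \<Sum>i\<in>UNIV. Z p (x i) * W p (x j) * E i p (\<lambda>q. E j q h))
      = (\<Sum>i\<in>UNIV. \<Sum>j\<in>UNIV. Z p (x i) * W p (x j) * E i p (\<lambda>q. E j q h))"
      by (rule sum.swap)
    finally show ?thesis .
  qed
  have key: "lie_bracket X Y p h = (\<Sum>j\<in>UNIV. lie_bracket X Y p (x j) * E j p h)" for h
  proof (cases "smooth_fun A h")
    case True
    have "(\<Sum>i\<in>UNIV. \<Sum>j\<in>UNIV. X p (x i) * Y p (x j) * E i p (\<lambda>q. E j q h))
      = (\<Sum>i\<in>UNIV. \<Sum>j\<in>UNIV. Y p (x i) * X p (x j) * E i p (\<lambda>q. E j q h))"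
      by (subst sum.swap) (simp add: f(7)[OF f(2) True] mult.commute)
    then show ?thesis
      using *[OF X Y True] *[OF Y X True]
      by (simp add: lie_bracket_def left_diff_distrib sum_subtractf)
  next
    case False
    then have "X q h = 0" "Y q h = 0" "E j q h = 0" for q j
      by (simp_all add: tangent_nonsmooth[OF smooth_vfield_tangent[OF X]]
        tangent_nonsmooth[OF smooth_vfield_tangent[OF Y]] tangent_nonsmooth[OF smooth_vfield_tangent[OF f(4)]])
    then show ?thesis
      using tangent_const[OF smooth_vfield_tangent[OF X]] tangent_const[OF smooth_vfield_tangent[OF Y]]
      by (simp add: lie_bracket_def)
  qed
  have "lie_bracket X Y p = (\<lambda>h. \<Sum>j\<in>UNIV. lie_bracket X Y p (x j) * E j p h)"
    by (rule ext) (rule key)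
  also have "... \<in> tangent_space A p"
    by (rule tangent_sum[OF finite smooth_vfield_tangent[OF f(4)]])
  finally show "lie_bracket X Y p \<in> tangent_space A p" .
qed

end

section \<open>Riemannian metrics\<close>

text \<open>Blending t with the constant 1 between 1/4 and 1/2 gives a smooth positive function that
  equals t from 1/2 on. The result allows a vector field to be rescaled by a globally smooth factor
  even if it vanishes somewhere.\<close>

lemma smooth_inverse_sqrt_near:
  obtains G :: "real \<Rightarrow> real" where "smooth_on UNIV G" "\<And>t. t \<ge> 1/2 \<Longrightarrow> G t = 1 / sqrt t"
proof -
  define m where "m t = t * smooth_step (4 * t - 1) + (1 - smooth_step (4 * t - 1))" for t :: real
  have s: "smooth_on UNIV (\<lambda>t. smooth_step (4 * t - 1))"
    by (rule smooth_on_compose[OF open_UNIV subset_UNIV smooth_on_smooth_step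
        smooth_on_diff[OF open_UNIV smooth_on_mult[OF open_UNIV smooth_on_const smooth_on_id[OF open_UNIV]] smooth_on_const]])
  have m: "smooth_on UNIV m" unfolding m_def[abs_def]
    by (rule smooth_on_add[OF open_UNIV smooth_on_mult[OF open_UNIV smooth_on_id[OF open_UNIV] s]
          smooth_on_diff[OF open_UNIV smooth_on_const s]])
  have pos: "m t > 0" for t
  proof (cases "t \<le> 1/4")
    case True
    then show ?thesis by (simp add: m_def smooth_step_0)
  next
    case False
    let ?s = "smooth_step (4 * t - 1)"
    have "min t 1 = min t 1 * ?s + min t 1 * (1 - ?s)" by (simp add: algebra_simps)
    also have "... \<le> t * ?s + 1 * (1 - ?s)"
      using smooth_step_ge_0[of "4 * t - 1"] smooth_step_le_1[of "4 * t - 1"]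
      by (intro add_mono mult_right_mono) auto
    finally show ?thesis using False by (simp add: m_def min_def split: if_splits)
  qed
  have sq: "smooth_on UNIV (\<lambda>t. sqrt (m t))"
    by (rule smooth_on_compose[OF open_UNIV _ smooth_on_sqrt m]) (use pos in auto)
  have "smooth_on UNIV (\<lambda>t. 1 / sqrt (m t))"
    by (rule smooth_on_divide[OF open_UNIV smooth_on_const sq]) (use pos in \<open>auto simp: less_imp_neq[THEN not_sym]\<close>)
  moreover have "1 / sqrt (m t) = 1 / sqrt t" if "t \<ge> 1/2" for t
    using that by (simp add: m_def smooth_step_1)
  ultimately show ?thesis using that[of "\<lambda>t. 1 / sqrt (m t)"] by blast
qed

lemma sum_mult_delta:
  fixes c :: "'i::finite \<Rightarrow> real"
  shows "(\<Sum>i\<in>UNIV. c i * (if i = j then 1 else 0)) = c j" "(\<Sum>i\<in>UNIV. c i * (if j = i then 1 else 0)) = c j"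
proof -
  have "(\<Sum>i\<in>UNIV. c i * (if i = j then 1 else 0)) = (\<Sum>i\<in>UNIV. if i = j then c i else 0)"
    by (rule sum.cong) auto
  then show "(\<Sum>i\<in>UNIV. c i * (if i = j then 1 else 0)) = c j" by simp
  then show "(\<Sum>i\<in>UNIV. c i * (if j = i then 1 else 0)) = c j" by (simp only: eq_commute[of j])
qed

locale riemannian = manifold A for A :: "('m::{t2_space, second_countable_topology}, 'n::finite) atlas" +
  fixes g :: "'m metric"
  assumes metric: "riemannian_metric A g"
begin

lemma g_lin: "u \<in> tangent_space A p \<Longrightarrow> v \<in> tangent_space A p \<Longrightarrow> w \<in> tangent_space A p \<Longrightarrow>
    g p (\<lambda>h. a * u h + b * v h) w = a * g p u w + b * g p v w"
  and g_sym: "u \<in> tangent_space A p \<Longrightarrow> v \<in> tangent_space A p \<Longrightarrow> g p u v = g p v u"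
  and g_pos: "v \<in> tangent_space A p \<Longrightarrow> v \<noteq> (\<lambda>h. 0) \<Longrightarrow> g p v v > 0"
  and g_smooth: "smooth_vfield A X \<Longrightarrow> smooth_vfield A Y \<Longrightarrow> smooth_fun A (\<lambda>p. g p (X p) (Y p))"
  using metric unfolding riemannian_metric_def by blast+

lemma g_lin_right: "u \<in> tangent_space A p \<Longrightarrow> v \<in> tangent_space A p \<Longrightarrow> w \<in> tangent_space A p \<Longrightarrow>
    g p w (\<lambda>h. a * u h + b * v h) = a * g p w u + b * g p w v"
  by (simp add: g_sym[of w] tangent_lin_comb g_lin)

lemma g_zero: "w \<in> tangent_space A p \<Longrightarrow> g p (\<lambda>h. 0) w = 0"
  using g_lin[OF tangent_zero tangent_zero, of w p 0 0] by simp

lemma g_scale: "u \<in> tangent_space A p \<Longrightarrow> w \<in> tangent_space A p \<Longrightarrow> g p (\<lambda>h. a * u h) w = a * g p u w"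
  using g_lin[of u p u w a 0] by simp

lemma g_scale_right: "u \<in> tangent_space A p \<Longrightarrow> w \<in> tangent_space A p \<Longrightarrow> g p w (\<lambda>h. a * u h) = a * g p w u"
  by (simp add: g_sym[of w] g_scale tangent_scale)

lemma g_diff: "u \<in> tangent_space A p \<Longrightarrow> v \<in> tangent_space A p \<Longrightarrow> w \<in> tangent_space A p \<Longrightarrow>
    g p (\<lambda>h. u h - v h) w = g p u w - g p v w"
  using g_lin[of u p v w 1 "-1"] by simp

lemma g_sum:
  assumes "finite I" "\<And>i. i \<in> I \<Longrightarrow> v i \<in> tangent_space A p" "w \<in> tangent_space A p"
  shows "g p (\<lambda>h. \<Sum>i\<in>I. c i * v i h) w = (\<Sum>i\<in>I. c i * g p (v i) w)"
  using assms(1,2)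
proof (induction I rule: finite_induct)
  case (insert i I)
  then show ?case
    using g_lin[of "v i" p "\<lambda>h. \<Sum>i\<in>I. c i * v i h" w "c i" 1] by (simp add: tangent_sum assms(3))
qed (simp add: g_zero assms(3))

lemma g_sum_right:
  assumes "finite I" "\<And>i. i \<in> I \<Longrightarrow> v i \<in> tangent_space A p" "w \<in> tangent_space A p"
  shows "g p w (\<lambda>h. \<Sum>i\<in>I. c i * v i h) = (\<Sum>i\<in>I. c i * g p w (v i))"
  using g_sum[OF assms] g_sym[OF assms(3) tangent_sum[OF assms(1,2)]] g_sym[OF assms(3,2)] by simp

lemma g_nonneg: "v \<in> tangent_space A p \<Longrightarrow> g p v v \<ge> 0"
  using g_pos[of v p] g_zero[of v p] by (cases "v = (\<lambda>h. 0)") auto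

lemma g_eq_0: "v \<in> tangent_space A p \<Longrightarrow> g p v v = 0 \<Longrightarrow> v = (\<lambda>h. 0)"
  using g_pos[of v p] by (cases "v = (\<lambda>h. 0)") auto

lemma g_eqI:
  assumes "u \<in> tangent_space A p" "v \<in> tangent_space A p" "\<And>w. w \<in> tangent_space A p \<Longrightarrow> g p u w = g p v w"
  shows "u = v"
proof -
  have d: "(\<lambda>h. u h - v h) \<in> tangent_space A p" by (rule tangent_diff[OF assms(1,2)])
  have "g p (\<lambda>h. u h - v h) (\<lambda>h. u h - v h) = 0" using g_diff[OF assms(1,2) d] assms(3)[OF d] by simp
  from g_eq_0[OF d this] show ?thesis by (simp add: fun_eq_iff)
qed

lemma g_Cauchy_Schwarz:
  assumes u: "u \<in> tangent_space A p" and v: "v \<in> tangent_space A p"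
  shows "(g p u v)\<^sup>2 \<le> g p u u * g p v v"
proof (cases "g p v v = 0")
  case True
  then show ?thesis using g_eq_0[OF v True] g_sym[OF u v] g_zero[OF u] by simp
next
  case False
  \<comment> \<open>The component of \<open>u\<close> orthogonal to \<open>v\<close>, scaled to
    avoid a division.\<close>
  let ?w = "\<lambda>h. g p v v * u h + (- g p u v) * v h"
  have w: "?w \<in> tangent_space A p" by (rule tangent_lin_comb[OF u v])
  have "0 \<le> g p ?w ?w" by (rule g_nonneg[OF w])
  also have "g p ?w ?w = g p v v * (g p v v * g p u u - (g p u v)\<^sup>2)"
    unfolding g_lin[OF u v w] g_lin_right[OF u v u] g_lin_right[OF u v v] g_sym[OF v u]
    by (simp add: algebra_simps power2_eq_square)
  finally have "0 \<le> g p v v * (g p v v * g p u u - (g p u v)\<^sup>2)" .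
  moreover have "g p v v > 0" using False g_nonneg[OF v] by simp
  ultimately show ?thesis by (simp add: zero_le_mult_iff mult.commute)
qed

text \<open>Gram-Schmidt, indexed by subsets of the type \<open>'n\<close>. A set that misses
  \<open>k\<close> has fewer than \<open>CARD('n)\<close> elements, so the coordinates of the
  vectors found so far do not span and a further tangent vector is available.\<close>

lemma orthonormal_family_exists:
  assumes "finite (I :: 'n set)"
  shows "\<exists>e. \<forall>i\<in>I. e i \<in> tangent_space A p \<and> (\<forall>j\<in>I. g p (e i) (e j) = (if i = j then 1 else 0))"
  using assms
proof (induction I rule: finite_induct)
  case (insert k I)
  then obtain e where e: "\<And>i. i \<in> I \<Longrightarrow> e i \<in> tangent_space A p"
    "\<And>i j. i \<in> I \<Longrightarrow> j \<in> I \<Longrightarrow> g p (e i) (e j) = (if i = j then 1 else 0)" by blast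
  obtain V x X where "coord_frame p V x X" using coordinate_frame by blast
  note f = coord_frameD[OF this]
  let ?c = "\<lambda>v. \<chi> i. v (x i)"
  have "dim (?c ` e ` I) \<le> card (?c ` e ` I)" by (rule dim_le_card') (use insert in auto)
  also have "... \<le> card I" using insert(1) by (meson card_image_le finite_imageI order_trans)
  also have "... < CARD('n)" by (rule psubset_card_mono) (use insert(2) in auto)
  finally have "dim (?c ` e ` I) < CARD('n)" .
  then have "span (?c ` e ` I) \<noteq> UNIV" using dim_eq_full[of "?c ` e ` I"] by simp
  then obtain a where a: "a \<notin> span (?c ` e ` I)" by blast
  define u where "u = (\<lambda>h. \<Sum>i\<in>UNIV. (a $ i) * X i p h)"
  have u: "u \<in> tangent_space A p" unfolding u_def by (rule tangent_sum[OF finite smooth_vfield_tangent[OF f(4)]])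
  have ua: "u (x j) = a $ j" for j unfolding u_def by (simp add: f(5)[OF f(2)] sum_mult_delta)
  define s where "s = (\<lambda>h. \<Sum>i\<in>I. g p u (e i) * e i h)"
  have s: "s \<in> tangent_space A p" unfolding s_def by (rule tangent_sum[OF insert(1) e(1)])
  define w where "w = (\<lambda>h. u h - s h)"
  have w: "w \<in> tangent_space A p" unfolding w_def by (rule tangent_diff[OF u s])
  have "w \<noteq> (\<lambda>h. 0)"
  proof
    assume "w = (\<lambda>h. 0)"
    then have "u h = s h" for h unfolding w_def by (metis right_minus_eq)
    then have "a = (\<Sum>i\<in>I. g p u (e i) *\<^sub>R ?c (e i))"
      by (simp add: vec_eq_iff ua[symmetric] s_def)
    also have "... \<in> span (?c ` e ` I)" by (intro span_sum span_scale span_base) auto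
    finally show False using a by simp
  qed
  then have ww: "g p w w > 0" using g_pos[OF w] by simp
  have we: "g p w (e j) = 0" if "j \<in> I" for j
  proof -
    have "g p s (e j) = (\<Sum>i\<in>I. g p u (e i) * g p (e i) (e j))"
      unfolding s_def by (rule g_sum[OF insert(1) e(1) e(1)[OF that]])
    also have "... = (\<Sum>i\<in>I. if i = j then g p u (e i) else 0)" by (rule sum.cong) (simp_all add: e(2) that)
    also have "... = g p u (e j)" using insert(1) that by simp
    finally show ?thesis unfolding w_def g_diff[OF u s e(1)[OF that]] by simp
  qed
  define z where "z = (\<lambda>h. (1 / sqrt (g p w w)) * w h)"
  have z: "z \<in> tangent_space A p" unfolding z_def by (rule tangent_scale[OF w])
  have zz: "g p z z = 1"
  proof -
    have "g p z z = (1 / sqrt (g p w w)) * ((1 / sqrt (g p w w)) * g p w w)"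
      unfolding z_def g_scale[OF w tangent_scale[OF w]] g_scale_right[OF w w] ..
    then show ?thesis using ww by (simp add: field_simps)
  qed
  have ze: "g p z (e j) = 0" "g p (e j) z = 0" if "j \<in> I" for j
  proof -
    show "g p z (e j) = 0" unfolding z_def g_scale[OF w e(1)[OF that]] we[OF that] by simp
    then show "g p (e j) z = 0" using g_sym[OF z e(1)[OF that]] by simp
  qed
  show ?case
    by (rule exI[of _ "e(k := z)"]) (use e z zz ze insert(2) in auto)
qed auto

lemma orthonormal_basis_exists: "\<exists>e. orthonormal_basis A g p e"
proof -
  obtain e :: "'n \<Rightarrow> 'm tangent" where "\<forall>i\<in>UNIV. e i \<in> tangent_space A p \<and> (\<forall>j\<in>UNIV. g p (e i) (e j) = (if i = j then 1 else 0))"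
    using orthonormal_family_exists[OF finite_class.finite_UNIV, of p] ..
  then have "orthonormal_basis A g p e" unfolding orthonormal_basis_def by simp
  then show ?thesis by (rule exI[of "orthonormal_basis A g p" e])
qed

lemma some_onb: "orthonormal_basis A g p (some_onb A g p)"
  unfolding some_onb_def by (rule someI_ex[OF orthonormal_basis_exists])

lemma onb_tangent: "orthonormal_basis A g p e \<Longrightarrow> e i \<in> tangent_space A p"
  and onb_g: "orthonormal_basis A g p e \<Longrightarrow> g p (e i) (e j) = (if i = j then 1 else 0)"
  by (simp_all add: orthonormal_basis_def)

text \<open>An orthonormal family is independent, so the map from coefficients to the coordinates of
  the resulting vector is injective; as a linear map of \<open>real ^ 'n\<close> to itself it is
  then onto.\<close>

lemma onb_expand:
  assumes e: "orthonormal_basis A g p e" and v: "v \<in> tangent_space A p"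
  shows "v h = (\<Sum>i\<in>UNIV. g p v (e i) * e i h)"
proof -
  obtain V x X where "coord_frame p V x X" using coordinate_frame by blast
  note f = coord_frameD[OF this]
  define L where "L a = (\<lambda>h. \<Sum>i\<in>UNIV. a $ i * e i h)" for a :: "real ^ 'n"
  define M :: "real ^ 'n \<Rightarrow> real ^ 'n" where "M a = (\<chi> j. L a (x j))" for a
  have L: "L a \<in> tangent_space A p" for a unfolding L_def by (rule tangent_sum[OF finite onb_tangent[OF e]])
  have Lg: "g p (L a) (e j) = a $ j" for a j
  proof -
    have "g p (L a) (e j) = (\<Sum>i\<in>UNIV. a $ i * g p (e i) (e j))"
      unfolding L_def by (rule g_sum[OF finite onb_tangent[OF e] onb_tangent[OF e]])
    then show ?thesis by (simp add: onb_g[OF e] sum_mult_delta)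
  qed
  have "linear M"
    by (rule linearI) (simp_all add: M_def L_def vec_eq_iff distrib_right sum.distrib sum_distrib_left mult.assoc)
  moreover have "inj M"
  proof (rule linear_injective_0[OF \<open>linear M\<close>, THEN iffD2], intro allI impI)
    fix a assume "M a = 0"
    then have "L a (x j) = 0" for j by (simp add: M_def vec_eq_iff)
    then have "(\<Sum>i\<in>UNIV. L a (x i) * X i p h) = 0" for h by simp
    then have "L a = (\<lambda>h. 0)" unfolding f(6)[OF f(2) L, symmetric] by (rule ext)
    then have "a $ j = 0" for j using Lg[of a j] g_zero[OF onb_tangent[OF e]] by simp
    then show "a = 0" by (simp add: vec_eq_iff)
  qed
  ultimately have "surj M" by (rule linear_injective_imp_surjective) simp
  then obtain a where a: "M a = (\<chi> j. v (x j))" by (metis surjD)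
  then have "L a (x j) = v (x j)" for j by (simp add: M_def vec_eq_iff)
  then have "(\<Sum>i\<in>UNIV. L a (x i) * X i p h) = (\<Sum>i\<in>UNIV. v (x i) * X i p h)" for h by simp
  then have "v = L a" unfolding f(6)[OF f(2) L, symmetric] f(6)[OF f(2) v, symmetric] by (intro ext) simp
  then show ?thesis by (simp only: Lg) (simp only: L_def)
qed

text \<open>Gram-Schmidt on vector fields. At \<open>p\<close> nothing changes because the given
  vectors are already orthonormal; on a neighbourhood the squared length stays above 1/2, where the
  smooth factor \<open>G\<close> is the inverse root.\<close>

lemma orthonormal_extension:
  assumes e: "orthonormal_basis A g p e" and "finite (I :: 'n set)"
  shows "\<exists>V E. open V \<and> p \<in> V \<and> (\<forall>i\<in>I. smooth_vfield A (E i) \<and> E i p = e i) \<and>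
    (\<forall>q\<in>V. \<forall>i\<in>I. \<forall>j\<in>I. g q (E i q) (E j q) = (if i = j then 1 else 0))"
  using assms(2)
proof (induction I rule: finite_induct)
  case (insert k I)
  then obtain V E where V: "open V" "p \<in> V" and E: "\<And>i. i \<in> I \<Longrightarrow> smooth_vfield A (E i)"
    "\<And>i. i \<in> I \<Longrightarrow> E i p = e i"
    "\<And>q i j. q \<in> V \<Longrightarrow> i \<in> I \<Longrightarrow> j \<in> I \<Longrightarrow> g q (E i q) (E j q) = (if i = j then 1 else 0)" by blast
  obtain X where X: "smooth_vfield A X" "X p = e k" using tangent_extend[OF onb_tangent[OF e]] by blast
  define S where "S = (\<lambda>q h. \<Sum>i\<in>I. g q (X q) (E i q) * E i q h)"
  have S: "smooth_vfield A S" unfolding S_def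
    by (rule smooth_vfield_sum[OF insert(1) g_smooth[OF X(1) E(1)] E(1)])
  define Y where "Y = (\<lambda>q h. 1 * X q h + (- 1) * S q h)"
  have Y: "smooth_vfield A Y" unfolding Y_def by (rule smooth_vfield_lin[OF X(1) S smooth_fun_const smooth_fun_const])
  have Yq: "Y q = (\<lambda>h. X q h - S q h)" for q by (simp add: Y_def)
  have "g p (X p) (E i p) = 0" if "i \<in> I" for i
    unfolding X(2) E(2)[OF that] onb_g[OF e] using insert(2) that by auto
  then have "S p = (\<lambda>h. 0)" by (simp add: S_def)
  then have Yp: "Y p = e k" by (simp add: Yq X(2))
  define s where "s = (\<lambda>q. g q (Y q) (Y q))"
  have s: "smooth_fun A s" unfolding s_def by (rule g_smooth[OF Y Y])
  have sp: "s p = 1" by (simp add: s_def Yp onb_g[OF e])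
  obtain G :: "real \<Rightarrow> real" where G: "smooth_on UNIV G" "\<And>t. t \<ge> 1/2 \<Longrightarrow> G t = 1 / sqrt t"
    using smooth_inverse_sqrt_near by blast
  define Z where "Z = (\<lambda>q h. G (s q) * Y q h)"
  have Z: "smooth_vfield A Z" unfolding Z_def
    by (rule smooth_vfield_scale[OF Y smooth_fun_compose[OF G(1) s UNIV_I]])
  have Zp: "Z p = e k" by (simp add: Z_def sp Yp G(2))
  define W where "W = V \<inter> {q. s q > 1/2}"
  have o: "open {q. s q > 1/2}" by (rule open_Collect_less[OF continuous_on_const smooth_fun_continuous[OF s]])
  have W: "open W" "p \<in> W" unfolding W_def using open_Int[OF V(1) o] V(2) sp by simp_all
  note T = smooth_vfield_tangent
  have YE: "g q (Y q) (E j q) = 0" if "q \<in> V" "j \<in> I" for q j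
  proof -
    have "g q (S q) (E j q) = (\<Sum>i\<in>I. g q (X q) (E i q) * g q (E i q) (E j q))"
      unfolding S_def by (rule g_sum[OF insert(1) T[OF E(1)] T[OF E(1)[OF that(2)]]])
    also have "... = (\<Sum>i\<in>I. if i = j then g q (X q) (E i q) else 0)"
      by (rule sum.cong) (simp_all add: E(3) that)
    also have "... = g q (X q) (E j q)" using insert(1) that by simp
    finally show ?thesis unfolding Yq g_diff[OF T[OF X(1)] T[OF S] T[OF E(1)[OF that(2)]]] by simp
  qed
  have ZE: "g q (Z q) (E j q) = 0" "g q (E j q) (Z q) = 0" if "q \<in> W" "j \<in> I" for q j
    using g_scale[OF T[OF Y] T[OF E(1)[OF that(2)]], of q "G (s q)"] YE that
      g_sym[OF T[OF Z] T[OF E(1)[OF that(2)]], of q] by (simp_all add: Z_def W_def)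
  have ZZ: "g q (Z q) (Z q) = 1" if "q \<in> W" for q
  proof -
    have "g q (Z q) (Z q) = G (s q) * (G (s q) * s q)"
      unfolding Z_def s_def g_scale[OF T[OF Y] tangent_scale[OF T[OF Y]]] g_scale_right[OF T[OF Y] T[OF Y]] ..
    moreover have "s q > 1/2" using that by (simp add: W_def)
    ultimately show ?thesis by (simp add: G(2) field_simps)
  qed
  show ?case
  proof (intro exI[of _ W] exI[of _ "E(k := Z)"] conjI ballI)
    fix q i j assume "q \<in> W" "i \<in> insert k I" "j \<in> insert k I"
    then show "g q ((E(k := Z)) i q) ((E(k := Z)) j q) = (if i = j then 1 else 0)"
      using ZZ ZE E(3) insert(2) by (auto simp: W_def)
  qed (use W E Z Zp in auto)
qed auto

definition on_frame :: "'m set \<Rightarrow> ('n \<Rightarrow> 'm vfield) \<Rightarrow> bool" where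
  "on_frame V E \<longleftrightarrow> open V \<and> (\<forall>i. smooth_vfield A (E i)) \<and> (\<forall>q\<in>V. orthonormal_basis A g q (\<lambda>i. E i q))"

lemma on_frameD:
  assumes "on_frame V E"
  shows "open V" "\<And>i. smooth_vfield A (E i)" "\<And>q. q \<in> V \<Longrightarrow> orthonormal_basis A g q (\<lambda>i. E i q)"
  using assms by (auto simp: on_frame_def)

lemma onb_extend:
  assumes e: "orthonormal_basis A g p e"
  shows "\<exists>V E. on_frame V E \<and> p \<in> V \<and> (\<forall>i. E i p = e i)"
proof -
  obtain V E where V: "open V" "p \<in> V" and E: "\<forall>i\<in>UNIV. smooth_vfield A (E i) \<and> E i p = e i"
    "\<forall>q\<in>V. \<forall>i\<in>UNIV. \<forall>j\<in>UNIV. g q (E i q) (E j q) = (if i = j then 1 else 0)"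
    using orthonormal_extension[OF e finite_class.finite_UNIV] by blast
  have "smooth_vfield A (E i)" for i using E(1) by simp
  then have "on_frame V E"
    unfolding on_frame_def orthonormal_basis_def using V(1) E(2) smooth_vfield_tangent by simp
  then show ?thesis using V(2) E(1) by blast
qed

lemma on_frame_exists: "\<exists>V E. on_frame V E \<and> p \<in> V"
  using onb_extend[OF some_onb] by blast

text \<open>Riesz representation by means of an orthonormal basis, with uniqueness from
  nondegeneracy. It gives meaning to the description operator in \<open>gradient\<close>.\<close>

lemma gradient_unique_exists:
  assumes h: "smooth_fun A h"
  shows "\<exists>!u. u \<in> tangent_space A p \<and> (\<forall>v\<in>tangent_space A p. g p u v = v h)"
proof -
  obtain e where e: "orthonormal_basis A g p e" using orthonormal_basis_exists by blast
  let ?u = "\<lambda>k. \<Sum>i\<in>UNIV. e i h * e i k"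
  have u: "?u \<in> tangent_space A p" by (rule tangent_sum[OF finite onb_tangent[OF e]])
  have uv: "g p ?u v = v h" if v: "v \<in> tangent_space A p" for v
  proof -
    have "g p ?u v = (\<Sum>i\<in>UNIV. e i h * g p (e i) v)" by (rule g_sum[OF finite onb_tangent[OF e] v])
    also have "... = v h" unfolding onb_expand[OF e v, of h] g_sym[OF v onb_tangent[OF e]] by (simp add: mult.commute)
    finally show ?thesis .
  qed
  show ?thesis
  proof (rule ex1I[of _ ?u])
    show "?u \<in> tangent_space A p \<and> (\<forall>v\<in>tangent_space A p. g p ?u v = v h)" using u uv by blast
    fix w assume w: "w \<in> tangent_space A p \<and> (\<forall>v\<in>tangent_space A p. g p w v = v h)"
    show "w = ?u" by (rule g_eqI) (use w u uv in auto)
  qed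
qed

lemma gradient:
  assumes "smooth_fun A h"
  shows gradient_tangent: "gradient A g h p \<in> tangent_space A p"
    and g_gradient: "v \<in> tangent_space A p \<Longrightarrow> g p (gradient A g h p) v = v h"
  using theI'[OF gradient_unique_exists[OF assms]] unfolding gradient_def by blast+

lemma g_gradient_right: "smooth_fun A h \<Longrightarrow> v \<in> tangent_space A p \<Longrightarrow> g p v (gradient A g h p) = v h"
  by (simp add: g_sym[of v] g_gradient gradient_tangent)

lemma smooth_gradient:
  assumes h: "smooth_fun A h"
  shows "smooth_vfield A (gradient A g h)"
proof (rule smooth_vfieldI)
  show "gradient A g h p \<in> tangent_space A p" for p by (rule gradient_tangent[OF h])
  fix k assume k: "smooth_fun A k"
  show "smooth_fun A (\<lambda>p. gradient A g h p k)"
  proof (rule smooth_fun_local)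
    fix p
    obtain V E where VE: "on_frame V E" "p \<in> V" using on_frame_exists by blast
    note f = on_frameD[OF VE(1)]
    have "gradient A g h q k = (\<Sum>i\<in>UNIV. E i q h * E i q k)" if "q \<in> V" for q
      using onb_expand[OF f(3)[OF that] gradient_tangent[OF h], of k]
      by (simp add: g_gradient[OF h smooth_vfield_tangent[OF f(2)]])
    moreover have "smooth_fun A (\<lambda>q. \<Sum>i\<in>UNIV. E i q h * E i q k)"
      by (rule smooth_fun_sum[OF smooth_fun_mult[OF smooth_vfield_fun[OF f(2) h] smooth_vfield_fun[OF f(2) k]]])
    ultimately show "\<exists>W k'. open W \<and> p \<in> W \<and> smooth_fun A k' \<and> (\<forall>q\<in>W. gradient A g h q k = k' q)"
      using f(1) VE(2) by blast
  qed
qed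

end

section \<open>The Levi-Civita connection\<close>

text \<open>\<open>is_levi_civita\<close> states linearity over functions for this one combination,
  which covers sums and multiples together; a named form lets such rules be chained by
  rewriting.\<close>

definition axpy :: "('m \<Rightarrow> real) \<Rightarrow> 'm vfield \<Rightarrow> 'm vfield \<Rightarrow> 'm vfield" where
  "axpy f X Y = (\<lambda>p k. f p * X p k + Y p k)"

context manifold
begin

lemma smooth_vfield_axpy:
  "smooth_vfield A X \<Longrightarrow> smooth_vfield A Y \<Longrightarrow> smooth_fun A f \<Longrightarrow> smooth_vfield A (axpy f X Y)"
  unfolding axpy_def by (rule smooth_vfield_affine)

lemma tangent_axpy_fun:
  assumes "v \<in> tangent_space A p" "smooth_fun A f" "smooth_fun A a" "smooth_fun A b"
  shows "v (\<lambda>q. f q * a q + b q) = f p * v a + v f * a p + v b"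
  using tangent_add[OF assms(1) smooth_fun_mult[OF assms(2,3)] assms(4)] tangent_mult[OF assms(1-3)] by simp

lemma lie_bracket_antisym: "lie_bracket X Y p k = - lie_bracket Y X p k"
  by (simp add: lie_bracket_def)

lemma lie_bracket_axpy:
  assumes X: "smooth_vfield A X" and Z: "smooth_vfield A Z" and W: "smooth_vfield A W" and f: "smooth_fun A f"
  shows "lie_bracket X (axpy f Z W) p = (\<lambda>k. f p * lie_bracket X Z p k + X p f * Z p k + lie_bracket X W p k)"
proof (rule ext)
  fix k
  note T = smooth_vfield_tangent
  show "lie_bracket X (axpy f Z W) p k = f p * lie_bracket X Z p k + X p f * Z p k + lie_bracket X W p k"
  proof (cases "smooth_fun A k")
    case True
    have "X p (\<lambda>q. f q * Z q k + W q k) = f p * X p (\<lambda>q. Z q k) + X p f * Z p k + X p (\<lambda>q. W q k)"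
      by (rule tangent_axpy_fun[OF T[OF X] f smooth_vfield_fun[OF Z True] smooth_vfield_fun[OF W True]])
    then show ?thesis by (simp add: lie_bracket_def axpy_def algebra_simps)
  next
    case False
    have z: "Y q k = 0" if "smooth_vfield A Y" for Y q by (rule tangent_nonsmooth[OF T[OF that] False])
    show ?thesis
      by (simp add: lie_bracket_def axpy_def z[OF X] z[OF Z] z[OF W] tangent_const[OF T[OF X]]
          tangent_const[OF T[OF Z]] tangent_const[OF T[OF W]])
  qed
qed

end

context riemannian
begin

section \<open>Koszul's formula and its behaviour in each argument\<close>

lemma g_lin3:
  assumes "u \<in> tangent_space A p" "v \<in> tangent_space A p" "w \<in> tangent_space A p" "z \<in> tangent_space A p"
  shows "g p (\<lambda>k. a * u k + b * v k + w k) z = a * g p u z + b * g p v z + g p w z"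
  using g_lin[OF tangent_lin_comb[OF assms(1,2)] assms(3,4), of 1 a b 1] g_lin[OF assms(1,2,4)] by simp

abbreviation gg :: "'m vfield \<Rightarrow> 'm vfield \<Rightarrow> 'm \<Rightarrow> real" where
  "gg X Y \<equiv> \<lambda>q. g q (X q) (Y q)"

lemma gg_axpy:
  assumes "smooth_vfield A X" "smooth_vfield A Y" "smooth_vfield A Z"
  shows "g q (axpy f X Y q) (Z q) = f q * g q (X q) (Z q) + g q (Y q) (Z q)"
    "g q (Z q) (axpy f X Y q) = f q * g q (Z q) (X q) + g q (Z q) (Y q)"
  using g_lin[of "X q" q "Y q" "Z q" "f q" 1] g_lin_right[of "X q" q "Y q" "Z q" "f q" 1]
  by (simp_all add: axpy_def smooth_vfield_tangent[OF assms(1)] smooth_vfield_tangent[OF assms(2)]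
      smooth_vfield_tangent[OF assms(3)])

lemma gg_sym: "smooth_vfield A X \<Longrightarrow> smooth_vfield A Y \<Longrightarrow> g q (X q) (Y q) = g q (Y q) (X q)"
  by (rule g_sym[OF smooth_vfield_tangent smooth_vfield_tangent])

text \<open>Koszul's expression for twice the inner product with \<open>Z\<close> of the covariant
  derivative of \<open>Y\<close> along \<open>X\<close>, as forced by metric compatibility and
  vanishing torsion.\<close>

definition koszul :: "'m vfield \<Rightarrow> 'm vfield \<Rightarrow> 'm vfield \<Rightarrow> 'm \<Rightarrow> real" where
  "koszul X Y Z p = X p (gg Y Z) + Y p (gg X Z) - Z p (gg X Y)
    + g p (lie_bracket X Y p) (Z p) - g p (lie_bracket X Z p) (Y p) - g p (lie_bracket Y Z p) (X p)"

lemma smooth_koszul: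
  assumes "smooth_vfield A X" "smooth_vfield A Y" "smooth_vfield A Z"
  shows "smooth_fun A (koszul X Y Z)"
  unfolding koszul_def[abs_def]
  by (simp add: smooth_fun_add smooth_fun_diff smooth_vfield_fun g_smooth smooth_vfield_bracket assms)

lemma g_bracket_axpy:
  assumes X: "smooth_vfield A X" and Z: "smooth_vfield A Z" and W: "smooth_vfield A W" and f: "smooth_fun A f"
    and Y: "smooth_vfield A Y"
  shows "g p (lie_bracket X (axpy f Z W) p) (Y p) =
      f p * g p (lie_bracket X Z p) (Y p) + X p f * g p (Z p) (Y p) + g p (lie_bracket X W p) (Y p)"
    "g p (lie_bracket (axpy f Z W) X p) (Y p) =
      f p * g p (lie_bracket Z X p) (Y p) - X p f * g p (Z p) (Y p) + g p (lie_bracket W X p) (Y p)"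
proof -
  note T = smooth_vfield_tangent
  show 1: "g p (lie_bracket X (axpy f Z W) p) (Y p) =
      f p * g p (lie_bracket X Z p) (Y p) + X p f * g p (Z p) (Y p) + g p (lie_bracket X W p) (Y p)"
    unfolding lie_bracket_axpy[OF X Z W f]
    by (rule g_lin3) (rule T smooth_vfield_bracket assms)+
  have a: "g p (lie_bracket U V p) (Y p) = - g p (lie_bracket V U p) (Y p)"
    if "smooth_vfield A U" "smooth_vfield A V" for U V
  proof -
    have "lie_bracket U V p = (\<lambda>k. (- 1) * lie_bracket V U p k)"
      using lie_bracket_antisym[of U V p] by auto
    then show ?thesis using g_scale[OF T[OF smooth_vfield_bracket[OF that(2,1)]] T[OF Y], of p "- 1"] by simp
  qed
  show "g p (lie_bracket (axpy f Z W) X p) (Y p) =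
      f p * g p (lie_bracket Z X p) (Y p) - X p f * g p (Z p) (Y p) + g p (lie_bracket W X p) (Y p)"
    using 1 a[OF smooth_vfield_axpy[OF Z W f] X] a[OF Z X] a[OF W X] by simp
qed

lemma bracket_antisym_g:
  assumes "smooth_vfield A X" "smooth_vfield A Y" "smooth_vfield A Z"
  shows "g p (lie_bracket X Y p) (Z p) = - g p (lie_bracket Y X p) (Z p)"
proof -
  note T = smooth_vfield_tangent
  have "lie_bracket X Y p = (\<lambda>k. (- 1) * lie_bracket Y X p k)"
    using lie_bracket_antisym[of X Y p] by auto
  then show ?thesis using g_scale[OF T[OF smooth_vfield_bracket[OF assms(2,1)]] T[OF assms(3)], of p "- 1"] by simp
qed

lemma vfield_gg_axpy:
  assumes X: "smooth_vfield A X" and Z: "smooth_vfield A Z" and W: "smooth_vfield A W" and f: "smooth_fun A f"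
    and Y: "smooth_vfield A Y"
  shows "Y p (gg (axpy f X W) Z) = f p * Y p (gg X Z) + Y p f * g p (X p) (Z p) + Y p (gg W Z)"
    "Y p (gg Z (axpy f X W)) = f p * Y p (gg Z X) + Y p f * g p (Z p) (X p) + Y p (gg Z W)"
proof -
  note T = smooth_vfield_tangent
  have "Y p (gg (axpy f X W) Z) = Y p (\<lambda>q. f q * gg X Z q + gg W Z q)"
    by (simp only: gg_axpy[OF X W Z])
  then show "Y p (gg (axpy f X W) Z) = f p * Y p (gg X Z) + Y p f * g p (X p) (Z p) + Y p (gg W Z)"
    using tangent_axpy_fun[OF T[OF Y] f g_smooth[OF X Z] g_smooth[OF W Z]] by simp
  have "Y p (gg Z (axpy f X W)) = Y p (\<lambda>q. f q * gg Z X q + gg Z W q)"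
    by (simp only: gg_axpy[OF X W Z])
  then show "Y p (gg Z (axpy f X W)) = f p * Y p (gg Z X) + Y p f * g p (Z p) (X p) + Y p (gg Z W)"
    using tangent_axpy_fun[OF T[OF Y] f g_smooth[OF Z X] g_smooth[OF Z W]] by simp
qed

text \<open>Derivatives of \<open>f\<close> arise from differentiating the metric and from the
  brackets, and they cancel in pairs. The expression is thus tensorial in \<open>Z\<close> and
  represents a vector.\<close>

lemma koszul_axpy3:
  assumes X: "smooth_vfield A X" and Y: "smooth_vfield A Y" and Z: "smooth_vfield A Z" and W: "smooth_vfield A W"
    and f: "smooth_fun A f"
  shows "koszul X Y (axpy f Z W) p = f p * koszul X Y Z p + koszul X Y W p"
proof -
  have a: "axpy f Z W p (gg X Y) = f p * Z p (gg X Y) + W p (gg X Y)" by (simp add: axpy_def)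
  show ?thesis
    unfolding koszul_def a vfield_gg_axpy(2)[OF Z Y W f X] vfield_gg_axpy(2)[OF Z X W f Y]
      gg_axpy(2)[OF Z W smooth_vfield_bracket[OF X Y]] g_bracket_axpy(1)[OF X Z W f Y] g_bracket_axpy(1)[OF Y Z W f X]
    using gg_sym[OF Z Y] gg_sym[OF Z X] by (simp add: algebra_simps)
qed

lemma koszul_axpy1:
  assumes X: "smooth_vfield A X" and Y: "smooth_vfield A Y" and Z: "smooth_vfield A Z" and V: "smooth_vfield A V"
    and f: "smooth_fun A f"
  shows "koszul (axpy f X V) Y Z p = f p * koszul X Y Z p + koszul V Y Z p"
proof -
  have a: "axpy f X V p (gg Y Z) = f p * X p (gg Y Z) + V p (gg Y Z)" by (simp add: axpy_def)
  show ?thesis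
    unfolding koszul_def a vfield_gg_axpy(1)[OF X Z V f Y] vfield_gg_axpy(1)[OF X Y V f Z]
      gg_axpy(2)[OF X V smooth_vfield_bracket[OF Y Z]] g_bracket_axpy(2)[OF Y X V f Z] g_bracket_axpy(2)[OF Z X V f Y]
    by (simp add: algebra_simps)
qed

text \<open>The derivatives of the metric are unaffected by the exchange; the bracket term is what
  distinguishes the two orders. This becomes the absence of torsion.\<close>

lemma koszul_swap:
  assumes X: "smooth_vfield A X" and Y: "smooth_vfield A Y" and Z: "smooth_vfield A Z"
  shows "koszul X Y Z p = koszul Y X Z p + 2 * g p (lie_bracket X Y p) (Z p)"
proof -
  have "gg X Y = gg Y X" using gg_sym[OF X Y] by auto
  then show ?thesis unfolding koszul_def using bracket_antisym_g[OF Y X Z, of p] by simp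
qed

text \<open>Reduced to the first argument by exchanging the two. The bracket then contributes the
  derivative of \<open>f\<close>, which becomes the product rule of the connection.\<close>

lemma koszul_axpy2:
  assumes X: "smooth_vfield A X" and Y: "smooth_vfield A Y" and Z: "smooth_vfield A Z" and V: "smooth_vfield A V"
    and f: "smooth_fun A f"
  shows "koszul X (axpy f Y V) Z p = f p * koszul X Y Z p + koszul X V Z p + 2 * (X p f * g p (Y p) (Z p))"
  unfolding koszul_swap[OF X smooth_vfield_axpy[OF Y V f] Z] koszul_swap[OF X Y Z] koszul_swap[OF X V Z]
    koszul_axpy1[OF Y X Z V f] g_bracket_axpy(1)[OF X Y V f Z]
  by (simp add: algebra_simps)

text \<open>Apart from its first term the expression is antisymmetric in \<open>Y\<close> and
  \<open>Z\<close>. This becomes compatibility with the metric.\<close>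

lemma koszul_metric:
  assumes X: "smooth_vfield A X" and Y: "smooth_vfield A Y" and Z: "smooth_vfield A Z"
  shows "koszul X Y Z p + koszul X Z Y p = 2 * X p (gg Y Z)"
proof -
  have "gg Y Z = gg Z Y" using gg_sym[OF Y Z] by auto
  then show ?thesis unfolding koszul_def using bracket_antisym_g[OF Y Z X, of p] by simp
qed

text \<open>Multiplied by a bump that is 1 near \<open>p\<close> and supported in \<open>V\<close>,
  the field equals on the whole manifold a finite combination of the global fields
  \<open>E i\<close> with smooth coefficients. The rule for \<open>T\<close> then applies term by
  term and evaluates the coefficients at \<open>p\<close>.\<close>

lemma tensor_at:
  fixes T :: "'m vfield \<Rightarrow> real"
  assumes T: "\<And>f Z W. smooth_fun A f \<Longrightarrow> smooth_vfield A Z \<Longrightarrow> smooth_vfield A W \<Longrightarrow>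
      T (axpy f Z W) = f p * T Z + T W"
    and E: "on_frame V E" "p \<in> V" and Z: "smooth_vfield A Z"
  shows "T Z = (\<Sum>i\<in>UNIV. g p (Z p) (E i p) * T (E i))"
proof -
  note f = on_frameD[OF E(1)]
  let ?z = "(\<lambda>q k. 0) :: 'm vfield"
  note zero = smooth_vfield_zero
  have "axpy (\<lambda>q. 1) ?z ?z = ?z" by (simp add: axpy_def)
  then have T0: "T ?z = 0" using T[OF smooth_fun_const zero zero, of 1] by simp
  obtain \<eta> W K where \<eta>: "smooth_fun A \<eta>" "open W" "p \<in> W" "W \<subseteq> K" "compact K" "K \<subseteq> V"
    "\<And>q. q \<in> W \<Longrightarrow> \<eta> q = 1" "\<And>q. q \<notin> K \<Longrightarrow> \<eta> q = 0"
    using smooth_bump[OF f(1) E(2)] by metis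
  let ?c = "\<lambda>i q. \<eta> q * g q (Z q) (E i q)"
  have c: "smooth_fun A (?c i)" for i by (rule smooth_fun_mult[OF \<eta>(1) g_smooth[OF Z f(2)]])
  have sums: "smooth_vfield A (\<lambda>q k. \<Sum>i\<in>I. ?c i q * E i q k) \<and>
      T (\<lambda>q k. \<Sum>i\<in>I. ?c i q * E i q k) = (\<Sum>i\<in>I. ?c i p * T (E i))" if "finite I" for I
    using that
  proof (induction I rule: finite_induct)
    case empty
    then show ?case using T0 zero by simp
  next
    case (insert i I)
    have "(\<lambda>q k. \<Sum>i\<in>insert i I. ?c i q * E i q k) = axpy (?c i) (E i) (\<lambda>q k. \<Sum>i\<in>I. ?c i q * E i q k)"
      using insert(1,2) by (simp add: axpy_def)
    then show ?case
      using insert(1,2) T[OF c f(2) conjunct1[OF insert(3)], of i i] smooth_vfield_axpy[OF f(2) conjunct1[OF insert(3)] c, of i i]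
        conjunct2[OF insert(3)] by simp
  qed
  have "axpy \<eta> Z ?z = (\<lambda>q k. \<Sum>i\<in>UNIV. ?c i q * E i q k)"
  proof (intro ext)
    fix q k
    show "axpy \<eta> Z ?z q k = (\<Sum>i\<in>UNIV. ?c i q * E i q k)"
    proof (cases "q \<in> V")
      case True
      have "axpy \<eta> Z ?z q k = \<eta> q * (\<Sum>i\<in>UNIV. g q (Z q) (E i q) * E i q k)"
        unfolding axpy_def onb_expand[OF f(3)[OF True] smooth_vfield_tangent[OF Z], symmetric] by simp
      then show ?thesis by (simp add: sum_distrib_left mult.assoc)
    next
      case False
      then have "\<eta> q = 0" using \<eta>(6,8) by blast
      then show ?thesis by (simp add: axpy_def)
    qed
  qed
  then have "T (axpy \<eta> Z ?z) = (\<Sum>i\<in>UNIV. ?c i p * T (E i))"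
    using conjunct2[OF sums[OF finite_class.finite_UNIV]] by simp
  then show ?thesis using T[OF \<eta>(1) Z zero] T0 \<eta>(3,7) by simp
qed

text \<open>The inner product of a vector with the gradient of \<open>k\<close> is its derivative of
  \<open>k\<close>. Inserting that gradient into half of Koszul's expression therefore defines the
  vector directly as an operator on functions, without a frame.\<close>

definition koszul_connection :: "'m vfield \<Rightarrow> 'm vfield \<Rightarrow> 'm vfield" where
  "koszul_connection X Y = (\<lambda>p k. if smooth_fun A k then koszul X Y (gradient A g k) p / 2 else 0)"

text \<open>Tensoriality in the third argument turns the operator into a combination of frame
  vectors, hence into a tangent vector.\<close>

lemma koszul_connection:
  assumes X: "smooth_vfield A X" and Y: "smooth_vfield A Y"
  shows koszul_connection_tangent: "koszul_connection X Y p \<in> tangent_space A p"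
    and g_koszul_connection: "smooth_vfield A Z \<Longrightarrow> g p (koszul_connection X Y p) (Z p) = koszul X Y Z p / 2"
proof -
  obtain V E where E: "on_frame V E" "p \<in> V" using on_frame_exists by blast
  note f = on_frameD[OF E(1)]
  have t: "koszul X Y Z p = (\<Sum>i\<in>UNIV. g p (Z p) (E i p) * koszul X Y (E i) p)" if "smooth_vfield A Z" for Z
    by (rule tensor_at[where T = "\<lambda>Z. koszul X Y Z p", OF koszul_axpy3[OF X Y] E that])
  have "koszul_connection X Y p k = (\<Sum>i\<in>UNIV. koszul X Y (E i) p / 2 * E i p k)" for k
  proof (cases "smooth_fun A k")
    case True
    have "koszul X Y (gradient A g k) p = (\<Sum>i\<in>UNIV. E i p k * koszul X Y (E i) p)"
      unfolding t[OF smooth_gradient[OF True]] g_gradient[OF True smooth_vfield_tangent[OF f(2)]] ..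
    then show ?thesis using True by (simp add: koszul_connection_def sum_divide_distrib mult.commute)
  next
    case False
    then show ?thesis by (simp add: koszul_connection_def tangent_nonsmooth[OF smooth_vfield_tangent[OF f(2)]])
  qed
  then have eq: "koszul_connection X Y p = (\<lambda>k. \<Sum>i\<in>UNIV. koszul X Y (E i) p / 2 * E i p k)" by (rule ext)
  show "koszul_connection X Y p \<in> tangent_space A p"
    unfolding eq by (rule tangent_sum[OF finite smooth_vfield_tangent[OF f(2)]])
  show "g p (koszul_connection X Y p) (Z p) = koszul X Y Z p / 2" if Z: "smooth_vfield A Z"
  proof -
    have "g p (koszul_connection X Y p) (Z p) = (\<Sum>i\<in>UNIV. koszul X Y (E i) p / 2 * g p (E i p) (Z p))"
      unfolding eq by (rule g_sum[OF finite smooth_vfield_tangent[OF f(2)] smooth_vfield_tangent[OF Z]])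
    also have "... = koszul X Y Z p / 2"
      unfolding t[OF Z] gg_sym[OF Z f(2)] by (simp add: sum_divide_distrib mult.commute)
    finally show ?thesis .
  qed
qed

text \<open>\<open>levi_civita\<close> is chosen by \<open>SOME\<close>, and a witness gives it its
  properties. Each of them is a rule for \<open>koszul\<close> in translation.\<close>

lemma levi_civita_exists: "is_levi_civita A g koszul_connection"
  unfolding is_levi_civita_def
proof (intro conjI allI impI)
  note T = smooth_vfield_tangent
  fix X Y :: "'m vfield" assume X: "smooth_vfield A X" and Y: "smooth_vfield A Y"
  show "smooth_vfield A (koszul_connection X Y)"
  proof (rule smooth_vfieldI[OF koszul_connection_tangent[OF X Y]])
    fix k assume k: "smooth_fun A k"
    have "smooth_fun A (\<lambda>p. koszul X Y (gradient A g k) p * (1 / 2))"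
      by (rule smooth_fun_mult[OF smooth_koszul[OF X Y smooth_gradient[OF k]] smooth_fun_const])
    then show "smooth_fun A (\<lambda>p. koszul_connection X Y p k)" using k by (simp add: koszul_connection_def)
  qed
  show "(\<lambda>p k. koszul_connection X Y p k - koszul_connection Y X p k) = lie_bracket X Y"
  proof (intro ext)
    fix p k
    show "koszul_connection X Y p k - koszul_connection Y X p k = lie_bracket X Y p k"
    proof (cases "smooth_fun A k")
      case True
      then show ?thesis
        using koszul_swap[OF X Y smooth_gradient[OF True], of p]
          g_gradient_right[OF True T[OF smooth_vfield_bracket[OF X Y]], of p] by (simp add: koszul_connection_def add_divide_distrib)
    next
      case False
      then show ?thesis by (simp add: koszul_connection_def tangent_nonsmooth[OF T[OF smooth_vfield_bracket[OF X Y]]])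
    qed
  qed
  fix Z :: "'m vfield" assume Z: "smooth_vfield A Z"
  show "X p (\<lambda>q. g q (Y q) (Z q)) = g p (koszul_connection X Y p) (Z p) + g p (Y p) (koszul_connection X Z p)" for p
    using g_koszul_connection[OF X Y Z, of p] g_koszul_connection[OF X Z Y, of p] koszul_metric[OF X Y Z, of p]
      g_sym[OF T[OF Y] koszul_connection_tangent[OF X Z], of p] by simp
  fix h assume h: "smooth_fun A h"
  show "koszul_connection (\<lambda>p k. h p * X p k + Y p k) Z
      = (\<lambda>p k. h p * koszul_connection X Z p k + koszul_connection Y Z p k)"
  proof (intro ext)
    fix p k
    show "koszul_connection (\<lambda>p k. h p * X p k + Y p k) Z p k
      = h p * koszul_connection X Z p k + koszul_connection Y Z p k"
    proof (cases "smooth_fun A k")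
      case True
      then show ?thesis
        using koszul_axpy1[OF X Z smooth_gradient[OF True] Y h, of p] by (simp add: koszul_connection_def axpy_def add_divide_distrib)
    qed (simp add: koszul_connection_def)
  qed
  show "koszul_connection X (\<lambda>p k. h p * Y p k + Z p k)
      = (\<lambda>p k. X p h * Y p k + h p * koszul_connection X Y p k + koszul_connection X Z p k)"
  proof (intro ext)
    fix p k
    show "koszul_connection X (\<lambda>p k. h p * Y p k + Z p k) p k
      = X p h * Y p k + h p * koszul_connection X Y p k + koszul_connection X Z p k"
    proof (cases "smooth_fun A k")
      case True
      then show ?thesis
        using koszul_axpy2[OF X Y smooth_gradient[OF True] Z h, of p] g_gradient_right[OF True T[OF Y], of p]
        by (simp add: koszul_connection_def axpy_def add_divide_distrib)
    next
      case False
      then show ?thesis by (simp add: koszul_connection_def tangent_nonsmooth[OF T[OF Y]])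
    qed
  qed
qed

end

section \<open>Tensoriality, curvature and traces\<close>

context riemannian
begin

abbreviation D :: "'m vfield \<Rightarrow> 'm vfield \<Rightarrow> 'm vfield" where
  "D \<equiv> levi_civita A g"

lemma levi_civita: "is_levi_civita A g D"
  unfolding levi_civita_def by (rule someI[where P = "is_levi_civita A g", OF levi_civita_exists])

lemma D_smooth: "smooth_vfield A X \<Longrightarrow> smooth_vfield A Y \<Longrightarrow> smooth_vfield A (D X Y)"
  using levi_civita unfolding is_levi_civita_def by blast

lemma D_axpy1: "smooth_vfield A X \<Longrightarrow> smooth_vfield A Y \<Longrightarrow> smooth_vfield A Z \<Longrightarrow> smooth_fun A h \<Longrightarrow>
    D (axpy h X Y) Z = axpy h (D X Z) (D Y Z)"
  using levi_civita unfolding is_levi_civita_def axpy_def by blast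

lemma D_axpy2: "smooth_vfield A X \<Longrightarrow> smooth_vfield A Y \<Longrightarrow> smooth_vfield A Z \<Longrightarrow> smooth_fun A h \<Longrightarrow>
    D X (axpy h Y Z) = axpy (\<lambda>p. X p h) Y (axpy h (D X Y) (D X Z))"
proof -
  assume a: "smooth_vfield A X" "smooth_vfield A Y" "smooth_vfield A Z" "smooth_fun A h"
  have "D X (\<lambda>p k. h p * Y p k + Z p k) = (\<lambda>p k. X p h * Y p k + h p * D X Y p k + D X Z p k)"
    using levi_civita a unfolding is_levi_civita_def by blast
  then show ?thesis by (simp add: axpy_def add.assoc)
qed

lemma vfield_tensor_at:
  assumes T: "\<And>f Z W. smooth_fun A f \<Longrightarrow> smooth_vfield A Z \<Longrightarrow> smooth_vfield A W \<Longrightarrow>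
      T (axpy f Z W) = (\<lambda>k. f p * T Z k + T W k)"
    and E: "on_frame V E" "p \<in> V" and Z: "smooth_vfield A Z"
  shows "T Z k = (\<Sum>i\<in>UNIV. g p (Z p) (E i p) * T (E i) k)"
  by (rule tensor_at[where T = "\<lambda>Z. T Z k", OF _ E Z]) (simp add: T)

lemma tensor_cong:
  assumes T: "\<And>f Z W. smooth_fun A f \<Longrightarrow> smooth_vfield A Z \<Longrightarrow> smooth_vfield A W \<Longrightarrow>
      T (axpy f Z W) = (\<lambda>k. f p * T Z k + T W k)"
    and Z: "smooth_vfield A Z" "smooth_vfield A Z'" "Z p = Z' p"
  shows "T Z = T Z'"
proof -
  obtain V E where E: "on_frame V E" "p \<in> V" using on_frame_exists by blast
  have t: "T Y k = (\<Sum>i\<in>UNIV. g p (Y p) (E i p) * T (E i) k)" if "smooth_vfield A Y" for Y k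
    by (rule vfield_tensor_at[OF T E that])
  have "T Z k = T Z' k" for k unfolding t[OF Z(1)] t[OF Z(2)] Z(3) ..
  then show ?thesis by (rule ext)
qed

text \<open>The direction enters tensorially, so the arbitrary \<open>extension\<close> in the
  definitions of the Hessian and of the second fundamental form does no harm.\<close>

lemma D_cong:
  assumes "smooth_vfield A X" "smooth_vfield A X'" "X p = X' p" "smooth_vfield A Z"
  shows "D X Z p = D X' Z p"
proof (rule tensor_cong[where T = "\<lambda>X. D X Z p", OF _ assms(1-3)])
  fix f U W assume "smooth_fun A f" "smooth_vfield A U" "smooth_vfield A W"
  then show "D (axpy f U W) Z p = (\<lambda>k. f p * D U Z p k + D W Z p k)"
    by (simp only: D_axpy1[OF _ _ assms(4)]) (simp add: axpy_def)
qed

lemma D_lin: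
  assumes u: "u \<in> tangent_space A p" and v: "v \<in> tangent_space A p" and Z: "smooth_vfield A Z"
  shows "D (extension A p (\<lambda>h. a * u h + b * v h)) Z p = (\<lambda>k. a * D (extension A p u) Z p k + b * D (extension A p v) Z p k)"
proof -
  note eu = extension[OF u] and ev = extension[OF v] and euv = extension[OF tangent_lin_comb[OF u v, of a b]]
  let ?z = "(\<lambda>q k. 0) :: 'm vfield"
  note zero = smooth_vfield_zero
  let ?Y = "axpy (\<lambda>q. b) (extension A p v) ?z"
  have Y: "smooth_vfield A ?Y" by (rule smooth_vfield_axpy[OF ev(1) zero smooth_fun_const])
  let ?X = "axpy (\<lambda>q. a) (extension A p u) ?Y"
  have X: "smooth_vfield A ?X" by (rule smooth_vfield_axpy[OF eu(1) Y smooth_fun_const])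
  \<comment> \<open>Linearity is available in the form f X + Y; applied to 0 = 1 * 0 + 0 it gives
    that the derivative along the zero field is 0.\<close>
  have "axpy (\<lambda>q. 1) ?z ?z = ?z" by (simp add: axpy_def)
  then have "D ?z Z = axpy (\<lambda>q. 1) (D ?z Z) (D ?z Z)" using D_axpy1[OF zero zero Z smooth_fun_const, of 1] by simp
  then have D0: "D ?z Z p k = 0" for k by (metis (no_types, lifting) axpy_def add_cancel_left_left mult_1)
  have "D (extension A p (\<lambda>h. a * u h + b * v h)) Z p = D ?X Z p"
    by (rule D_cong[OF euv(1) X _ Z]) (simp add: euv(2) axpy_def eu(2) ev(2))
  also have "... = (\<lambda>k. a * D (extension A p u) Z p k + b * D (extension A p v) Z p k)"
    unfolding D_axpy1[OF eu(1) Y Z smooth_fun_const] D_axpy1[OF ev(1) zero Z smooth_fun_const]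
    by (simp add: axpy_def D0)
  finally show ?thesis .
qed

lemma g_D_lin:
  assumes u: "u \<in> tangent_space A p" and v: "v \<in> tangent_space A p" and w: "w \<in> tangent_space A p" and Z: "smooth_vfield A Z"
  shows "g p (D (extension A p (\<lambda>h. a * u h + b * v h)) Z p) w =
     a * g p (D (extension A p u) Z p) w + b * g p (D (extension A p v) Z p) w"
  unfolding D_lin[OF u v Z]
  by (rule g_lin[OF smooth_vfield_tangent[OF D_smooth[OF extension(1)[OF u] Z]] smooth_vfield_tangent[OF D_smooth[OF extension(1)[OF v] Z]] w])

section \<open>Tensoriality of the curvature\<close>

lemma curvature_tangent:
  assumes X: "smooth_vfield A X" and Y: "smooth_vfield A Y" and Z: "smooth_vfield A Z"
  shows "smooth_vfield A (curvature A g X Y Z)"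
proof -
  note s = D_smooth[OF X D_smooth[OF Y Z]] D_smooth[OF Y D_smooth[OF X Z]] D_smooth[OF smooth_vfield_bracket[OF X Y] Z]
  have "smooth_vfield A (\<lambda>p h. 1 * (1 * D X (D Y Z) p h + (- 1) * D Y (D X Z) p h) + (- 1) * D (lie_bracket X Y) Z p h)"
    by (rule smooth_vfield_lin[OF smooth_vfield_lin[OF s(1,2) smooth_fun_const smooth_fun_const] s(3) smooth_fun_const smooth_fun_const])
  then show ?thesis by (simp add: curvature_def Let_def)
qed

lemma lie_bracket_axpy_left:
  assumes X: "smooth_vfield A X" and Y: "smooth_vfield A Y" and V: "smooth_vfield A V" and f: "smooth_fun A f"
  shows "lie_bracket (axpy f X V) Y = axpy (\<lambda>q. - Y q f) X (axpy f (lie_bracket X Y) (lie_bracket V Y))"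
proof (intro ext)
  fix p k
  show "lie_bracket (axpy f X V) Y p k = axpy (\<lambda>q. - Y q f) X (axpy f (lie_bracket X Y) (lie_bracket V Y)) p k"
    unfolding lie_bracket_antisym[of "axpy f X V" Y] lie_bracket_axpy[OF Y X V f]
    using lie_bracket_antisym[of X Y p k] lie_bracket_antisym[of V Y p k] by (simp add: axpy_def)
qed

lemma curvature_axpy1:
  assumes X: "smooth_vfield A X" and Y: "smooth_vfield A Y" and Z: "smooth_vfield A Z" and V: "smooth_vfield A V" and f: "smooth_fun A f"
  shows "curvature A g (axpy f X V) Y Z p = (\<lambda>k. f p * curvature A g X Y Z p k + curvature A g V Y Z p k)"
proof -
  note B = smooth_vfield_bracket
  have Yf: "smooth_fun A (\<lambda>q. - Y q f)"
    using smooth_fun_mult[OF smooth_fun_const[of "- 1"] smooth_vfield_fun[OF Y f]] by simp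
  note s = smooth_vfield_axpy[OF B[OF X Y] B[OF V Y] f]
  show ?thesis
    unfolding curvature_def Let_def D_axpy1[OF X V D_smooth[OF Y Z] f] D_axpy1[OF X V Z f]
      D_axpy2[OF Y D_smooth[OF X Z] D_smooth[OF V Z] f] lie_bracket_axpy_left[OF X Y V f]
      D_axpy1[OF X s Z Yf] D_axpy1[OF B[OF X Y] B[OF V Y] Z f]
    by (simp add: axpy_def algebra_simps)
qed

text \<open>Antisymmetry in the first two arguments reduces this to the preceding case.\<close>

lemma curvature_axpy2:
  assumes X: "smooth_vfield A X" and Y: "smooth_vfield A Y" and Z: "smooth_vfield A Z" and V: "smooth_vfield A V" and f: "smooth_fun A f"
  shows "curvature A g Y (axpy f X V) Z p = (\<lambda>k. f p * curvature A g Y X Z p k + curvature A g Y V Z p k)"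
proof -
  note B = smooth_vfield_bracket
  have a: "curvature A g Y W Z p k = - curvature A g W Y Z p k" if W: "smooth_vfield A W" for W k
  proof -
    let ?z = "(\<lambda>q k. 0) :: 'm vfield"
    note zero = smooth_vfield_zero
    have b: "lie_bracket Y W = axpy (\<lambda>q. - 1) (lie_bracket W Y) ?z"
      by (intro ext) (simp add: axpy_def lie_bracket_antisym[of Y W])
    have "axpy (\<lambda>q. 1) ?z ?z = ?z" by (simp add: axpy_def)
    then have "D ?z Z = axpy (\<lambda>q. 1) (D ?z Z) (D ?z Z)" using D_axpy1[OF zero zero Z smooth_fun_const, of 1] by simp
    then have D0: "D ?z Z p k = 0" for k by (metis (no_types, lifting) axpy_def add_cancel_left_left mult_1)
    have "D (lie_bracket Y W) Z p k = - D (lie_bracket W Y) Z p k"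
      unfolding b D_axpy1[OF B[OF W Y] zero Z smooth_fun_const] by (simp add: axpy_def D0)
    then show ?thesis by (simp add: curvature_def Let_def)
  qed
  show ?thesis
    unfolding a[OF smooth_vfield_axpy[OF X V f]] curvature_axpy1[OF X Y Z V f]
    by (rule ext) (simp add: a[OF X] a[OF V] a[OF smooth_vfield_axpy[OF X V f]] curvature_axpy1[OF X Y Z V f])
qed

text \<open>Differentiating twice produces X(Y f) - Y(X f) times \<open>Z\<close>; the product rule
  for the derivative along the bracket removes exactly this term.\<close>

lemma curvature_axpy3:
  assumes X: "smooth_vfield A X" and Y: "smooth_vfield A Y" and Z: "smooth_vfield A Z" and V: "smooth_vfield A V" and f: "smooth_fun A f"
  shows "curvature A g X Y (axpy f Z V) p = (\<lambda>k. f p * curvature A g X Y Z p k + curvature A g X Y V p k)"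
proof -
  note B = smooth_vfield_bracket and s = smooth_vfield_fun and d = D_smooth
  have 1: "D U (D W (axpy f Z V)) = axpy (\<lambda>p. U p (\<lambda>p. W p f)) Z (axpy (\<lambda>p. W p f) (D U Z)
      (axpy (\<lambda>p. U p f) (D W Z) (axpy f (D U (D W Z)) (D U (D W V)))))"
    if U: "smooth_vfield A U" and W: "smooth_vfield A W" for U W
    unfolding D_axpy2[OF W Z V f]
      D_axpy2[OF U Z smooth_vfield_axpy[OF d[OF W Z] d[OF W V] f] s[OF W f]]
      D_axpy2[OF U d[OF W Z] d[OF W V] f] ..
  show ?thesis
    unfolding curvature_def Let_def 1[OF X Y] 1[OF Y X] D_axpy2[OF B[OF X Y] Z V f]
    by (simp add: axpy_def lie_bracket_def algebra_simps)
qed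

text \<open>Makes \<open>ricci\<close> independent of the three extensions in its
  definition.\<close>

lemma curvature_cong:
  assumes "smooth_vfield A X" "smooth_vfield A X'" "X p = X' p"
    and "smooth_vfield A Y" "smooth_vfield A Y'" "Y p = Y' p"
    and "smooth_vfield A Z" "smooth_vfield A Z'" "Z p = Z' p"
  shows "curvature A g X Y Z p = curvature A g X' Y' Z' p"
proof -
  have "curvature A g X Y Z p = curvature A g X' Y Z p"
    by (rule tensor_cong[where T = "\<lambda>X. curvature A g X Y Z p", OF curvature_axpy1[OF _ assms(4,7)] assms(1-3)])
  also have "... = curvature A g X' Y' Z p"
    by (rule tensor_cong[where T = "\<lambda>Y. curvature A g X' Y Z p", OF curvature_axpy2[OF _ assms(2,7)] assms(4-6)])
  also have "... = curvature A g X' Y' Z' p"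
    by (rule tensor_cong[where T = "\<lambda>Z. curvature A g X' Y' Z p", OF curvature_axpy3[OF assms(2,5)] assms(7-9)])
  finally show ?thesis .
qed

section \<open>Traces and norms of bilinear forms in orthonormal bases\<close>

definition bilinear_form :: "'m \<Rightarrow> ('m tangent \<Rightarrow> 'm tangent \<Rightarrow> real) \<Rightarrow> bool" where
  "bilinear_form p b \<longleftrightarrow>
    (\<forall>u\<in>tangent_space A p. \<forall>v\<in>tangent_space A p. \<forall>w\<in>tangent_space A p. \<forall>r s.
      b (\<lambda>h. r * u h + s * v h) w = r * b u w + s * b v w \<and> b w (\<lambda>h. r * u h + s * v h) = r * b w u + s * b w v)"

lemma bilinear_form_sum:
  assumes b: "bilinear_form p b" and "finite I" "\<And>i. i \<in> I \<Longrightarrow> v i \<in> tangent_space A p" "w \<in> tangent_space A p"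
  shows "b (\<lambda>h. \<Sum>i\<in>I. c i * v i h) w = (\<Sum>i\<in>I. c i * b (v i) w)"
    "b w (\<lambda>h. \<Sum>i\<in>I. c i * v i h) = (\<Sum>i\<in>I. c i * b w (v i))"
proof -
  have l: "b (\<lambda>h. r * u h + s * v h) w = r * b u w + s * b v w" "b w (\<lambda>h. r * u h + s * v h) = r * b w u + s * b w v"
    if "u \<in> tangent_space A p" "v \<in> tangent_space A p" for u v r s
    using b that assms(4) unfolding bilinear_form_def by blast+
  have z: "b (\<lambda>h. 0) w = 0" "b w (\<lambda>h. 0) = 0" using l[OF tangent_zero tangent_zero, of 0 0] by simp_all
  show "b (\<lambda>h. \<Sum>i\<in>I. c i * v i h) w = (\<Sum>i\<in>I. c i * b (v i) w)"
    using assms(2,3)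
  proof (induction I rule: finite_induct)
    case (insert i I)
    then show ?case using l(1)[of "v i" "\<lambda>h. \<Sum>i\<in>I. c i * v i h" "c i" 1] by (simp add: tangent_sum)
  qed (simp add: z)
  show "b w (\<lambda>h. \<Sum>i\<in>I. c i * v i h) = (\<Sum>i\<in>I. c i * b w (v i))"
    using assms(2,3)
  proof (induction I rule: finite_induct)
    case (insert i I)
    then show ?case using l(2)[of "v i" "\<lambda>h. \<Sum>i\<in>I. c i * v i h" "c i" 1] by (simp add: tangent_sum)
  qed (simp add: z)
qed

lemma bilinear_form_expand:
  assumes b: "bilinear_form p b" and e: "orthonormal_basis A g p e" and u: "u \<in> tangent_space A p" and v: "v \<in> tangent_space A p"
  shows "b u v = (\<Sum>i\<in>UNIV. \<Sum>j\<in>UNIV. g p u (e i) * g p v (e j) * b (e i) (e j))"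
proof -
  note t = onb_tangent[OF e]
  have "u = (\<lambda>h. \<Sum>i\<in>UNIV. g p u (e i) * e i h)" "v = (\<lambda>h. \<Sum>i\<in>UNIV. g p v (e i) * e i h)"
    by (rule ext, rule onb_expand[OF e u], rule ext, rule onb_expand[OF e v])
  then have "b u v = b (\<lambda>h. \<Sum>i\<in>UNIV. g p u (e i) * e i h) (\<lambda>h. \<Sum>i\<in>UNIV. g p v (e i) * e i h)" by simp
  also have "... = (\<Sum>i\<in>UNIV. g p u (e i) * (\<Sum>j\<in>UNIV. g p v (e j) * b (e i) (e j)))"
    by (simp only: bilinear_form_sum(1)[OF b finite t tangent_sum[OF finite t]] bilinear_form_sum(2)[OF b finite t t])
  finally show ?thesis by (simp add: sum_distrib_left mult.assoc)
qed

lemma onb_dual_orthonormal: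
  assumes e: "orthonormal_basis A g p e" and e': "orthonormal_basis A g p e'"
  shows "(\<Sum>a\<in>UNIV. g p (e' a) (e i) * g p (e' a) (e j)) = (if i = j then 1 else 0)"
proof -
  note t = onb_tangent[OF e] and t' = onb_tangent[OF e']
  have "e j = (\<lambda>h. \<Sum>a\<in>UNIV. g p (e j) (e' a) * e' a h)" by (rule ext, rule onb_expand[OF e' t])
  then have "g p (e j) (e i) = g p (\<lambda>h. \<Sum>a\<in>UNIV. g p (e j) (e' a) * e' a h) (e i)" by simp
  also have "... = (\<Sum>a\<in>UNIV. g p (e j) (e' a) * g p (e' a) (e i))" by (rule g_sum[OF finite t' t])
  finally show ?thesis using onb_g[OF e] by (simp add: g_sym[OF t t'] mult.commute eq_commute)
qed

text \<open>Expanding one basis in the other produces the products of the coefficients summed over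
  the first basis, which form the identity matrix because the change of basis is orthogonal.\<close>

lemma trace_onb_invariant:
  assumes b: "bilinear_form p b" and e: "orthonormal_basis A g p e" and e': "orthonormal_basis A g p e'"
  shows "(\<Sum>a\<in>UNIV. b (e' a) (e' a)) = (\<Sum>i\<in>UNIV. b (e i) (e i))"
proof -
  note t' = onb_tangent[OF e']
  have "(\<Sum>a\<in>UNIV. b (e' a) (e' a))
    = (\<Sum>a\<in>UNIV. \<Sum>i\<in>UNIV. \<Sum>j\<in>UNIV. g p (e' a) (e i) * g p (e' a) (e j) * b (e i) (e j))"
    by (rule sum.cong[OF refl]) (rule bilinear_form_expand[OF b e t' t'])
  also have "... = (\<Sum>i\<in>UNIV. \<Sum>a\<in>UNIV. \<Sum>j\<in>UNIV. g p (e' a) (e i) * g p (e' a) (e j) * b (e i) (e j))"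
    by (rule sum.swap)
  also have "... = (\<Sum>i\<in>UNIV. \<Sum>j\<in>UNIV. \<Sum>a\<in>UNIV. g p (e' a) (e i) * g p (e' a) (e j) * b (e i) (e j))"
    by (rule sum.cong[OF refl]) (rule sum.swap)
  also have "... = (\<Sum>i\<in>UNIV. \<Sum>j\<in>UNIV. b (e i) (e j) * (if i = j then 1 else 0))"
    unfolding onb_dual_orthonormal[OF e e', symmetric] by (simp add: sum_distrib_left mult.commute)
  also have "... = (\<Sum>i\<in>UNIV. b (e i) (e i))" by (simp only: sum_mult_delta)
  finally show ?thesis .
qed

lemma trace_form_onb:
  "bilinear_form p b \<Longrightarrow> orthonormal_basis A g p e \<Longrightarrow> trace_form A g p b = (\<Sum>i\<in>UNIV. b (e i) (e i))"
  unfolding trace_form_def by (rule trace_onb_invariant[OF _ _ some_onb])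

text \<open>The sum of squares is a trace in each of the two arguments separately, so the invariance
  of the trace is used twice.\<close>

lemma norm_sq_form_onb:
  assumes b: "bilinear_form p b" and e: "orthonormal_basis A g p e"
  shows "norm_sq_form A g p b = (\<Sum>i\<in>UNIV. \<Sum>j\<in>UNIV. (b (e i) (e j))\<^sup>2)"
proof -
  let ?s = "some_onb A g p"
  note t = onb_tangent[OF e] and ts = onb_tangent[OF some_onb, of p]
  have bl: "b (\<lambda>h. r * u h + s * v h) w = r * b u w + s * b v w" "b w (\<lambda>h. r * u h + s * v h) = r * b w u + s * b w v"
    if "u \<in> tangent_space A p" "v \<in> tangent_space A p" "w \<in> tangent_space A p" for u v w r s
    using b that unfolding bilinear_form_def by blast+
  have 1: "bilinear_form p (\<lambda>u v. \<Sum>j\<in>UNIV. b u (?s j) * b v (?s j))"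
    unfolding bilinear_form_def by (simp add: bl ts algebra_simps sum.distrib sum_distrib_left)
  have 2: "bilinear_form p (\<lambda>u v. b (e i) u * b (e i) v)" for i
    unfolding bilinear_form_def by (simp add: bl t algebra_simps)
  have "norm_sq_form A g p b = (\<Sum>i\<in>UNIV. \<Sum>j\<in>UNIV. b (?s i) (?s j) * b (?s i) (?s j))"
    by (simp add: norm_sq_form_def power2_eq_square)
  also have "... = (\<Sum>i\<in>UNIV. \<Sum>j\<in>UNIV. b (e i) (?s j) * b (e i) (?s j))"
    by (rule trace_onb_invariant[OF 1 e some_onb])
  also have "... = (\<Sum>i\<in>UNIV. \<Sum>j\<in>UNIV. b (e i) (e j) * b (e i) (e j))"
    by (rule sum.cong[OF refl]) (rule trace_onb_invariant[OF 2 e some_onb])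
  finally show ?thesis by (simp add: power2_eq_square)
qed

text \<open>\<open>ricci\<close> is defined pointwise through chosen bases and extensions. In terms
  of fields it becomes a formula that is visibly smooth in the point.\<close>

lemma ricci_frame:
  assumes E: "on_frame V E" "p \<in> V" and N: "smooth_vfield A N"
  shows "ricci A g p (N p) (N p) = (\<Sum>i\<in>UNIV. g p (curvature A g (E i) N N p) (E i p))"
proof -
  note T = smooth_vfield_tangent and f = on_frameD[OF E(1)]
  let ?b = "\<lambda>u u'. g p (curvature A g (extension A p u) (extension A p (N p)) (extension A p (N p)) p) u'"
  have cc: "curvature A g (extension A p u) (extension A p (N p)) (extension A p (N p)) p = curvature A g X N N p"
    if "smooth_vfield A X" "u = X p" for u X
    by (rule curvature_cong) (use that extension[OF T[OF that(1)]] extension[OF T[OF N]] N in auto)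
  have ct: "curvature A g (extension A p u) (extension A p (N p)) (extension A p (N p)) p \<in> tangent_space A p"
    if "u \<in> tangent_space A p" for u
    by (rule T[OF curvature_tangent]) (use extension(1)[OF that] extension(1)[OF T[OF N]] in auto)
  have b: "bilinear_form p ?b"
    unfolding bilinear_form_def
  proof (intro ballI allI conjI)
    fix u v w r s assume u: "u \<in> tangent_space A p" and v: "v \<in> tangent_space A p" and w: "w \<in> tangent_space A p"
    show "?b w (\<lambda>h. r * u h + s * v h) = r * ?b w u + s * ?b w v" by (rule g_lin_right[OF u v ct[OF w]])
    note eu = extension[OF u] and ev = extension[OF v]
    let ?z = "(\<lambda>q k. 0) :: 'm vfield"
    note zero = smooth_vfield_zero
    let ?Y = "axpy (\<lambda>q. s) (extension A p v) ?z"
    have Y: "smooth_vfield A ?Y" by (rule smooth_vfield_axpy[OF ev(1) zero smooth_fun_const])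
    let ?X = "axpy (\<lambda>q. r) (extension A p u) ?Y"
    have X: "smooth_vfield A ?X" by (rule smooth_vfield_axpy[OF eu(1) Y smooth_fun_const])
    have Xp: "(\<lambda>h. r * u h + s * v h) = ?X p" by (simp add: axpy_def eu(2) ev(2))
    have "curvature A g (axpy (\<lambda>q. 1) ?z ?z) N N p = curvature A g ?z N N p" by (simp add: axpy_def)
    then have z: "curvature A g ?z N N p k = 0" for k
      unfolding curvature_axpy1[OF zero N N zero smooth_fun_const] by (metis (no_types, lifting) add_cancel_left_left mult_1)
    have "curvature A g ?X N N p = (\<lambda>h. r * curvature A g (extension A p u) N N p h + s * curvature A g (extension A p v) N N p h)"
      unfolding curvature_axpy1[OF eu(1) N N Y smooth_fun_const] curvature_axpy1[OF ev(1) N N zero smooth_fun_const]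
      by (simp add: z)
    then have "?b (\<lambda>h. r * u h + s * v h) w = g p (\<lambda>h. r * curvature A g (extension A p u) N N p h + s * curvature A g (extension A p v) N N p h) w"
      unfolding cc[OF X Xp] by simp
    also have "... = r * g p (curvature A g (extension A p u) N N p) w + s * g p (curvature A g (extension A p v) N N p) w"
      by (rule g_lin[OF T[OF curvature_tangent[OF eu(1) N N]] T[OF curvature_tangent[OF ev(1) N N]] w])
    finally show "?b (\<lambda>h. r * u h + s * v h) w = r * ?b u w + s * ?b v w"
      unfolding cc[OF eu(1) eu(2)[symmetric]] cc[OF ev(1) ev(2)[symmetric]] .
  qed
  show ?thesis
    unfolding ricci_def trace_form_onb[OF b f(3)[OF E(2)]] cc[OF f(2) refl] ..
qed

lemma onb_parseval:
  assumes e: "orthonormal_basis A g p e" and u: "u \<in> tangent_space A p" and v: "v \<in> tangent_space A p"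
  shows "g p u v = (\<Sum>i\<in>UNIV. g p u (e i) * g p v (e i))"
proof -
  note t = onb_tangent[OF e]
  have "u = (\<lambda>h. \<Sum>i\<in>UNIV. g p u (e i) * e i h)" by (rule ext, rule onb_expand[OF e u])
  then have "g p u v = g p (\<lambda>h. \<Sum>i\<in>UNIV. g p u (e i) * e i h) v" by simp
  also have "... = (\<Sum>i\<in>UNIV. g p u (e i) * g p (e i) v)" by (rule g_sum[OF finite t v])
  finally show ?thesis by (simp only: g_sym[OF v t])
qed

lemma hessian_field:
  assumes N: "smooth_vfield A N" and h: "smooth_fun A h"
  shows "hessian A g h p (N p) (N p) = g p (D N (gradient A g h) p) (N p)"
  unfolding hessian_def
  using D_cong[OF extension(1)[OF smooth_vfield_tangent[OF N]] N extension(2)[OF smooth_vfield_tangent[OF N]] smooth_gradient[OF h]]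
  by simp

end

section \<open>Immersed hypersurfaces\<close>

text \<open>Gives a function smooth on all of Euclidean space, so that composing it with smooth
  functions on a manifold demands no control of their range.\<close>

lemma smooth_on_global_extension:
  fixes H :: "'a::euclidean_space \<Rightarrow> real"
  assumes "open T" "y \<in> T" "smooth_on T H"
  obtains H' r where "smooth_on UNIV H'" "r > 0" "ball y r \<subseteq> T" "\<And>x. x \<in> ball y r \<Longrightarrow> H' x = H x"
proof -
  obtain e where e: "e > 0" "cball y e \<subseteq> T" using assms open_contains_cball by blast
  obtain \<beta> :: "'a \<Rightarrow> real" where \<beta>: "smooth_on UNIV \<beta>"
    "\<And>x. dist y x \<le> e / 2 \<Longrightarrow> \<beta> x = 1" "\<And>x. dist y x \<ge> 2 * (e / 2) \<Longrightarrow> \<beta> x = 0"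
    using euclidean_bump[of "e / 2" y] e(1) by (metis half_gt_zero)
  let ?H = "\<lambda>x. if x \<in> T then \<beta> x * H x else 0"
  have sm: "smooth_on UNIV ?H"
  proof (rule smooth_on_local)
    fix x :: 'a
    show "\<exists>S. open S \<and> x \<in> S \<and> smooth_on S ?H"
    proof (cases "x \<in> T")
      case True
      have "smooth_on T ?H"
        by (rule smooth_on_cong[OF assms(1) _ smooth_on_mult[OF assms(1) smooth_on_subset[OF \<beta>(1) subset_UNIV] assms(3)]]) simp
      then show ?thesis using True assms(1) by blast
    next
      case False
      have "0 = ?H z" if "z \<in> - cball y e" for z using that \<beta>(3)[of z] by auto
      then have "smooth_on (- cball y e) ?H"
        by (intro smooth_on_cong[OF _ _ smooth_on_const[of _ 0]]) auto
      then show ?thesis using False e(2) by (intro exI[of _ "- cball y e"]) auto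
    qed
  qed
  have sub: "ball y (e / 2) \<subseteq> T" using e by auto
  have "?H x = H x" if "x \<in> ball y (e / 2)" for x
    using that \<beta>(2)[of x] sub by auto
  then show ?thesis by (rule that[OF sm half_gt_zero[OF e(1)] sub])
qed

locale hypersurface = M: riemannian A g + S: manifold B
  for A :: "('m::{t2_space, second_countable_topology}, 'n::finite) atlas" and g :: "'m metric"
    and B :: "('s::{t2_space, second_countable_topology}, 'k::finite) atlas" +
  fixes F :: "'s \<Rightarrow> 'm" and \<nu> :: "'s \<Rightarrow> 'm tangent"
  assumes immersed: "immersed_hypersurface A B F" and normal: "unit_normal A g B F \<nu>"
begin

abbreviation gS :: "'s metric" where "gS \<equiv> induced_metric A g F"
abbreviation push :: "'s tangent \<Rightarrow> 'm tangent" where "push \<equiv> pushforward A F"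

lemma F_continuous: "continuous_on UNIV F"
  and F_chart: "(U, \<phi>) \<in> B \<Longrightarrow> (V, \<psi>) \<in> A \<Longrightarrow> smooth_on (\<phi> ` (U \<inter> F -` V)) (\<psi> \<circ> F \<circ> inv_into U \<phi>)"
  using immersed unfolding immersed_hypersurface_def smooth_map_def by blast+

lemma F_vimage_open: "open V \<Longrightarrow> open (F -` V)"
  using F_continuous by (rule continuous_on_open_vimage[OF open_UNIV, THEN iffD1, rule_format, of F V, simplified])

lemma push_inj: "inj_on push (tangent_space B q)"
  using immersed unfolding immersed_hypersurface_def by blast

lemma smooth_fun_F:
  assumes h: "smooth_fun A h"
  shows "smooth_fun B (\<lambda>q. h (F q))"
proof (rule S.smooth_funI, rule smooth_on_local)
  fix U \<phi> x assume c: "(U, \<phi>) \<in> B" and "x \<in> \<phi> ` U"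
  then obtain q where q: "q \<in> U" "x = \<phi> q" by auto
  obtain V \<psi> where d: "(V, \<psi>) \<in> A" "F q \<in> V" by (rule M.chart_exists)
  let ?T = "\<phi> ` (U \<inter> F -` V)"
  have o: "open ?T" by (rule S.chart_open_image[OF c F_vimage_open[OF M.chart_open[OF d(1)]]])
  have "smooth_on ?T (\<lambda>x. h (inv_into V \<psi> ((\<psi> \<circ> F \<circ> inv_into U \<phi>) x)))"
    by (rule smooth_on_compose[OF o _ M.smooth_funD[OF h d(1)] F_chart[OF c d(1)]])
      (use S.chart_inv[OF c] in auto)
  then have "smooth_on ?T (\<lambda>x. h (F (inv_into U \<phi> x)))"
    by (rule smooth_on_cong[OF o, rotated]) (use S.chart_inv[OF c] M.chart_inv[OF d(1)] in auto)
  then show "\<exists>T. open T \<and> x \<in> T \<and> smooth_on T (\<lambda>x. h (F (inv_into U \<phi> x)))" using o q d(2) by blast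
qed

lemma push_smooth: "smooth_fun A h \<Longrightarrow> push x h = x (\<lambda>q. h (F q))"
  by (simp add: pushforward_def o_def)

lemma push_lin: "push (\<lambda>h. a * x h + b * y h) = (\<lambda>h. a * push x h + b * push y h)"
  by (auto simp: pushforward_def)

lemma push_tangent:
  assumes x: "x \<in> tangent_space B q"
  shows "push x \<in> tangent_space A (F q)"
proof -
  obtain U \<phi> a where c: "(U, \<phi>) \<in> B" "q \<in> U" and a: "x = coord_vec B (U, \<phi>) q a" using S.tangentE[OF x] .
  obtain V \<psi> where d: "(V, \<psi>) \<in> A" "F q \<in> V" by (rule M.chart_exists)
  let ?\<tau> = "\<psi> \<circ> F \<circ> inv_into U \<phi>"
  have \<tau>: "(?\<tau> has_derivative frechet_derivative ?\<tau> (at (\<phi> q))) (at (\<phi> q))"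
    by (rule smooth_on_imp_has_derivative[OF F_chart[OF c(1) d(1)]]) (use c d in auto)
  have "push x h = coord_vec A (V, \<psi>) (F q) (frechet_derivative ?\<tau> (at (\<phi> q)) a) h" for h
  proof (cases "smooth_fun A h")
    case True
    have t: "?\<tau> (\<phi> q) = \<psi> (F q)" using S.chart_inv[OF c] by simp
    have 1: "((\<lambda>x. h (inv_into V \<psi> (?\<tau> x))) has_derivative
        (\<lambda>a. coord_vec A (V, \<psi>) (F q) (frechet_derivative ?\<tau> (at (\<phi> q)) a) h)) (at (\<phi> q))"
      by (rule has_derivative_compose[OF \<tau>, unfolded t, OF M.chart_has_derivative[OF True d]])
    have "((\<lambda>x. h (F (inv_into U \<phi> x))) has_derivative
        (\<lambda>a. coord_vec A (V, \<psi>) (F q) (frechet_derivative ?\<tau> (at (\<phi> q)) a) h)) (at (\<phi> q))"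
      by (rule has_derivative_transform_within_open[OF 1 S.chart_open_image[OF c(1) F_vimage_open[OF M.chart_open[OF d(1)]]]])
        (use c d S.chart_inv[OF c(1)] M.chart_inv[OF d(1)] in auto)
    then have "coord_vec B (U, \<phi>) q a (\<lambda>q. h (F q)) = coord_vec A (V, \<psi>) (F q) (frechet_derivative ?\<tau> (at (\<phi> q)) a) h"
      by (rule S.coord_vec_unique[OF smooth_fun_F[OF True]])
    then show ?thesis using True by (simp add: push_smooth a)
  next
    case False
    then show ?thesis by (simp add: pushforward_def M.coord_vec_nonsmooth)
  qed
  then have "push x = coord_vec A (V, \<psi>) (F q) (frechet_derivative ?\<tau> (at (\<phi> q)) a)" by (rule ext)
  then show ?thesis using M.coord_vec_tangent[OF d] by simp
qed

text \<open>Sections of the pulled back tangent bundle, with smoothness tested on ambient functions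
  as in \<open>unit_normal\<close>. Such a section need not come from a field on the ambient
  manifold, since \<open>F\<close> may have self-intersections.\<close>

definition along :: "('s \<Rightarrow> 'm tangent) \<Rightarrow> bool" where
  "along \<xi> \<longleftrightarrow> (\<forall>q. \<xi> q \<in> tangent_space A (F q)) \<and> (\<forall>h. smooth_fun A h \<longrightarrow> smooth_fun B (\<lambda>q. \<xi> q h))"

lemma along_tangent: "along \<xi> \<Longrightarrow> \<xi> q \<in> tangent_space A (F q)"
  and along_fun: "along \<xi> \<Longrightarrow> smooth_fun A h \<Longrightarrow> smooth_fun B (\<lambda>q. \<xi> q h)"
  by (simp_all add: along_def)

lemma along_normal: "along \<nu>"
  using normal unfolding unit_normal_def along_def by blast+

lemma along_push: "smooth_vfield B X \<Longrightarrow> along (\<lambda>q. push (X q))"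
  unfolding along_def by (simp add: push_tangent S.smooth_vfield_tangent push_smooth S.smooth_vfield_fun smooth_fun_F)

text \<open>In an ambient coordinate frame the coefficients \<open>\<xi> r (x i)\<close> are smooth
  by the definition of \<open>along\<close>, and the remaining inner products are ambient functions
  composed with \<open>F\<close>.\<close>

lemma smooth_g_along:
  assumes \<xi>: "along \<xi>" and Y: "smooth_vfield A Y"
  shows "smooth_fun B (\<lambda>q. g (F q) (\<xi> q) (Y (F q)))"
proof (rule S.smooth_fun_local)
  fix q
  obtain V x X where "M.coord_frame (F q) V x X" using M.coordinate_frame by blast
  note f = M.coord_frameD[OF this]
  note T = M.smooth_vfield_tangent
  have "g (F r) (\<xi> r) (Y (F r)) = (\<Sum>i\<in>UNIV. \<xi> r (x i) * g (F r) (X i (F r)) (Y (F r)))" if "r \<in> F -` V" for r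
  proof -
    have "\<xi> r = (\<lambda>h. \<Sum>i\<in>UNIV. \<xi> r (x i) * X i (F r) h)"
      by (rule ext, rule f(6)[OF _ along_tangent[OF \<xi>]]) (use that in simp)
    then have "g (F r) (\<xi> r) (Y (F r)) = g (F r) (\<lambda>h. \<Sum>i\<in>UNIV. \<xi> r (x i) * X i (F r) h) (Y (F r))" by simp
    also have "... = (\<Sum>i\<in>UNIV. \<xi> r (x i) * g (F r) (X i (F r)) (Y (F r)))"
      by (rule M.g_sum[OF finite T[OF f(4)] T[OF Y]])
    finally show ?thesis .
  qed
  moreover have "smooth_fun B (\<lambda>r. \<Sum>i\<in>UNIV. \<xi> r (x i) * g (F r) (X i (F r)) (Y (F r)))"
    by (rule S.smooth_fun_sum[OF S.smooth_fun_mult[OF along_fun[OF \<xi> f(3)] smooth_fun_F[OF M.g_smooth[OF f(4) Y]]]])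
  ultimately show "\<exists>W k. open W \<and> q \<in> W \<and> smooth_fun B k \<and> (\<forall>r\<in>W. g (F r) (\<xi> r) (Y (F r)) = k r)"
    using F_vimage_open[OF f(1)] f(2) by blast
qed

text \<open>Expanding the inner product in an ambient orthonormal frame reduces it to products of
  the kind treated above.\<close>

lemma smooth_g_along2:
  assumes \<xi>: "along \<xi>" and \<zeta>: "along \<zeta>"
  shows "smooth_fun B (\<lambda>q. g (F q) (\<xi> q) (\<zeta> q))"
proof (rule S.smooth_fun_local)
  fix q
  obtain V E where E: "M.on_frame V E" "F q \<in> V" using M.on_frame_exists by blast
  note f = M.on_frameD[OF E(1)]
  have "g (F r) (\<xi> r) (\<zeta> r) = (\<Sum>i\<in>UNIV. g (F r) (\<xi> r) (E i (F r)) * g (F r) (\<zeta> r) (E i (F r)))" if "r \<in> F -` V" for r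
    by (rule M.onb_parseval[OF f(3) along_tangent[OF \<xi>] along_tangent[OF \<zeta>]]) (use that in simp)
  moreover have "smooth_fun B (\<lambda>r. \<Sum>i\<in>UNIV. g (F r) (\<xi> r) (E i (F r)) * g (F r) (\<zeta> r) (E i (F r)))"
    by (rule S.smooth_fun_sum[OF S.smooth_fun_mult[OF smooth_g_along[OF \<xi> f(2)] smooth_g_along[OF \<zeta> f(2)]]])
  ultimately show "\<exists>W k. open W \<and> q \<in> W \<and> smooth_fun B k \<and> (\<forall>r\<in>W. g (F r) (\<xi> r) (\<zeta> r) = k r)"
    using F_vimage_open[OF f(1)] E(2) by blast
qed

text \<open>Positivity is the point at which the injectivity of the differential enters; smoothness
  comes from regarding pushed-forward fields as fields along \<open>F\<close>.\<close>

lemma riemannian_gS: "riemannian_metric B gS"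
  unfolding riemannian_metric_def induced_metric_def
proof (intro conjI allI ballI impI)
  fix q u v w a b
  assume u: "u \<in> tangent_space B q" and v: "v \<in> tangent_space B q" and w: "w \<in> tangent_space B q"
  show "g (F q) (push (\<lambda>h. a * u h + b * v h)) (push w) = a * g (F q) (push u) (push w) + b * g (F q) (push v) (push w)"
    unfolding push_lin by (rule M.g_lin[OF push_tangent[OF u] push_tangent[OF v] push_tangent[OF w]])
next
  fix q u v assume u: "u \<in> tangent_space B q" and v: "v \<in> tangent_space B q"
  show "g (F q) (push u) (push v) = g (F q) (push v) (push u)"
    by (rule M.g_sym[OF push_tangent[OF u] push_tangent[OF v]])
next
  fix q v assume v: "v \<in> tangent_space B q" "v \<noteq> (\<lambda>h. 0)"
  have "push (\<lambda>h. 0) = (\<lambda>h. 0)" by (auto simp: pushforward_def)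
  then have "push v \<noteq> (\<lambda>h. 0)" using inj_onD[OF push_inj _ v(1) S.tangent_zero] v(2) by auto
  then show "0 < g (F q) (push v) (push v)" by (rule M.g_pos[OF push_tangent[OF v(1)]])
next
  fix X Y assume "smooth_vfield B X" "smooth_vfield B Y"
  then show "smooth_fun B (\<lambda>q. g (F q) (push (X q)) (push (Y q)))"
    by (intro smooth_g_along2 along_push)
qed

sublocale S: riemannian B gS
  by unfold_locales (rule riemannian_gS)

text \<open>The normal form of an immersion in disguise. A linear left inverse \<open>P\<close> of
  the differential turns ambient coordinates into functions \<open>z i\<close> whose pullback
  \<open>\<Phi>\<close> has identity derivative at the point, hence gives coordinates of the
  hypersurface near \<open>q\<close>. There \<open>c\<close> is a function of \<open>\<Phi>\<close>,
  and the same function of the \<open>z i\<close> extends it to the ambient manifold.\<close>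

lemma extend_fun_along:
  assumes c: "smooth_fun B c"
  shows "\<exists>c' W. smooth_fun A c' \<and> open W \<and> q \<in> W \<and> (\<forall>r\<in>W. c' (F r) = c r)"
proof -
  obtain U \<phi> where d: "(U, \<phi>) \<in> B" "q \<in> U" by (rule S.chart_exists)
  obtain V y Y where "M.coord_frame (F q) V y Y" using M.coordinate_frame by blast
  note f = M.coord_frameD[OF this]
  define L :: "real ^ 'k \<Rightarrow> real ^ 'n" where "L a = (\<chi> j. coord_vec B (U, \<phi>) q a (\<lambda>r. y j (F r)))" for a
  have L: "linear L"
  proof (rule linearI)
    show "L (a + b) = L a + L b" for a b
      using S.coord_vec_lin[OF d, of 1 a 1 b] by (simp add: L_def vec_eq_iff)
    show "L (t *\<^sub>R a) = t *\<^sub>R L a" for t a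
      using S.coord_vec_lin[OF d, of t a 0 a] by (simp add: L_def vec_eq_iff)
  qed
  have "inj L"
  proof (rule linear_injective_0[OF L, THEN iffD2], intro allI impI)
    fix a assume "L a = 0"
    let ?v = "coord_vec B (U, \<phi>) q a"
    have v: "?v \<in> tangent_space B q" by (rule S.coord_vec_tangent[OF d])
    have "push ?v (y j) = 0" for j using \<open>L a = 0\<close> by (simp add: push_smooth[OF f(3)] L_def vec_eq_iff)
    then have "(\<Sum>j\<in>UNIV. push ?v (y j) * Y j (F q) h) = 0" for h by simp
    then have "push ?v = (\<lambda>h. 0)" unfolding f(6)[OF f(2) push_tangent[OF v], symmetric] by (rule ext)
    moreover have "push (\<lambda>h. 0) = (\<lambda>h. 0)" by (auto simp: pushforward_def)
    ultimately have z: "?v = (\<lambda>h. 0)" using inj_onD[OF push_inj _ v S.tangent_zero] by auto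
    have nth: "smooth_on UNIV (\<lambda>y :: real ^ 'k. y $ i)" for i
      by (rule smooth_on_linear) (auto intro: bounded_linear_vec_nth)
    obtain x :: "'k \<Rightarrow> 's \<Rightarrow> real" and V1 where x: "\<And>i. smooth_fun B (x i)" "open V1" "q \<in> V1" "V1 \<subseteq> U"
      "\<And>r i. r \<in> V1 \<Longrightarrow> \<phi> r \<in> UNIV \<and> x i r = \<phi> r $ i"
      using S.local_smooth_extension[OF d open_UNIV UNIV_I, where H = "\<lambda>i y. y $ i", OF nth] by blast
    have "?v (x i) = a $ i" for i
      by (rule S.coord_vec_local[OF x(1) d x(2,3), where H = "\<lambda>y. y $ i"])
        (use x(5) in \<open>auto intro!: bounded_linear_imp_has_derivative bounded_linear_vec_nth\<close>)
    then show "a = 0" by (simp add: z vec_eq_iff)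
  qed
  then obtain P where P: "linear P" "P \<circ> L = id" using linear_injective_left_inverse[OF L] by blast
  define z :: "'k \<Rightarrow> 'm \<Rightarrow> real" where "z i p = (\<Sum>j\<in>UNIV. matrix P $ i $ j * y j p)" for i p
  have z: "smooth_fun A (z i)" for i unfolding z_def[abs_def]
    by (rule M.smooth_fun_sum[OF M.smooth_fun_mult[OF M.smooth_fun_const f(3)]])
  note zF = smooth_fun_F[OF z]
  define \<Phi> where "\<Phi> x = (\<chi> i. z i (F (inv_into U \<phi> x)))" for x
  have \<Phi>: "smooth_on (\<phi> ` U) \<Phi>" unfolding \<Phi>_def[abs_def]
    by (rule smooth_on_vec_nth[OF S.chart_open_range[OF d(1)]]) (simp add: S.smooth_funD[OF zF d(1)])
  have "(\<Phi> has_derivative (\<lambda>a. a)) (at (\<phi> q))"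
  proof (rule has_derivative_componentwise_within[THEN iffD2], rule ballI)
    fix i :: "real ^ 'k" assume "i \<in> Basis"
    then obtain k where i: "i = axis k 1" by (auto simp: Basis_vec_def)
    have v: "coord_vec B (U, \<phi>) q a (\<lambda>r. z k (F r)) = a $ k" for a
    proof -
      let ?v = "coord_vec B (U, \<phi>) q a"
      have v: "?v \<in> tangent_space B q" by (rule S.coord_vec_tangent[OF d])
      have "?v (\<lambda>r. z k (F r)) = (\<Sum>j\<in>UNIV. ?v (\<lambda>r. matrix P $ k $ j * y j (F r)))" unfolding z_def
        by (rule S.tangent_sum_fun[OF v finite S.smooth_fun_mult[OF S.smooth_fun_const smooth_fun_F[OF f(3)]]])
      also have "... = (\<Sum>j\<in>UNIV. matrix P $ k $ j * L a $ j)"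
        by (simp add: S.tangent_cmult[OF v smooth_fun_F[OF f(3)]] L_def)
      also have "... = (matrix P *v L a) $ k" by (simp add: matrix_vector_mult_def)
      also have "matrix P *v L a = P (L a)" by (rule fun_cong[OF matrix_vector_mul(2)[OF P(1)]])
      also have "P (L a) = a" using P(2) by (metis comp_apply id_apply)
      finally show ?thesis .
    qed
    have "((\<lambda>x. z k (F (inv_into U \<phi> x))) has_derivative (\<lambda>a. a $ k)) (at (\<phi> q))"
      using S.chart_has_derivative[OF zF d, of k] unfolding v .
    then show "((\<lambda>x. \<Phi> x \<bullet> i) has_derivative (\<lambda>x. x \<bullet> i)) (at (\<phi> q))"
      by (simp add: \<Phi>_def i inner_axis)
  qed
  then have "frechet_derivative \<Phi> (at (\<phi> q)) = (\<lambda>a. a)" by (metis frechet_derivative_at)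
  then have inj: "inj (frechet_derivative \<Phi> (at (\<phi> q)))" by (simp add: inj_def)
  obtain U' V' G where G: "open U'" "U' \<subseteq> \<phi> ` U" "\<phi> q \<in> U'" "open V'" "homeomorphism U' V' \<Phi> G" "smooth_on V' G"
    using smooth_local_inverse[OF S.chart_open_range[OF d(1)] \<Phi> _ inj] d(2) by blast
  have GV: "G ` V' \<subseteq> \<phi> ` U" using G(2,5) by (auto simp: homeomorphism_def)
  have H: "smooth_on V' (\<lambda>w. c (inv_into U \<phi> (G w)))"
    by (rule smooth_on_compose[OF G(4) GV S.smooth_funD[OF c d(1)] G(6)])
  have "\<Phi> (\<phi> q) \<in> V'" using G(3,5) by (auto simp: homeomorphism_def)
  then obtain H' r where H': "smooth_on UNIV H'" "r > 0" "ball (\<Phi> (\<phi> q)) r \<subseteq> V'"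
    "\<And>w. w \<in> ball (\<Phi> (\<phi> q)) r \<Longrightarrow> H' w = c (inv_into U \<phi> (G w))"
    using smooth_on_global_extension[OF G(4) _ H] by blast
  \<comment> \<open>Small enough for \<open>G\<close> to invert \<open>\<Phi>\<close> and for the
    globally smooth \<open>H'\<close> to agree with the function it replaces.\<close>
  define W where "W = U \<inter> \<phi> -` (U' \<inter> (\<phi> ` U \<inter> \<Phi> -` ball (\<Phi> (\<phi> q)) r))"
  have "open W" unfolding W_def
    by (intro S.chart_open_preimage[OF d(1)] open_Int G(1)
        continuous_open_preimage[OF smooth_on_imp_continuous_on[OF \<Phi>] S.chart_open_range[OF d(1)] open_ball])
  moreover have "q \<in> W" using d(2) G(3) H'(2) by (auto simp: W_def)
  moreover have "smooth_fun A (\<lambda>p. H' (\<chi> i. z i p))" by (rule M.smooth_fun_compose_vec[OF H'(1) z])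
  moreover have "H' (\<chi> i. z i (F r')) = c r'" if "r' \<in> W" for r'
  proof -
    have r': "r' \<in> U" "\<phi> r' \<in> U'" "\<Phi> (\<phi> r') \<in> ball (\<Phi> (\<phi> q)) r" using that by (auto simp: W_def)
    have "(\<chi> i. z i (F r')) = \<Phi> (\<phi> r')" using S.chart_inv[OF d(1) r'(1)] by (simp add: \<Phi>_def)
    moreover have "G (\<Phi> (\<phi> r')) = \<phi> r'" using G(5) r'(2) by (auto simp: homeomorphism_def)
    ultimately show ?thesis using H'(4)[OF r'(3)] S.chart_inv[OF d(1) r'(1)] by simp
  qed
  ultimately show ?thesis by blast
qed

text \<open>The coefficients with respect to a coordinate frame are extended one by one, and the
  finitely many neighbourhoods are intersected. Applied to \<nu>, this makes the choice in
  \<open>normal_extension\<close> meaningful.\<close>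

lemma extend_along:
  assumes \<xi>: "along \<xi>"
  shows "\<exists>N. smooth_vfield A N \<and> (\<exists>W. open W \<and> q \<in> W \<and> (\<forall>q'\<in>W. N (F q') = \<xi> q'))"
proof -
  obtain V x X where "M.coord_frame (F q) V x X" using M.coordinate_frame by blast
  note f = M.coord_frameD[OF this]
  have "\<forall>i. \<exists>c' W. smooth_fun A c' \<and> open W \<and> q \<in> W \<and> (\<forall>r\<in>W. c' (F r) = \<xi> r (x i))"
    using extend_fun_along[OF along_fun[OF \<xi> f(3)]] by blast
  then obtain c W where cW: "\<And>i. smooth_fun A (c i)" "\<And>i. open (W i)" "\<And>i. q \<in> W i"
    "\<And>i r. r \<in> W i \<Longrightarrow> c i (F r) = \<xi> r (x i)" by metis
  let ?N = "\<lambda>p h. \<Sum>i\<in>UNIV. c i p * X i p h"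
  let ?W = "F -` V \<inter> (\<Inter>i. W i)"
  have "smooth_vfield A ?N" by (rule M.smooth_vfield_sum[OF finite cW(1) f(4)])
  moreover have "open ?W" using F_vimage_open[OF f(1)] cW(2) by (intro open_Int open_INT) auto
  moreover have "q \<in> ?W" using f(2) cW(3) by auto
  moreover have "?N (F r) = \<xi> r" if "r \<in> ?W" for r
  proof (rule ext)
    fix h
    have "(\<Sum>i\<in>UNIV. c i (F r) * X i (F r) h) = (\<Sum>i\<in>UNIV. \<xi> r (x i) * X i (F r) h)"
      using that cW(4)[of r] by (intro sum.cong) auto
    also have "... = \<xi> r h" by (rule f(6)[OF _ along_tangent[OF \<xi>], symmetric]) (use that in auto)
    finally show "(\<Sum>i\<in>UNIV. c i (F r) * X i (F r) h) = \<xi> r h" .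
  qed
  ultimately show ?thesis by blast
qed

end

section \<open>The second fundamental form and the regularity of the stability integrand\<close>

context hypersurface
begin

lemma normal_extension:
  "smooth_vfield A (normal_extension A F \<nu> q)"
  "\<exists>W. open W \<and> q \<in> W \<and> (\<forall>q'\<in>W. normal_extension A F \<nu> q (F q') = \<nu> q')"
  using someI_ex[OF extend_along[OF along_normal, of q]] unfolding normal_extension_def by blast+

text \<open>In a frame the coefficients of \<open>Z\<close> vanish along the hypersurface near
  \<open>q\<close>, and so do their derivatives in the tangential direction \<open>push x\<close>;
  both terms of the product rule are therefore 0 at the point.\<close>

lemma D_vanish_along:
  assumes X: "smooth_vfield A X" and Z: "smooth_vfield A Z" and x: "x \<in> tangent_space B q" "X (F q) = push x"
    and W: "open W" "q \<in> W" "\<And>r. r \<in> W \<Longrightarrow> Z (F r) = (\<lambda>h. 0)"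
  shows "M.D X Z (F q) = (\<lambda>k. 0)"
proof -
  note T = M.smooth_vfield_tangent
  obtain V E where E: "M.on_frame V E" "F q \<in> V" using M.on_frame_exists by blast
  note f = M.on_frameD[OF E(1)]
  obtain \<eta> V' K where \<eta>: "smooth_fun A \<eta>" "open V'" "F q \<in> V'" "V' \<subseteq> K" "compact K" "K \<subseteq> V"
    "\<And>q. q \<in> V' \<Longrightarrow> \<eta> q = 1" "\<And>q. q \<notin> K \<Longrightarrow> \<eta> q = 0"
    using M.smooth_bump[OF f(1) E(2)] by metis
  let ?z = "(\<lambda>q k. 0) :: 'm vfield"
  note zero = M.smooth_vfield_zero
  let ?c = "\<lambda>i p. \<eta> p * g p (Z p) (E i p)"
  have c: "smooth_fun A (?c i)" for i by (rule M.smooth_fun_mult[OF \<eta>(1) M.g_smooth[OF Z f(2)]])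
  have c0: "?c i (F r) = 0" if "r \<in> W" for i r
    unfolding W(3)[OF that] by (simp add: M.g_zero[OF T[OF f(2)]])
  have Xc: "X (F q) (?c i) = 0" for i
  proof -
    have "x (\<lambda>r. ?c i (F r)) = x (\<lambda>r. 0)"
      by (rule S.tangent_local[OF x(1) smooth_fun_F[OF c] S.smooth_fun_const W(1,2)]) (rule c0)
    then show ?thesis by (simp add: x(2) push_smooth[OF c] S.tangent_const[OF x(1)])
  qed
  have "axpy (\<lambda>q. 1) ?z ?z = ?z" by (simp add: axpy_def)
  then have "M.D X ?z = axpy (\<lambda>p. X p (\<lambda>q. 1)) ?z (axpy (\<lambda>q. 1) (M.D X ?z) (M.D X ?z))"
    using M.D_axpy2[OF X zero zero M.smooth_fun_const, of 1] by simp
  then have "M.D X ?z (F q) k = axpy (\<lambda>p. X p (\<lambda>q. 1)) ?z (axpy (\<lambda>q. 1) (M.D X ?z) (M.D X ?z)) (F q) k" for k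
    by (rule arg_cong)
  then have D0: "M.D X ?z (F q) k = 0" for k unfolding axpy_def by (metis add_cancel_left_left mult_1 mult_zero_right)
  have sums: "smooth_vfield A (\<lambda>p k. \<Sum>i\<in>I. ?c i p * E i p k) \<and>
      M.D X (\<lambda>p k. \<Sum>i\<in>I. ?c i p * E i p k) (F q) = (\<lambda>k. 0)" if "finite I" for I
    using that
  proof (induction I rule: finite_induct)
    case empty
    then show ?case using D0 zero by auto
  next
    case (insert i I)
    have "(\<lambda>p k. \<Sum>i\<in>insert i I. ?c i p * E i p k) = axpy (?c i) (E i) (\<lambda>p k. \<Sum>i\<in>I. ?c i p * E i p k)"
      using insert(1,2) by (simp add: axpy_def)
    moreover have "smooth_vfield A (axpy (?c i) (E i) (\<lambda>p k. \<Sum>i\<in>I. ?c i p * E i p k))"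
      by (rule M.smooth_vfield_axpy[OF f(2) conjunct1[OF insert(3)] c])
    moreover have "M.D X (axpy (?c i) (E i) (\<lambda>p k. \<Sum>i\<in>I. ?c i p * E i p k)) (F q) = (\<lambda>k. 0)"
      unfolding M.D_axpy2[OF X f(2) conjunct1[OF insert(3)] c]
      unfolding axpy_def Xc c0[OF W(2)] conjunct2[OF insert(3)] by simp
    ultimately show ?case by simp
  qed
  have "axpy \<eta> Z ?z = (\<lambda>p k. \<Sum>i\<in>UNIV. ?c i p * E i p k)"
  proof (intro ext)
    fix p k
    show "axpy \<eta> Z ?z p k = (\<Sum>i\<in>UNIV. ?c i p * E i p k)"
    proof (cases "p \<in> V")
      case True
      have "axpy \<eta> Z ?z p k = \<eta> p * (\<Sum>i\<in>UNIV. g p (Z p) (E i p) * E i p k)"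
        unfolding axpy_def M.onb_expand[OF f(3)[OF True] T[OF Z], symmetric] by simp
      then show ?thesis by (simp add: sum_distrib_left mult.assoc)
    next
      case False
      then have "\<eta> p = 0" using \<eta>(6,8) by blast
      then show ?thesis by (simp add: axpy_def)
    qed
  qed
  then have "M.D X (axpy \<eta> Z ?z) (F q) = (\<lambda>k. 0)"
    using conjunct2[OF sums[OF finite_class.finite_UNIV]] by simp
  then have "X (F q) \<eta> * Z (F q) k + (\<eta> (F q) * M.D X Z (F q) k + M.D X ?z (F q) k) = 0" for k
    unfolding M.D_axpy2[OF X Z zero \<eta>(1)] unfolding axpy_def by (rule fun_cong)
  then show ?thesis using W(2,3) \<eta>(3,7) D0 by (simp add: fun_eq_iff)
qed

lemma D_cong_along:
  assumes X: "smooth_vfield A X" and Z: "smooth_vfield A Z" "smooth_vfield A Z'" and x: "x \<in> tangent_space B q" "X (F q) = push x"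
    and W: "open W" "q \<in> W" "\<And>r. r \<in> W \<Longrightarrow> Z (F r) = Z' (F r)"
  shows "M.D X Z (F q) = M.D X Z' (F q)"
proof -
  let ?Y = "axpy (\<lambda>p. - 1) Z' Z"
  have Y: "smooth_vfield A ?Y" by (rule M.smooth_vfield_axpy[OF Z(2,1) M.smooth_fun_const])
  have "M.D X ?Y (F q) = (\<lambda>k. 0)"
    by (rule D_vanish_along[OF X Y x W(1,2)]) (simp add: axpy_def W(3))
  then have "X (F q) (\<lambda>p. - 1) * Z' (F q) k + (- 1 * M.D X Z' (F q) k + M.D X Z (F q) k) = 0" for k
    unfolding M.D_axpy2[OF X Z(2,1) M.smooth_fun_const] unfolding axpy_def by (rule fun_cong)
  then show ?thesis using M.tangent_const[OF M.smooth_vfield_tangent[OF X]] by (simp add: fun_eq_iff)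
qed

abbreviation II :: "'s \<Rightarrow> 's tangent \<Rightarrow> 's tangent \<Rightarrow> real" where
  "II \<equiv> second_ff A g F \<nu>"

text \<open>Independence of the extension of \<nu>, since two extensions agree along the
  hypersurface. As one field \<open>N\<close> serves all points of \<open>W\<close>, the dependence
  on the point becomes accessible as well.\<close>

lemma II_extension:
  assumes N: "smooth_vfield A N" and W: "open W" "\<And>r. r \<in> W \<Longrightarrow> N (F r) = \<nu> r" and q: "q \<in> W" and x: "x \<in> tangent_space B q"
  shows "II q x y = g (F q) (M.D (extension A (F q) (push x)) N (F q)) (push y)"
proof -
  obtain W' where W': "open W'" "q \<in> W'" "\<forall>q'\<in>W'. normal_extension A F \<nu> q (F q') = \<nu> q'"
    using normal_extension(2)[of q] by blast
  note e = M.extension[OF push_tangent[OF x]]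
  have "M.D (extension A (F q) (push x)) (normal_extension A F \<nu> q) (F q) = M.D (extension A (F q) (push x)) N (F q)"
    by (rule D_cong_along[OF e(1) normal_extension(1) N x e(2) open_Int[OF W(1) W'(1)]]) (use q W' W(2) in auto)
  then show ?thesis by (simp add: second_ff_def)
qed

lemma bilinear_II: "S.bilinear_form q (II q)"
  unfolding S.bilinear_form_def
proof (intro ballI allI conjI)
  fix u v w r s assume u: "u \<in> tangent_space B q" and v: "v \<in> tangent_space B q" and w: "w \<in> tangent_space B q"
  note N = normal_extension(1)[of q]
  show "II q (\<lambda>h. r * u h + s * v h) w = r * II q u w + s * II q v w"
    unfolding second_ff_def push_lin
    by (rule M.g_D_lin[OF push_tangent[OF u] push_tangent[OF v] push_tangent[OF w] N])
  show "II q w (\<lambda>h. r * u h + s * v h) = r * II q w u + s * II q w v"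
    unfolding second_ff_def push_lin
    by (rule M.g_lin_right[OF push_tangent[OF u] push_tangent[OF v]
          M.smooth_vfield_tangent[OF M.D_smooth[OF M.extension(1)[OF push_tangent[OF w]] N]]])
qed

text \<open>With a fixed extension \<open>N\<close> and a fixed ambient frame, the direction enters
  through its coefficients alone; what remains are inner products of fields along the
  immersion.\<close>

lemma smooth_II:
  assumes X: "smooth_vfield B X" and Y: "smooth_vfield B Y"
  shows "smooth_fun B (\<lambda>q. II q (X q) (Y q))"
proof (rule S.smooth_fun_local)
  fix q
  note T = M.smooth_vfield_tangent
  obtain N W where N: "smooth_vfield A N" and W: "open W" "q \<in> W" "\<forall>q'\<in>W. N (F q') = \<nu> q'"
    using extend_along[OF along_normal, of q] by blast
  obtain V E where E: "M.on_frame V E" "F q \<in> V" using M.on_frame_exists by blast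
  note f = M.on_frameD[OF E(1)]
  let ?k = "\<lambda>r. \<Sum>i\<in>UNIV. g (F r) (push (X r)) (E i (F r)) * g (F r) (push (Y r)) (M.D (E i) N (F r))"
  have "II r (X r) (Y r) = ?k r" if r: "r \<in> W \<inter> F -` V" for r
  proof -
    note x = S.smooth_vfield_tangent[OF X, of r] and y = S.smooth_vfield_tangent[OF Y, of r]
    note e = M.extension[OF push_tangent[OF x]]
    have "M.D (extension A (F r) (push (X r))) N (F r) k
      = (\<Sum>i\<in>UNIV. g (F r) (extension A (F r) (push (X r)) (F r)) (E i (F r)) * M.D (E i) N (F r) k)" for k
    proof (rule M.vfield_tensor_at[where T = "\<lambda>X. M.D X N (F r)", OF _ E(1) _ e(1)])
      fix h U U' assume "smooth_fun A h" "smooth_vfield A U" "smooth_vfield A U'"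
      then show "M.D (axpy h U U') N (F r) = (\<lambda>k. h (F r) * M.D U N (F r) k + M.D U' N (F r) k)"
        by (simp only: M.D_axpy1[OF _ _ N]) (simp add: axpy_def)
    qed (use r in simp)
    then have "M.D (extension A (F r) (push (X r))) N (F r)
      = (\<lambda>k. \<Sum>i\<in>UNIV. g (F r) (push (X r)) (E i (F r)) * M.D (E i) N (F r) k)" by (simp add: e(2) fun_eq_iff)
    then have "II r (X r) (Y r) = g (F r) (\<lambda>k. \<Sum>i\<in>UNIV. g (F r) (push (X r)) (E i (F r)) * M.D (E i) N (F r) k) (push (Y r))"
      using II_extension[OF N W(1) _ _ x, of "Y r"] W(3) r by simp
    also have "... = (\<Sum>i\<in>UNIV. g (F r) (push (X r)) (E i (F r)) * g (F r) (M.D (E i) N (F r)) (push (Y r)))"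
      by (rule M.g_sum[OF finite T[OF M.D_smooth[OF f(2) N]] push_tangent[OF y]])
    also have "... = ?k r" by (simp only: M.g_sym[OF push_tangent[OF y] T[OF M.D_smooth[OF f(2) N]]])
    finally show ?thesis .
  qed
  moreover have "smooth_fun B ?k"
    by (rule S.smooth_fun_sum[OF S.smooth_fun_mult[OF smooth_g_along[OF along_push[OF X] f(2)]
            smooth_g_along[OF along_push[OF Y] M.D_smooth[OF f(2) N]]]])
  moreover have "open (W \<inter> F -` V)" by (rule open_Int[OF W(1) F_vimage_open[OF f(1)]])
  ultimately show "\<exists>W k. open W \<and> q \<in> W \<and> smooth_fun B k \<and> (\<forall>r\<in>W. II r (X r) (Y r) = k r)"
    using W(2) E(2) by blast
qed

lemma smooth_norm_sq_II: "smooth_fun B (\<lambda>q. norm_sq_form B gS q (II q))"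
proof (rule S.smooth_fun_local)
  fix q
  obtain V E where E: "S.on_frame V E" "q \<in> V" using S.on_frame_exists by blast
  note f = S.on_frameD[OF E(1)]
  have "norm_sq_form B gS r (II r) = (\<Sum>i\<in>UNIV. \<Sum>j\<in>UNIV. II r (E i r) (E j r) * II r (E i r) (E j r))" if "r \<in> V" for r
    using S.norm_sq_form_onb[OF bilinear_II f(3)[OF that]] by (simp add: power2_eq_square)
  moreover have "smooth_fun B (\<lambda>r. \<Sum>i\<in>UNIV. \<Sum>j\<in>UNIV. II r (E i r) (E j r) * II r (E i r) (E j r))"
    by (rule S.smooth_fun_sum[OF S.smooth_fun_sum[OF S.smooth_fun_mult[OF smooth_II[OF f(2) f(2)] smooth_II[OF f(2) f(2)]]]])
  ultimately show "\<exists>W k. open W \<and> q \<in> W \<and> smooth_fun B k \<and> (\<forall>r\<in>W. norm_sq_form B gS r (II r) = k r)"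
    using f(1) E(2) by blast
qed

text \<open>Near each point the value is a smooth ambient function, built from a local extension of
  \<nu> and an orthonormal frame, composed with \<open>F\<close>.\<close>

lemma smooth_ric_f_infty_normal:
  assumes h: "smooth_fun A h"
  shows "smooth_fun B (\<lambda>q. ric_f_infty A g h (F q) (\<nu> q) (\<nu> q))"
proof (rule S.smooth_fun_local)
  fix q
  obtain N W where N: "smooth_vfield A N" and W: "open W" "q \<in> W" "\<forall>q'\<in>W. N (F q') = \<nu> q'"
    using extend_along[OF along_normal, of q] by blast
  obtain V E where E: "M.on_frame V E" "F q \<in> V" using M.on_frame_exists by blast
  note f = M.on_frameD[OF E(1)]
  let ?k = "\<lambda>p. (\<Sum>i\<in>UNIV. g p (curvature A g (E i) N N p) (E i p)) + g p (M.D N (gradient A g h) p) (N p)"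
  have "ric_f_infty A g h (F r) (\<nu> r) (\<nu> r) = ?k (F r)" if r: "r \<in> W \<inter> F -` V" for r
  proof -
    have "F r \<in> V" "\<nu> r = N (F r)" using r W(3) by auto
    then show ?thesis
      using M.ricci_frame[OF E(1) _ N, of "F r"] M.hessian_field[OF N h, of "F r"] by (simp add: ric_f_infty_def)
  qed
  moreover have "smooth_fun A ?k"
    by (rule M.smooth_fun_add[OF M.smooth_fun_sum[OF M.g_smooth[OF M.curvature_tangent[OF f(2) N N] f(2)]]
          M.g_smooth[OF M.D_smooth[OF N M.smooth_gradient[OF h]] N]])
  moreover have "open (W \<inter> F -` V)" by (rule open_Int[OF W(1) F_vimage_open[OF f(1)]])
  ultimately show "\<exists>W k. open W \<and> q \<in> W \<and> smooth_fun B k \<and> (\<forall>r\<in>W. ric_f_infty A g h (F r) (\<nu> r) (\<nu> r) = k r)"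
    using smooth_fun_F W(2) E(2) by blast
qed

text \<open>The factor of the squared test function in the stability inequality, called Q in the
  overview.\<close>

definition stability_potential :: "('m \<Rightarrow> real) \<Rightarrow> 's \<Rightarrow> real" where
  "stability_potential f q = ric_f_infty A g f (F q) (\<nu> q) (\<nu> q) + norm_sq_form B gS q (II q)"

lemma smooth_stability_potential: "smooth_fun A f \<Longrightarrow> smooth_fun B (stability_potential f)"
  unfolding stability_potential_def[abs_def]
  by (rule S.smooth_fun_add[OF smooth_ric_f_infty_normal smooth_norm_sq_II])

lemma card_n: "real CARD('n) - 1 = real CARD('k)"
  using immersed by (simp add: immersed_hypersurface_def)

lemma normal_deriv_eq: "smooth_fun A f \<Longrightarrow> normal_deriv A g f F \<nu> q = \<nu> q f"
  unfolding normal_deriv_def by (rule M.g_gradient[OF _ along_tangent[OF along_normal]])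

text \<open>The trace-free part of the second fundamental form splits off because \<open>H = f\<^sub>\<nu>\<close>.\<close>

lemma stability_potential_split:
  assumes f: "smooth_fun A f" and min: "f_minimal A g f B F \<nu>" and e: "orthonormal_basis B gS q e"
  shows "stability_potential f q = ric_f_1 A g f (F q) (\<nu> q) (\<nu> q)
    + (\<Sum>i\<in>UNIV. \<Sum>j\<in>UNIV. (II q (e i) (e j) - normal_deriv A g f F \<nu> q / real CARD('k) * (if i = j then 1 else 0))\<^sup>2)"
proof -
  let ?k = "real CARD('k)" and ?d = "normal_deriv A g f F \<nu> q"
  let ?c = "?d / ?k"
  have k: "?k > 0" by simp
  have tr: "(\<Sum>i\<in>UNIV. II q (e i) (e i)) = ?d"
    using min S.trace_form_onb[OF bilinear_II e] by (simp add: f_minimal_def mean_curvature_def)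
  have "(\<Sum>i\<in>UNIV. \<Sum>j\<in>UNIV. (II q (e i) (e j) - ?c * (if i = j then 1 else 0))\<^sup>2)
    = (\<Sum>i\<in>UNIV. \<Sum>j\<in>UNIV. (II q (e i) (e j))\<^sup>2 + (- 2 * ?c * II q (e i) (e j) + ?c\<^sup>2) * (if i = j then 1 else 0))"
    by (intro sum.cong refl) (auto simp: power2_eq_square algebra_simps)
  also have "... = (\<Sum>i\<in>UNIV. \<Sum>j\<in>UNIV. (II q (e i) (e j))\<^sup>2) + (\<Sum>i\<in>UNIV. - 2 * ?c * II q (e i) (e i) + ?c\<^sup>2)"
    by (simp only: sum.distrib sum_mult_delta)
  also have "(\<Sum>i\<in>UNIV. - 2 * ?c * II q (e i) (e i) + ?c\<^sup>2) = - 2 * ?c * ?d + ?k * ?c\<^sup>2"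
    by (simp only: sum.distrib sum_distrib_left[symmetric] tr) simp
  \<comment> \<open>Minus the term by which \<open>ric_f_1\<close> exceeds
    \<open>ric_f_infty\<close> on the normal, because \<open>CARD('n) - 1\<close> is
    \<open>CARD('k)\<close>.\<close>
  also have "... = - (?d * ?d / ?k)" using k by (simp add: power2_eq_square field_simps)
  finally show ?thesis
    unfolding stability_potential_def S.norm_sq_form_onb[OF bilinear_II e] ric_f_1_def ric_f_infty_def card_n
      normal_deriv_eq[OF f, symmetric] by simp
qed

lemma stability_potential_nonneg:
  assumes "smooth_fun A f" "f_minimal A g f B F \<nu>" "ric_f_1 A g f (F q) (\<nu> q) (\<nu> q) \<ge> 0"
  shows "stability_potential f q \<ge> 0"
  unfolding stability_potential_split[OF assms(1,2) S.some_onb]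
  by (intro add_nonneg_nonneg assms(3) sum_nonneg) auto

text \<open>Both parts of the splitting are nonnegative, so each vanishes. The vanishing of the
  second determines \<open>II\<close> on an orthonormal basis, and bilinearity does the
  rest.\<close>

lemma stability_potential_zero:
  assumes f: "smooth_fun A f" "f_minimal A g f B F \<nu>" and ric: "ric_f_1 A g f (F q) (\<nu> q) (\<nu> q) \<ge> 0"
    and zero: "stability_potential f q = 0"
  shows "ric_f_1 A g f (F q) (\<nu> q) (\<nu> q) = 0"
    "x \<in> tangent_space B q \<Longrightarrow> y \<in> tangent_space B q \<Longrightarrow>
      II q x y = normal_deriv A g f F \<nu> q / (real CARD('n) - 1) * gS q x y"
proof -
  obtain e where e: "orthonormal_basis B gS q e" using S.orthonormal_basis_exists by blast
  let ?c = "normal_deriv A g f F \<nu> q / real CARD('k)"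
  let ?s = "\<Sum>i\<in>UNIV. \<Sum>j\<in>UNIV. (II q (e i) (e j) - ?c * (if i = j then 1 else 0))\<^sup>2"
  have "?s \<ge> 0" by (intro sum_nonneg) auto
  then have s: "?s = 0" "ric_f_1 A g f (F q) (\<nu> q) (\<nu> q) = 0"
    using stability_potential_split[OF f e] zero ric by linarith+
  show "ric_f_1 A g f (F q) (\<nu> q) (\<nu> q) = 0" by (rule s(2))
  have II: "II q (e i) (e j) = ?c * (if i = j then 1 else 0)" for i j
  proof -
    have "(\<Sum>j\<in>UNIV. (II q (e i) (e j) - ?c * (if i = j then 1 else 0))\<^sup>2) = 0"
      using s(1) by (subst (asm) sum_nonneg_eq_0_iff) (auto intro: sum_nonneg)
    then have "(II q (e i) (e j) - ?c * (if i = j then 1 else 0))\<^sup>2 = 0"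
      by (subst (asm) sum_nonneg_eq_0_iff) auto
    then show ?thesis by simp
  qed
  assume x: "x \<in> tangent_space B q" and y: "y \<in> tangent_space B q"
  have "II q x y = (\<Sum>i\<in>UNIV. \<Sum>j\<in>UNIV. gS q x (e i) * gS q y (e j) * (?c * (if i = j then 1 else 0)))"
    unfolding S.bilinear_form_expand[OF bilinear_II e x y] II ..
  also have "... = (\<Sum>i\<in>UNIV. \<Sum>j\<in>UNIV. (?c * gS q x (e i) * gS q y (e j)) * (if i = j then 1 else 0))"
    by (simp only: mult.assoc mult.left_commute)
  also have "... = (\<Sum>i\<in>UNIV. ?c * gS q x (e i) * gS q y (e i))" by (simp only: sum_mult_delta)
  also have "... = ?c * gS q x y"
    unfolding S.onb_parseval[OF e x y] by (simp add: sum_distrib_left mult.assoc)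
  finally show "II q x y = normal_deriv A g f F \<nu> q / (real CARD('n) - 1) * gS q x y"
    unfolding card_n .
qed

end

section \<open>Change of variables for nonnegative functions\<close>

text \<open>The change of variables theorem of the library needs a well-ordered index type, so it is
  transported along a well-ordered copy of the index type.\<close>

typedef 'a wo_copy = "UNIV :: 'a set" by auto

instance wo_copy :: (finite) finite
proof
  have "(UNIV :: 'a wo_copy set) = Abs_wo_copy ` UNIV"
    by (metis Rep_wo_copy_inverse surj_def)
  then show "finite (UNIV :: 'a wo_copy set)" by (metis finite_class.finite_UNIV finite_imageI)
qed

text \<open>Any injection into the natural numbers serves to order a finite type; the order has no
  geometric meaning.\<close>

definition finite_rank :: "'a::finite \<Rightarrow> nat" where
  "finite_rank = (SOME r. inj r)"

lemma inj_finite_rank: "inj (finite_rank :: 'a::finite \<Rightarrow> nat)"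
proof -
  have "\<exists>r :: 'a \<Rightarrow> nat. inj r" using finite_imp_inj_to_nat_seg[of "UNIV :: 'a set"] by auto
  then show ?thesis unfolding finite_rank_def by (rule someI_ex)
qed

instantiation wo_copy :: (finite) wellorder
begin

definition less_eq_wo_copy :: "'a wo_copy \<Rightarrow> 'a wo_copy \<Rightarrow> bool" where
  "less_eq_wo_copy x y \<longleftrightarrow> finite_rank (Rep_wo_copy x) \<le> finite_rank (Rep_wo_copy y)"

definition less_wo_copy :: "'a wo_copy \<Rightarrow> 'a wo_copy \<Rightarrow> bool" where
  "less_wo_copy x y \<longleftrightarrow> finite_rank (Rep_wo_copy x) < finite_rank (Rep_wo_copy y)"

instance
proof
  fix x y :: "'a wo_copy" assume "x \<le> y" "y \<le> x"
  then have "finite_rank (Rep_wo_copy x) = finite_rank (Rep_wo_copy y)" by (simp add: less_eq_wo_copy_def)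
  then show "x = y" using injD[OF inj_finite_rank] by (simp add: Rep_wo_copy_inject[symmetric])
next
  fix P :: "'a wo_copy \<Rightarrow> bool" and a :: "'a wo_copy" assume step: "\<And>x. (\<And>y. y < x \<Longrightarrow> P y) \<Longrightarrow> P x"
  show "P a"
    by (induction a rule: measure_induct_rule[of "\<lambda>x. finite_rank (Rep_wo_copy x)"])
      (rule step, simp add: less_wo_copy_def)
qed (auto simp: less_eq_wo_copy_def less_wo_copy_def)

end

lemma bij_Rep_wo_copy: "bij Rep_wo_copy"
  by (rule bijI) (auto simp: inj_def Rep_wo_copy_inject surj_def intro!: Abs_wo_copy_inverse[OF UNIV_I, symmetric])

text \<open>Relabelling rows and columns by the same bijection conjugates the permutations in the
  Leibniz formula, which preserves their signs.\<close>

lemma det_reindex: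
  fixes M :: "real ^ 'b ^ 'b" and r :: "'a::finite \<Rightarrow> 'b::finite"
  assumes r: "bij r"
  shows "det (\<chi> i j. M $ r i $ r j) = det M"
proof -
  have inj: "inj r" using r by (rule bij_is_inj)
  let ?m = "map_permutation UNIV r" and ?m' = "map_permutation UNIV (inv r)"
  have "det (\<chi> i j. M $ r i $ r j) = (\<Sum>p | p permutes UNIV. of_int (sign p) * (\<Prod>i\<in>UNIV. M $ r i $ r (p i)))"
    by (simp add: det_def)
  also have "... = (\<Sum>p | p permutes UNIV. of_int (sign p) * (\<Prod>i\<in>UNIV. M $ i $ p i))"
  proof (rule sum.reindex_bij_witness[where i = ?m' and j = ?m])
    fix p :: "'a \<Rightarrow> 'a" assume p: "p \<in> {p. p permutes UNIV}"
    show "?m' (?m p) = p"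
      by (rule map_permutation_compose_inv) (use r p inj in \<open>auto simp: inv_f_f\<close>)
    show "?m p \<in> {p. p permutes UNIV}" using map_permutation_permutes[OF r] p by simp
    have "sign (?m p) = sign p"
      by (rule sign_map_permutation) (use p inj in auto)
    moreover have "(\<Prod>i\<in>UNIV. M $ i $ ?m p i) = (\<Prod>i\<in>UNIV. M $ r i $ ?m p (r i))"
      by (rule prod.reindex_bij_betw[OF r, symmetric])
    moreover have "?m p (r i) = r (p i)" for i by (rule map_permutation_apply[OF inj UNIV_I])
    ultimately show "of_int (sign (?m p)) * (\<Prod>i\<in>UNIV. M $ i $ ?m p i) = of_int (sign p) * (\<Prod>i\<in>UNIV. M $ r i $ r (p i))"
      by simp
  next
    fix p :: "'b \<Rightarrow> 'b" assume p: "p \<in> {p. p permutes UNIV}"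
    note r' = bij_imp_bij_inv[OF r]
    show "?m (?m' p) = p"
      by (rule map_permutation_compose_inv[OF r']) (use p r in \<open>auto simp: bij_is_surj surj_f_inv_f\<close>)
    show "?m' p \<in> {p. p permutes UNIV}" using map_permutation_permutes[OF r'] p by simp
  qed
  finally show ?thesis by (simp add: det_def)
qed

definition reindex_vec :: "real ^ 'k::finite \<Rightarrow> real ^ 'k wo_copy" where
  "reindex_vec x = (\<chi> j. x $ Rep_wo_copy j)"

definition unindex_vec :: "real ^ 'k::finite wo_copy \<Rightarrow> real ^ 'k" where
  "unindex_vec y = (\<chi> i. y $ Abs_wo_copy i)"

lemma unindex_reindex[simp]: "unindex_vec (reindex_vec x) = x"
  by (simp add: unindex_vec_def reindex_vec_def vec_eq_iff Abs_wo_copy_inverse)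

lemma reindex_unindex[simp]: "reindex_vec (unindex_vec y) = y"
  by (simp add: unindex_vec_def reindex_vec_def vec_eq_iff Rep_wo_copy_inverse)

lemma bounded_linear_reindex: "bounded_linear reindex_vec"
  by (intro linear_conv_bounded_linear[THEN iffD1] linearI) (simp_all add: reindex_vec_def vec_eq_iff)

lemma bounded_linear_unindex: "bounded_linear unindex_vec"
  by (intro linear_conv_bounded_linear[THEN iffD1] linearI) (simp_all add: unindex_vec_def vec_eq_iff)

lemma borel_reindex[measurable]: "reindex_vec \<in> borel_measurable borel"
  by (intro borel_measurable_continuous_onI linear_continuous_on bounded_linear_reindex)

lemma borel_unindex[measurable]: "unindex_vec \<in> borel_measurable borel"
  by (intro borel_measurable_continuous_onI linear_continuous_on bounded_linear_unindex)

text \<open>Lebesgue measure is characterised by the volume of boxes, and relabelling coordinates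
  takes boxes to boxes with the same side lengths.\<close>

lemma lborel_reindex: "distr lborel borel reindex_vec = (lborel :: (real ^ 'k::finite wo_copy) measure)"
proof (rule sym, rule lborel_eqI)
  fix l u :: "real ^ 'k wo_copy" assume le: "\<And>b. b \<in> Basis \<Longrightarrow> l \<bullet> b \<le> u \<bullet> b"
  have "l $ i \<le> u $ i" for i using le[of "axis i 1"] by (simp add: inner_axis)
  then have le': "unindex_vec l \<bullet> b \<le> unindex_vec u \<bullet> b" if "b \<in> Basis" for b
    using that by (auto simp: Basis_vec_def inner_axis unindex_vec_def)
  have "reindex_vec -` box l u = box (unindex_vec l) (unindex_vec u)"
  proof (intro set_eqI)
    fix x
    have "(\<forall>j. l $ j < x $ Rep_wo_copy j \<and> x $ Rep_wo_copy j < u $ j) \<longleftrightarrow> (\<forall>i. l $ Abs_wo_copy i < x $ i \<and> x $ i < u $ Abs_wo_copy i)"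
      by (metis Abs_wo_copy_inverse UNIV_I Rep_wo_copy_inverse)
    then show "x \<in> reindex_vec -` box l u \<longleftrightarrow> x \<in> box (unindex_vec l) (unindex_vec u)"
      by (simp add: mem_box_cart reindex_vec_def unindex_vec_def)
  qed
  then have "emeasure (distr lborel borel reindex_vec) (box l u) = emeasure lborel (box (unindex_vec l) (unindex_vec u))"
    by (subst emeasure_distr) auto
  also have "... = ennreal (\<Prod>b\<in>Basis. (unindex_vec u - unindex_vec l) \<bullet> b)"
    by (rule emeasure_lborel_box[OF le'])
  also have "(\<Prod>b\<in>Basis. (unindex_vec u - unindex_vec l) \<bullet> b) = (\<Prod>i\<in>UNIV. (u - l) $ Abs_wo_copy i)"
    by (simp add: Basis_vec_def prod.UNION_disjoint inner_axis axis_eq_axis unindex_vec_def)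
  also have "... = (\<Prod>j\<in>UNIV. (u - l) $ j)"
    by (rule prod.reindex_bij_witness[of _ Rep_wo_copy Abs_wo_copy])
      (simp_all add: Abs_wo_copy_inverse Rep_wo_copy_inverse)
  also have "... = (\<Prod>b\<in>Basis. (u - l) \<bullet> b)"
    by (simp add: Basis_vec_def prod.UNION_disjoint inner_axis axis_eq_axis)
  finally show "emeasure (distr lborel borel reindex_vec) (box l u) = ennreal (\<Prod>b\<in>Basis. (u - l) \<bullet> b)" .
qed simp

lemma nn_integral_reindex:
  fixes f :: "real ^ 'k \<Rightarrow> ennreal"
  assumes [measurable]: "f \<in> borel_measurable borel"
  shows "(\<integral>\<^sup>+ x. f x \<partial>lborel) = (\<integral>\<^sup>+ y. f (unindex_vec y) \<partial>lborel)"
  unfolding lborel_reindex[symmetric, where 'k = 'k] by (subst nn_integral_distr) auto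

text \<open>Sets of infinite volume occur, so the transformation formula is wanted also when both
  sides are infinite; this serves that case.\<close>

lemma nn_integral_eq_infinity:
  fixes f :: "'a::euclidean_space \<Rightarrow> real"
  assumes f: "(\<lambda>x. if x \<in> S then f x else 0) \<in> borel_measurable borel" "\<And>x. x \<in> S \<Longrightarrow> 0 \<le> f x" and "\<not> f integrable_on S"
  shows "(\<integral>\<^sup>+ x. ennreal (f x) * indicator S x \<partial>lborel) = \<infinity>"
proof (rule ccontr)
  assume "(\<integral>\<^sup>+ x. ennreal (f x) * indicator S x \<partial>lborel) \<noteq> \<infinity>"
  also have "(\<integral>\<^sup>+ x. ennreal (f x) * indicator S x \<partial>lborel) = (\<integral>\<^sup>+ x. ennreal (if x \<in> S then f x else 0) \<partial>lborel)"
    by (rule nn_integral_cong) (simp add: indicator_def)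
  finally have "(\<integral>\<^sup>+ x. ennreal (if x \<in> S then f x else 0) \<partial>lborel) < \<infinity>" by (simp add: less_top)
  then have "(\<lambda>x. if x \<in> S then f x else 0) integrable_on UNIV"
    using f by (intro nn_integral_integrable_on) auto
  then show False using assms(3) by (simp add: integrable_restrict_UNIV)
qed

text \<open>The underlying theorem concerns absolutely integrable functions with values in a
  coordinate space, so scalars are embedded along \<open>?u\<close> in \<open>real ^ 1\<close>.
  Being an equivalence, it yields equal integrals when one side is integrable, and otherwise that
  both sides are infinite.\<close>

lemma nn_change_of_variables_wo:
  fixes f :: "real ^ 'k::{finite,wellorder} \<Rightarrow> real" and \<tau> :: "real ^ 'k::_ \<Rightarrow> real ^ 'k::_"
  assumes E: "E \<in> sets borel" and der: "\<And>x. x \<in> E \<Longrightarrow> (\<tau> has_derivative \<tau>' x) (at x)" and inj: "inj_on \<tau> E"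
    and f: "\<And>x. 0 \<le> f x"
    and m1: "(\<lambda>x. if x \<in> \<tau> ` E then f x else 0) \<in> borel_measurable borel"
    and m2: "(\<lambda>x. if x \<in> E then \<bar>det (matrix (\<tau>' x))\<bar> * f (\<tau> x) else 0) \<in> borel_measurable borel"
  shows "(\<integral>\<^sup>+ y. ennreal (f y) * indicator (\<tau> ` E) y \<partial>lborel) =
    (\<integral>\<^sup>+ x. ennreal (\<bar>det (matrix (\<tau>' x))\<bar> * f (\<tau> x)) * indicator E x \<partial>lborel)"
proof -
  let ?u = "axis 1 1 :: real ^ 1" and ?j = "\<lambda>x. \<bar>det (matrix (\<tau>' x))\<bar> * f (\<tau> x)"
  have lin1: "bounded_linear (\<lambda>c :: real. c *\<^sub>R ?u)" by (rule bounded_linear_scaleR_left)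
  have lin2: "bounded_linear (\<lambda>v :: real ^ 1. v $ 1)" by (rule bounded_linear_vec_nth)
  have cov: "(\<lambda>x. \<bar>det (matrix (\<tau>' x))\<bar> *\<^sub>R (f (\<tau> x) *\<^sub>R ?u)) absolutely_integrable_on E \<and>
           integral E (\<lambda>x. \<bar>det (matrix (\<tau>' x))\<bar> *\<^sub>R (f (\<tau> x) *\<^sub>R ?u)) = b
     \<longleftrightarrow> (\<lambda>y. f y *\<^sub>R ?u) absolutely_integrable_on (\<tau> ` E) \<and> integral (\<tau> ` E) (\<lambda>y. f y *\<^sub>R ?u) = b" for b
    by (rule has_absolute_integral_change_of_variables[OF _ _ inj, of \<tau>' "\<lambda>y. f y *\<^sub>R ?u"])
      (use E der in \<open>auto intro: has_derivative_at_withinI\<close>)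
  have conv: "(\<lambda>x. h x *\<^sub>R ?u) absolutely_integrable_on S \<longleftrightarrow> h integrable_on S"
    "integral S (\<lambda>x. h x *\<^sub>R ?u) = integral S h *\<^sub>R ?u \<or> \<not> h integrable_on S"
    if h: "\<And>x. x \<in> S \<Longrightarrow> 0 \<le> h x" for h :: "real ^ 'k::_ \<Rightarrow> real" and S
  proof -
    show "(\<lambda>x. h x *\<^sub>R ?u) absolutely_integrable_on S \<longleftrightarrow> h integrable_on S"
    proof
      assume "(\<lambda>x. h x *\<^sub>R ?u) absolutely_integrable_on S"
      from absolutely_integrable_linear[OF this lin2] have "h absolutely_integrable_on S" by (simp add: o_def)
      then show "h integrable_on S" by (rule set_lebesgue_integral_eq_integral(1))
    next
      assume "h integrable_on S"
      then have "h absolutely_integrable_on S" by (rule nonnegative_absolutely_integrable_1) (rule h)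
      from absolutely_integrable_linear[OF this lin1] show "(\<lambda>x. h x *\<^sub>R ?u) absolutely_integrable_on S"
        by (simp add: o_def)
    qed
    show "integral S (\<lambda>x. h x *\<^sub>R ?u) = integral S h *\<^sub>R ?u \<or> \<not> h integrable_on S"
      using integral_linear[OF _ lin1, of h S] by (auto simp: o_def)
  qed
  have jn: "0 \<le> ?j x" for x by (simp add: f)
  have scal: "\<bar>det (matrix (\<tau>' x))\<bar> *\<^sub>R (f (\<tau> x) *\<^sub>R ?u) = ?j x *\<^sub>R ?u" for x by simp
  have iff: "?j integrable_on E \<longleftrightarrow> f integrable_on \<tau> ` E"
    using cov conv(1)[of E ?j] conv(1)[of "\<tau> ` E" f] f jn unfolding scal by blast
  show ?thesis
  proof (cases "f integrable_on \<tau> ` E")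
    case True
    have "integral E ?j = integral (\<tau> ` E) f"
    proof -
      have "integral E (\<lambda>x. ?j x *\<^sub>R ?u) = integral (\<tau> ` E) (\<lambda>y. f y *\<^sub>R ?u)"
        using cov conv(1)[of E ?j] conv(1)[of "\<tau> ` E" f] f jn True iff unfolding scal by blast
      then have "integral E ?j *\<^sub>R ?u = integral (\<tau> ` E) f *\<^sub>R ?u"
        using conv(2)[of E ?j] conv(2)[of "\<tau> ` E" f] f jn True iff by auto
      then show ?thesis by (simp add: vec_eq_iff axis_def)
    qed
    then have "(?j has_integral integral (\<tau> ` E) f) E" using iff True by (metis integrable_integral)
    then have "(\<integral>\<^sup>+ x. ennreal (?j x) * indicator E x \<partial>lborel) = ennreal (integral (\<tau> ` E) f)"
      by (rule nn_integral_has_integral_lebesgue'[OF jn])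
    moreover have "(\<integral>\<^sup>+ y. ennreal (f y) * indicator (\<tau> ` E) y \<partial>lborel) = ennreal (integral (\<tau> ` E) f)"
      by (rule nn_integral_has_integral_lebesgue'[OF f integrable_integral[OF True]])
    ultimately show ?thesis by simp
  next
    case False
    then show ?thesis
      using nn_integral_eq_infinity[OF m1 f False] nn_integral_eq_infinity[OF m2 jn] iff by simp
  qed
qed

lemma nn_change_of_variables:
  fixes f :: "real ^ 'k \<Rightarrow> real" and \<tau> :: "real ^ 'k \<Rightarrow> real ^ 'k"
  assumes E: "E \<in> sets borel" and der: "\<And>x. x \<in> E \<Longrightarrow> (\<tau> has_derivative \<tau>' x) (at x)" and inj: "inj_on \<tau> E"
    and f: "\<And>x. 0 \<le> f x"
    and m1: "(\<lambda>x. if x \<in> \<tau> ` E then f x else 0) \<in> borel_measurable borel"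
    and m2: "(\<lambda>x. if x \<in> E then \<bar>det (matrix (\<tau>' x))\<bar> * f (\<tau> x) else 0) \<in> borel_measurable borel"
  shows "(\<integral>\<^sup>+ y. ennreal (f y) * indicator (\<tau> ` E) y \<partial>lborel) =
    (\<integral>\<^sup>+ x. ennreal (\<bar>det (matrix (\<tau>' x))\<bar> * f (\<tau> x)) * indicator E x \<partial>lborel)"
proof -
  let ?R = "reindex_vec :: real ^ 'k \<Rightarrow> real ^ 'k wo_copy" and ?S = "unindex_vec :: real ^ 'k wo_copy \<Rightarrow> real ^ 'k"
  let ?E = "?S -` E" and ?f = "\<lambda>y. f (?S y)" and ?\<tau> = "\<lambda>y. ?R (\<tau> (?S y))" and ?\<tau>' = "\<lambda>y v. ?R (\<tau>' (?S y) (?S v))"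
  have E': "?E \<in> sets borel" using measurable_sets[OF borel_unindex E] by simp
  have img: "y \<in> ?\<tau> ` ?E \<longleftrightarrow> ?S y \<in> \<tau> ` E" for y
  proof
    assume "?S y \<in> \<tau> ` E"
    then obtain x where "x \<in> E" "?S y = \<tau> x" by auto
    then have "y = ?\<tau> (?R x)" "?R x \<in> ?E" by (metis reindex_unindex unindex_reindex, simp)
    then show "y \<in> ?\<tau> ` ?E" by blast
  qed auto
  have der': "(?\<tau> has_derivative ?\<tau>' y) (at y)" if "y \<in> ?E" for y
  proof -
    have "((\<lambda>y. \<tau> (?S y)) has_derivative (\<lambda>v. \<tau>' (?S y) (?S v))) (at y)"
      by (rule has_derivative_compose[OF bounded_linear_imp_has_derivative[OF bounded_linear_unindex] der]) (use that in simp)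
    then show ?thesis
      by (rule bounded_linear.has_derivative[OF bounded_linear_reindex])
  qed
  have inj': "inj_on ?\<tau> ?E"
  proof (rule inj_onI)
    fix x y assume "x \<in> ?E" "y \<in> ?E" "?\<tau> x = ?\<tau> y"
    then have "\<tau> (?S x) = \<tau> (?S y)" by (metis unindex_reindex)
    then have "?S x = ?S y" using inj \<open>x \<in> ?E\<close> \<open>y \<in> ?E\<close> by (auto dest: inj_onD)
    then show "x = y" by (metis reindex_unindex)
  qed
  have det: "det (matrix (?\<tau>' y)) = det (matrix (\<tau>' (?S y)))" for y
  proof -
    have "?S (axis j 1) = axis (Rep_wo_copy j) 1" for j
      by (simp add: unindex_vec_def axis_def vec_eq_iff) (metis Abs_wo_copy_inverse Rep_wo_copy_inverse UNIV_I)
    then have "matrix (?\<tau>' y) = (\<chi> i j. matrix (\<tau>' (?S y)) $ Rep_wo_copy i $ Rep_wo_copy j)"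
      by (simp only: matrix_def reindex_vec_def) (simp add: vec_eq_iff)
    then show ?thesis by (simp only: det_reindex[OF bij_Rep_wo_copy])
  qed
  have m1': "(\<lambda>y. if y \<in> ?\<tau> ` ?E then ?f y else 0) \<in> borel_measurable borel"
    using measurable_compose[OF borel_unindex m1] unfolding img .
  have m2': "(\<lambda>y. if y \<in> ?E then \<bar>det (matrix (?\<tau>' y))\<bar> * ?f (?\<tau> y) else 0) \<in> borel_measurable borel"
    using measurable_compose[OF borel_unindex m2] unfolding det unindex_reindex vimage_eq .
  have "(\<integral>\<^sup>+ y. ennreal (f y) * indicator (\<tau> ` E) y \<partial>lborel) = (\<integral>\<^sup>+ y. ennreal (if y \<in> \<tau> ` E then f y else 0) \<partial>lborel)"
    by (rule nn_integral_cong) (simp add: indicator_def)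
  also have "... = (\<integral>\<^sup>+ y. ennreal (if ?S y \<in> \<tau> ` E then f (?S y) else 0) \<partial>lborel)"
    by (rule nn_integral_reindex) (use m1 in measurable)
  also have "... = (\<integral>\<^sup>+ y. ennreal (?f y) * indicator (?\<tau> ` ?E) y \<partial>lborel)"
    unfolding img[symmetric] by (rule nn_integral_cong) (simp add: indicator_def)
  also have "... = (\<integral>\<^sup>+ y. ennreal (\<bar>det (matrix (?\<tau>' y))\<bar> * ?f (?\<tau> y)) * indicator ?E y \<partial>lborel)"
    by (rule nn_change_of_variables_wo[OF E' der' inj' _ m1' m2']) (simp_all add: f)
  also have "... = (\<integral>\<^sup>+ y. ennreal (if ?S y \<in> E then \<bar>det (matrix (\<tau>' (?S y)))\<bar> * f (\<tau> (?S y)) else 0) \<partial>lborel)"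
    by (rule nn_integral_cong) (simp add: indicator_def det)
  also have "... = (\<integral>\<^sup>+ x. ennreal (if x \<in> E then \<bar>det (matrix (\<tau>' x))\<bar> * f (\<tau> x) else 0) \<partial>lborel)"
    by (rule nn_integral_reindex[symmetric]) (use m2 in measurable)
  also have "... = (\<integral>\<^sup>+ x. ennreal (\<bar>det (matrix (\<tau>' x))\<bar> * f (\<tau> x)) * indicator E x \<partial>lborel)"
    by (rule nn_integral_cong) (simp add: indicator_def)
  finally show ?thesis .
qed

section \<open>The Riemannian volume measure\<close>

lemma emeasure_lborel_open_pos:
  fixes S :: "'a::euclidean_space set"
  assumes "open S" "x \<in> S"
  shows "emeasure lborel S > 0"
proof -
  obtain e where e: "e > 0" "ball x e \<subseteq> S" using assms openE by blast
  have "0 < measure lborel (ball x e)" using e(1) by (rule content_ball_pos)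
  then have "emeasure lborel (ball x e) \<noteq> 0" by (auto simp: measure_def)
  then have "0 < emeasure lborel (ball x e)" by (simp add: zero_less_iff_neq_zero)
  also have "... \<le> emeasure lborel S" using e(2) assms(1) by (intro emeasure_mono) auto
  finally show ?thesis .
qed

context riemannian
begin

lemma coord_vec_expand:
  assumes c: "(U, \<phi>) \<in> A" "p \<in> U"
  shows "coord_vec A (U, \<phi>) p a = (\<lambda>h. \<Sum>i\<in>UNIV. a $ i * coord_vec A (U, \<phi>) p (axis i 1) h)"
proof (rule tangent_eqI[OF coord_vec_tangent[OF c] tangent_sum[OF finite coord_vec_tangent[OF c]]])
  fix h assume h: "smooth_fun A h"
  note lin = has_derivative_linear[OF chart_has_derivative[OF h c]]
  have "a = (\<Sum>i\<in>UNIV. (a $ i) *\<^sub>R axis i 1)" using basis_expansion[of a] by (simp only: scalar_mult_eq_scaleR)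
  then have "coord_vec A (U, \<phi>) p a h = coord_vec A (U, \<phi>) p (\<Sum>i\<in>UNIV. (a $ i) *\<^sub>R axis i 1) h" by simp
  also have "... = (\<Sum>i\<in>UNIV. a $ i * coord_vec A (U, \<phi>) p (axis i 1) h)"
    by (simp only: linear_sum[OF lin] linear_cmul[OF lin] real_scaleR_def)
  finally show "coord_vec A (U, \<phi>) p a h = (\<Sum>i\<in>UNIV. a $ i * coord_vec A (U, \<phi>) p (axis i 1) h)" .
qed

lemma g_coord_vec:
  assumes c: "(U, \<phi>) \<in> A" "p \<in> U"
  shows "g p (coord_vec A (U, \<phi>) p a) (coord_vec A (U, \<phi>) p b)
    = (\<Sum>i\<in>UNIV. \<Sum>j\<in>UNIV. a $ i * b $ j * gram_matrix A g (U, \<phi>) p $ i $ j)"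
proof -
  note t = coord_vec_tangent[OF c]
  have "g p (coord_vec A (U, \<phi>) p a) (coord_vec A (U, \<phi>) p b)
    = (\<Sum>i\<in>UNIV. a $ i * (\<Sum>j\<in>UNIV. b $ j * g p (coord_vec A (U, \<phi>) p (axis i 1)) (coord_vec A (U, \<phi>) p (axis j 1))))"
    by (subst (1) coord_vec_expand[OF c, of a], subst (1) coord_vec_expand[OF c, of b])
      (simp only: g_sum[OF finite t tangent_sum[OF finite t]] g_sum_right[OF finite t t])
  then show ?thesis by (simp add: gram_matrix_def sum_distrib_left mult.assoc)
qed

lemma smooth_on_gram:
  assumes c: "(U, \<phi>) \<in> A"
  shows "smooth_on (\<phi> ` U) (\<lambda>x. gram_matrix A g (U, \<phi>) (inv_into U \<phi> x) $ i $ j)"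
proof (rule smooth_on_local)
  fix x assume "x \<in> \<phi> ` U"
  then obtain p where p: "p \<in> U" "x = \<phi> p" by auto
  obtain X :: "'n \<Rightarrow> 'm vfield" and V where X: "\<And>i. smooth_vfield A (X i)" "open V" "p \<in> V" "V \<subseteq> U"
    "\<forall>q\<in>V. \<forall>i. X i q = coord_vec A (U, \<phi>) q (axis i 1)"
    using chart_fields[OF c p(1)] by metis
  have o: "open (\<phi> ` (U \<inter> V))" by (rule chart_open_image[OF c X(2)])
  have s: "smooth_on (\<phi> ` (U \<inter> V)) (\<lambda>x. gg (X i) (X j) (inv_into U \<phi> x))"
    by (rule smooth_on_subset[OF smooth_funD[OF g_smooth[OF X(1) X(1)] c]]) auto
  have "smooth_on (\<phi> ` (U \<inter> V)) (\<lambda>x. gram_matrix A g (U, \<phi>) (inv_into U \<phi> x) $ i $ j)"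
  proof (rule smooth_on_cong[OF o _ s])
    fix y assume "y \<in> \<phi> ` (U \<inter> V)"
    then have "inv_into U \<phi> y \<in> V" using chart_inv[OF c] by auto
    then show "gg (X i) (X j) (inv_into U \<phi> y) = gram_matrix A g (U, \<phi>) (inv_into U \<phi> y) $ i $ j"
      using X(5) by (simp add: gram_matrix_def)
  qed
  then show "\<exists>T. open T \<and> x \<in> T \<and> smooth_on T (\<lambda>x. gram_matrix A g (U, \<phi>) (inv_into U \<phi> x) $ i $ j)"
    using o p X(3) by blast
qed

text \<open>Relative to an orthonormal basis the Gram matrix is the product of the transpose of
  \<open>M\<close> with \<open>M\<close>, and \<open>M\<close> is invertible because the coordinate
  vectors are independent.\<close>

lemma det_gram_pos:
  assumes c: "(U, \<phi>) \<in> A" "p \<in> U"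
  shows "det (gram_matrix A g (U, \<phi>) p) > 0"
proof -
  obtain e where e: "orthonormal_basis A g p e" using orthonormal_basis_exists by blast
  let ?c = "\<lambda>a. coord_vec A (U, \<phi>) p a"
  note t = coord_vec_tangent[OF c]
  define M :: "real ^ 'n ^ 'n" where "M = (\<chi> i j. g p (?c (axis j 1)) (e i))"
  have "gram_matrix A g (U, \<phi>) p = transpose M ** M"
    unfolding vec_eq_iff
  proof (intro allI)
    fix i j
    have "gram_matrix A g (U, \<phi>) p $ i $ j = (\<Sum>k\<in>UNIV. g p (?c (axis i 1)) (e k) * g p (?c (axis j 1)) (e k))"
      unfolding gram_matrix_def by (simp add: onb_parseval[OF e t t])
    then show "gram_matrix A g (U, \<phi>) p $ i $ j = (transpose M ** M) $ i $ j"
      by (simp add: matrix_matrix_mult_def transpose_def M_def)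
  qed
  then have d: "det (gram_matrix A g (U, \<phi>) p) = det M * det M" by (simp add: det_mul)
  have "det M \<noteq> 0"
  proof
    assume "det M = 0"
    then have "\<not> inj ((*v) M)" using invertible_det_nz invertible_left_inverse matrix_left_invertible_injective by metis
    then obtain a where a: "M *v a = 0" "a \<noteq> 0"
      using linear_injective_0[OF matrix_vector_mul_linear] by blast
    have "g p (?c a) (e i) = (M *v a) $ i" for i
    proof -
      have "g p (?c a) (e i) = (\<Sum>j\<in>UNIV. a $ j * g p (?c (axis j 1)) (e i))"
        by (subst coord_vec_expand[OF c, of a]) (rule g_sum[OF finite t onb_tangent[OF e]])
      then show ?thesis by (simp add: matrix_vector_mult_def M_def mult.commute)
    qed
    then have "g p (?c a) (e i) = 0" for i using a(1) by simp
    then have "?c a h = 0" for h using onb_expand[OF e t, of a h] by simp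
    then have "a = 0" by (intro coord_vec_eq_zero[OF c]) (rule ext)
    then show False using a(2) by simp
  qed
  then show ?thesis unfolding d using zero_less_mult_iff by (metis linorder_neqE_linordered_idom)
qed

text \<open>Extended by 0 outside the range of the chart, so that it is a Borel function on the
  whole space.\<close>

definition vol_density :: "'m set \<Rightarrow> ('m \<Rightarrow> real ^ 'n) \<Rightarrow> real ^ 'n \<Rightarrow> real" where
  "vol_density U \<phi> x = (if x \<in> \<phi> ` U then sqrt (det (gram_matrix A g (U, \<phi>) (inv_into U \<phi> x))) else 0)"

lemma vol_density_pos: "(U, \<phi>) \<in> A \<Longrightarrow> x \<in> \<phi> ` U \<Longrightarrow> vol_density U \<phi> x > 0"
  using det_gram_pos chart_inv by (auto simp: vol_density_def)

lemma vol_density_nonneg: "(U, \<phi>) \<in> A \<Longrightarrow> 0 \<le> vol_density U \<phi> x"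
  using vol_density_pos[of U \<phi> x] by (cases "x \<in> \<phi> ` U") (auto simp: vol_density_def)

lemma borel_vol_density:
  assumes c: "(U, \<phi>) \<in> A"
  shows "vol_density U \<phi> \<in> borel_measurable borel"
proof -
  have cont: "continuous_on (\<phi> ` U) (\<lambda>x. sqrt (det (gram_matrix A g (U, \<phi>) (inv_into U \<phi> x))))"
    unfolding det_def
    by (intro continuous_intros smooth_on_imp_continuous_on[OF smooth_on_gram[OF c]])
  have "(\<lambda>x. indicator (\<phi> ` U) x *\<^sub>R sqrt (det (gram_matrix A g (U, \<phi>) (inv_into U \<phi> x)))) \<in> borel_measurable borel"
    by (rule borel_measurable_continuous_on_indicator[OF _ cont]) (use chart_open_range[OF c] in simp)
  also have "(\<lambda>x. indicator (\<phi> ` U) x *\<^sub>R sqrt (det (gram_matrix A g (U, \<phi>) (inv_into U \<phi> x)))) = vol_density U \<phi>"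
    by (auto simp: vol_density_def)
  finally show ?thesis .
qed

text \<open>A total version of the inverse chart; one fixed value outside the open range keeps it
  Borel measurable. Where this default value is taken, \<open>vol_density\<close> is 0.\<close>

definition chart_inverse :: "'m set \<Rightarrow> ('m \<Rightarrow> real ^ 'n) \<Rightarrow> real ^ 'n \<Rightarrow> 'm" where
  "chart_inverse U \<phi> x = (if x \<in> \<phi> ` U then inv_into U \<phi> x else undefined)"

lemma borel_chart_inverse:
  assumes c: "(U, \<phi>) \<in> A"
  shows "chart_inverse U \<phi> \<in> borel_measurable borel"
proof (rule borel_measurableI)
  fix S :: "'m set" assume S: "open S"
  have "chart_inverse U \<phi> -` S = \<phi> ` (U \<inter> S) \<union> (if undefined \<in> S then - \<phi> ` U else {})"
    using chart_inv[OF c] by (auto simp: chart_inverse_def split: if_splits)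
  moreover have "\<phi> ` (U \<inter> S) \<in> sets borel" using chart_open_image[OF c S] by simp
  moreover have "- \<phi> ` U \<in> sets borel" using chart_open_range[OF c] by simp
  ultimately show "chart_inverse U \<phi> -` S \<inter> space borel \<in> sets borel" by auto
qed

lemma borel_chart_image:
  assumes c: "(U, \<phi>) \<in> A" and E: "E \<in> sets borel" "E \<subseteq> U"
  shows "\<phi> ` E \<in> sets borel"
proof -
  have "\<phi> ` E = \<phi> ` U \<inter> (chart_inverse U \<phi> -` E \<inter> space borel)"
    using E(2) chart_inv[OF c] by (auto simp: chart_inverse_def intro!: image_eqI)
  also have "... \<in> sets borel"
    using measurable_sets[OF borel_chart_inverse[OF c] E(1)] chart_open_range[OF c] by (intro sets.Int) auto
  finally show ?thesis .
qed

section \<open>Gluing the measures in charts to the volume measure\<close>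

definition chart_measure :: "'m set \<Rightarrow> ('m \<Rightarrow> real ^ 'n) \<Rightarrow> 'm measure" where
  "chart_measure U \<phi> = distr (density lborel (\<lambda>x. ennreal (vol_density U \<phi> x))) borel (chart_inverse U \<phi>)"

lemma sets_chart_measure: "sets (chart_measure U \<phi>) = sets borel"
  by (simp add: chart_measure_def)

lemma emeasure_chart_measure:
  assumes c: "(U, \<phi>) \<in> A" and E: "E \<in> sets borel" "E \<subseteq> U"
  shows "emeasure (chart_measure U \<phi>) E = (\<integral>\<^sup>+ x. ennreal (vol_density U \<phi> x) * indicator (\<phi> ` E) x \<partial>lborel)"
proof -
  note [measurable] = borel_chart_inverse[OF c] borel_vol_density[OF c] E(1)
  have "emeasure (chart_measure U \<phi>) E
    = emeasure (density lborel (\<lambda>x. ennreal (vol_density U \<phi> x))) (chart_inverse U \<phi> -` E \<inter> space lborel)"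
    unfolding chart_measure_def by (subst emeasure_distr) auto
  also have "... = (\<integral>\<^sup>+ x. ennreal (vol_density U \<phi> x) * indicator (chart_inverse U \<phi> -` E \<inter> space lborel) x \<partial>lborel)"
    by (rule emeasure_density) (use measurable_sets[OF borel_chart_inverse[OF c] E(1)] in auto)
  also have "... = (\<integral>\<^sup>+ x. ennreal (vol_density U \<phi> x) * indicator (\<phi> ` E) x \<partial>lborel)"
  proof (rule nn_integral_cong)
    fix x
    have "x \<in> \<phi> ` U \<Longrightarrow> chart_inverse U \<phi> x \<in> E \<longleftrightarrow> x \<in> \<phi> ` E"
      using E(2) chart_inv[OF c] by (auto simp: chart_inverse_def intro!: image_eqI)
    then show "ennreal (vol_density U \<phi> x) * indicator (chart_inverse U \<phi> -` E \<inter> space lborel) x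
      = ennreal (vol_density U \<phi> x) * indicator (\<phi> ` E) x"
      by (cases "x \<in> \<phi> ` U") (auto simp: vol_density_def indicator_def)
  qed
  finally show ?thesis .
qed

lemma chart_integral_eq:
  assumes c: "(U, \<phi>) \<in> A" and E: "E \<subseteq> U"
  shows "(\<integral>\<^sup>+ x\<in>\<phi> ` E. ennreal (sqrt (det (gram_matrix A g (U, \<phi>) (inv_into U \<phi> x)))) \<partial>lborel)
    = (\<integral>\<^sup>+ x. ennreal (vol_density U \<phi> x) * indicator (\<phi> ` E) x \<partial>lborel)"
  by (rule nn_integral_cong) (use E in \<open>auto simp: vol_density_def indicator_def\<close>)

text \<open>The Gram matrix transforms as a quadratic form under the Jacobian matrix of the
  transition map; the square root of its determinant therefore picks up the absolute value of the
  Jacobian determinant.\<close>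

lemma vol_density_change:
  assumes c: "(U, \<phi>) \<in> A" and d: "(V, \<psi>) \<in> A" and p: "p \<in> U" "p \<in> V"
  shows "vol_density U \<phi> (\<phi> p) =
    \<bar>det (matrix (frechet_derivative (\<psi> \<circ> inv_into U \<phi>) (at (\<phi> p))))\<bar> * vol_density V \<psi> (\<psi> p)"
proof -
  let ?L = "frechet_derivative (\<psi> \<circ> inv_into U \<phi>) (at (\<phi> p))"
  let ?T = "matrix ?L" and ?G = "gram_matrix A g (V, \<psi>) p"
  have cv: "coord_vec A (U, \<phi>) p a = coord_vec A (V, \<psi>) p (?L a)" for a
    by (rule coord_vec_change[OF d p(2) c p(1)])
  have "gram_matrix A g (U, \<phi>) p = transpose ?T ** ?G ** ?T"
    unfolding vec_eq_iff
  proof (intro allI)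
    fix i j
    have "gram_matrix A g (U, \<phi>) p $ i $ j = (\<Sum>k\<in>UNIV. \<Sum>l\<in>UNIV. ?T $ k $ i * ?T $ l $ j * ?G $ k $ l)"
      unfolding gram_matrix_def[of A g "(U, \<phi>)"] by (simp add: cv g_coord_vec[OF d p(2)] matrix_def)
    also have "... = (\<Sum>l\<in>UNIV. (\<Sum>k\<in>UNIV. ?T $ k $ i * ?G $ k $ l) * ?T $ l $ j)"
      by (subst sum.swap) (simp add: sum_distrib_left sum_distrib_right ac_simps)
    finally show "gram_matrix A g (U, \<phi>) p $ i $ j = (transpose ?T ** ?G ** ?T) $ i $ j"
      by (simp add: matrix_matrix_mult_def transpose_def)
  qed
  then have "det (gram_matrix A g (U, \<phi>) p) = (det ?T)\<^sup>2 * det ?G"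
    by (simp add: det_mul power2_eq_square)
  then show ?thesis using p chart_inv[OF c p(1)] chart_inv[OF d p(2)]
    by (simp add: vol_density_def real_sqrt_mult)
qed

text \<open>The Jacobian by which the densities differ is the one that the change of variables along
  the transition map produces.\<close>

lemma chart_measure_overlap:
  assumes c: "(U, \<phi>) \<in> A" and d: "(V, \<psi>) \<in> A" and E: "E \<in> sets borel" "E \<subseteq> U" "E \<subseteq> V"
  shows "emeasure (chart_measure U \<phi>) E = emeasure (chart_measure V \<psi>) E"
proof -
  let ?\<tau> = "\<psi> \<circ> inv_into U \<phi>"
  let ?\<tau>' = "\<lambda>x. frechet_derivative ?\<tau> (at x)"
  have img: "?\<tau> ` \<phi> ` E = \<psi> ` E" using E(2) chart_inv[OF c] by (auto simp: image_iff subset_iff)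
  have dens: "\<bar>det (matrix (?\<tau>' x))\<bar> * vol_density V \<psi> (?\<tau> x) = vol_density U \<phi> x" if "x \<in> \<phi> ` E" for x
  proof -
    obtain p where p: "p \<in> E" "x = \<phi> p" using \<open>x \<in> \<phi> ` E\<close> by auto
    then have "p \<in> U" "p \<in> V" using E by auto
    then show ?thesis using vol_density_change[OF c d, of p] chart_inv[OF c, of p] p by simp
  qed
  have "emeasure (chart_measure V \<psi>) E = (\<integral>\<^sup>+ y. ennreal (vol_density V \<psi> y) * indicator (?\<tau> ` \<phi> ` E) y \<partial>lborel)"
    unfolding img by (rule emeasure_chart_measure[OF d E(1,3)])
  also have "... = (\<integral>\<^sup>+ x. ennreal (\<bar>det (matrix (?\<tau>' x))\<bar> * vol_density V \<psi> (?\<tau> x)) * indicator (\<phi> ` E) x \<partial>lborel)"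
  proof (rule nn_change_of_variables[OF borel_chart_image[OF c E(1,2)]])
    show "(?\<tau> has_derivative ?\<tau>' x) (at x)" if "x \<in> \<phi> ` E" for x
      by (rule smooth_on_imp_has_derivative[OF chart_transition[OF c d]]) (use that E in auto)
    show "inj_on ?\<tau> (\<phi> ` E)"
    proof (rule inj_onI)
      fix x y assume "x \<in> \<phi> ` E" "y \<in> \<phi> ` E" and eq: "?\<tau> x = ?\<tau> y"
      then obtain p q where pq: "p \<in> E" "q \<in> E" "x = \<phi> p" "y = \<phi> q" by auto
      then have "\<psi> p = \<psi> q" using eq E(2) chart_inv[OF c] by (metis comp_apply subsetD)
      then have "p = q" using pq(1,2) E(3) chart_inv[OF d] by (metis subsetD)
      then show "x = y" using pq by simp
    qed
    show "(\<lambda>x. if x \<in> ?\<tau> ` \<phi> ` E then vol_density V \<psi> x else 0) \<in> borel_measurable borel"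
      unfolding img using borel_vol_density[OF d] borel_chart_image[OF d E(1,3)] by (intro measurable_If_set) auto
    have "(\<lambda>x. if x \<in> \<phi> ` E then \<bar>det (matrix (?\<tau>' x))\<bar> * vol_density V \<psi> (?\<tau> x) else 0)
      = (\<lambda>x. if x \<in> \<phi> ` E then vol_density U \<phi> x else 0)" by (rule ext) (simp add: dens del: o_apply)
    then show "(\<lambda>x. if x \<in> \<phi> ` E then \<bar>det (matrix (?\<tau>' x))\<bar> * vol_density V \<psi> (?\<tau> x) else 0) \<in> borel_measurable borel"
      using borel_vol_density[OF c] borel_chart_image[OF c E(1,2)] by (simp only:) (intro measurable_If_set, auto)
  qed (rule vol_density_nonneg[OF d])
  also have "... = (\<integral>\<^sup>+ x. ennreal (vol_density U \<phi> x) * indicator (\<phi> ` E) x \<partial>lborel)"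
    by (rule nn_integral_cong) (simp add: indicator_def dens del: o_apply)
  also have "... = emeasure (chart_measure U \<phi>) E" by (rule emeasure_chart_measure[OF c E(1,2), symmetric])
  finally show ?thesis ..
qed

lemma countable_charts:
  "\<exists>c :: nat \<Rightarrow> 'm set \<times> ('m \<Rightarrow> real ^ 'n). range c \<subseteq> A \<and> (\<Union>n. fst (c n)) = UNIV"
proof -
  have op: "\<And>S. S \<in> fst ` A \<Longrightarrow> open S" using chart_open by auto
  obtain \<F> where F: "\<F> \<subseteq> fst ` A" "countable \<F>" "\<Union>\<F> = \<Union>(fst ` A)" using Lindelof[OF op] by blast
  have cov: "\<Union>(fst ` A) = UNIV" using chart_exists by (metis UNIV_eq_I UnionI fst_conv image_eqI)
  then have "\<F> \<noteq> {}" using F(3) by auto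
  define c where "c n = (SOME a. a \<in> A \<and> fst a = from_nat_into \<F> n)" for n
  have c: "c n \<in> A \<and> fst (c n) = from_nat_into \<F> n" for n
  proof -
    have "from_nat_into \<F> n \<in> fst ` A" using from_nat_into[OF \<open>\<F> \<noteq> {}\<close>, of n] F(1) by blast
    then have "\<exists>a. a \<in> A \<and> fst a = from_nat_into \<F> n" by (metis imageE)
    then show ?thesis unfolding c_def by (rule someI_ex)
  qed
  have "(\<Union>n. fst (c n)) = \<Union>(range (from_nat_into \<F>))" using c by auto
  also have "... = UNIV" using range_from_nat_into[OF \<open>\<F> \<noteq> {}\<close> F(2)] F(3) cov by simp
  finally show ?thesis using c by blast
qed

text \<open>The domains of a countable covering family of charts are made disjoint, and the chart
  measures are summed over the pieces; agreement on overlaps yields the density formula in every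
  chart. Conversely the formula fixes the measure on each piece, hence everywhere.\<close>

lemma volume_measure_exists_unique:
  "\<exists>!\<mu>. sets \<mu> = sets borel \<and>
     (\<forall>(U, \<phi>)\<in>A. \<forall>E\<in>sets borel. E \<subseteq> U \<longrightarrow>
        emeasure \<mu> E =
          (\<integral>\<^sup>+ x\<in>\<phi> ` E. ennreal (sqrt (det (gram_matrix A g (U, \<phi>) (inv_into U \<phi> x)))) \<partial>lborel))"
proof -
  obtain c :: "nat \<Rightarrow> 'm set \<times> ('m \<Rightarrow> real ^ 'n)" where c: "range c \<subseteq> A" "(\<Union>n. fst (c n)) = UNIV"
    using countable_charts by blast
  let ?U = "\<lambda>n. fst (c n)" and ?\<phi> = "\<lambda>n. snd (c n)"
  have cA: "(?U n, ?\<phi> n) \<in> A" for n using c(1) by auto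
  define Dj where "Dj = disjointed ?U"
  have Dj: "disjoint_family Dj" "(\<Union>n. Dj n) = UNIV" "Dj n \<subseteq> ?U n" "Dj n \<in> sets borel" for n
  proof -
    show "disjoint_family Dj" "(\<Union>n. Dj n) = UNIV"
      using c(2) by (simp_all add: Dj_def disjoint_family_disjointed UN_disjointed_eq)
    show "Dj n \<subseteq> ?U n" unfolding Dj_def by (rule disjointed_subset)
    have "range ?U \<subseteq> sets borel" using chart_open[OF cA] by auto
    from sets.range_disjointed_sets[OF this] show "Dj n \<in> sets borel" unfolding Dj_def by (rule subsetD) (rule rangeI)
  qed
  define m where "m E = (\<Sum>n. emeasure (chart_measure (?U n) (?\<phi> n)) (E \<inter> Dj n))" for E
  define \<mu> where "\<mu> = measure_of UNIV (sets (borel :: 'm measure)) m"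
  have sets: "sets \<mu> = sets borel" unfolding \<mu>_def using sets.sigma_sets_eq[of "borel :: 'm measure"] by simp
  have em: "emeasure \<mu> E = m E" if "E \<in> sets borel" for E
  proof (rule emeasure_measure_of[OF \<mu>_def])
    show "positive (sets \<mu>) m" by (simp add: positive_def m_def)
    show "countably_additive (sets \<mu>) m"
      unfolding countably_additive_def
    proof (intro allI impI)
      fix E :: "nat \<Rightarrow> 'm set" assume E: "range E \<subseteq> sets \<mu>" "disjoint_family E"
      \<comment> \<open>The series over the pieces is written as an integral over
        \<open>count_space\<close>, so that it can be interchanged with the series over
        \<open>i\<close>.\<close>
      have "(\<Sum>i. m (E i)) = (\<Sum>i. \<integral>\<^sup>+ n. emeasure (chart_measure (?U n) (?\<phi> n)) (E i \<inter> Dj n) \<partial>count_space UNIV)"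
        by (simp add: m_def nn_integral_count_space_nat)
      also have "... = (\<integral>\<^sup>+ n. (\<Sum>i. emeasure (chart_measure (?U n) (?\<phi> n)) (E i \<inter> Dj n)) \<partial>count_space UNIV)"
        by (rule nn_integral_suminf[symmetric]) simp
      also have "... = (\<integral>\<^sup>+ n. emeasure (chart_measure (?U n) (?\<phi> n)) (\<Union>i. E i \<inter> Dj n) \<partial>count_space UNIV)"
      proof (rule nn_integral_cong)
        fix n
        show "(\<Sum>i. emeasure (chart_measure (?U n) (?\<phi> n)) (E i \<inter> Dj n)) = emeasure (chart_measure (?U n) (?\<phi> n)) (\<Union>i. E i \<inter> Dj n)"
          by (rule suminf_emeasure) (use E Dj(4) sets in \<open>auto simp: sets_chart_measure disjoint_family_on_def\<close>)
      qed
      also have "... = m (\<Union>i. E i)" by (simp add: m_def nn_integral_count_space_nat)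
      finally show "(\<Sum>i. m (E i)) = m (\<Union>i. E i)" .
    qed
  qed (use that sets in auto)
  have chart: "emeasure \<mu> E = (\<integral>\<^sup>+ x\<in>\<phi> ` E. ennreal (sqrt (det (gram_matrix A g (U, \<phi>) (inv_into U \<phi> x)))) \<partial>lborel)"
    if d: "(U, \<phi>) \<in> A" and E: "E \<in> sets borel" "E \<subseteq> U" for U \<phi> E
  proof -
    have "emeasure \<mu> E = (\<Sum>n. emeasure (chart_measure U \<phi>) (E \<inter> Dj n))"
      unfolding em[OF E(1)] m_def
    proof (rule suminf_cong)
      fix n
      show "emeasure (chart_measure (?U n) (?\<phi> n)) (E \<inter> Dj n) = emeasure (chart_measure U \<phi>) (E \<inter> Dj n)"
        by (rule chart_measure_overlap[OF cA d]) (use E Dj(3,4)[of n] in auto)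
    qed
    also have "... = emeasure (chart_measure U \<phi>) (\<Union>n. E \<inter> Dj n)"
      by (rule suminf_emeasure) (use E Dj in \<open>auto simp: sets_chart_measure disjoint_family_on_def\<close>)
    also have "(\<Union>n. E \<inter> Dj n) = E" using Dj(2) by auto
    finally show ?thesis unfolding emeasure_chart_measure[OF d E] chart_integral_eq[OF d E(2)] .
  qed
  show ?thesis
  proof (rule ex1I[of _ \<mu>])
    show "sets \<mu> = sets borel \<and> (\<forall>(U, \<phi>)\<in>A. \<forall>E\<in>sets borel. E \<subseteq> U \<longrightarrow>
        emeasure \<mu> E = (\<integral>\<^sup>+ x\<in>\<phi> ` E. ennreal (sqrt (det (gram_matrix A g (U, \<phi>) (inv_into U \<phi> x)))) \<partial>lborel))"
      using sets chart by blast
    fix \<mu>' assume \<mu>': "sets \<mu>' = sets borel \<and> (\<forall>(U, \<phi>)\<in>A. \<forall>E\<in>sets borel. E \<subseteq> U \<longrightarrow>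
        emeasure \<mu>' E = (\<integral>\<^sup>+ x\<in>\<phi> ` E. ennreal (sqrt (det (gram_matrix A g (U, \<phi>) (inv_into U \<phi> x)))) \<partial>lborel))"
    show "\<mu>' = \<mu>"
    proof (rule measure_eqI)
      show "sets \<mu>' = sets \<mu>" using \<mu>' sets by simp
      fix E assume "E \<in> sets \<mu>'"
      then have E: "E \<in> sets borel" using \<mu>' by simp
      have "emeasure \<mu>' (E \<inter> Dj n) = emeasure \<mu> (E \<inter> Dj n)" for n
      proof -
        have *: "\<forall>E\<in>sets borel. E \<subseteq> ?U n \<longrightarrow> emeasure \<mu>' E =
          (\<integral>\<^sup>+ x\<in>?\<phi> n ` E. ennreal (sqrt (det (gram_matrix A g (?U n, ?\<phi> n) (inv_into (?U n) (?\<phi> n) x)))) \<partial>lborel)"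
          using conjunct2[OF \<mu>'] cA[of n] by fast
        note E' = sets.Int[OF E Dj(4)[of n]] le_infI2[OF Dj(3)[of n], of E]
        show ?thesis by (simp only: *[rule_format, OF E'] chart[OF cA E'])
      qed
      moreover have "emeasure \<mu>' E = (\<Sum>n. emeasure \<mu>' (E \<inter> Dj n))" "emeasure \<mu> E = (\<Sum>n. emeasure \<mu> (E \<inter> Dj n))"
      proof -
        have "E = (\<Union>n. E \<inter> Dj n)" using Dj(2) by auto
        moreover have "(\<Sum>n. emeasure N (E \<inter> Dj n)) = emeasure N (\<Union>n. E \<inter> Dj n)" if "sets N = sets borel" for N
          by (rule suminf_emeasure) (use E Dj that in \<open>auto simp: disjoint_family_on_def\<close>)
        ultimately show "emeasure \<mu>' E = (\<Sum>n. emeasure \<mu>' (E \<inter> Dj n))" "emeasure \<mu> E = (\<Sum>n. emeasure \<mu> (E \<inter> Dj n))"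
          using \<mu>' sets by metis+
      qed
      ultimately show "emeasure \<mu>' E = emeasure \<mu> E" by simp
    qed
  qed
qed

lemma sets_volume_measure: "sets (volume_measure A g) = sets borel"
  using theI'[OF volume_measure_exists_unique] unfolding volume_measure_def by blast

lemma emeasure_volume_measure:
  "(U, \<phi>) \<in> A \<Longrightarrow> E \<in> sets borel \<Longrightarrow> E \<subseteq> U \<Longrightarrow> emeasure (volume_measure A g) E =
    (\<integral>\<^sup>+ x. ennreal (vol_density U \<phi> x) * indicator (\<phi> ` E) x \<partial>lborel)"
  using theI'[OF volume_measure_exists_unique] unfolding volume_measure_def by (simp only: chart_integral_eq[symmetric]) blast

lemma sets_weighted_measure: "sets (weighted_measure A g f) = sets borel"
  by (simp add: weighted_measure_def sets_volume_measure)

text \<open>Density and weight are positive, and nonempty open sets have positive Lebesgue measure.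
  This later turns a bound on the integral of a continuous function into pointwise
  vanishing.\<close>

lemma emeasure_weighted_open_pos:
  assumes f: "smooth_fun A f" and W: "open W" "q \<in> W"
  shows "emeasure (weighted_measure A g f) W > 0"
proof (rule ccontr)
  assume "\<not> emeasure (weighted_measure A g f) W > 0"
  then have z: "emeasure (weighted_measure A g f) W = 0" by simp
  have "(\<lambda>p. exp (- f p)) \<in> borel_measurable borel"
    by (intro borel_measurable_continuous_onI continuous_intros smooth_fun_continuous[OF f])
  then have m: "(\<lambda>p. ennreal (exp (- f p))) \<in> borel_measurable (volume_measure A g)"
    using measurable_cong_sets[OF sets_volume_measure refl] by auto
  have "W \<in> null_sets (weighted_measure A g f)"
    using z W(1) by (intro null_setsI) (simp_all add: sets_weighted_measure)
  then have "AE p in volume_measure A g. p \<in> W \<longrightarrow> ennreal (exp (- f p)) = 0"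
    unfolding weighted_measure_def null_sets_density_iff[OF m] by simp
  then have "AE p in volume_measure A g. p \<notin> W" by simp
  then have "W \<in> null_sets (volume_measure A g)"
    using W(1) AE_iff_null_sets[of W "volume_measure A g"] by (simp add: sets_volume_measure)
  then have "emeasure (volume_measure A g) W = 0" by auto
  moreover obtain U \<phi> where c: "(U, \<phi>) \<in> A" "q \<in> U" by (rule chart_exists)
  ultimately have "emeasure (volume_measure A g) (U \<inter> W) = 0"
    using emeasure_mono[of "U \<inter> W" W "volume_measure A g"] W(1) by (simp add: sets_volume_measure)
  then have "(\<integral>\<^sup>+ x. ennreal (vol_density U \<phi> x) * indicator (\<phi> ` (U \<inter> W)) x \<partial>lborel) = 0"
    using emeasure_volume_measure[OF c(1), of "U \<inter> W"] W(1) chart_open[OF c(1)] by simp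
  then have "emeasure lborel {x \<in> space lborel. ennreal (vol_density U \<phi> x) * indicator (\<phi> ` (U \<inter> W)) x \<noteq> 0} = 0"
    by (subst (asm) nn_integral_0_iff)
      (use borel_vol_density[OF c(1)] chart_open_image[OF c(1) W(1)] in auto)
  moreover have "{x \<in> space lborel. ennreal (vol_density U \<phi> x) * indicator (\<phi> ` (U \<inter> W)) x \<noteq> 0} = \<phi> ` (U \<inter> W)"
  proof -
    have "\<not> vol_density U \<phi> (\<phi> p) \<le> 0" if "p \<in> U" for p using vol_density_pos[OF c(1), of "\<phi> p"] that by auto
    then show ?thesis by (auto simp: indicator_def ennreal_eq_0_iff split: if_splits)
  qed
  ultimately have "emeasure lborel (\<phi> ` (U \<inter> W)) = 0" by simp
  moreover have "emeasure lborel (\<phi> ` (U \<inter> W)) > 0"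
    by (rule emeasure_lborel_open_pos[OF chart_open_image[OF c(1) W(1)], of "\<phi> q"]) (use c W in auto)
  ultimately show False by simp
qed

end

section \<open>Length of curves\<close>

text \<open>The functions are compared on the closed interval, whereas the derivatives are
  two-sided; the endpoints are therefore added to the exceptional set.\<close>

lemma piecewise_C1_differentiable_cong:
  fixes f k :: "real \<Rightarrow> 'a::real_normed_vector"
  assumes f: "f piecewise_C1_differentiable_on {a..b}" and eq: "\<And>t. t \<in> {a..b} \<Longrightarrow> f t = k t"
  shows "k piecewise_C1_differentiable_on {a..b}"
proof -
  obtain S where S: "finite S" "f C1_differentiable_on ({a..b} - S)" "continuous_on {a..b} f"
    using f unfolding piecewise_C1_differentiable_on_def by blast
  then obtain D where D: "\<And>x. x \<in> {a..b} - S \<Longrightarrow> (f has_vector_derivative D x) (at x)" "continuous_on ({a..b} - S) D"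
    unfolding C1_differentiable_on_def by blast
  have "(k has_vector_derivative D x) (at x)" if "x \<in> {a..b} - (S \<union> {a, b})" for x
    by (rule has_vector_derivative_transform_within_open[OF D(1), of _ "{a<..<b}"]) (use that eq in auto)
  moreover have "continuous_on ({a..b} - (S \<union> {a, b})) D" by (rule continuous_on_subset[OF D(2)]) auto
  ultimately have "k C1_differentiable_on ({a..b} - (S \<union> {a, b}))" unfolding C1_differentiable_on_def by blast
  moreover have "continuous_on {a..b} k" by (rule continuous_on_eq[OF S(3) eq])
  moreover have "finite (S \<union> {a, b})" using S(1) by simp
  ultimately show ?thesis unfolding piecewise_C1_differentiable_on_def by blast
qed

lemma AE_lborel_not_in_finite: "finite S \<Longrightarrow> AE t::real in lborel. t \<notin> S"
  by (intro AE_not_in finite_imp_null_set_lborel)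

context riemannian
begin

text \<open>\<open>velocity\<close> is built from the total operator \<open>deriv\<close> and may be
  meaningless at corners of a curve; regular times are those at which it is the true
  velocity.\<close>

definition regular :: "(real \<Rightarrow> 'm) \<Rightarrow> real \<Rightarrow> bool" where
  "regular \<gamma> t \<longleftrightarrow> velocity A \<gamma> t \<in> tangent_space A (\<gamma> t) \<and>
    (\<forall>h. smooth_fun A h \<longrightarrow> ((\<lambda>s. h (\<gamma> s)) has_real_derivative velocity A \<gamma> t h) (at t))"

abbreviation sq_speed :: "(real \<Rightarrow> 'm) \<Rightarrow> real \<Rightarrow> real" where
  "sq_speed \<gamma> t \<equiv> g (\<gamma> t) (velocity A \<gamma> t) (velocity A \<gamma> t)"

lemma velocity_eqI:
  "(\<And>h. smooth_fun A h \<Longrightarrow> ((\<lambda>s. h (\<gamma> s)) has_real_derivative v h) (at t)) \<Longrightarrow>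
    (\<And>h. \<not> smooth_fun A h \<Longrightarrow> v h = 0) \<Longrightarrow> velocity A \<gamma> t = v"
  unfolding velocity_def by (rule ext) (simp add: DERIV_imp_deriv comp_def)

lemma regularI:
  assumes "\<And>h. smooth_fun A h \<Longrightarrow> ((\<lambda>s. h (\<gamma> s)) has_real_derivative v h) (at t)" "v \<in> tangent_space A (\<gamma> t)"
  shows "regular \<gamma> t" "velocity A \<gamma> t = v"
proof -
  show v: "velocity A \<gamma> t = v" by (rule velocity_eqI[OF assms(1) tangent_nonsmooth[OF assms(2)]])
  show "regular \<gamma> t" using assms unfolding regular_def v by blast
qed

text \<open>In coordinates the squared speed is a quadratic expression in the derivative, continuous
  off a finite set, with the entries of the Gram matrix as coefficients.\<close>

lemma regular_in_chart:
  assumes c: "(U, \<phi>) \<in> A" and U: "\<gamma> ` {a..b} \<subseteq> U" and C1: "(\<phi> \<circ> \<gamma>) piecewise_C1_differentiable_on {a..b}"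
  shows "\<exists>S. finite S \<and> (\<forall>t\<in>{a<..<b} - S. regular \<gamma> t) \<and> continuous_on ({a<..<b} - S) (sq_speed \<gamma>)"
proof -
  obtain S where S: "finite S" "(\<phi> \<circ> \<gamma>) C1_differentiable_on ({a..b} - S)" "continuous_on {a..b} (\<phi> \<circ> \<gamma>)"
    using C1 unfolding piecewise_C1_differentiable_on_def by blast
  then obtain D where D: "\<And>x. x \<in> {a..b} - S \<Longrightarrow> (\<phi> \<circ> \<gamma> has_vector_derivative D x) (at x)" "continuous_on ({a..b} - S) D"
    unfolding C1_differentiable_on_def by blast
  let ?O = "{a<..<b} - S"
  have O: "open ?O" "?O \<subseteq> {a..b} - S" using S(1) by (auto intro: open_Diff finite_imp_closed)
  have inU: "t \<in> ?O \<Longrightarrow> \<gamma> t \<in> U" for t using U by auto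
  have reg: "regular \<gamma> t" "velocity A \<gamma> t = coord_vec A (U, \<phi>) (\<gamma> t) (D t)" if t: "t \<in> ?O" for t
  proof -
    have d: "((\<lambda>s. h (\<gamma> s)) has_real_derivative coord_vec A (U, \<phi>) (\<gamma> t) (D t) h) (at t)" if h: "smooth_fun A h" for h
    proof -
      have 1: "((\<lambda>s. (\<phi> \<circ> \<gamma>) s) has_derivative (\<lambda>s. s *\<^sub>R D t)) (at t)"
        using D(1)[of t] t O(2) unfolding has_vector_derivative_def o_def by auto
      have 2: "((\<lambda>x. h (inv_into U \<phi> x)) has_derivative (\<lambda>a. coord_vec A (U, \<phi>) (\<gamma> t) a h)) (at ((\<phi> \<circ> \<gamma>) t))"
        using chart_has_derivative[OF h c inU[OF t]] by simp
      have lin: "coord_vec A (U, \<phi>) (\<gamma> t) (s *\<^sub>R D t) h = s * coord_vec A (U, \<phi>) (\<gamma> t) (D t) h" for s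
        using coord_vec_lin[OF c inU[OF t], of s "D t" 0 0 h] by simp
      have 3: "((\<lambda>s. h (inv_into U \<phi> (\<phi> (\<gamma> s)))) has_derivative (\<lambda>s. s * coord_vec A (U, \<phi>) (\<gamma> t) (D t) h)) (at t)"
        using has_derivative_compose[OF 1 2] by (simp add: lin)
      have "((\<lambda>s. h (\<gamma> s)) has_derivative (\<lambda>s. s * coord_vec A (U, \<phi>) (\<gamma> t) (D t) h)) (at t)"
        by (rule has_derivative_transform_within_open[OF 3 O(1) t]) (use chart_inv[OF c inU] in auto)
      then show ?thesis by (simp add: has_field_derivative_def mult.commute[of _ "coord_vec A (U, \<phi>) (\<gamma> t) (D t) h"] mult_commute_abs)
    qed
    show "regular \<gamma> t" "velocity A \<gamma> t = coord_vec A (U, \<phi>) (\<gamma> t) (D t)"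
      using regularI[OF d coord_vec_tangent[OF c inU[OF t]]] by auto
  qed
  have "continuous_on ?O (\<lambda>t. \<Sum>i\<in>UNIV. \<Sum>j\<in>UNIV. D t $ i * D t $ j * gram_matrix A g (U, \<phi>) (inv_into U \<phi> ((\<phi> \<circ> \<gamma>) t)) $ i $ j)"
  proof (intro continuous_on_sum continuous_on_mult)
    show "continuous_on ?O (\<lambda>t. D t $ i)" for i by (intro continuous_intros continuous_on_subset[OF D(2) O(2)])
    then show "continuous_on ?O (\<lambda>t. D t $ i)" for i .
    show "continuous_on ?O (\<lambda>t. gram_matrix A g (U, \<phi>) (inv_into U \<phi> ((\<phi> \<circ> \<gamma>) t)) $ i $ j)" for i j
      by (rule continuous_on_compose2[OF smooth_on_imp_continuous_on[OF smooth_on_gram[OF c]] continuous_on_subset[OF S(3)]])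
        (use inU O(2) in auto)
  qed
  then have "continuous_on ?O (sq_speed \<gamma>)"
    by (rule continuous_on_eq) (simp add: reg(2) g_coord_vec[OF c inU] chart_inv[OF c inU])
  then show ?thesis using S(1) reg(1) by blast
qed

text \<open>The curve stays in one chart only for a short time. The property passes from adjacent
  intervals to their union, the common endpoint becoming exceptional, and it holds on short
  intervals around every time; bisection then gives it on the unit interval. Continuity is recorded
  for the measurability of the speed.\<close>

lemma pw_C1_regular:
  assumes \<gamma>: "pw_C1_curve A \<gamma>"
  shows "\<exists>S. finite S \<and> (\<forall>t\<in>{0<..<1} - S. regular \<gamma> t) \<and> continuous_on ({0<..<1} - S) (sq_speed \<gamma>)"
proof -
  let ?Q = "\<lambda>a b. \<exists>S. finite S \<and> (\<forall>t\<in>{a<..<b} - S. regular \<gamma> t) \<and> continuous_on ({a<..<b} - S) (sq_speed \<gamma>)"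
  have cont: "continuous_on {0..1} \<gamma>" using \<gamma> by (simp add: pw_C1_curve_def)
  define P where "P a b \<longleftrightarrow> ({a..b} \<subseteq> {0..1} \<longrightarrow> ?Q a b)" for a b
  have trans: "P a c" if P: "P a b" "P b c" "a \<le> b" "b \<le> c" for a b c
    unfolding P_def
  proof
    assume "{a..c} \<subseteq> {0..1}"
    then have "{a..b} \<subseteq> {0..1}" "{b..c} \<subseteq> {0..1}" using P(3,4) by auto
    then have Q: "?Q a b" "?Q b c" using P(1,2) unfolding P_def by (simp_all only: simp_thms)
    from Q(1) obtain S where S: "finite S" "\<forall>t\<in>{a<..<b} - S. regular \<gamma> t" "continuous_on ({a<..<b} - S) (sq_speed \<gamma>)"
      by (elim exE conjE)
    from Q(2) obtain T where T: "finite T" "\<forall>t\<in>{b<..<c} - T. regular \<gamma> t" "continuous_on ({b<..<c} - T) (sq_speed \<gamma>)"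
      by (elim exE conjE)
    let ?R = "S \<union> T \<union> {b}"
    have "continuous_on (({a<..<b} - S) \<union> ({b<..<c} - T)) (sq_speed \<gamma>)"
      by (rule continuous_on_open_Un[OF _ _ S(3) T(3)]) (use S(1) T(1) in \<open>auto intro: open_Diff finite_imp_closed\<close>)
    moreover have "{a<..<c} - ?R \<subseteq> ({a<..<b} - S) \<union> ({b<..<c} - T)" by auto
    ultimately have "continuous_on ({a<..<c} - ?R) (sq_speed \<gamma>)" by (rule continuous_on_subset)
    moreover have "\<forall>t\<in>{a<..<c} - ?R. regular \<gamma> t"
    proof
      fix t assume "t \<in> {a<..<c} - ?R"
      then show "regular \<gamma> t" using S(2) T(2) by (cases "t < b") auto
    qed
    moreover have "finite ?R" using S(1) T(1) by simp
    ultimately show "?Q a c" by (intro exI[of _ ?R] conjI)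
  qed
  have loc: "\<exists>d>0. \<forall>a b. a \<le> x \<and> x \<le> b \<and> b - a < d \<longrightarrow> P a b" if x: "0 \<le> x" "x \<le> 1" for x
  proof -
    obtain U \<phi> where c: "(U, \<phi>) \<in> A" "\<gamma> x \<in> U" by (rule chart_exists)
    have "openin (top_of_set {0..1}) ({0..1} \<inter> \<gamma> -` U)"
      by (rule continuous_openin_preimage_gen[OF cont chart_open[OF c(1)]])
    moreover have "x \<in> {0..1} \<inter> \<gamma> -` U" using x c(2) by simp
    ultimately have "\<exists>e>0. \<forall>y\<in>{0..1}. dist y x < e \<longrightarrow> y \<in> {0..1} \<inter> \<gamma> -` U"
      unfolding openin_euclidean_subtopology_iff by (elim conjE bspec)
    then obtain e where e: "e > 0" "\<And>y. y \<in> {0..1} \<Longrightarrow> dist y x < e \<Longrightarrow> \<gamma> y \<in> U" by auto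
    have "P a b" if ab: "a \<le> x \<and> x \<le> b \<and> b - a < e" for a b
      unfolding P_def
    proof
      assume I: "{a..b} \<subseteq> {0..1}"
      then have U: "\<gamma> ` {a..b} \<subseteq> U" using ab by (auto simp: dist_real_def intro!: e(2))
      have "a \<le> b" using ab by simp
      then have "(\<phi> \<circ> \<gamma>) piecewise_C1_differentiable_on {a..b}"
        using conjunct2[OF \<gamma>[unfolded pw_C1_curve_def]] c(1) I U by fast
      then show "?Q a b" by (rule regular_in_chart[OF c(1) U])
    qed
    then show ?thesis using e(1) by blast
  qed
  have "P 0 1" by (rule Bolzano[of 0 1 P, OF _ trans loc]) auto
  then show ?thesis by (simp add: P_def)
qed

text \<open>Set to 0 at times where the velocity carries no information. For a piecewise
  differentiable curve this is a Borel function whose integral is the length.\<close>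

definition speed :: "(real \<Rightarrow> 'm) \<Rightarrow> real \<Rightarrow> real" where
  "speed \<gamma> t = (if t \<in> {0<..<1} \<and> regular \<gamma> t then sqrt (sq_speed \<gamma> t) else 0)"

lemma speed_nonneg: "0 \<le> speed \<gamma> t"
  by (simp add: speed_def regular_def g_nonneg)

lemma borel_speed:
  assumes \<gamma>: "pw_C1_curve A \<gamma>"
  shows "speed \<gamma> \<in> borel_measurable borel"
proof -
  obtain S where S: "finite S" "\<forall>t\<in>{0<..<1} - S. regular \<gamma> t" "continuous_on ({0<..<1} - S) (sq_speed \<gamma>)"
    using pw_C1_regular[OF \<gamma>] by blast
  have "(\<lambda>t. indicator ({0<..<1} - S) t *\<^sub>R sqrt (sq_speed \<gamma> t)) \<in> borel_measurable borel"
    by (rule borel_measurable_continuous_on_indicator[OF borel_open[OF open_Diff[OF open_greaterThanLessThan finite_imp_closed[OF S(1)]]]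
          continuous_on_real_sqrt[OF S(3)]])
  then show ?thesis
    by (rule measurable_discrete_difference[where X = S]) (use S in \<open>auto simp: speed_def countable_finite\<close>)
qed

lemma curve_length_speed:
  assumes \<gamma>: "pw_C1_curve A \<gamma>"
  shows "curve_length A g \<gamma> = (\<integral>\<^sup>+ t. ennreal (speed \<gamma> t) \<partial>lborel)"
proof -
  obtain S where S: "finite S" "\<forall>t\<in>{0<..<1} - S. regular \<gamma> t"
    using pw_C1_regular[OF \<gamma>] by blast
  have "AE t in lborel. t \<notin> S \<union> {0, 1}" using S(1) by (intro AE_lborel_not_in_finite) simp
  then show ?thesis unfolding curve_length_def
    by (intro nn_integral_cong_AE, elim AE_mp, intro AE_I2) (use S(2) in \<open>auto simp: speed_def indicator_def\<close>)
qed

lemma regular_affine: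
  assumes "regular \<gamma> (m * t + c)"
  shows "regular (\<lambda>t. \<gamma> (m * t + c)) t"
    and "velocity A (\<lambda>t. \<gamma> (m * t + c)) t = (\<lambda>h. m * velocity A \<gamma> (m * t + c) h)"
proof -
  have d: "((\<lambda>s. h (\<gamma> (m * s + c))) has_real_derivative m * velocity A \<gamma> (m * t + c) h) (at t)" if h: "smooth_fun A h" for h
  proof -
    have 1: "((\<lambda>s. h (\<gamma> s)) has_real_derivative velocity A \<gamma> (m * t + c) h) (at (m * t + c))"
      using assms h by (simp add: regular_def)
    have 2: "((\<lambda>s. m * s + c) has_real_derivative m) (at t)" by (auto intro!: derivative_eq_intros)
    show ?thesis using DERIV_chain2[OF 1 2] by (simp add: mult.commute)
  qed
  have "velocity A \<gamma> (m * t + c) \<in> tangent_space A (\<gamma> (m * t + c))" using assms by (simp add: regular_def)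
  then have "(\<lambda>h. m * velocity A \<gamma> (m * t + c) h) \<in> tangent_space A (\<gamma> (m * t + c))" by (rule tangent_scale)
  then show "regular (\<lambda>t. \<gamma> (m * t + c)) t"
    and "velocity A (\<lambda>t. \<gamma> (m * t + c)) t = (\<lambda>h. m * velocity A \<gamma> (m * t + c) h)"
    using regularI[where \<gamma> = "\<lambda>t. \<gamma> (m * t + c)", OF d] by blast+
qed

lemma pw_C1_affine:
  assumes \<gamma>: "pw_C1_curve A \<gamma>" and mc: "m \<noteq> 0" "0 \<le> c" "c \<le> 1" "0 \<le> m + c" "m + c \<le> 1"
  shows "pw_C1_curve A (\<lambda>t. \<gamma> (m * t + c))"
  unfolding pw_C1_curve_def
proof (intro conjI ballI allI impI, safe)
  have 0: "m * t + c \<in> {0..1}" if "t \<in> {0..1}" for t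
  proof -
    have "m * t + c = (1 - t) * c + t * (m + c)" by (simp add: algebra_simps)
    moreover have "0 \<le> (1 - t) * c + t * (m + c)" using that mc by simp
    moreover have "(1 - t) * c + t * (m + c) \<le> (1 - t) * 1 + t * 1"
      using that mc by (intro add_mono mult_left_mono) auto
    ultimately show ?thesis by simp
  qed
  have "continuous_on {0..1} \<gamma>" using \<gamma> by (simp add: pw_C1_curve_def)
  then show "continuous_on {0..1} (\<lambda>t. \<gamma> (m * t + c))"
    by (rule continuous_on_compose2) (use 0 in \<open>auto intro!: continuous_intros\<close>)
  fix U \<phi> and a b :: real assume cA: "(U, \<phi>) \<in> A" and ab: "a \<le> b" "{a..b} \<subseteq> {0..1}" and U: "(\<lambda>t. \<gamma> (m * t + c)) ` {a..b} \<subseteq> U"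
  have "\<exists>a' b'. a' \<le> b' \<and> (\<lambda>t. m * t + c) ` {a..b} = {a'..b'}"
  proof (cases "0 \<le> m")
    case True
    then have "m * a + c \<le> m * b + c" using ab(1) by (simp add: mult_left_mono)
    then show ?thesis using True ab(1) by (subst image_affinity_atLeastAtMost) auto
  next
    case False
    then have "m * b + c \<le> m * a + c" using ab(1) by simp
    then show ?thesis using False ab(1) by (subst image_affinity_atLeastAtMost) auto
  qed
  then obtain a' b' where i: "a' \<le> b'" "(\<lambda>t. m * t + c) ` {a..b} = {a'..b'}" by blast
  have "{a'..b'} \<subseteq> {0..1}" unfolding i(2)[symmetric] using 0 ab(2) by blast
  moreover have "\<gamma> ` {a'..b'} \<subseteq> U" unfolding i(2)[symmetric] using U by auto
  ultimately have "(\<phi> \<circ> \<gamma>) piecewise_C1_differentiable_on ((\<lambda>t. m * t + c) ` {a..b})"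
    using \<gamma> cA i by (auto simp: pw_C1_curve_def)
  from piecewise_C1_differentiable_affine[OF this]
  show "(\<phi> \<circ> (\<lambda>t. \<gamma> (m * t + c))) piecewise_C1_differentiable_on {a..b}" by (simp add: o_def)
qed

text \<open>Restriction to a subinterval and reversal are both instances; in the latter the slope is
  negative, whence the minimum and the maximum.\<close>

lemma curve_length_affine:
  assumes \<gamma>: "pw_C1_curve A \<gamma>" and mc: "m \<noteq> 0" "0 \<le> c" "c \<le> 1" "0 \<le> m + c" "m + c \<le> 1"
  shows "curve_length A g (\<lambda>t. \<gamma> (m * t + c)) =
    (\<integral>\<^sup>+ t. ennreal (speed \<gamma> t) * indicator {min c (m + c)..max c (m + c)} t \<partial>lborel)"
proof -
  let ?I = "{min c (m + c)..max c (m + c)}"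
  obtain S where S: "finite S" "\<forall>t\<in>{0<..<1} - S. regular \<gamma> t"
    using pw_C1_regular[OF \<gamma>] by blast
  let ?F = "(\<lambda>s. (s - c) / m) ` S \<union> {0, 1}"
  have ae: "AE t in lborel. t \<notin> ?F" using S(1) by (intro AE_lborel_not_in_finite) simp
  have eq: "ennreal (speed (\<lambda>t. \<gamma> (m * t + c)) t) = ennreal \<bar>m\<bar> * (ennreal (speed \<gamma> (c + m * t)) * indicator ?I (c + m * t))"
    if t: "t \<notin> ?F" for t
  proof (cases "t \<in> {0<..<1}")
    case True
    have bnd: "c + m * t \<in> {0<..<1}" "c + m * t \<in> ?I"
    proof -
      show "c + m * t \<in> ?I"
      proof (cases "0 < m")
        case True
        then have "0 \<le> m * t" "m * t \<le> m * 1" using \<open>t \<in> {0<..<1}\<close> by (auto intro!: mult_left_mono simp del: mult_1_right)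
        then show ?thesis by auto
      next
        case False
        then have "m * 1 \<le> m * t" "m * t \<le> 0" using \<open>t \<in> {0<..<1}\<close> by (auto intro!: mult_left_mono_neg mult_nonpos_nonneg simp del: mult_1_right)
        then show ?thesis by auto
      qed
      show "c + m * t \<in> {0<..<1}"
      proof (cases "0 < m")
        case True
        then have "0 < m * t" "m * t < m * 1" using \<open>t \<in> {0<..<1}\<close> by (auto intro!: mult_strict_left_mono simp del: mult_1_right)
        then show ?thesis using mc by auto
      next
        case False
        then have "m < 0" using mc by simp
        then have "m * 1 < m * t" "m * t < 0" using \<open>t \<in> {0<..<1}\<close> by (auto intro!: mult_strict_left_mono_neg mult_neg_pos simp del: mult_1_right)
        then show ?thesis using mc by auto
      qed
    qed
    have "c + m * t \<notin> S"
    proof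
      assume "c + m * t \<in> S"
      then have "(c + m * t - c) / m \<in> ?F" by blast
      then show False using t mc(1) by simp
    qed
    then have reg: "regular \<gamma> (m * t + c)" using S(2) bnd by (simp add: add.commute)
    then have T: "velocity A \<gamma> (m * t + c) \<in> tangent_space A (\<gamma> (m * t + c))" by (simp add: regular_def)
    have "sq_speed (\<lambda>t. \<gamma> (m * t + c)) t = m\<^sup>2 * sq_speed \<gamma> (m * t + c)"
      unfolding regular_affine(2)[OF reg]
      by (simp add: g_scale[OF T tangent_scale[OF T]] g_scale_right[OF T T] power2_eq_square)
    then have "speed (\<lambda>t. \<gamma> (m * t + c)) t = \<bar>m\<bar> * speed \<gamma> (c + m * t)"
      using True bnd(1) reg regular_affine(1)[OF reg] by (simp add: speed_def real_sqrt_mult add.commute)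
    then show ?thesis using bnd(2) speed_nonneg by (simp add: ennreal_mult)
  next
    case False
    then have "t < 0 \<or> 1 < t" using t by auto
    moreover have "m * t < 0 \<or> m * 1 < m * t" if "m > 0" using \<open>t < 0 \<or> 1 < t\<close> that by (auto intro!: mult_pos_neg)
    moreover have "0 < m * t \<or> m * t < m * 1" if "m < 0" using \<open>t < 0 \<or> 1 < t\<close> that by (auto intro!: mult_neg_neg)
    ultimately have "c + m * t \<notin> ?I" using mc(1) by (cases "m > 0") auto
    moreover have "speed (\<lambda>t. \<gamma> (m * t + c)) t = 0" using False unfolding speed_def by presburger
    ultimately show ?thesis by simp
  qed
  note [measurable] = borel_speed[OF \<gamma>]
  have "curve_length A g (\<lambda>t. \<gamma> (m * t + c)) = (\<integral>\<^sup>+ t. ennreal (speed (\<lambda>t. \<gamma> (m * t + c)) t) \<partial>lborel)"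
    by (rule curve_length_speed[OF pw_C1_affine[OF \<gamma> mc]])
  also have "... = (\<integral>\<^sup>+ t. ennreal \<bar>m\<bar> * (ennreal (speed \<gamma> (c + m * t)) * indicator ?I (c + m * t)) \<partial>lborel)"
    by (intro nn_integral_cong_AE, use ae in eventually_elim) (rule eq)
  also have "... = ennreal \<bar>m\<bar> * (\<integral>\<^sup>+ t. ennreal (speed \<gamma> (c + m * t)) * indicator ?I (c + m * t) \<partial>lborel)"
    by (rule nn_integral_cmult) measurable
  also have "... = (\<integral>\<^sup>+ t. ennreal (speed \<gamma> t) * indicator ?I t \<partial>lborel)"
    by (rule nn_integral_real_affine[symmetric, where f = "\<lambda>t. ennreal (speed \<gamma> t) * indicator ?I t"]) (use mc(1) in measurable)
  finally show ?thesis .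
qed

lemma curve_length_cong:
  assumes "\<And>t. t \<in> {0..1} \<Longrightarrow> \<gamma> t = \<delta> t"
  shows "curve_length A g \<gamma> = curve_length A g \<delta>"
proof -
  have v: "velocity A \<gamma> t = velocity A \<delta> t" if t: "t \<in> {0<..<1}" for t
  proof -
    have "deriv (h \<circ> \<gamma>) t = deriv (h \<circ> \<delta>) t" for h :: "'m \<Rightarrow> real"
      by (rule deriv_cong_ev[OF _ refl])
        (use eventually_nhds_in_open[OF open_greaterThanLessThan t] in \<open>eventually_elim, auto simp: assms\<close>)
    then show ?thesis by (simp add: velocity_def cong: if_cong)
  qed
  have "AE t in lborel. t \<notin> {0, 1::real}" by (rule AE_lborel_not_in_finite) simp
  then show ?thesis unfolding curve_length_def
    by (intro nn_integral_cong_AE, elim AE_mp, intro AE_I2) (use v assms in \<open>auto simp: indicator_def\<close>)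
qed

lemma curve_length_split:
  assumes \<gamma>: "pw_C1_curve A \<gamma>" and t: "0 < t" "t < 1"
  shows "curve_length A g \<gamma> = curve_length A g (\<lambda>s. \<gamma> (t * s + 0)) + curve_length A g (\<lambda>s. \<gamma> ((1 - t) * s + t))"
proof -
  note [measurable] = borel_speed[OF \<gamma>]
  have ae: "AE s in lborel. s \<notin> {t}" by (rule AE_lborel_not_in_finite) simp
  have "curve_length A g \<gamma> = (\<integral>\<^sup>+ s. ennreal (speed \<gamma> s) * indicator {0..t} s + ennreal (speed \<gamma> s) * indicator {t..1} s \<partial>lborel)"
    unfolding curve_length_speed[OF \<gamma>]
    by (intro nn_integral_cong_AE, use ae in eventually_elim) (use t in \<open>auto simp: indicator_def speed_def\<close>)
  also have "... = (\<integral>\<^sup>+ s. ennreal (speed \<gamma> s) * indicator {0..t} s \<partial>lborel) + (\<integral>\<^sup>+ s. ennreal (speed \<gamma> s) * indicator {t..1} s \<partial>lborel)"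
    by (rule nn_integral_add) measurable
  finally show ?thesis
    using curve_length_affine[OF \<gamma>, of t 0] curve_length_affine[OF \<gamma>, of "1 - t" t] t by (simp add: min_def max_def)
qed

lemma curve_length_reverse:
  assumes \<gamma>: "pw_C1_curve A \<gamma>"
  shows "pw_C1_curve A (\<lambda>s. \<gamma> (- 1 * s + 1))" "curve_length A g (\<lambda>s. \<gamma> (- 1 * s + 1)) = curve_length A g \<gamma>"
proof -
  show "pw_C1_curve A (\<lambda>s. \<gamma> (- 1 * s + 1))" by (rule pw_C1_affine[OF \<gamma>]) auto
  have "curve_length A g (\<lambda>s. \<gamma> (- 1 * s + 1)) = (\<integral>\<^sup>+ s. ennreal (speed \<gamma> s) * indicator {0..1} s \<partial>lborel)"
    using curve_length_affine[OF \<gamma>, of "- 1" 1] by (simp del: mult_minus1)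
  also have "... = curve_length A g \<gamma>" unfolding curve_length_speed[OF \<gamma>]
    by (rule nn_integral_cong) (auto simp: indicator_def speed_def)
  finally show "curve_length A g (\<lambda>s. \<gamma> (- 1 * s + 1)) = curve_length A g \<gamma>" .
qed

text \<open>At the junction a corner may appear, which piecewise differentiability admits. The
  length formula follows by splitting the joined curve at 1/2 and recognising the two
  halves.\<close>

lemma pw_C1_join:
  assumes \<gamma>: "pw_C1_curve A \<gamma>" and \<delta>: "pw_C1_curve A \<delta>" and eq: "\<gamma> 1 = \<delta> 0"
  shows "pw_C1_curve A (\<gamma> +++ \<delta>)"
    and "curve_length A g (\<gamma> +++ \<delta>) = curve_length A g \<gamma> + curve_length A g \<delta>"
proof -
  have cont: "continuous_on {0..1} \<gamma>" "continuous_on {0..1} \<delta>" using \<gamma> \<delta> by (simp_all add: pw_C1_curve_def)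
  show j: "pw_C1_curve A (\<gamma> +++ \<delta>)"
    unfolding pw_C1_curve_def
  proof (intro conjI ballI allI impI, safe)
    show "continuous_on {0..1} (\<gamma> +++ \<delta>)"
      using path_join_imp[of \<gamma> \<delta>] cont eq by (simp add: path_def pathfinish_def pathstart_def)
    fix U \<phi> and a b :: real assume cA: "(U, \<phi>) \<in> A" and ab: "a \<le> b" "{a..b} \<subseteq> {0..1}" and U: "(\<gamma> +++ \<delta>) ` {a..b} \<subseteq> U"
    have left: "(\<lambda>t. \<phi> (\<gamma> (2 * t))) piecewise_C1_differentiable_on {a..b'}"
      if b': "a \<le> b'" "b' \<le> b" "b' \<le> 1 / 2" for b'
    proof -
      have i: "(\<lambda>t. 2 * t + 0) ` {a..b'} = {2 * a..2 * b'}" using b' by (subst image_affinity_atLeastAtMost) auto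
      have "\<gamma> ` {2 * a..2 * b'} \<subseteq> U"
      proof (rule image_subsetI)
        fix t assume "t \<in> {2 * a..2 * b'}"
        then have "t / 2 \<in> {a..b}" "t / 2 \<le> 1 / 2" using b' by auto
        then have "(\<gamma> +++ \<delta>) (t / 2) \<in> U" using U by blast
        moreover have "(\<gamma> +++ \<delta>) (t / 2) = \<gamma> t" using \<open>t / 2 \<le> 1 / 2\<close> by (simp add: joinpaths_def)
        ultimately show "\<gamma> t \<in> U" by simp
      qed
      moreover have "{2 * a..2 * b'} \<subseteq> {0..1}" using ab b' by auto
      ultimately have "(\<phi> \<circ> \<gamma>) piecewise_C1_differentiable_on ((\<lambda>t. 2 * t + 0) ` {a..b'})"
        using \<gamma> cA b'(1) unfolding i by (auto simp: pw_C1_curve_def)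
      from piecewise_C1_differentiable_affine[OF this] show ?thesis by (simp add: o_def)
    qed
    have right: "(\<lambda>t. \<phi> (\<delta> (2 * t - 1))) piecewise_C1_differentiable_on {a'..b}"
      if a': "a \<le> a'" "a' \<le> b" "1 / 2 \<le> a'" for a'
    proof -
      have i: "(\<lambda>t. 2 * t + (- 1)) ` {a'..b} = {2 * a' - 1..2 * b - 1}" using a' by (subst image_affinity_atLeastAtMost) auto
      have "\<delta> ` {2 * a' - 1..2 * b - 1} \<subseteq> U"
      proof (rule image_subsetI)
        fix t assume "t \<in> {2 * a' - 1..2 * b - 1}"
        then have t: "(t + 1) / 2 \<in> {a..b}" "(t + 1) / 2 \<ge> 1 / 2" using a' by auto
        have "(\<gamma> +++ \<delta>) ((t + 1) / 2) = \<delta> t"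
        proof (cases "t = 0")
          case False
          then have "\<not> (t + 1) / 2 \<le> 1 / 2" "2 * ((t + 1) / 2) - 1 = t" using t(2) by (auto simp: field_simps)
          then show ?thesis by (simp only: joinpaths_def if_False)
        qed (simp add: joinpaths_def eq)
        moreover have "(\<gamma> +++ \<delta>) ((t + 1) / 2) \<in> U" using U t(1) by blast
        ultimately show "\<delta> t \<in> U" by (simp only:)
      qed
      moreover have "{2 * a' - 1..2 * b - 1} \<subseteq> {0..1}" using ab a' by auto
      ultimately have "(\<phi> \<circ> \<delta>) piecewise_C1_differentiable_on ((\<lambda>t. 2 * t + (- 1)) ` {a'..b})"
        using \<delta> cA a'(2) unfolding i by (auto simp: pw_C1_curve_def)
      from piecewise_C1_differentiable_affine[OF this] show ?thesis by (simp add: o_def)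
    qed
    consider "b \<le> 1 / 2" | "1 / 2 \<le> a" | "a \<le> 1 / 2" "1 / 2 \<le> b" by linarith
    then show "(\<phi> \<circ> (\<gamma> +++ \<delta>)) piecewise_C1_differentiable_on {a..b}"
    proof cases
      case 1
      show ?thesis by (rule piecewise_C1_differentiable_cong[OF left[OF ab(1) order_refl 1]]) (use 1 in \<open>auto simp: joinpaths_def\<close>)
    next
      case 2
      show ?thesis
      proof (rule piecewise_C1_differentiable_cong[OF right[OF order_refl ab(1) 2]])
        fix t assume "t \<in> {a..b}"
        show "\<phi> (\<delta> (2 * t - 1)) = (\<phi> \<circ> (\<gamma> +++ \<delta>)) t"
        proof (cases "t = 1 / 2")
          case True
          show ?thesis unfolding True by (simp add: joinpaths_def eq)
        next
          case False
          then have "\<not> t \<le> 1 / 2" using 2 \<open>t \<in> {a..b}\<close> by auto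
          then show ?thesis by (simp add: joinpaths_def)
        qed
      qed
    next
      case 3
      show ?thesis
        by (rule piecewise_C1_differentiable_cong[OF piecewise_C1_differentiable_cases[OF left[OF 3 order_refl] right[OF 3 order_refl] 3]])
          (auto simp: joinpaths_def eq)
    qed
  qed
  have "curve_length A g (\<lambda>s. (\<gamma> +++ \<delta>) (1 / 2 * s + 0)) = curve_length A g \<gamma>"
    by (rule curve_length_cong) (auto simp: joinpaths_def)
  moreover have "curve_length A g (\<lambda>s. (\<gamma> +++ \<delta>) ((1 - 1 / 2) * s + 1 / 2)) = curve_length A g \<delta>"
  proof (rule curve_length_cong)
    fix t :: real assume "t \<in> {0..1}"
    then show "(\<gamma> +++ \<delta>) ((1 - 1 / 2) * t + 1 / 2) = \<delta> t" using eq by (cases "t = 0") (auto simp: joinpaths_def)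
  qed
  ultimately show "curve_length A g (\<gamma> +++ \<delta>) = curve_length A g \<gamma> + curve_length A g \<delta>"
    using curve_length_split[OF j, of "1 / 2"] by simp
qed

text \<open>The fundamental theorem of calculus for \<open>h\<close> along the curve, whose
  derivative is at most \<open>G\<close> times the speed. Curves of infinite length are treated
  apart; there \<open>G > 0\<close> makes the right-hand side infinite.\<close>

lemma curve_length_ge:
  assumes \<gamma>: "pw_C1_curve A \<gamma>" and h: "smooth_fun A h" and G: "G > 0"
    "\<And>p v. v \<in> tangent_space A p \<Longrightarrow> \<bar>v h\<bar> \<le> G * sqrt (g p v v)"
  shows "ennreal \<bar>h (\<gamma> 1) - h (\<gamma> 0)\<bar> \<le> ennreal G * curve_length A g \<gamma>"
proof (cases "curve_length A g \<gamma> < \<infinity>")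
  case True
  then have fin: "(\<integral>\<^sup>+ t. ennreal (speed \<gamma> t) \<partial>lborel) < \<infinity>" unfolding curve_length_speed[OF \<gamma>] .
  note i = nn_integral_integrable_on[OF borel_speed[OF \<gamma>] speed_nonneg fin]
  obtain S where S: "finite S" "\<forall>t\<in>{0<..<1} - S. regular \<gamma> t"
    using pw_C1_regular[OF \<gamma>] by blast
  let ?f = "\<lambda>t. if t \<in> {0<..<1} \<and> regular \<gamma> t then velocity A \<gamma> t h else 0"
  have "(?f has_integral (h (\<gamma> 1) - h (\<gamma> 0))) {0..1}"
  proof (rule fundamental_theorem_of_calculus_interior_strong[OF S(1)])
    show "((\<lambda>t. h (\<gamma> t)) has_vector_derivative ?f t) (at t)" if "t \<in> {0<..<1} - S" for t
      using S(2) that h by (simp add: regular_def has_real_derivative_iff_has_vector_derivative[symmetric])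
    show "continuous_on {0..1} (\<lambda>t. h (\<gamma> t))"
      by (rule continuous_on_compose2[OF smooth_fun_continuous[OF h]]) (use \<gamma> in \<open>auto simp: pw_C1_curve_def\<close>)
  qed simp
  then have f: "integral {0..1} ?f = h (\<gamma> 1) - h (\<gamma> 0)" "?f integrable_on {0..1}" by auto
  have sp: "(\<lambda>t. G * speed \<gamma> t) integrable_on {0..1}"
    using integrable_cmul[OF integrable_on_subinterval[OF i], of 0 1 G] by simp
  have "norm (integral {0..1} ?f) \<le> integral {0..1} (\<lambda>t. G * speed \<gamma> t)"
    by (rule integral_norm_bound_integral[OF f(2) sp]) (auto simp: speed_def regular_def intro!: G(2))
  then have "\<bar>h (\<gamma> 1) - h (\<gamma> 0)\<bar> \<le> G * integral {0..1} (speed \<gamma>)"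
    unfolding f(1) real_norm_def by simp
  also have "... \<le> G * integral UNIV (speed \<gamma>)"
    using G(1) by (intro mult_left_mono integral_subset_le integrable_on_subinterval[OF i] i) (auto simp: speed_nonneg)
  finally have "ennreal \<bar>h (\<gamma> 1) - h (\<gamma> 0)\<bar> \<le> ennreal G * ennreal (integral UNIV (speed \<gamma>))"
    using G(1) by (subst ennreal_mult'[symmetric]) (auto intro: ennreal_leI)
  then show ?thesis
    unfolding curve_length_speed[OF \<gamma>] nn_integral_lborel_eq_integral[OF borel_speed[OF \<gamma>] speed_nonneg fin] .
next
  case False
  then have "curve_length A g \<gamma> = \<infinity>" by (simp add: less_top[symmetric])
  then show ?thesis using G(1) by (simp add: ennreal_mult_top)
qed

end

section \<open>The Riemannian distance\<close>

context riemannian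
begin

text \<open>Not geodesic normal coordinates, but a chart followed by a linear map in which the
  metric is comparable to the Euclidean one up to the factor 2. The radius \<open>3 * r\<close>
  leaves room for the doubled balls used in the smoothing.\<close>

definition normal_chart :: "'m \<Rightarrow> 'm set \<Rightarrow> ('m \<Rightarrow> real ^ 'n) \<Rightarrow> (real ^ 'n \<Rightarrow> real ^ 'n) \<Rightarrow> real \<Rightarrow> bool" where
  "normal_chart p U \<phi> T r \<longleftrightarrow> (U, \<phi>) \<in> A \<and> p \<in> U \<and> linear T \<and> bij T \<and> r > 0 \<and> ball (T (\<phi> p)) (3 * r) \<subseteq> T ` \<phi> ` U \<and>
    (\<forall>q\<in>U. T (\<phi> q) \<in> ball (T (\<phi> p)) (3 * r) \<longrightarrow> (\<forall>a.
      norm (T a) \<le> 2 * sqrt (g q (coord_vec A (U, \<phi>) q a) (coord_vec A (U, \<phi>) q a)) \<and>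
      sqrt (g q (coord_vec A (U, \<phi>) q a) (coord_vec A (U, \<phi>) q a)) \<le> 2 * norm (T a)))"

lemma normal_chartD:
  assumes "normal_chart p U \<phi> T r"
  shows "(U, \<phi>) \<in> A" "p \<in> U" "linear T" "bij T" "r > 0" "ball (T (\<phi> p)) (3 * r) \<subseteq> T ` \<phi> ` U"
    and "q \<in> U \<Longrightarrow> T (\<phi> q) \<in> ball (T (\<phi> p)) (3 * r) \<Longrightarrow> norm (T a) \<le> 2 * sqrt (g q (coord_vec A (U, \<phi>) q a) (coord_vec A (U, \<phi>) q a))"
    and "q \<in> U \<Longrightarrow> T (\<phi> q) \<in> ball (T (\<phi> p)) (3 * r) \<Longrightarrow> sqrt (g q (coord_vec A (U, \<phi>) q a) (coord_vec A (U, \<phi>) q a)) \<le> 2 * norm (T a)"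
  using assms unfolding normal_chart_def by blast+

text \<open>\<open>T\<close> is an isometry for the metric at \<open>p\<close>, and the coefficients
  of the metric depend continuously on the point.\<close>

lemma normal_chart_exists: "\<exists>U \<phi> T r. normal_chart p U \<phi> T r"
proof -
  obtain U \<phi> where c: "(U, \<phi>) \<in> A" "p \<in> U" by (rule chart_exists)
  obtain e where e: "orthonormal_basis A g p e" using orthonormal_basis_exists by blast
  let ?c = "\<lambda>a. coord_vec A (U, \<phi>) p a"
  note t = coord_vec_tangent[OF c]
  define T :: "real ^ 'n \<Rightarrow> real ^ 'n" where "T a = (\<chi> i. g p (?c a) (e i))" for a
  have add: "?c (a + b) = (\<lambda>h. 1 * ?c a h + 1 * ?c b h)" for a b
    using coord_vec_lin[OF c, of 1 a 1 b] by (intro ext) simp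
  have scale: "?c (s *\<^sub>R a) = (\<lambda>h. s * ?c a h)" for s a
    using coord_vec_lin[OF c, of s a 0 0] by (intro ext) simp
  have lin: "linear T"
  proof (rule linearI)
    show "T (a + b) = T a + T b" for a b
      unfolding T_def add g_lin[OF t t onb_tangent[OF e]] by (simp add: vec_eq_iff)
    show "T (s *\<^sub>R a) = s *\<^sub>R T a" for s a
      unfolding T_def scale g_scale[OF t onb_tangent[OF e]] by (simp add: vec_eq_iff)
  qed
  have normT: "(norm (T a))\<^sup>2 = g p (?c a) (?c a)" for a
    by (simp add: onb_parseval[OF e t t] power2_norm_eq_inner inner_vec_def T_def)
  have inj: "inj T"
  proof (subst linear_injective_0[OF lin], intro allI impI)
    fix a assume "T a = 0"
    then have "?c a = (\<lambda>h. 0)" using normT[of a] by (intro g_eq_0[OF t]) simp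
    then show "a = 0" by (rule coord_vec_eq_zero[OF c])
  qed
  have surj: "surj T" by (rule linear_injective_imp_surjective[OF lin inj]) simp
  obtain B where B: "B > 0" "\<And>x. B * norm x \<le> norm (T x)" using that by (rule linear_inj_bounded_below_pos[OF lin inj])
  define M where "M x = (\<Sum>i\<in>UNIV. \<Sum>j\<in>UNIV. \<bar>gram_matrix A g (U, \<phi>) (inv_into U \<phi> x) $ i $ j - gram_matrix A g (U, \<phi>) p $ i $ j\<bar>)" for x
  have contM: "continuous_on (\<phi> ` U) M"
    unfolding M_def by (intro continuous_intros smooth_on_imp_continuous_on[OF smooth_on_gram[OF c(1)]])
  \<comment> \<open>\<open>B\<close> bounds \<open>T\<close> from below, so an error of the Gram
    matrix below half of \<open>B\<^sup>2\<close> changes squared lengths by at most half of their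
    value at \<open>p\<close>.\<close>
  define W where "W = \<phi> ` U \<inter> M -` {..<B\<^sup>2 / 2}"
  have W: "open W" unfolding W_def by (rule continuous_open_preimage[OF contM chart_open_range[OF c(1)]]) simp
  have "\<phi> p \<in> W" using c(2) B(1) chart_inv[OF c] by (simp add: W_def M_def)
  moreover have "open (T ` W)" by (rule open_surjective_linear_image[OF W lin surj])
  ultimately obtain r where r: "r > 0" "ball (T (\<phi> p)) r \<subseteq> T ` W" using open_contains_ball by blast
  have est: "norm (T a) \<le> 2 * sqrt (g q (coord_vec A (U, \<phi>) q a) (coord_vec A (U, \<phi>) q a)) \<and>
      sqrt (g q (coord_vec A (U, \<phi>) q a) (coord_vec A (U, \<phi>) q a)) \<le> 2 * norm (T a)"
    if q: "q \<in> U" "T (\<phi> q) \<in> ball (T (\<phi> p)) r" for q a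
  proof -
    have "T (\<phi> q) \<in> T ` W" using q(2) r(2) by blast
    then have "\<phi> q \<in> W" using inj by (simp add: inj_image_mem_iff)
    then have M: "M (\<phi> q) < B\<^sup>2 / 2" by (simp add: W_def)
    let ?N = "g q (coord_vec A (U, \<phi>) q a) (coord_vec A (U, \<phi>) q a)"
    have "?N - (norm (T a))\<^sup>2 = (\<Sum>i\<in>UNIV. \<Sum>j\<in>UNIV. a $ i * a $ j * (gram_matrix A g (U, \<phi>) q $ i $ j - gram_matrix A g (U, \<phi>) p $ i $ j))"
      unfolding normT g_coord_vec[OF c] g_coord_vec[OF c(1) q(1)] by (simp add: sum_subtractf[symmetric] algebra_simps)
    then have "\<bar>?N - (norm (T a))\<^sup>2\<bar> \<le> (\<Sum>i\<in>UNIV. \<Sum>j\<in>UNIV. \<bar>a $ i * a $ j * (gram_matrix A g (U, \<phi>) q $ i $ j - gram_matrix A g (U, \<phi>) p $ i $ j)\<bar>)"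
      by (auto intro!: order_trans[OF sum_abs] sum_mono)
    also have "... \<le> (\<Sum>i\<in>UNIV. \<Sum>j\<in>UNIV. (norm a)\<^sup>2 * \<bar>gram_matrix A g (U, \<phi>) q $ i $ j - gram_matrix A g (U, \<phi>) p $ i $ j\<bar>)"
      unfolding abs_mult power2_eq_square by (intro sum_mono mult_mono component_le_norm_cart) auto
    also have "... = (norm a)\<^sup>2 * M (\<phi> q)" by (simp add: M_def chart_inv[OF c(1) q(1)] sum_distrib_left)
    also have "... \<le> (norm a)\<^sup>2 * (B\<^sup>2 / 2)" using M by (intro mult_left_mono) auto
    also have "... = (B * norm a)\<^sup>2 / 2" by (simp add: power_mult_distrib)
    also have "... \<le> (norm (T a))\<^sup>2 / 2" using B(1) B(2)[of a] by (intro divide_right_mono power_mono) auto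
    finally have "?N \<le> 4 * (norm (T a))\<^sup>2" "(norm (T a))\<^sup>2 / 4 \<le> ?N"
      using zero_le_power2[of "norm (T a)"] by linarith+
    then have "?N \<le> (2 * norm (T a))\<^sup>2" "(norm (T a) / 2)\<^sup>2 \<le> ?N" by (simp_all add: power_mult_distrib power_divide)
    then have "sqrt ?N \<le> 2 * norm (T a)"
      by (intro real_le_lsqrt g_nonneg coord_vec_tangent[OF c(1) q(1)]) auto
    moreover have "norm (T a) / 2 \<le> sqrt ?N" by (rule real_le_rsqrt) fact
    ultimately show ?thesis by simp
  qed
  \<comment> \<open>The comparison holds on a ball of radius \<open>r\<close>, while
    \<open>normal_chart\<close> speaks of three times its radius.\<close>
  have "normal_chart p U \<phi> T (r / 3)"
    unfolding normal_chart_def using c lin inj surj r est by (auto simp: bij_def W_def)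
  then show ?thesis by blast
qed

lemma normal_chart_nbhd:
  assumes n: "normal_chart p U \<phi> T r"
  shows "open {q \<in> U. dist (T (\<phi> p)) (T (\<phi> q)) < s}"
proof -
  note d = normal_chartD[OF n]
  have "{q \<in> U. dist (T (\<phi> p)) (T (\<phi> q)) < s} = U \<inter> \<phi> -` (T -` ball (T (\<phi> p)) s)" by auto
  moreover have "open (T -` ball (T (\<phi> p)) s)"
    using linear_continuous_on[OF linear_conv_bounded_linear[THEN iffD1, OF d(3)]] by (intro open_vimage) auto
  ultimately show ?thesis using chart_open_preimage[OF d(1)] by simp
qed

text \<open>The straight segment in coordinates provides upper bounds for the distance. Its
  differentiability has to be verified in every chart that it meets, which is done through the
  transition maps.\<close>

lemma coordinate_segment:
  assumes c: "(U, \<phi>) \<in> A" and q: "q1 \<in> U" "q2 \<in> U"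
    and l: "\<And>t. t \<in> {0..1} \<Longrightarrow> \<phi> q1 + t *\<^sub>R (\<phi> q2 - \<phi> q1) \<in> \<phi> ` U"
    and bnd: "\<And>t q. t \<in> {0..1} \<Longrightarrow> q = inv_into U \<phi> (\<phi> q1 + t *\<^sub>R (\<phi> q2 - \<phi> q1)) \<Longrightarrow>
      sqrt (g q (coord_vec A (U, \<phi>) q (\<phi> q2 - \<phi> q1)) (coord_vec A (U, \<phi>) q (\<phi> q2 - \<phi> q1))) \<le> C"
  shows "\<exists>\<gamma>. pw_C1_curve A \<gamma> \<and> \<gamma> 0 = q1 \<and> \<gamma> 1 = q2 \<and> curve_length A g \<gamma> \<le> ennreal C"
proof -
  define a where "a = \<phi> q2 - \<phi> q1"
  define L where "L t = \<phi> q1 + t *\<^sub>R a" for t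
  define \<gamma> where "\<gamma> t = inv_into U \<phi> (L t)" for t
  have LU: "L t \<in> \<phi> ` U" if "t \<in> {0..1}" for t using l[OF that] by (simp add: L_def a_def)
  have \<gamma>U: "\<gamma> t \<in> U" "\<phi> (\<gamma> t) = L t" if "t \<in> {0..1}" for t
    using LU[OF that] by (auto simp: \<gamma>_def chart_inv[OF c] inv_into_into f_inv_into_f)
  have Ld: "(L has_derivative (\<lambda>s. s *\<^sub>R a)) (at t)" for t unfolding L_def by (auto intro!: derivative_eq_intros)
  have Lc: "continuous_on S L" for S unfolding L_def by (intro continuous_intros)
  have "pw_C1_curve A \<gamma>"
    unfolding pw_C1_curve_def
  proof (intro conjI ballI allI impI, safe)
    show "continuous_on {0..1} \<gamma>" unfolding \<gamma>_def
      by (rule continuous_on_compose2[OF chart_inv_continuous[OF c] Lc]) (use LU in auto)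
    fix V \<psi> and s t :: real assume d: "(V, \<psi>) \<in> A" and st: "s \<le> t" "{s..t} \<subseteq> {0..1}" and V: "\<gamma> ` {s..t} \<subseteq> V"
    let ?\<tau> = "\<psi> \<circ> inv_into U \<phi>" and ?O = "\<phi> ` (U \<inter> V)"
    have sm: "smooth_on ?O ?\<tau>" by (rule chart_transition[OF c d])
    have LO: "L x \<in> ?O" if "x \<in> {s..t}" for x
    proof -
      have "x \<in> {0..1}" using that st(2) by blast
      then show ?thesis using \<gamma>U[of x] V that by (metis IntI image_eqI image_subset_iff)
    qed
    have "(\<psi> \<circ> \<gamma>) C1_differentiable_on {s..t}"
      unfolding C1_differentiable_on_def
    proof (intro exI conjI ballI)
      show "(\<psi> \<circ> \<gamma> has_vector_derivative frechet_derivative ?\<tau> (at (L x)) a) (at x)" if "x \<in> {s..t}" for x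
      proof -
        note D = smooth_on_imp_has_derivative[OF sm LO[OF that]]
        from has_derivative_compose[OF Ld D]
        have "((\<lambda>x. ?\<tau> (L x)) has_derivative (\<lambda>y. frechet_derivative ?\<tau> (at (L x)) (y *\<^sub>R a))) (at x)" .
        then show ?thesis
          unfolding has_vector_derivative_def linear_cmul[OF has_derivative_linear[OF D]] by (simp add: o_def \<gamma>_def[abs_def])
      qed
      show "continuous_on {s..t} (\<lambda>x. frechet_derivative ?\<tau> (at (L x)) a)"
        by (rule continuous_on_compose2[OF smooth_on_imp_continuous_on[OF smooth_on_frechet[OF sm]] Lc]) (use LO in auto)
    qed
    then show "(\<psi> \<circ> \<gamma>) piecewise_C1_differentiable_on {s..t}" by (rule C1_differentiable_imp_piecewise)
  qed
  moreover have "curve_length A g \<gamma> \<le> ennreal C"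
  proof -
    have v: "velocity A \<gamma> t = coord_vec A (U, \<phi>) (\<gamma> t) a" if t: "t \<in> {0..1}" for t
    proof (rule velocity_eqI)
      fix h assume h: "smooth_fun A h"
      have "((\<lambda>x. h (inv_into U \<phi> x)) has_derivative (\<lambda>b. coord_vec A (U, \<phi>) (\<gamma> t) b h)) (at (L t))"
        using chart_has_derivative[OF h c \<gamma>U(1)[OF t]] \<gamma>U(2)[OF t] by simp
      from has_derivative_compose[OF Ld this]
      have "((\<lambda>s. h (\<gamma> s)) has_derivative (\<lambda>s. coord_vec A (U, \<phi>) (\<gamma> t) (s *\<^sub>R a) h)) (at t)" by (simp add: \<gamma>_def)
      moreover have "coord_vec A (U, \<phi>) (\<gamma> t) (s *\<^sub>R a) h = coord_vec A (U, \<phi>) (\<gamma> t) a h * s" for s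
        using coord_vec_lin[OF c \<gamma>U(1)[OF t], of s a 0 0 h] by simp
      ultimately show "((\<lambda>s. h (\<gamma> s)) has_real_derivative coord_vec A (U, \<phi>) (\<gamma> t) a h) (at t)"
        by (simp add: has_field_derivative_def)
    qed (rule coord_vec_nonsmooth)
    have "curve_length A g \<gamma> \<le> (\<integral>\<^sup>+ t. ennreal C * indicator {0..1::real} t \<partial>lborel)"
      unfolding curve_length_def
    proof (rule nn_integral_mono)
      fix t :: real
      show "ennreal (sqrt (sq_speed \<gamma> t)) * indicator {0..1} t \<le> ennreal C * indicator {0..1} t"
      proof (cases "t \<in> {0..1}")
        case True
        then show ?thesis using bnd[OF True, of "\<gamma> t"] v[OF True] by (simp add: \<gamma>_def L_def a_def ennreal_leI)
      qed simp
    qed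
    also have "... = ennreal C" by (subst nn_integral_cmult_indicator) auto
    finally show ?thesis .
  qed
  moreover have "\<gamma> 0 = q1" "\<gamma> 1 = q2" by (simp_all add: \<gamma>_def L_def a_def chart_inv[OF c] q)
  ultimately show ?thesis by blast
qed

text \<open>The infimum is kept in \<open>ennreal\<close> until connectedness shows it to be finite,
  since \<open>enn2real\<close> would send an infinite distance to 0.\<close>

definition edist :: "'m \<Rightarrow> 'm \<Rightarrow> ennreal" where
  "edist p q = (INF \<gamma>\<in>{\<gamma>. pw_C1_curve A \<gamma> \<and> \<gamma> 0 = p \<and> \<gamma> 1 = q}. curve_length A g \<gamma>)"

lemma edist_le: "pw_C1_curve A \<gamma> \<Longrightarrow> edist (\<gamma> 0) (\<gamma> 1) \<le> curve_length A g \<gamma>"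
  unfolding edist_def by (intro INF_lower) auto

lemma edist_less:
  assumes "edist p q < r"
  shows "\<exists>\<gamma>. pw_C1_curve A \<gamma> \<and> \<gamma> 0 = p \<and> \<gamma> 1 = q \<and> curve_length A g \<gamma> < r"
  using assms unfolding edist_def INF_less_iff by blast

lemma edist_local:
  assumes n: "normal_chart p U \<phi> T r" and q: "q1 \<in> U" "T (\<phi> q1) \<in> ball (T (\<phi> p)) (3 * r)" "q2 \<in> U" "T (\<phi> q2) \<in> ball (T (\<phi> p)) (3 * r)"
  shows "edist q1 q2 \<le> ennreal (2 * dist (T (\<phi> q1)) (T (\<phi> q2)))"
proof -
  note d = normal_chartD[OF n]
  let ?L = "\<lambda>t. \<phi> q1 + t *\<^sub>R (\<phi> q2 - \<phi> q1)"
  have TL: "T (?L t) \<in> ball (T (\<phi> p)) (3 * r)" if "t \<in> {0..1}" for t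
  proof -
    have "T (?L t) = (1 - t) *\<^sub>R T (\<phi> q1) + t *\<^sub>R T (\<phi> q2)"
      by (simp add: linear_add[OF d(3)] linear_cmul[OF d(3)] linear_diff[OF d(3)] algebra_simps)
    then show ?thesis using convexD_alt[OF convex_ball q(2,4), of t] that by simp
  qed
  have L: "?L t \<in> \<phi> ` U" if "t \<in> {0..1}" for t
    using subsetD[OF d(6) TL[OF that]] d(4) by (simp add: inj_image_mem_iff bij_is_inj)
  have "\<exists>\<gamma>. pw_C1_curve A \<gamma> \<and> \<gamma> 0 = q1 \<and> \<gamma> 1 = q2 \<and> curve_length A g \<gamma> \<le> ennreal (2 * norm (T (\<phi> q2 - \<phi> q1)))"
  proof (rule coordinate_segment[OF d(1) q(1,3) L])
    fix t q assume t: "t \<in> {0..1}" and qt: "q = inv_into U \<phi> (?L t)"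
    have "q \<in> U" "\<phi> q = ?L t" unfolding qt using L[OF t] by (auto intro: inv_into_into f_inv_into_f)
    then show "sqrt (g q (coord_vec A (U, \<phi>) q (\<phi> q2 - \<phi> q1)) (coord_vec A (U, \<phi>) q (\<phi> q2 - \<phi> q1))) \<le> 2 * norm (T (\<phi> q2 - \<phi> q1))"
      using TL[OF t] by (intro d(8)) auto
  qed
  then obtain \<gamma> where \<gamma>: "pw_C1_curve A \<gamma>" "\<gamma> 0 = q1" "\<gamma> 1 = q2" "curve_length A g \<gamma> \<le> ennreal (2 * norm (T (\<phi> q2 - \<phi> q1)))" by blast
  have "edist q1 q2 \<le> curve_length A g \<gamma>" using edist_le[OF \<gamma>(1)] \<gamma>(2,3) by simp
  also have "... \<le> ennreal (2 * dist (T (\<phi> q1)) (T (\<phi> q2)))"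
    using \<gamma>(4) by (simp add: linear_diff[OF d(3)] dist_norm norm_minus_commute)
  finally show ?thesis .
qed

lemma edist_refl: "edist p p = 0"
proof -
  obtain U \<phi> T r where n: "normal_chart p U \<phi> T r" using normal_chart_exists by blast
  have "edist p p \<le> ennreal (2 * dist (T (\<phi> p)) (T (\<phi> p)))"
    by (rule edist_local[OF n]) (use normal_chartD[OF n] in auto)
  then show ?thesis by simp
qed

lemma edist_sym: "edist p q = edist q p"
proof -
  have "edist q p \<le> edist p q" for p q
    unfolding edist_def[of p q]
  proof (rule INF_greatest)
    fix \<gamma> assume "\<gamma> \<in> {\<gamma>. pw_C1_curve A \<gamma> \<and> \<gamma> 0 = p \<and> \<gamma> 1 = q}"
    then show "edist q p \<le> curve_length A g \<gamma>"
      using edist_le[OF curve_length_reverse(1), of \<gamma>] curve_length_reverse(2)[of \<gamma>] by auto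
  qed
  then show ?thesis by (intro antisym)
qed

text \<open>Nearly shortest curves are joined; as the infimum may not be attained, the excess
  \<open>e\<close> is divided between them.\<close>

lemma edist_triangle: "edist p r \<le> edist p q + edist q r"
proof (rule ennreal_le_epsilon)
  fix e :: real assume fin: "edist p q + edist q r < top" and e: "0 < e"
  have less: "x < x + ennreal (e / 2)" if "x < top" for x
    using that e by (cases x rule: ennreal_cases) (auto simp: ennreal_plus[symmetric] ennreal_lessI simp del: ennreal_plus)
  obtain \<gamma> where \<gamma>: "pw_C1_curve A \<gamma>" "\<gamma> 0 = p" "\<gamma> 1 = q" "curve_length A g \<gamma> < edist p q + ennreal (e / 2)"
    using edist_less[OF less[of "edist p q"]] fin by auto
  obtain \<delta> where \<delta>: "pw_C1_curve A \<delta>" "\<delta> 0 = q" "\<delta> 1 = r" "curve_length A g \<delta> < edist q r + ennreal (e / 2)"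
    using edist_less[OF less[of "edist q r"]] fin by auto
  have j: "\<gamma> 1 = \<delta> 0" using \<gamma> \<delta> by simp
  have "edist p r \<le> curve_length A g \<gamma> + curve_length A g \<delta>"
    using edist_le[OF pw_C1_join(1)[OF \<gamma>(1) \<delta>(1) j]] pw_C1_join(2)[OF \<gamma>(1) \<delta>(1) j] \<gamma>(2) \<delta>(3)
    by (simp add: joinpaths_def)
  also have "... \<le> (edist p q + ennreal (e / 2)) + (edist q r + ennreal (e / 2))"
    using \<gamma>(4) \<delta>(4) by (intro add_mono less_imp_le)
  also have "... = edist p q + edist q r + (ennreal (e / 2) + ennreal (e / 2))" by (simp only: ac_simps)
  also have "ennreal (e / 2) + ennreal (e / 2) = ennreal e" using e by (subst ennreal_plus[symmetric]) auto
  finally show "edist p r \<le> edist p q + edist q r + ennreal e" .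
qed

lemma tangent_vanish:
  assumes v: "v \<in> tangent_space A q" and h: "smooth_fun A h" and V: "open V" "q \<in> V" "\<And>p. p \<in> V \<Longrightarrow> h p = 0"
  shows "v h = 0"
  using tangent_local[OF v h smooth_fun_const V(1,2), of 0] V(3) tangent_const[OF v] by auto

text \<open>The gradient is bounded in norm on the compact set, and on its open complement the
  function is constant, so that all derivatives vanish there.\<close>

lemma compact_support_Lipschitz:
  assumes h: "smooth_fun A h" and K: "compact K" "\<And>q. q \<notin> K \<Longrightarrow> h q = 0"
  shows "\<exists>G>0. \<forall>p. \<forall>v\<in>tangent_space A p. \<bar>v h\<bar> \<le> G * sqrt (g p v v)"
proof -
  let ?N = "\<lambda>p. g p (gradient A g h p) (gradient A g h p)"
  have "continuous_on K ?N"
    by (rule continuous_on_subset[OF smooth_fun_continuous[OF g_smooth[OF smooth_gradient[OF h] smooth_gradient[OF h]]]]) simp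
  then have "bounded (?N ` K)" using K(1) by (intro compact_imp_bounded compact_continuous_image)
  then obtain B where B: "\<And>p. p \<in> K \<Longrightarrow> \<bar>?N p\<bar> \<le> B" unfolding bounded_iff by auto
  show ?thesis
  proof (intro exI[of _ "sqrt (max B 0 + 1)"] conjI allI ballI)
    show "0 < sqrt (max B 0 + 1)" by (simp add: add_nonneg_pos)
    fix p v assume v: "v \<in> tangent_space A p"
    show "\<bar>v h\<bar> \<le> sqrt (max B 0 + 1) * sqrt (g p v v)"
    proof (cases "p \<in> K")
      case True
      have "(v h)\<^sup>2 = (g p (gradient A g h p) v)\<^sup>2" by (simp add: g_gradient[OF h v])
      also have "... \<le> ?N p * g p v v" by (rule g_Cauchy_Schwarz[OF gradient_tangent[OF h] v])
      also have "... \<le> (max B 0 + 1) * g p v v" using B[OF True] by (intro mult_right_mono g_nonneg v) auto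
      finally have "sqrt ((v h)\<^sup>2) \<le> sqrt ((max B 0 + 1) * g p v v)" by (rule real_sqrt_le_mono)
      then show ?thesis by (simp add: real_sqrt_mult)
    next
      case False
      then have "v h = 0" using K by (intro tangent_vanish[OF v h, of "- K"]) (auto simp: compact_imp_closed open_Compl)
      then show ?thesis by (simp add: g_nonneg[OF v])
    qed
  qed
qed

lemma edist_ge:
  assumes h: "smooth_fun A h" and G: "G > 0" "\<And>p v. v \<in> tangent_space A p \<Longrightarrow> \<bar>v h\<bar> \<le> G * sqrt (g p v v)"
  shows "ennreal (\<bar>h p - h q\<bar> / G) \<le> edist p q"
  unfolding edist_def
proof (rule INF_greatest)
  fix \<gamma> assume "\<gamma> \<in> {\<gamma>. pw_C1_curve A \<gamma> \<and> \<gamma> 0 = p \<and> \<gamma> 1 = q}"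
  then have "ennreal \<bar>h p - h q\<bar> \<le> ennreal G * curve_length A g \<gamma>"
    using curve_length_ge[OF _ h G, of \<gamma>] by (auto simp: abs_minus_commute)
  then show "ennreal (\<bar>h p - h q\<bar> / G) \<le> curve_length A g \<gamma>"
    using G(1) by (cases "curve_length A g \<gamma>" rule: ennreal_cases)
      (auto simp: ennreal_mult'[symmetric] divide_le_eq mult.commute intro!: ennreal_leI)
qed

text \<open>Along any curve from \<open>p\<close> to a point outside \<open>W\<close> a bump
  function drops from 1 to 0, which by its Lipschitz bound costs a definite length. Distances are
  thus bounded below without following curves through charts.\<close>

lemma edist_separation:
  assumes "open W" "p \<in> W"
  shows "\<exists>\<delta>>0. \<forall>q. q \<notin> W \<longrightarrow> ennreal \<delta> \<le> edist p q"
proof -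
  obtain \<eta> V K where \<eta>: "smooth_fun A \<eta>" "p \<in> V" "V \<subseteq> K" "compact K" "K \<subseteq> W"
    "\<And>q. q \<in> V \<Longrightarrow> \<eta> q = 1" "\<And>q. q \<notin> K \<Longrightarrow> \<eta> q = 0" using smooth_bump[OF assms] by metis
  obtain G where G: "G > 0" "\<And>p v. v \<in> tangent_space A p \<Longrightarrow> \<bar>v \<eta>\<bar> \<le> G * sqrt (g p v v)"
    using compact_support_Lipschitz[OF \<eta>(1,4,7)] by blast
  have "ennreal (1 / G) \<le> edist p q" if "q \<notin> W" for q
  proof -
    have "\<eta> p = 1" "\<eta> q = 0" using \<eta> that by auto
    then show ?thesis using edist_ge[OF \<eta>(1) G, of p q] by simp
  qed
  then show ?thesis using G(1) by (intro exI[of _ "1 / G"]) auto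
qed

end

locale connected_riemannian = riemannian A g
  for A :: "('m::{t2_space, second_countable_topology}, 'n::finite) atlas" and g :: "'m metric" +
  assumes connected_UNIV: "connected (UNIV :: 'm set)"
begin

text \<open>Nearby points of a chart are joined by a segment, so the points at finite distance from
  \<open>p\<close> form an open set, and so do those at infinite distance.\<close>

lemma edist_finite: "edist p q < top"
proof -
  have loc: "\<exists>W. open W \<and> x \<in> W \<and> (\<forall>y\<in>W. edist x y < top)" for x
  proof -
    obtain U \<phi> T r where n: "normal_chart x U \<phi> T r" using normal_chart_exists by blast
    note d = normal_chartD[OF n]
    let ?W = "{q \<in> U. dist (T (\<phi> x)) (T (\<phi> q)) < 3 * r}"
    have "edist x y < top" if "y \<in> ?W" for y
      by (rule le_less_trans[OF edist_local[OF n, of x y]]) (use that d in auto)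
    then show ?thesis using normal_chart_nbhd[OF n, of "3 * r"] d(2,5) by (intro exI[of _ ?W]) auto
  qed
  let ?S = "{x. edist p x < top}"
  have S: "open ?S"
  proof (subst open_subopen, intro ballI)
    fix x assume x: "x \<in> ?S"
    obtain W where "open W" "x \<in> W" "\<forall>y\<in>W. edist x y < top" using loc by blast
    moreover have "edist p y < top" if "edist x y < top" for y
      using le_less_trans[OF edist_triangle[of p y x]] x that by simp
    ultimately show "\<exists>T. open T \<and> x \<in> T \<and> T \<subseteq> ?S" by blast
  qed
  have C: "open (- ?S)"
  proof (subst open_subopen, intro ballI)
    fix x assume x: "x \<in> - ?S"
    obtain W where "open W" "x \<in> W" "\<forall>y\<in>W. edist x y < top" using loc by blast
    moreover have "\<not> edist p y < top" if "edist x y < top" for y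
      using le_less_trans[OF edist_triangle[of p x y]] x that by (auto simp: edist_sym[of y x])
    ultimately show "\<exists>T. open T \<and> x \<in> T \<and> T \<subseteq> - ?S" by blast
  qed
  have "?S \<inter> UNIV = {} \<or> - ?S \<inter> UNIV = {}" by (rule connectedD[OF connected_UNIV S C]) auto
  moreover have "p \<in> ?S" by (simp add: edist_refl)
  ultimately show ?thesis by blast
qed

abbreviation d :: "'m \<Rightarrow> 'm \<Rightarrow> real" where "d \<equiv> riem_dist A g"

lemma edist_d: "edist p q = ennreal (d p q)"
  unfolding riem_dist_def edist_def[symmetric] using edist_finite by simp

lemma d_nonneg: "0 \<le> d p q"
  by (simp add: riem_dist_def)

sublocale Metric_space UNIV d
proof
  show "0 \<le> d x y" for x y by (rule d_nonneg)
  show "d x y = d y x" for x y using edist_sym[of x y] by (simp add: edist_d d_nonneg)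
  show "d x y = 0 \<longleftrightarrow> x = y" for x y
  proof
    assume "d x y = 0"
    show "x = y"
    proof (rule ccontr)
      assume "x \<noteq> y"
      then obtain W where "open W" "x \<in> W" "y \<notin> W" using t1_space by blast
      then obtain \<delta> where "\<delta> > 0" "ennreal \<delta> \<le> edist x y" using edist_separation by blast
      then show False using \<open>d x y = 0\<close> by (simp add: edist_d)
    qed
  qed (simp add: riem_dist_def edist_def[symmetric] edist_refl)
  show "d x z \<le> d x y + d y z" for x y z
    using edist_triangle[of x z y] by (simp add: edist_d d_nonneg ennreal_plus[symmetric] del: ennreal_plus)
qed

text \<open>Segments in charts show that nearby points have small distance; bump functions show that
  points at small distance lie in a given neighbourhood.\<close>

lemma mtopology_eq_euclidean: "mtopology = euclidean"
proof (rule topology_eq[THEN iffD2], intro allI)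
  fix S :: "'m set"
  have "(\<forall>x. x \<in> S \<longrightarrow> (\<exists>r>0. mball x r \<subseteq> S)) \<longleftrightarrow> open S"
  proof
    assume S: "\<forall>x. x \<in> S \<longrightarrow> (\<exists>r>0. mball x r \<subseteq> S)"
    show "open S"
    proof (subst open_subopen, intro ballI)
      fix x assume "x \<in> S"
      then obtain e where e: "e > 0" "mball x e \<subseteq> S" using S by blast
      obtain U \<phi> T r where n: "normal_chart x U \<phi> T r" using normal_chart_exists by blast
      note N = normal_chartD[OF n]
      let ?W = "{q \<in> U. dist (T (\<phi> x)) (T (\<phi> q)) < min (3 * r) (e / 2)}"
      have "d x y < e" if "y \<in> ?W" for y
      proof -
        have "edist x y \<le> ennreal (2 * dist (T (\<phi> x)) (T (\<phi> y)))" by (rule edist_local[OF n]) (use that N in auto)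
        then show ?thesis using that by (simp add: edist_d)
      qed
      then have "?W \<subseteq> S" using e(2) by auto
      then show "\<exists>T. open T \<and> x \<in> T \<and> T \<subseteq> S"
        using normal_chart_nbhd[OF n, of "min (3 * r) (e / 2)"] N(2,5) e(1) by (intro exI[of _ ?W]) auto
    qed
  next
    assume S: "open S"
    show "\<forall>x. x \<in> S \<longrightarrow> (\<exists>r>0. mball x r \<subseteq> S)"
    proof (intro allI impI)
      fix x assume "x \<in> S"
      then obtain \<delta> where \<delta>: "\<delta> > 0" "\<And>q. q \<notin> S \<Longrightarrow> ennreal \<delta> \<le> edist x q" using edist_separation[OF S] by blast
      have "y \<in> S" if "d x y < \<delta>" for y
        using \<delta>(2)[of y] that by (force simp: edist_d d_nonneg)
      then show "\<exists>r>0. mball x r \<subseteq> S" using \<delta>(1) by (intro exI[of _ \<delta>]) auto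
    qed
  qed
  then show "openin mtopology S \<longleftrightarrow> openin euclidean S" by (simp add: openin_mtopology)
qed

lemma d_local:
  assumes "normal_chart p U \<phi> T r" "q1 \<in> U" "T (\<phi> q1) \<in> ball (T (\<phi> p)) (3 * r)" "q2 \<in> U" "T (\<phi> q2) \<in> ball (T (\<phi> p)) (3 * r)"
  shows "d q1 q2 \<le> 2 * dist (T (\<phi> q1)) (T (\<phi> q2))"
  using edist_local[OF assms] by (simp add: edist_d)

lemma continuous_on_d: "continuous_on UNIV (d p)"
proof (rule continuous_on_open_vimage[THEN iffD2, OF open_UNIV], intro allI impI)
  fix B :: "real set" assume B: "open B"
  show "open (d p -` B \<inter> UNIV)"
    unfolding openin_open[symmetric] open_openin mtopology_eq_euclidean[symmetric] openin_mtopology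
  proof (intro conjI allI impI)
    fix x assume "x \<in> d p -` B \<inter> UNIV"
    then obtain e where e: "e > 0" "\<And>y. dist y (d p x) < e \<Longrightarrow> y \<in> B" using B unfolding open_dist by auto
    have "y \<in> d p -` B \<inter> UNIV" if "d x y < e" for y
    proof -
      have "\<bar>d p y - d p x\<bar> \<le> d x y" using triangle[of p x y] triangle[of p y x] commute[of x y] by simp
      then show ?thesis using that e(2)[of "d p y"] by (simp add: dist_real_def)
    qed
    then show "\<exists>r>0. mball x r \<subseteq> d p -` B \<inter> UNIV" using e(1) by (intro exI[of _ e]) auto
  qed simp
qed

text \<open>Along a nearly shortest curve the distances to its two ends add up to less than
  \<open>r + s\<close>, so at every time one of them is below its bound. The two sets of times are
  relatively open, nonempty and cover the connected unit interval, hence they meet.\<close>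

lemma length_space:
  assumes less: "d x y < r + s" and rs: "r > 0" "s > 0"
  shows "\<exists>z. d x z < r \<and> d z y < s"
proof -
  have "edist x y < ennreal (r + s)" using less by (simp add: edist_d ennreal_lessI d_nonneg le_less_trans[OF d_nonneg])
  then obtain \<gamma> where \<gamma>: "pw_C1_curve A \<gamma>" "\<gamma> 0 = x" "\<gamma> 1 = y" "curve_length A g \<gamma> < ennreal (r + s)"
    using edist_less by blast
  have cont: "continuous_on {0..1} \<gamma>" using \<gamma>(1) by (simp add: pw_C1_curve_def)
  have cover: "d x (\<gamma> t) < r \<or> d (\<gamma> t) y < s" if t: "t \<in> {0..1}" for t
  proof (cases "t = 0 \<or> t = 1")
    case True
    then show ?thesis using \<gamma>(2,3) rs by auto
  next
    case False
    then have t: "0 < t" "t < 1" using t by auto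
    have "edist x (\<gamma> t) \<le> curve_length A g (\<lambda>s. \<gamma> (t * s + 0))"
      using edist_le[OF pw_C1_affine[OF \<gamma>(1), of t 0]] t \<gamma>(2) by simp
    moreover have "edist (\<gamma> t) y \<le> curve_length A g (\<lambda>s. \<gamma> ((1 - t) * s + t))"
      using edist_le[OF pw_C1_affine[OF \<gamma>(1), of "1 - t" t]] t \<gamma>(3) by simp
    ultimately have "ennreal (d x (\<gamma> t)) + ennreal (d (\<gamma> t) y) \<le> curve_length A g \<gamma>"
      unfolding curve_length_split[OF \<gamma>(1) t] by (simp add: edist_d add_mono)
    also have "... < ennreal (r + s)" by (rule \<gamma>(4))
    finally have "d x (\<gamma> t) + d (\<gamma> t) y < r + s"
      using rs by (simp add: ennreal_plus[symmetric] d_nonneg ennreal_less_iff del: ennreal_plus)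
    then show ?thesis by linarith
  qed
  let ?P = "{t \<in> {0..1}. d x (\<gamma> t) < r}" and ?Q = "{t \<in> {0..1}. d (\<gamma> t) y < s}"
  have P: "openin (top_of_set {0..1}) ?P"
    by (rule continuous_openin_preimage_gen[where f = "\<lambda>t. d x (\<gamma> t)" and T = "{..<r}", simplified, unfolded vimage_def Int_def, simplified])
      (rule continuous_on_compose2[OF continuous_on_d cont], simp)
  have Q: "openin (top_of_set {0..1}) ?Q"
    unfolding commute[of _ y]
    by (rule continuous_openin_preimage_gen[where f = "\<lambda>t. d y (\<gamma> t)" and T = "{..<s}", simplified, unfolded vimage_def Int_def, simplified])
      (rule continuous_on_compose2[OF continuous_on_d cont], simp)
  have "?P \<inter> ?Q \<noteq> {}"
  proof
    assume e: "?P \<inter> ?Q = {}"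
    have "connected {0..1::real}" by simp
    moreover have "{0..1} \<subseteq> ?P \<union> ?Q"
    proof
      fix t :: real assume "t \<in> {0..1}"
      then show "t \<in> ?P \<union> ?Q" using cover[of t] by simp
    qed
    moreover have "0 \<in> ?P" "1 \<in> ?Q" using \<gamma>(2,3) rs by auto
    ultimately show False using P Q e unfolding connected_openin by blast
  qed
  then show ?thesis by blast
qed

end

section \<open>Compactness of closed balls in a complete manifold\<close>

context connected_riemannian
begin

lemma closed_mcball: "closed (mcball x r)"
  using closedin_mcball[of x r] by (simp add: mtopology_eq_euclidean)

lemma open_mball: "open (mball x r)"
  using openin_mball[of x r] by (simp add: mtopology_eq_euclidean)

lemma compact_mcball_mono:
  assumes "compact (mcball x s)" "r \<le> s"
  shows "compact (mcball x r)"
proof -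
  have "mcball x r = mcball x s \<inter> mcball x r" using assms(2) by auto
  then show ?thesis using compact_Int_closed[OF assms(1) closed_mcball, of x r] by simp
qed

lemma small_mcball_compact: "\<exists>e>0. compact (mcball x e)"
proof -
  obtain U \<phi> T r where n: "normal_chart x U \<phi> T r" using normal_chart_exists by blast
  note N = normal_chartD[OF n]
  obtain \<beta> :: "real ^ 'n \<Rightarrow> real" and V K where K: "open V" "x \<in> V" "V \<subseteq> K" "compact K"
    using chart_bump[OF N(1,2) open_UNIV UNIV_I] by metis
  obtain \<delta> where \<delta>: "\<delta> > 0" "\<And>q. q \<notin> V \<Longrightarrow> ennreal \<delta> \<le> edist x q" using edist_separation[OF K(1,2)] by blast
  have "mcball x (\<delta> / 2) \<subseteq> K"
  proof
    fix q assume "q \<in> mcball x (\<delta> / 2)"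
    then have "d x q < \<delta>" using \<delta>(1) by simp
    then have "\<not> ennreal \<delta> \<le> edist x q" by (simp add: edist_d d_nonneg)
    then show "q \<in> K" using \<delta>(2) K(3) by blast
  qed
  then have "mcball x (\<delta> / 2) = K \<inter> mcball x (\<delta> / 2)" by blast
  then have "compact (mcball x (\<delta> / 2))" using compact_Int_closed[OF K(4) closed_mcball] by metis
  then show ?thesis using \<delta>(1) by (intro exI[of _ "\<delta> / 2"]) simp
qed

text \<open>The compact ball is covered by finitely many balls of half the radius for which
  compactness is known. Points slightly farther out are, by the length property, within \<delta> of
  the ball, and so lie in the finite union of the full balls.\<close>

lemma compact_mcball_extend:
  assumes r: "0 \<le> r" "compact (mcball x r)"
  shows "\<exists>s>r. compact (mcball x s)"
proof -
  obtain e where e: "\<And>y. e y > 0" "\<And>y. compact (mcball y (e y))" using small_mcball_compact by metis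
  have "mcball x r \<subseteq> (\<Union>y\<in>mcball x r. mball y (e y / 2))" using e(1) by auto
  then obtain Y where Y: "Y \<subseteq> mcball x r" "finite Y" "mcball x r \<subseteq> (\<Union>y\<in>Y. mball y (e y / 2))"
    using compactE_image[OF r(2), of "mcball x r" "\<lambda>y. mball y (e y / 2)"] open_mball by metis
  have "x \<in> mcball x r" using r(1) by simp
  then have Yne: "Y \<noteq> {}" using Y(3) by blast
  define \<delta> where "\<delta> = Min (e ` Y) / 2"
  have \<delta>: "\<delta> > 0" using Yne Y(2) e(1) by (simp add: \<delta>_def)
  have \<delta>e: "\<delta> \<le> e y / 2" if "y \<in> Y" for y using that Y(2) by (simp add: \<delta>_def)
  let ?K = "\<Union>y\<in>Y. mcball y (e y)"
  have K: "compact ?K" using Y(2) e(2) by (rule compact_UN)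
  have near: "z \<in> ?K" if y: "y \<in> mcball x r" and z: "d y z < \<delta>" for y z
  proof -
    obtain w where w: "w \<in> Y" "d w y < e w / 2" using Y(3) y by auto
    have "d w z \<le> e w" using triangle[of w y z] w(2) z \<delta>e[OF w(1)] by simp
    then show ?thesis using w(1) by auto
  qed
  have "mcball x (r + \<delta> / 2) \<subseteq> ?K"
  proof
    fix z assume "z \<in> mcball x (r + \<delta> / 2)"
    then have z: "d x z < r + \<delta>" using \<delta> by simp
    show "z \<in> ?K"
    \<comment> \<open>The length property splits a distance into two positive parts, so radius 0 is
      separate.\<close>
    proof (cases "r = 0")
      case True
      then show ?thesis using near[of x z] z by simp
    next
      case False
      then obtain y where "d x y < r" "d y z < \<delta>" using length_space[OF z _ \<delta>] r(1) by auto
      then show ?thesis by (intro near[of y]) simp_all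
    qed
  qed
  then have "mcball x (r + \<delta> / 2) = ?K \<inter> mcball x (r + \<delta> / 2)" by blast
  then have "compact (mcball x (r + \<delta> / 2))" using compact_Int_closed[OF K closed_mcball] by metis
  then show ?thesis using \<delta> by (intro exI[of _ "r + \<delta> / 2"]) simp
qed

text \<open>Every point of the ball is close to a smaller concentric ball, which is compact and
  hence totally bounded; completeness turns total boundedness of a closed set into
  compactness.\<close>

lemma compact_mcball_limit:
  assumes c: "mcomplete" and s: "s > 0" "\<And>r. 0 \<le> r \<Longrightarrow> r < s \<Longrightarrow> compact (mcball x r)"
  shows "compact (mcball x s)"
proof -
  have "mtotally_bounded (mcball x s)"
    unfolding mtotally_bounded_def
  proof (intro allI impI)
    fix \<epsilon> :: real assume \<epsilon>: "\<epsilon> > 0"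
    \<comment> \<open>Points at distance at most \<open>s\<close> lie within \<epsilon>/2 of the
      ball whose radius is smaller by \<epsilon>/4; the maximum keeps the radius nonnegative when
      \<epsilon> is large.\<close>
    define r where "r = max 0 (s - \<epsilon> / 4)"
    have r: "0 \<le> r" "r < s" using s(1) \<epsilon> by (auto simp: r_def)
    have "mtotally_bounded (mcball x r)"
      using compactin_imp_mtotally_bounded[of "mcball x r"] s(2)[OF r] by (simp add: mtopology_eq_euclidean)
    then obtain K where K: "finite K" "K \<subseteq> mcball x r" "mcball x r \<subseteq> (\<Union>y\<in>K. mball y (\<epsilon> / 2))"
      unfolding mtotally_bounded_def using \<epsilon> half_gt_zero by metis
    have "mcball x s \<subseteq> (\<Union>y\<in>K. mball y \<epsilon>)"
    proof
      fix z assume "z \<in> mcball x s"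
      then have z: "d x z \<le> s" by simp
      have "\<exists>y. d x y \<le> r \<and> d y z < \<epsilon> / 2"
      proof (cases "s - \<epsilon> / 4 > 0")
        case True
        then obtain y where "d x y < s - \<epsilon> / 4" "d y z < \<epsilon> / 2"
          using length_space[of x z "s - \<epsilon> / 4" "\<epsilon> / 2"] z \<epsilon> by auto
        then show ?thesis by (intro exI[of _ y]) (simp add: r_def)
      next
        case False
        then show ?thesis using z \<epsilon> r(1) by (intro exI[of _ x]) simp
      qed
      then obtain y where y: "d x y \<le> r" "d y z < \<epsilon> / 2" by blast
      then obtain w where w: "w \<in> K" "d w y < \<epsilon> / 2" using K(3) by auto
      have "d w z < \<epsilon>" using triangle[of w y z] y(2) w(2) by simp
      then show "z \<in> (\<Union>y\<in>K. mball y \<epsilon>)" using w(1) by auto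
    qed
    moreover have "K \<subseteq> mcball x s" using K(2) r(2) by (auto intro: less_imp_le le_less_trans)
    ultimately show "\<exists>K. finite K \<and> K \<subseteq> mcball x s \<and> mcball x s \<subseteq> (\<Union>y\<in>K. mball y \<epsilon>)" using K(1) by blast
  qed
  then have "compactin mtopology (mtopology closure_of (mcball x s))"
    using mtotally_bounded_eq_compact_closure_of[OF c] by blast
  then show ?thesis
    using closure_of_eq[of mtopology "mcball x s"] closedin_mcball by (simp add: mtopology_eq_euclidean)
qed

text \<open>The part of the Hopf--Rinow theorem which does not involve geodesics.\<close>

theorem complete_imp_compact_mcball:
  assumes c: "mcomplete"
  shows "compact (mcball x R)"
proof (rule ccontr)
  assume R: "\<not> compact (mcball x R)"
  define B where "B = {r. 0 \<le> r \<and> \<not> compact (mcball x r)}"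
  have "0 \<le> R"
  proof (rule ccontr)
    assume "\<not> 0 \<le> R"
    then have "mcball x R = {}" by (simp add: mcball_eq_empty)
    then show False using R by simp
  qed
  then have RB: "R \<in> B" using R by (simp add: B_def)
  have bdd: "bdd_below B" by (rule bdd_belowI[of _ 0]) (simp add: B_def)
  \<comment> \<open>The threshold of failure. The ball of this radius is compact by approximation
    from inside, and then a slightly larger one is too, against the choice of the infimum.\<close>
  define s where "s = Inf B"
  have s0: "0 \<le> s" unfolding s_def using RB by (intro cInf_greatest) (auto simp: B_def)
  have less: "compact (mcball x r)" if "0 \<le> r" "r < s" for r
    using that cInf_lower[OF _ bdd, of r] unfolding s_def[symmetric] by (force simp: B_def)
  have "compact (mcball x s)"
  proof (cases "s = 0")
    case True
    have "mcball x 0 = {x}" by (auto dest!: order_antisym[OF _ d_nonneg])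
    then show ?thesis unfolding True by simp
  next
    case False
    then have "0 < s" using s0 by simp
    then show ?thesis by (rule compact_mcball_limit[OF c]) (rule less)
  qed
  then obtain s' where s': "s' > s" "compact (mcball x s')" using compact_mcball_extend[OF s0] by blast
  have "s' \<le> r" if "r \<in> B" for r
    using compact_mcball_mono[OF s'(2), of r] that by (force simp: B_def)
  then have "s' \<le> s" unfolding s_def using RB by (intro cInf_greatest) auto
  then show False using s'(1) by simp
qed

end

section \<open>Smoothing of distance functions\<close>

text \<open>Outside [0, 1] the step is locally constant, and on this compact interval its derivative
  is continuous.\<close>

lemma smooth_step_deriv_bound:
  obtains S where "S > 0" "\<And>t. \<exists>D. (smooth_step has_real_derivative D) (at t) \<and> \<bar>D\<bar> \<le> S"
proof -
  define D where "D t = frechet_derivative smooth_step (at t) 1" for t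
  have d: "(smooth_step has_real_derivative D t) (at t)" for t
  proof -
    have fd: "(smooth_step has_derivative frechet_derivative smooth_step (at t)) (at t)"
      by (rule smooth_on_imp_has_derivative[OF smooth_on_smooth_step UNIV_I])
    have "frechet_derivative smooth_step (at t) s = D t * s" for s
      using linear_cmul[OF has_derivative_linear[OF fd], of s 1] by (simp add: D_def)
    then have "frechet_derivative smooth_step (at t) = (*) (D t)" by (rule ext)
    then show ?thesis using fd by (simp add: has_field_derivative_def)
  qed
  have "continuous_on {0..1} D"
    unfolding D_def by (rule continuous_on_subset[OF smooth_on_imp_continuous_on[OF smooth_on_frechet[OF smooth_on_smooth_step]]]) simp
  then have "bounded (D ` {0..1})" by (intro compact_imp_bounded compact_continuous_image) auto
  then obtain S where "\<forall>y\<in>D ` {0..1}. norm y \<le> S" unfolding bounded_iff by blast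
  then have S: "\<bar>D t\<bar> \<le> S" if "t \<in> {0..1}" for t using that by simp
  have "\<bar>D t\<bar> \<le> max S 1" for t
  proof -
    consider "t \<in> {0..1}" | "t < 0" | "t > 1" by fastforce
    then show ?thesis
    proof cases
      case 2
      have "(smooth_step has_real_derivative 0) (at t)"
        by (rule DERIV_cong_ev[OF refl _ refl, THEN iffD1, OF _ DERIV_const[of 0]])
          (use eventually_nhds_in_open[OF open_lessThan, of t 0] 2 in \<open>auto elim!: eventually_mono simp: smooth_step_0\<close>)
      then show ?thesis using DERIV_unique[OF d] by auto
    next
      case 3
      have "(smooth_step has_real_derivative 0) (at t)"
        by (rule DERIV_cong_ev[OF refl _ refl, THEN iffD1, OF _ DERIV_const[of 1]])
          (use eventually_nhds_in_open[OF open_greaterThan, of t 1] 3 in \<open>auto elim!: eventually_mono simp: smooth_step_1\<close>)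
      then show ?thesis using DERIV_unique[OF d] by auto
    qed (use S[of t] in auto)
  qed
  then show ?thesis using d by (intro that[of "max S 1"]) auto
qed

context connected_riemannian
begin

text \<open>A single \<delta> measures the error in value and the excess of the gradient over
  \<open>L\<close>. Gluing trades one for the other, so it can be iterated without enlarging
  \<open>L\<close>.\<close>

definition approximates :: "real \<Rightarrow> ('m \<Rightarrow> real) \<Rightarrow> real \<Rightarrow> 'm set \<Rightarrow> ('m \<Rightarrow> real) \<Rightarrow> bool" where
  "approximates L u \<delta> S w \<longleftrightarrow> smooth_fun A w \<and>
    (\<forall>q\<in>S. \<bar>w q - u q\<bar> \<le> \<delta> \<and> (\<forall>x\<in>tangent_space A q. \<bar>x w\<bar> \<le> (L + \<delta>) * sqrt (g q x x)))"

lemma approximatesD: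
  assumes "approximates L u \<delta> S w"
  shows "smooth_fun A w" "q \<in> S \<Longrightarrow> \<bar>w q - u q\<bar> \<le> \<delta>"
    "q \<in> S \<Longrightarrow> x \<in> tangent_space A q \<Longrightarrow> \<bar>x w\<bar> \<le> (L + \<delta>) * sqrt (g q x x)"
  using assms unfolding approximates_def by blast+

text \<open>In a normal chart \<open>d\<close> is at most twice the Euclidean distance, so half of
  \<open>u\<close> is 1-Lipschitz there and can be smoothed. Undoing the halving and comparing norms
  costs a factor 2 each, hence \<open>4 * L\<close>. For the later gluing the neighbourhood must not
  depend on \<delta>.\<close>

lemma local_approximation:
  "\<exists>L>0. \<forall>u. (\<forall>x y. \<bar>u x - u y\<bar> \<le> d x y) \<longrightarrow>
    (\<forall>p. \<exists>W. open W \<and> p \<in> W \<and> (\<forall>\<delta>>0. \<exists>w. approximates L u \<delta> W w))"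
proof -
  obtain L where L: "L > 0"
    "\<And>(u :: real ^ 'n \<Rightarrow> real) y0 r e. r > 0 \<Longrightarrow> e > 0 \<Longrightarrow>
      (\<And>x y. x \<in> ball y0 (2 * r) \<Longrightarrow> y \<in> ball y0 (2 * r) \<Longrightarrow> \<bar>u x - u y\<bar> \<le> dist x y) \<Longrightarrow>
      \<exists>V. smooth_on UNIV V \<and>
        (\<forall>y\<in>ball y0 r. \<bar>V y - u y\<bar> \<le> e \<and> (\<forall>v. \<bar>frechet_derivative V (at y) v\<bar> \<le> L * norm v))"
    using Lipschitz_smoothing by blast
  have "\<exists>W. open W \<and> p \<in> W \<and> (\<forall>\<delta>>0. \<exists>w. approximates (4 * L) u \<delta> W w)"
    if u: "\<forall>x y. \<bar>u x - u y\<bar> \<le> d x y" for u p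
  proof -
    obtain U \<phi> T r where n: "normal_chart p U \<phi> T r" using normal_chart_exists by blast
    note N = normal_chartD[OF n]
    have bT: "bounded_linear T" using N(3) by (simp add: linear_conv_bounded_linear)
    let ?y0 = "T (\<phi> p)"
    define \<kappa> where "\<kappa> y = inv_into U \<phi> (inv T y)" for y
    have \<kappa>: "\<kappa> y \<in> U" "T (\<phi> (\<kappa> y)) = y" if y: "y \<in> ball ?y0 (3 * r)" for y
    proof -
      obtain z where z: "z \<in> \<phi> ` U" "y = T z" using subsetD[OF N(6) y] by auto
      have "inv T y = z" unfolding z(2) by (rule inv_f_f[OF bij_is_inj[OF N(4)]])
      then show "\<kappa> y \<in> U" "T (\<phi> (\<kappa> y)) = y" using z by (auto simp: \<kappa>_def inv_into_into f_inv_into_f)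
    qed
    have \<kappa>': "\<kappa> (T (\<phi> q)) = q" if "q \<in> U" for q
      using that by (simp add: \<kappa>_def inv_f_f[OF bij_is_inj[OF N(4)]] chart_inv[OF N(1)])
    \<comment> \<open>Made smooth for every \<open>V\<close>, so that one application of
      \<open>local_smooth_extension\<close> yields a neighbourhood valid for all the smoothings that
      the different \<delta> produce.\<close>
    define H where "H V y = (if smooth_on UNIV V then 2 * V (T y) else 0)" for V :: "real ^ 'n \<Rightarrow> real" and y
    have H: "smooth_on UNIV (H V)" for V
    proof (cases "smooth_on UNIV V")
      case True
      have "smooth_on UNIV (\<lambda>y. V (T y))"
        by (rule smooth_on_compose[OF open_UNIV subset_UNIV True smooth_on_linear[OF open_UNIV bT]])
      then have "smooth_on UNIV (\<lambda>y. 2 * V (T y))" by (rule smooth_on_mult[OF open_UNIV smooth_on_const])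
      then show ?thesis using True by (simp add: H_def[abs_def])
    qed (simp add: H_def[abs_def] smooth_on_const)
    obtain h W where h: "\<And>V. smooth_fun A (h V)" "open W" "p \<in> W" "W \<subseteq> U"
      "\<And>q V. q \<in> W \<Longrightarrow> \<phi> q \<in> UNIV \<and> h V q = H V (\<phi> q)"
      using that by (rule local_smooth_extension[where H = H, OF N(1,2) open_UNIV UNIV_I H])
    define W' where "W' = W \<inter> {q \<in> U. dist ?y0 (T (\<phi> q)) < r}"
    have W': "open W'" "p \<in> W'" unfolding W'_def using h(2,3) normal_chart_nbhd[OF n, of r] N(2,5) by auto
    have "\<exists>w. approximates (4 * L) u \<delta> W' w" if \<delta>: "\<delta> > 0" for \<delta>
    proof -
      have "\<exists>V. smooth_on UNIV V \<and>
        (\<forall>y\<in>ball ?y0 r. \<bar>V y - u (\<kappa> y) / 2\<bar> \<le> \<delta> / 2 \<and> (\<forall>v. \<bar>frechet_derivative V (at y) v\<bar> \<le> L * norm v))"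
      proof (rule L(2)[OF N(5)])
        show "\<delta> / 2 > 0" using \<delta> by simp
        fix x y assume "x \<in> ball ?y0 (2 * r)" "y \<in> ball ?y0 (2 * r)"
        then have xy: "x \<in> ball ?y0 (3 * r)" "y \<in> ball ?y0 (3 * r)" using N(5) by auto
        have "\<bar>u (\<kappa> x) - u (\<kappa> y)\<bar> \<le> d (\<kappa> x) (\<kappa> y)" by (rule u[rule_format])
        also have "... \<le> 2 * dist x y" using d_local[OF n \<kappa>(1)[OF xy(1)] _ \<kappa>(1)[OF xy(2)]] \<kappa>(2) xy by simp
        finally show "\<bar>u (\<kappa> x) / 2 - u (\<kappa> y) / 2\<bar> \<le> dist x y" by simp
      qed
      then obtain V where V: "smooth_on UNIV V" "\<And>y. y \<in> ball ?y0 r \<Longrightarrow> \<bar>V y - u (\<kappa> y) / 2\<bar> \<le> \<delta> / 2"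
        "\<And>y v. y \<in> ball ?y0 r \<Longrightarrow> \<bar>frechet_derivative V (at y) v\<bar> \<le> L * norm v" by blast
      have "approximates (4 * L) u \<delta> W' (h V)"
        unfolding approximates_def
      proof (intro conjI ballI h(1))
        fix q assume "q \<in> W'"
        then have q: "q \<in> W" "q \<in> U" "T (\<phi> q) \<in> ball ?y0 r" "T (\<phi> q) \<in> ball ?y0 (3 * r)" using N(5) by (auto simp: W'_def)
        have hq: "h V q' = 2 * V (T (\<phi> q'))" if "q' \<in> W" for q' using h(5)[OF that, of V] V(1) by (simp add: H_def)
        have "\<bar>V (T (\<phi> q)) - u q / 2\<bar> \<le> \<delta> / 2" using V(2)[OF q(3)] \<kappa>'[OF q(2)] by simp
        then show "\<bar>h V q - u q\<bar> \<le> \<delta>" unfolding hq[OF q(1)] by linarith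
        fix x assume x: "x \<in> tangent_space A q"
        obtain a where a: "x = coord_vec A (U, \<phi>) q a" using tangent_in_chart[OF x N(1) q(2)] .
        have "x (h V) = 2 * frechet_derivative V (at (T (\<phi> q))) (T a)"
          unfolding a
        proof (rule coord_vec_local[OF h(1) N(1) q(2) h(2) q(1)])
          show "h V q' = 2 * V (T (\<phi> q'))" if "q' \<in> W" for q' by (rule hq[OF that])
          show "((\<lambda>y. 2 * V (T y)) has_derivative (\<lambda>a. 2 * frechet_derivative V (at (T (\<phi> q))) (T a))) (at (\<phi> q))"
            by (intro has_derivative_mult_right has_derivative_compose[OF bounded_linear_imp_has_derivative[OF bT]]
                smooth_on_imp_has_derivative[OF V(1) UNIV_I])
        qed
        then have "\<bar>x (h V)\<bar> \<le> 2 * (L * norm (T a))" using V(3)[OF q(3), of "T a"] by simp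
        also have "... \<le> 2 * (L * (2 * sqrt (g q x x)))"
          using N(7)[OF q(2,4), of a] L(1) unfolding a by (intro mult_left_mono) auto
        also have "... \<le> (4 * L + \<delta>) * sqrt (g q x x)"
          using \<delta> g_nonneg[OF x] by (simp add: algebra_simps)
        finally show "\<bar>x (h V)\<bar> \<le> (4 * L + \<delta>) * sqrt (g q x x)" .
      qed
      then show ?thesis by blast
    qed
    then show ?thesis using W' by blast
  qed
  then show ?thesis using L(1) by (intro exI[of _ "4 * L"] conjI allI impI) simp_all
qed

text \<open>Interpolation by a bump adds to the gradient the derivative of the bump times the
  difference of the two approximations. On the overlap that difference is as small as desired, so a
  finer accuracy \<epsilon> absorbs the extra term.\<close>

lemma approximates_glue:
  assumes w: "\<And>\<delta>. \<delta> > 0 \<Longrightarrow> \<exists>w. approximates L u \<delta> S w" and v: "\<And>\<delta>. \<delta> > 0 \<Longrightarrow> \<exists>w. approximates L u \<delta> W w"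
    and b: "smooth_fun A b" "\<And>q. 0 \<le> b q" "\<And>q. b q \<le> 1" "open V" "compact K" "V \<subseteq> K" "K \<subseteq> W"
      "\<And>q. q \<in> V \<Longrightarrow> b q = 1" "\<And>q. q \<notin> K \<Longrightarrow> b q = 0"
    and L: "L > 0" and \<delta>: "\<delta> > 0"
  shows "\<exists>w. approximates L u \<delta> (S \<union> V) w"
proof -
  obtain G where G: "G > 0" "\<And>p v. v \<in> tangent_space A p \<Longrightarrow> \<bar>v b\<bar> \<le> G * sqrt (g p v v)"
    using compact_support_Lipschitz[OF b(1,5,9)] by blast
  \<comment> \<open>The gradient excess after gluing is at most \<epsilon> + 2 \<epsilon> G, which
    this choice makes equal to \<delta>.\<close>
  define \<epsilon> where "\<epsilon> = \<delta> / (1 + 2 * G)"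
  have "\<epsilon> * (1 + 2 * G) = \<delta>" "\<epsilon> > 0" using \<delta> G(1) by (simp_all add: \<epsilon>_def)
  then have \<epsilon>: "\<epsilon> > 0" "\<epsilon> + 2 * \<epsilon> * G = \<delta>" by (simp_all add: algebra_simps)
  then have \<epsilon>\<delta>: "\<epsilon> \<le> \<delta>" using mult_pos_pos[OF \<epsilon>(1) G(1)] by linarith
  obtain w where w: "approximates L u \<epsilon> S w" using w[OF \<epsilon>(1)] by blast
  obtain v where v: "approximates L u \<epsilon> W v" using v[OF \<epsilon>(1)] by blast
  note W = approximatesD[OF w] and V = approximatesD[OF v]
  let ?w = "\<lambda>q. w q + b q * (v q - w q)"
  note sd = smooth_fun_diff[OF V(1) W(1)]
  note sm = smooth_fun_mult[OF b(1) sd]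
  have deriv: "x ?w = x w + (b q * (x v - x w) + x b * (v q - w q))" if x: "x \<in> tangent_space A q" for x q
    by (simp add: tangent_add[OF x W(1) sm] tangent_mult[OF x b(1) sd] tangent_minus_fun[OF x V(1) W(1)])
  have "approximates L u \<delta> (S \<union> V) ?w"
    unfolding approximates_def
  proof (intro conjI smooth_fun_add[OF W(1) sm] ballI)
    fix q assume q: "q \<in> S \<union> V"
    \<comment> \<open>On \<open>V\<close> the glued function is \<open>v\<close>, off
      \<open>K\<close> it is \<open>w\<close>, and in the remaining case both approximations are
      available.\<close>
    consider (1) "q \<in> V" | (2) "q \<in> S" "q \<notin> K" | (3) "q \<in> S" "q \<in> W" using q b(7) by blast
    note cs = this
    show "\<bar>?w q - u q\<bar> \<le> \<delta>"
      using cs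
    proof cases
      case 1
      then have "q \<in> W" using b(6,7) by blast
      then show ?thesis using b(8)[OF 1] V(2)[of q] \<epsilon>\<delta> by simp
    next
      case 2
      then show ?thesis using b(9)[OF 2(2)] W(2)[of q] \<epsilon>\<delta> by simp
    next
      case 3
      have "?w q - u q = (1 - b q) * (w q - u q) + b q * (v q - u q)" by (simp add: algebra_simps)
      then have "\<bar>?w q - u q\<bar> \<le> (1 - b q) * \<bar>w q - u q\<bar> + b q * \<bar>v q - u q\<bar>"
        using b(2,3)[of q] abs_triangle_ineq[of "(1 - b q) * (w q - u q)" "b q * (v q - u q)"] by (simp add: abs_mult)
      also have "... \<le> (1 - b q) * \<epsilon> + b q * \<epsilon>"
        using b(2,3)[of q] W(2)[OF 3(1)] V(2)[OF 3(2)] by (intro add_mono mult_left_mono) auto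
      also have "... \<le> \<delta>" using \<epsilon>\<delta> by (simp add: algebra_simps)
      finally show ?thesis .
    qed
    fix x assume x: "x \<in> tangent_space A q"
    let ?n = "sqrt (g q x x)"
    have n: "0 \<le> ?n" using g_nonneg[OF x] by simp
    have mono: "(L + \<epsilon>) * ?n \<le> (L + \<delta>) * ?n" using \<epsilon>\<delta> n by (intro mult_right_mono) auto
    show "\<bar>x ?w\<bar> \<le> (L + \<delta>) * ?n"
      using cs
    proof cases
      case 1
      have "x (\<lambda>q. b q - 1) = 0"
        by (rule tangent_vanish[OF x smooth_fun_diff[OF b(1) smooth_fun_const] b(4) 1]) (simp add: b(8))
      then have "x b = 0" by (simp add: tangent_minus_fun[OF x b(1) smooth_fun_const] tangent_const[OF x])
      moreover have "q \<in> W" using 1 b(6,7) by blast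
      ultimately show ?thesis using b(8)[OF 1] V(3)[of q, OF _ x] mono by (simp add: deriv[OF x])
    next
      case 2
      have "x b = 0"
        by (rule tangent_vanish[OF x b(1), of "- K"]) (use 2 b(5,9) in \<open>auto simp: compact_imp_closed open_Compl\<close>)
      then show ?thesis using b(9)[OF 2(2)] W(3)[OF 2(1) x] mono by (simp add: deriv[OF x])
    next
      case 3
      have "x ?w = ((1 - b q) * x w + b q * x v) + x b * (v q - w q)" unfolding deriv[OF x] by (simp add: algebra_simps)
      also have "\<bar>...\<bar> \<le> ((1 - b q) * \<bar>x w\<bar> + b q * \<bar>x v\<bar>) + \<bar>x b\<bar> * \<bar>v q - w q\<bar>"
        using b(2,3)[of q] by (intro order_trans[OF abs_triangle_ineq] add_mono order_trans[OF abs_triangle_ineq])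
          (simp_all add: abs_mult)
      also have "... \<le> ((1 - b q) * ((L + \<epsilon>) * ?n) + b q * ((L + \<epsilon>) * ?n)) + (G * ?n) * (2 * \<epsilon>)"
      proof (intro add_mono mult_left_mono mult_mono)
        show "\<bar>v q - w q\<bar> \<le> 2 * \<epsilon>" using W(2)[OF 3(1)] V(2)[OF 3(2)] by linarith
      qed (use b(2,3)[of q] W(3)[OF 3(1) x] V(3)[OF 3(2) x] G(1) G(2)[OF x] n in auto)
      also have "... = (L + (\<epsilon> + 2 * \<epsilon> * G)) * ?n" by (simp add: algebra_simps)
      also have "... = (L + \<delta>) * ?n" by (simp only: \<epsilon>(2))
      finally show ?thesis .
    qed
  qed
  then show ?thesis by blast
qed

text \<open>A finite cover and repeated gluing. The order of the quantifiers matters: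
  \<open>L\<close> is fixed before \<open>u\<close>, \<open>K\<close> and \<delta>, so the cutoffs
  below get a constant that is uniform in the scale.\<close>

lemma compact_approximation:
  "\<exists>L>0. \<forall>u. (\<forall>x y. \<bar>u x - u y\<bar> \<le> d x y) \<longrightarrow> (\<forall>K \<delta>. compact K \<longrightarrow> \<delta> > 0 \<longrightarrow>
    (\<exists>w. approximates L u \<delta> K w))"
proof -
  obtain L where L: "L > 0" "\<forall>u. (\<forall>x y. \<bar>u x - u y\<bar> \<le> d x y) \<longrightarrow>
    (\<forall>p. \<exists>W. open W \<and> p \<in> W \<and> (\<forall>\<delta>>0. \<exists>w. approximates L u \<delta> W w))"
    using local_approximation by (elim exE conjE)
  have "\<exists>w. approximates L u \<delta> K w" if u: "\<forall>x y. \<bar>u x - u y\<bar> \<le> d x y" and K: "compact K" and "\<delta> > 0" for u K \<delta>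
  proof -
    obtain W where W: "\<And>p. open (W p)" "\<And>p. p \<in> W p" "\<And>p \<delta>. \<delta> > 0 \<Longrightarrow> \<exists>w. approximates L u \<delta> (W p) w"
      using L(2)[rule_format, OF u[rule_format]] by metis
    define bump where "bump p \<eta> V K \<longleftrightarrow> smooth_fun A \<eta> \<and> (\<forall>q. 0 \<le> \<eta> q) \<and> (\<forall>q. \<eta> q \<le> 1) \<and> open V \<and> p \<in> V \<and> V \<subseteq> K \<and> compact K \<and> K \<subseteq> W p \<and>
      (\<forall>q\<in>V. \<eta> q = 1) \<and> (\<forall>q. q \<notin> K \<longrightarrow> \<eta> q = 0)" for p \<eta> V K
    have "\<exists>\<eta> V K. bump p \<eta> V K" for p
    proof (rule smooth_bump[OF W(1)[of p] W(2)[of p]])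
      fix \<eta> V K assume b: "smooth_fun A \<eta>" "\<And>q. 0 \<le> \<eta> q" "\<And>q. \<eta> q \<le> 1" "open V" "p \<in> V" "V \<subseteq> K" "compact K" "K \<subseteq> W p"
        "\<And>q. q \<in> V \<Longrightarrow> \<eta> q = 1" "\<And>q. q \<notin> K \<Longrightarrow> \<eta> q = 0"
      have "bump p \<eta> V K" unfolding bump_def by (intro conjI ballI allI impI b)
      then show ?thesis by blast
    qed
    then obtain \<eta> V C where "\<And>p. bump p (\<eta> p) (V p) (C p)" by metis
    note this[unfolded bump_def]
    then have \<eta>: "\<And>p. smooth_fun A (\<eta> p)" "\<And>p q. 0 \<le> \<eta> p q" "\<And>p q. \<eta> p q \<le> 1" "\<And>p. open (V p)" "\<And>p. p \<in> V p"
      "\<And>p. V p \<subseteq> C p" "\<And>p. compact (C p)" "\<And>p. C p \<subseteq> W p" "\<And>p q. q \<in> V p \<Longrightarrow> \<eta> p q = 1" "\<And>p q. q \<notin> C p \<Longrightarrow> \<eta> p q = 0"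
      by (simp_all only: simp_thms)
    have fin: "\<exists>w. approximates L u \<delta> (\<Union>p\<in>P. V p) w" if "finite P" "\<delta> > 0" for P \<delta>
      using that
    proof (induction P arbitrary: \<delta> rule: finite_induct)
      case empty
      show ?case by (simp add: approximates_def) (blast intro: smooth_fun_const)
    next
      case (insert p P)
      have "\<exists>w. approximates L u \<delta> ((\<Union>p\<in>P. V p) \<union> V p) w"
        by (rule approximates_glue[OF insert.IH W(3)[of _ p] \<eta>(1)[of p] \<eta>(2,3) \<eta>(4,7,6,8)[of p] \<eta>(9,10) L(1) insert.prems])
      then show ?case by (simp add: Un_commute)
    qed
    have cov: "K \<subseteq> (\<Union>p\<in>K. V p)" using \<eta>(5) by blast
    obtain P where P: "P \<subseteq> K" "finite P" "K \<subseteq> (\<Union>p\<in>P. V p)" by (rule compactE_image[OF K \<eta>(4) cov])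
    obtain w where "approximates L u \<delta> (\<Union>p\<in>P. V p) w" using fin[OF P(2) \<open>\<delta> > 0\<close>] by blast
    then show ?thesis using P(3) unfolding approximates_def by blast
  qed
  then show ?thesis using L(1) by (intro exI[of _ L] conjI allI impI) simp_all
qed

text \<open>A step of a smoothed distance \<open>w\<close> that on \<open>mcball p (3 * R)\<close>
  differs from the distance by at most R/4. The argument 6 - 4 w / R is at least 1 where the
  distance is at most R, and at most 0 where it lies between 7R/4 and 3R.\<close>

lemma cutoff_exists:
  assumes complete: "mcomplete"
  shows "\<exists>C>0. \<forall>R>0. \<exists>\<eta>. test_fun A \<eta> \<and> (\<forall>q. 0 \<le> \<eta> q \<and> \<eta> q \<le> 1) \<and> (\<forall>q. d p q \<le> R \<longrightarrow> \<eta> q = 1) \<and>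
    (\<forall>q. d p q \<ge> 2 * R \<longrightarrow> \<eta> q = 0) \<and>
    (\<forall>q. \<forall>x\<in>tangent_space A q. \<bar>x \<eta>\<bar> \<le> (if d p q < 2 * R then C / R * sqrt (g q x x) else 0))"
proof -
  obtain L where L: "L > 0" "\<forall>u. (\<forall>x y. \<bar>u x - u y\<bar> \<le> d x y) \<longrightarrow> (\<forall>K \<delta>. compact K \<longrightarrow> \<delta> > 0 \<longrightarrow>
    (\<exists>w. approximates L u \<delta> K w))" using compact_approximation by (elim exE conjE)
  obtain S where S: "S > 0" "\<And>t. \<exists>D. (smooth_step has_real_derivative D) (at t) \<and> \<bar>D\<bar> \<le> S"
    using that by (rule smooth_step_deriv_bound)
  have lip: "\<bar>d p x - d p y\<bar> \<le> d x y" for x y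
    using triangle[of p x y] triangle[of p y x] commute[of x y] by simp
  show ?thesis
  proof (intro exI[of _ "4 * S * (L + 1)"] conjI allI impI)
    show "4 * S * (L + 1) > 0" using S(1) L(1) by simp
    fix R :: real assume R: "R > 0"
    define \<delta> where "\<delta> = min 1 (R / 4)"
    have \<delta>: "\<delta> > 0" "\<delta> \<le> 1" "\<delta> \<le> R / 4" using R by (auto simp: \<delta>_def)
    obtain w where "approximates L (d p) \<delta> (mcball p (3 * R)) w"
      using L(2)[rule_format, OF lip complete_imp_compact_mcball[OF complete, of p "3 * R"] \<delta>(1)] by (elim exE)
    note w = approximatesD[OF this]
    define h where "h q = smooth_step (6 + (- 4 / R) * w q)" for q
    have sw: "smooth_fun A (\<lambda>q. 6 + (- 4 / R) * w q)"
      by (rule smooth_fun_add[OF smooth_fun_const smooth_fun_mult[OF smooth_fun_const w(1)]])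
    have h: "smooth_fun A h" unfolding h_def[abs_def] by (rule smooth_fun_compose[OF smooth_on_smooth_step sw UNIV_I])
    \<comment> \<open>Far away \<open>w\<close> is uncontrolled, so the function is set to 0 there
      by hand. In the shell between 7R/4 and 3R both prescriptions give 0, which keeps the result
      smooth.\<close>
    define \<eta> where "\<eta> q = (if d p q < 2 * R then h q else 0)" for q
    have h0: "h q = 0" if "7 / 4 * R \<le> d p q" "d p q < 3 * R" for q
    proof -
      have "3 / 2 * R \<le> w q" using w(2)[of q] that \<delta>(3) by auto
      then have "4 / R * (3 / 2 * R) \<le> 4 / R * w q" using R by (intro mult_left_mono) auto
      then show ?thesis unfolding h_def using R by (intro smooth_step_0) simp
    qed
    have h1: "h q = 1" if "d p q \<le> R" for q
    proof -
      have "w q \<le> 5 / 4 * R" using w(2)[of q] that \<delta>(3) R by auto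
      then have "4 / R * w q \<le> 4 / R * (5 / 4 * R)" using R by (intro mult_left_mono) auto
      then show ?thesis unfolding h_def using R by (intro smooth_step_1) simp
    qed
    have far: "open (- mcball p (7 / 4 * R))" using closed_mcball by (rule open_Compl)
    have \<eta>h: "\<eta> q = h q" if "q \<in> mball p (3 * R)" for q using h0[of q] that R by (auto simp: \<eta>_def)
    have \<eta>0: "\<eta> q = 0" if "q \<in> - mcball p (7 / 4 * R)" for q using h0[of q] that R by (auto simp: \<eta>_def)
    have \<eta>: "smooth_fun A \<eta>"
    proof (rule smooth_fun_local)
      fix q
      show "\<exists>W k. open W \<and> q \<in> W \<and> smooth_fun A k \<and> (\<forall>q\<in>W. \<eta> q = k q)"
      proof (cases "q \<in> mball p (3 * R)")
        case True
        then show ?thesis using open_mball h \<eta>h by blast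
      next
        case False
        then have "q \<in> - mcball p (7 / 4 * R)" using R by auto
        then show ?thesis using far smooth_fun_const[of 0] \<eta>0 by blast
      qed
    qed
    have "closure {q. \<eta> q \<noteq> 0} \<subseteq> mcball p (2 * R)"
      by (rule closure_minimal[OF _ closed_mcball]) (auto simp: \<eta>_def)
    then have "closure {q. \<eta> q \<noteq> 0} = mcball p (2 * R) \<inter> closure {q. \<eta> q \<noteq> 0}" by blast
    then have "compact (closure {q. \<eta> q \<noteq> 0})"
      using compact_Int_closed[OF complete_imp_compact_mcball[OF complete] closed_closure] by metis
    then have "test_fun A \<eta>" using \<eta> by (simp add: test_fun_def)
    moreover have "\<bar>x \<eta>\<bar> \<le> (if d p q < 2 * R then 4 * S * (L + 1) / R * sqrt (g q x x) else 0)"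
      if x: "x \<in> tangent_space A q" for q x
    proof (cases "d p q < 2 * R")
      case True
      have q: "q \<in> mball p (3 * R)" "q \<in> mcball p (3 * R)" using True R by auto
      obtain D where D: "(smooth_step has_real_derivative D) (at (6 + (- 4 / R) * w q))" "\<bar>D\<bar> \<le> S" using S(2) by blast
      have "x \<eta> = x h" by (rule tangent_local[OF x \<eta> h open_mball q(1) \<eta>h])
      also have "... = D * x (\<lambda>q. 6 + (- 4 / R) * w q)"
        unfolding h_def[abs_def] by (rule tangent_compose[OF x smooth_on_smooth_step sw D(1)])
      also have "x (\<lambda>q. 6 + (- 4 / R) * w q) = (- 4 / R) * x w"
        using tangent_add[OF x smooth_fun_const smooth_fun_mult[OF smooth_fun_const w(1)], of 6 "- 4 / R"]
          tangent_const[OF x, of 6] tangent_cmult[OF x w(1), of "- 4 / R"] by simp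
      finally have "\<bar>x \<eta>\<bar> = \<bar>D\<bar> * (4 / R * \<bar>x w\<bar>)" using R by (simp add: abs_mult)
      also have "... \<le> S * (4 / R * ((L + 1) * sqrt (g q x x)))"
      proof (intro mult_mono mult_left_mono D(2))
        have "\<bar>x w\<bar> \<le> (L + \<delta>) * sqrt (g q x x)" by (rule w(3)[OF q(2) x])
        also have "... \<le> (L + 1) * sqrt (g q x x)" using \<delta>(2) g_nonneg[OF x] by (intro mult_right_mono) auto
        finally show "\<bar>x w\<bar> \<le> (L + 1) * sqrt (g q x x)" .
      qed (use S(1) R in auto)
      finally show ?thesis using True by (simp add: field_simps)
    next
      case False
      then have "x \<eta> = 0" by (intro tangent_vanish[OF x \<eta> far _ \<eta>0]) (use R in auto)
      then show ?thesis using False by simp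
    qed
    moreover have "\<eta> q = 1" if "d p q \<le> R" for q using h1[OF that] that R by (simp add: \<eta>_def)
    ultimately show "\<exists>\<eta>. test_fun A \<eta> \<and> (\<forall>q. 0 \<le> \<eta> q \<and> \<eta> q \<le> 1) \<and> (\<forall>q. d p q \<le> R \<longrightarrow> \<eta> q = 1) \<and>
      (\<forall>q. d p q \<ge> 2 * R \<longrightarrow> \<eta> q = 0) \<and>
      (\<forall>q. \<forall>x\<in>tangent_space A q. \<bar>x \<eta>\<bar> \<le> (if d p q < 2 * R then 4 * S * (L + 1) / R * sqrt (g q x x) else 0))"
      by (intro exI[of _ \<eta>]) (auto simp: \<eta>_def h_def smooth_step_ge_0 smooth_step_le_1)
  qed
qed

end

section \<open>Logarithmic cutoffs under quadratic volume growth\<close>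

text \<open>A sum of distinct powers of 1/2 is at most twice its largest term. Applied to gradient
  bounds that decay with the scale, this replaces disjointness of supports: the square of the sum is
  at most a constant times the sum of the squares.\<close>

lemma sum_half_powers_squared:
  fixes J :: "nat set"
  assumes J: "finite J"
  shows "(\<Sum>j\<in>J. (1 / 2 :: real) ^ j)\<^sup>2 \<le> 4 * (\<Sum>j\<in>J. (1 / 4) ^ j)"
proof (cases "J = {}")
  case False
  define m where "m = Min J"
  have m: "m \<in> J" "\<And>j. j \<in> J \<Longrightarrow> m \<le> j" using J False by (simp_all add: m_def)
  have geo: "(\<Sum>i<n. (1 / 2 :: real) ^ i) = 2 - 2 * (1 / 2) ^ n" for n by (induction n) auto
  have "(\<Sum>j\<in>J. (1 / 2 :: real) ^ j) = (\<Sum>i\<in>(\<lambda>j. j - m) ` J. (1 / 2) ^ (m + i))"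
  proof (subst sum.reindex)
    show "inj_on (\<lambda>j. j - m) J" using m(2) by (metis (no_types, lifting) eq_diff_iff inj_onI)
    show "(\<Sum>j\<in>J. (1 / 2 :: real) ^ j) = sum ((\<lambda>i. (1 / 2) ^ (m + i)) \<circ> (\<lambda>j. j - m)) J"
      by (rule sum.cong) (use m(2) in auto)
  qed
  also have "... \<le> (\<Sum>i<Suc (Max J). (1 / 2) ^ (m + i))"
  proof (rule sum_mono2)
    show "(\<lambda>j. j - m) ` J \<subseteq> {..<Suc (Max J)}" by (auto simp: less_Suc_eq_le intro!: le_trans[OF diff_le_self Max_ge[OF J]])
  qed auto
  also have "... = (1 / 2) ^ m * (\<Sum>i<Suc (Max J). (1 / 2) ^ i)" by (simp only: power_add sum_distrib_left)
  also have "... \<le> (1 / 2) ^ m * 2" unfolding geo by (intro mult_left_mono) auto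
  finally have "(\<Sum>j\<in>J. (1 / 2 :: real) ^ j)\<^sup>2 \<le> ((1 / 2) ^ m * 2)\<^sup>2" by (intro power_mono sum_nonneg) auto
  also have "... = 4 * (1 / 4) ^ m" by (simp add: power2_eq_square power_mult_distrib[symmetric])
  also have "... \<le> 4 * (\<Sum>j\<in>J. (1 / 4) ^ j)" using J m(1) by (intro mult_left_mono member_le_sum) auto
  finally show ?thesis .
qed simp

context connected_riemannian
begin

definition cutoff :: "'m \<Rightarrow> real \<Rightarrow> real \<Rightarrow> ('m \<Rightarrow> real) \<Rightarrow> bool" where
  "cutoff p C R \<eta> \<longleftrightarrow> test_fun A \<eta> \<and> (\<forall>q. 0 \<le> \<eta> q \<and> \<eta> q \<le> 1) \<and> (\<forall>q. d p q \<le> R \<longrightarrow> \<eta> q = 1) \<and>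
    (\<forall>q. d p q \<ge> 2 * R \<longrightarrow> \<eta> q = 0) \<and>
    (\<forall>q. \<forall>x\<in>tangent_space A q. \<bar>x \<eta>\<bar> \<le> (if d p q < 2 * R then C / R * sqrt (g q x x) else 0))"

lemma cutoffD:
  assumes "cutoff p C R \<eta>"
  shows "smooth_fun A \<eta>" "0 \<le> \<eta> q" "\<eta> q \<le> 1" "d p q \<le> R \<Longrightarrow> \<eta> q = 1" "d p q \<ge> 2 * R \<Longrightarrow> \<eta> q = 0"
    "x \<in> tangent_space A q \<Longrightarrow> \<bar>x \<eta>\<bar> \<le> (if d p q < 2 * R then C / R * sqrt (g q x x) else 0)"
  using assms unfolding cutoff_def test_fun_def by blast+

text \<open>A cutoff of scale r enters the average with a gradient of size at most C1 / (k r), on a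
  ball of measure at most C (2 r)^2. Up to a constant r cancels, and k scales contribute k times
  1/k^2.\<close>

lemma small_energy_cutoff:
  assumes complete: "mcomplete" and m: "sets m = sets borel"
    and C: "C > 0" "\<And>r. r > 0 \<Longrightarrow> emeasure m (mball p r) \<le> ennreal (C * r\<^sup>2)" and R: "R > 0" and \<epsilon>: "\<epsilon> > 0"
  shows "\<exists>\<phi> \<rho>. test_fun A \<phi> \<and> (\<forall>q. d p q \<le> R \<longrightarrow> \<phi> q = 1) \<and> (\<forall>q. d p q \<ge> \<rho> \<longrightarrow> \<phi> q = 0) \<and>
    (\<integral>q. g q (gradient A g \<phi> q) (gradient A g \<phi> q) \<partial>m) \<le> \<epsilon>"
proof -
  obtain C1 where C1: "C1 > 0" "\<forall>R>0. \<exists>\<eta>. cutoff p C1 R \<eta>"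
    using cutoff_exists[OF complete, of p, folded cutoff_def] by (elim exE conjE)
  define r where "r j = R * 2 ^ j" for j :: nat
  have r: "r j > 0" for j using R by (simp add: r_def)
  have "\<exists>\<eta>. cutoff p C1 (r j) \<eta>" for j using C1(2) r by blast
  then obtain \<eta> where cut: "\<And>j. cutoff p C1 (r j) (\<eta> j)" by metis
  note \<eta> = cutoffD[OF cut]
  \<comment> \<open>The final energy bound is \<open>16 * C1\<^sup>2 * C / real k\<close>: one
    factor 4 from squaring the geometric sum, another from the balls of radius
    \<open>2 * r j\<close>.\<close>
  obtain k :: nat where k: "16 * C1\<^sup>2 * C / \<epsilon> < k" using reals_Archimedean2 by blast
  have "16 * C1\<^sup>2 * C / \<epsilon> > 0" using C1(1) C(1) \<epsilon> by simp
  then have k0: "real k > 0" using k by linarith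
  define \<phi> where "\<phi> q = 1 / real k * (\<Sum>j<k. \<eta> j q)" for q
  have sum: "smooth_fun A (\<lambda>q. \<Sum>j<k. \<eta> j q)" by (rule smooth_fun_sum) (rule \<eta>(1))
  have sm: "smooth_fun A \<phi>" unfolding \<phi>_def[abs_def] by (rule smooth_fun_mult[OF smooth_fun_const sum])
  have one: "\<phi> q = 1" if "d p q \<le> R" for q
  proof -
    have "\<eta> j q = 1" for j
    proof (rule \<eta>(4))
      have "R * 1 \<le> r j" unfolding r_def using R by (intro mult_left_mono) auto
      then show "d p q \<le> r j" using that by simp
    qed
    then show ?thesis using k0 by (simp add: \<phi>_def)
  qed
  have zero: "\<phi> q = 0" if "d p q \<ge> 2 * r k" for q
  proof -
    have "\<eta> j q = 0" if "j < k" for j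
    proof (rule \<eta>(5))
      have "r j \<le> r k" unfolding r_def using R that by (intro mult_left_mono power_increasing) auto
      then show "d p q \<ge> 2 * r j" using \<open>d p q \<ge> 2 * r k\<close> by simp
    qed
    then show ?thesis by (simp add: \<phi>_def)
  qed
  have "{q. \<phi> q \<noteq> 0} \<subseteq> mcball p (2 * r k)"
  proof
    fix q assume "q \<in> {q. \<phi> q \<noteq> 0}"
    then have "\<not> d p q \<ge> 2 * r k" using zero[of q] by auto
    then show "q \<in> mcball p (2 * r k)" by simp
  qed
  then have "closure {q. \<phi> q \<noteq> 0} \<subseteq> mcball p (2 * r k)" by (rule closure_minimal[OF _ closed_mcball])
  then have "closure {q. \<phi> q \<noteq> 0} = mcball p (2 * r k) \<inter> closure {q. \<phi> q \<noteq> 0}" by blast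
  then have "compact (closure {q. \<phi> q \<noteq> 0})"
    using compact_Int_closed[OF complete_imp_compact_mcball[OF complete] closed_closure] by metis
  then have test: "test_fun A \<phi>" using sm by (simp add: test_fun_def)
  let ?N = "\<lambda>q. g q (gradient A g \<phi> q) (gradient A g \<phi> q)"
  let ?G = "\<lambda>q. \<Sum>j<k. (4 * C1\<^sup>2 / (real k)\<^sup>2 / (r j)\<^sup>2) * indicator (mball p (2 * r j)) q"
  have bound: "?N q \<le> ?G q" for q
  proof -
    define x where "x = gradient A g \<phi> q"
    define J where "J = {j. j < k \<and> d p q < 2 * r j}"
    have J: "finite J" "J \<subseteq> {..<k}" by (auto simp: J_def)
    have x: "x \<in> tangent_space A q" unfolding x_def by (rule gradient_tangent[OF sm])
    define n where "n = sqrt (g q x x)"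
    have n: "0 \<le> n" "?N q = n\<^sup>2" using g_nonneg[OF x] by (simp_all add: n_def x_def)
    define s where "s = C1 / (real k * R) * (\<Sum>j\<in>J. (1 / 2) ^ j)"
    have \<phi>_eq: "\<phi> = (\<lambda>q. 1 / real k * (\<Sum>j<k. \<eta> j q))" by (rule ext) (rule \<phi>_def)
    \<comment> \<open>The squared norm of the gradient is the derivative of \<phi> along the
      gradient. The bounds for the cutoffs along this vector \<open>x\<close> give n^2 \<le> s n,
      hence n \<le> s.\<close>
    have "?N q = x \<phi>" unfolding x_def by (rule g_gradient[OF sm x[unfolded x_def]])
    also have "... = 1 / real k * (\<Sum>j<k. x (\<eta> j))"
      unfolding \<phi>_eq tangent_cmult[OF x sum] by (simp only: tangent_sum_fun[OF x finite_lessThan \<eta>(1)])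
    also have "... \<le> 1 / real k * (\<Sum>j<k. if d p q < 2 * r j then C1 / r j * n else 0)"
      unfolding n_def by (intro mult_left_mono sum_mono order_trans[OF abs_ge_self \<eta>(6)[OF x]]) auto
    also have "(\<Sum>j<k. if d p q < 2 * r j then C1 / r j * n else 0) = (\<Sum>j\<in>J. C1 / r j * n)"
      by (rule sum.mono_neutral_cong_right) (auto simp: J_def)
    also have "... = C1 / R * n * (\<Sum>j\<in>J. (1 / 2) ^ j)"
      unfolding sum_distrib_left by (rule sum.cong) (auto simp: r_def power_one_over field_simps)
    also have "1 / real k * (C1 / R * n * (\<Sum>j\<in>J. (1 / 2) ^ j)) = s * n" by (simp add: s_def)
    finally have sn: "n * n \<le> s * n" using n(2) by (simp add: power2_eq_square)
    have s0: "0 \<le> s" unfolding s_def using C1(1) R by (intro mult_nonneg_nonneg sum_nonneg) auto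
    have "n \<le> s"
    proof (cases "n = 0")
      case False
      then show ?thesis using sn n(1) by (intro mult_right_le_imp_le[OF sn]) auto
    qed (simp add: s0)
    then have "?N q \<le> s\<^sup>2" unfolding n(2) using n(1) by (intro power_mono)
    also have "... = (C1 / (real k * R))\<^sup>2 * (\<Sum>j\<in>J. (1 / 2) ^ j)\<^sup>2" by (simp only: s_def power_mult_distrib)
    also have "... \<le> (C1 / (real k * R))\<^sup>2 * (4 * (\<Sum>j\<in>J. (1 / 4) ^ j))"
      by (intro mult_left_mono sum_half_powers_squared J(1)) auto
    also have "... = (\<Sum>j\<in>J. 4 * C1\<^sup>2 / (real k)\<^sup>2 / (r j)\<^sup>2)"
    proof -
      have "(2 :: real) ^ j * 2 ^ j = 4 ^ j" for j by (simp add: power_mult_distrib[symmetric])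
      then have rsq: "(r j)\<^sup>2 = R\<^sup>2 * 4 ^ j" for j by (simp add: r_def power2_eq_square)
      show ?thesis unfolding sum_distrib_left
        by (rule sum.cong[OF refl]) (simp add: rsq power_one_over power_mult_distrib power_divide ac_simps)
    qed
    also have "... = ?G q"
      by (rule sum.mono_neutral_cong_left) (auto simp: J_def indicator_def)
    finally show ?thesis .
  qed
  have ball: "mball p (2 * r j) \<in> sets m" for j using open_mball m by simp
  have meas: "emeasure m (mball p (2 * r j)) \<le> ennreal (C * (2 * r j)\<^sup>2)" for j by (rule C(2)) (use r[of j] in simp)
  have fin: "emeasure m (mball p (2 * r j)) < \<infinity>" for j by (rule le_less_trans[OF meas]) simp
  have "measure m (mball p (2 * r j)) \<le> C * (2 * r j)\<^sup>2" for j
    unfolding measure_def using C(1) by (intro enn2real_leI meas) auto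
  then have "(\<Sum>j<k. (4 * C1\<^sup>2 / (real k)\<^sup>2 / (r j)\<^sup>2) * measure m (mball p (2 * r j)))
      \<le> (\<Sum>j<k. (4 * C1\<^sup>2 / (real k)\<^sup>2 / (r j)\<^sup>2) * (C * (2 * r j)\<^sup>2))"
    by (intro sum_mono mult_left_mono) auto
  also have "... = (\<Sum>j<k. 16 * C1\<^sup>2 * C / (real k)\<^sup>2)"
    by (rule sum.cong) (use r[THEN less_imp_neq, symmetric] in \<open>auto simp: field_simps power2_eq_square\<close>)
  also have "... = 16 * C1\<^sup>2 * C / real k" using k0 by (simp add: power2_eq_square)
  also have "... \<le> \<epsilon>" using k k0 \<epsilon> by (simp add: field_simps)
  finally have "(\<Sum>j<k. (4 * C1\<^sup>2 / (real k)\<^sup>2 / (r j)\<^sup>2) * measure m (mball p (2 * r j))) \<le> \<epsilon>" .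
  moreover have "integral\<^sup>L m ?G = (\<Sum>j<k. (4 * C1\<^sup>2 / (real k)\<^sup>2 / (r j)\<^sup>2) * measure m (mball p (2 * r j)))"
    by (subst Bochner_Integration.integral_sum) (use ball fin in \<open>auto intro!: integrable_mult_right integrable_real_indicator\<close>)
  moreover have "integral\<^sup>L m ?N \<le> integral\<^sup>L m ?G"
  proof (rule integral_mono')
    show "integrable m ?G"
      using ball fin by (intro Bochner_Integration.integrable_sum integrable_mult_right integrable_real_indicator)
    show "0 \<le> ?G q" for q by (intro sum_nonneg mult_nonneg_nonneg) auto
  qed (rule bound)
  ultimately have "integral\<^sup>L m ?N \<le> \<epsilon>" by linarith
  then show ?thesis
    by (intro exI[of _ \<phi>] exI[of _ "2 * r k"] conjI allI impI test one zero)
qed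

text \<open>If \<open>Q\<close> were positive at \<open>q0\<close>, it would exceed some
  \<open>c > 0\<close> on an open set of positive measure, inside a ball on which the test functions
  equal 1, while stability makes the integral arbitrarily small.\<close>

lemma stable_potential_zero:
  assumes complete: "mcomplete" and f: "smooth_fun A f"
    and C: "C > 0" "\<And>r. r > 0 \<Longrightarrow> emeasure (weighted_measure A g f) (mball p r) \<le> ennreal (C * r\<^sup>2)"
    and Q: "continuous_on UNIV Q" "\<And>q. 0 \<le> Q q"
    and stable: "\<And>\<phi>. test_fun A \<phi> \<Longrightarrow> (\<integral>q. Q q * (\<phi> q)\<^sup>2 \<partial>weighted_measure A g f)
      \<le> (\<integral>q. g q (gradient A g \<phi> q) (gradient A g \<phi> q) \<partial>weighted_measure A g f)"
  shows "Q q0 = 0"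
proof (rule ccontr)
  let ?m = "weighted_measure A g f"
  assume "Q q0 \<noteq> 0"
  then have pos: "Q q0 > 0" using Q(2)[of q0] by simp
  define c where "c = Q q0 / 2"
  define R where "R = d p q0 + 1"
  have R: "R > 0" unfolding R_def using d_nonneg[of p q0] by linarith
  define W where "W = Q -` {c<..} \<inter> mball p R"
  have "open (Q -` {c<..})" by (rule open_vimage[OF open_greaterThan Q(1)])
  then have W: "open W" "q0 \<in> W" using open_mball[of p R] pos by (auto simp: W_def c_def R_def)
  note sm = sets_weighted_measure[of f]
  have fin: "emeasure ?m (mball p r) < \<infinity>" if "r > 0" for r
    by (rule le_less_trans[OF C(2)[OF that]]) simp
  have Wfin: "emeasure ?m W < \<infinity>"
    by (rule le_less_trans[OF emeasure_mono fin[OF R]]) (use open_mball in \<open>auto simp: W_def sm\<close>)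
  have Wpos: "measure ?m W > 0"
    using emeasure_weighted_open_pos[OF f W] Wfin by (simp add: measure_def enn2real_positive_iff)
  \<comment> \<open>Half of the lower bound \<open>c * measure ?m W\<close> for the left-hand side
    of the stability inequality.\<close>
  define \<epsilon> where "\<epsilon> = c * measure ?m W / 2"
  have \<epsilon>: "\<epsilon> > 0" using pos Wpos by (simp add: \<epsilon>_def c_def)
  obtain \<phi> \<rho> where \<phi>: "test_fun A \<phi>" "\<forall>q. d p q \<le> R \<longrightarrow> \<phi> q = 1" "\<forall>q. d p q \<ge> \<rho> \<longrightarrow> \<phi> q = 0"
    "(\<integral>q. g q (gradient A g \<phi> q) (gradient A g \<phi> q) \<partial>?m) \<le> \<epsilon>"
    using small_energy_cutoff[OF complete sm C R \<epsilon>] by blast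
  let ?h = "\<lambda>q. Q q * (\<phi> q)\<^sup>2"
  have cont: "continuous_on UNIV ?h"
    using smooth_fun_continuous[of \<phi>] \<phi>(1) by (intro continuous_intros Q(1)) (simp add: test_fun_def)
  have "bounded (?h ` mcball p \<rho>)"
    by (intro compact_imp_bounded compact_continuous_image continuous_on_subset[OF cont] complete_imp_compact_mcball[OF complete]) simp
  then obtain b where "\<forall>y\<in>?h ` mcball p \<rho>. norm y \<le> b" unfolding bounded_iff by blast
  then have b: "\<bar>?h q\<bar> \<le> b" if "d p q \<le> \<rho>" for q using that by simp
  have meas: "?h \<in> borel_measurable ?m"
    using borel_measurable_continuous_onI[OF cont] measurable_cong_sets[OF sm refl] by blast
  \<comment> \<open>To be checked because the Bochner integral of a non-integrable function is 0,
    which would spoil the lower bound. The radius \<open>max \<rho> 1\<close> is positive, as the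
    volume bound requires.\<close>
  have "integrable ?m ?h"
  proof (rule Bochner_Integration.integrable_bound[OF _ meas])
    have "mball p (max \<rho> 1) \<in> sets ?m" using open_mball by (simp add: sm)
    then show "integrable ?m (\<lambda>q. b * indicator (mball p (max \<rho> 1)) q)"
      using fin[of "max \<rho> 1"] by (intro integrable_mult_right integrable_real_indicator) auto
    have "norm (?h q) \<le> norm (b * indicator (mball p (max \<rho> 1)) q)" for q
    proof (cases "d p q < \<rho>")
      case True
      then show ?thesis using b[of q] by simp
    next
      case False
      then show ?thesis using \<phi>(3) by simp
    qed
    then show "AE q in ?m. norm (?h q) \<le> norm (b * indicator (mball p (max \<rho> 1)) q)" by simp
  qed
  moreover have "integrable ?m (\<lambda>q. c * indicator W q)"
    using W(1) Wfin by (intro integrable_mult_right integrable_real_indicator) (auto simp: sm)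
  moreover have "c * indicator W q \<le> ?h q" for q
  proof (cases "q \<in> W")
    case True
    then have "c \<le> Q q" "\<phi> q = 1" using \<phi>(2) by (auto simp: W_def)
    then show ?thesis using True by simp
  qed (simp add: Q(2))
  ultimately have "(\<integral>q. c * indicator W q \<partial>?m) \<le> (\<integral>q. ?h q \<partial>?m)" by (intro integral_mono)
  also have "... \<le> \<epsilon>" using stable[OF \<phi>(1)] \<phi>(4) by linarith
  also have "(\<integral>q. c * indicator W q \<partial>?m) = c * measure ?m W" using W(1) Wfin by (simp add: sm)
  finally have "c * measure ?m W \<le> c * measure ?m W / 2" by (simp add: \<epsilon>_def)
  then show False using pos Wpos by (simp add: c_def)
qed

end

section \<open>The hypersurface with its induced metric and weight\<close>

theorem lemma3p1:
  fixes A :: "('m::{t2_space, second_countable_topology}, 'n::finite) atlas"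
    and g :: "'m metric"
    and f :: "'m \<Rightarrow> real"
    and B :: "('s::{t2_space, second_countable_topology}, 'k::finite) atlas"
    and F :: "'s \<Rightarrow> 'm"
    and \<nu> :: "'s \<Rightarrow> 'm tangent"
    and base :: 's
  assumes "CARD('n) \<ge> 2"
    and "weighted_manifold A g f" and "complete_riemannian A g" and "orientable A"
    and "immersed_hypersurface A B F"
    and "complete_riemannian B (induced_metric A g F)" and "orientable B"
    and "unit_normal A g B F \<nu>"
    and "stable_f_minimal A g f B F \<nu>"
    and "\<And>q v. v \<in> tangent_space A (F q) \<Longrightarrow> ric_f_1 A g f (F q) v v \<ge> 0"
    and "\<exists>C>0. \<forall>r>0. emeasure (hypersurface_measure A g f B F)
           (geodesic_ball B (induced_metric A g F) base r) \<le> ennreal (C * r\<^sup>2)"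
  shows "(\<forall>q. \<forall>x\<in>tangent_space B q. \<forall>y\<in>tangent_space B q.
            second_ff A g F \<nu> q x y =
              normal_deriv A g f F \<nu> q / (real CARD('n) - 1) * induced_metric A g F q x y) \<and>
         (\<forall>q. ric_f_1 A g f (F q) (\<nu> q) (\<nu> q) = 0)"
proof -
  have A: "is_atlas A" "riemannian_metric A g" and f: "smooth_fun A f"
    using assms(2) by (auto simp: weighted_manifold_def smooth_manifold_def)
  have B: "is_atlas B" "connected (UNIV :: 's set)"
    using assms(5) by (auto simp: immersed_hypersurface_def smooth_manifold_def)
  interpret H: hypersurface A g B F \<nu>
    by unfold_locales (use A B(1) assms(5,8) in auto)
  \<comment> \<open>The cutoff argument runs intrinsically on the hypersurface, with its own
    distance and the restricted weight \<open>f \<circ> F\<close>.\<close>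
  interpret S: connected_riemannian B "induced_metric A g F"
    by unfold_locales (rule B(2))
  have min: "f_minimal A g f B F \<nu>" using assms(9) by (simp add: stable_f_minimal_def)
  have ric: "ric_f_1 A g f (F q) (\<nu> q) (\<nu> q) \<ge> 0" for q
    using assms(8) by (intro assms(10)) (simp add: unit_normal_def)
  obtain C where C: "C > 0" "\<forall>r>0. emeasure (hypersurface_measure A g f B F)
           (geodesic_ball B (induced_metric A g F) base r) \<le> ennreal (C * r\<^sup>2)" using assms(11) by (elim exE conjE)
  have complete: "S.mcomplete" using assms(6) by (simp add: complete_riemannian_def)
  have fF: "smooth_fun B (f \<circ> F)" using H.smooth_fun_F[OF f] by (simp add: o_def)
  have "H.stability_potential f q = 0" for q
  proof (rule S.stable_potential_zero[OF complete fF C(1)])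
    show "emeasure (weighted_measure B (induced_metric A g F) (f \<circ> F)) (S.mball base r) \<le> ennreal (C * r\<^sup>2)" if "r > 0" for r
      using C(2)[rule_format, OF that] by (simp add: hypersurface_measure_def geodesic_ball_def)
    show "continuous_on UNIV (H.stability_potential f)"
      by (rule H.S.smooth_fun_continuous[OF H.smooth_stability_potential[OF f]])
    show "0 \<le> H.stability_potential f q" for q by (rule H.stability_potential_nonneg[OF f min ric])
    show "(\<integral>q. H.stability_potential f q * (\<phi> q)\<^sup>2 \<partial>weighted_measure B (induced_metric A g F) (f \<circ> F))
      \<le> (\<integral>q. induced_metric A g F q (gradient B (induced_metric A g F) \<phi> q) (gradient B (induced_metric A g F) \<phi> q)
        \<partial>weighted_measure B (induced_metric A g F) (f \<circ> F))" if "test_fun B \<phi>" for \<phi>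
      using assms(9) that unfolding stable_f_minimal_def Let_def H.stability_potential_def hypersurface_measure_def by blast
  qed
  note zero = H.stability_potential_zero[OF f min ric this]
  show ?thesis using zero by blast
qed

end
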